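(* Let $F,\Sigma\in\mathbb{R}^{d\times d}$, $H\in\mathbb{R}^{k\times d}$, $\Gamma\in\mathbb{R}^{k\times k}$, where $(H,F)$ is a c-detectable pair and $\Sigma,\Gamma$ are symmetric positive definite. Let $\varphi:\mathbb{R}^d\to\mathbb{R}$ be either a uniformly continuous and bounded function or $\varphi(x)=x_i$ for some $i=1,\dots,d$. Let $\mu,\nu\in\mathcal{P}_2(\mathbb{R}^d)$ with $\mathrm{Cov}(\mu),\mathrm{Cov}(\nu)\succ0$ be the respective initial data for the mean-field ensemble Kalman filter distributions $(\pi_t^\mu)_{t\ge0}$ and the optimal filtering distributions $(\bar\pi_t^\nu)_{t\ge0}$ (both defined in the context), driven by the same observations $(Z_t^\dagger)_{t\ge 0}$. Then, for almost every sample path of $(Z_t^\dagger)_{t\ge0}$, $$\pi_t^\mu(\varphi)-\bar\pi_t^\nu(\varphi)\to0\quad\text{as }t\to\infty.$$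
   Context: $\mathcal{P}_2(\mathbb{R}^d)$: Borel probability measures on $\mathbb{R}^d$ with finite second moments; $\mathrm{Cov}$ denotes the covariance matrix; $\pi(\varphi):=\int\varphi\,d\pi$. A pair $(H,F)$ is c-detectable if there exists $K\in\mathbb{R}^{d\times k}$ such that all eigenvalues of $F-KH$ have strictly negative real part. Signal-observation model: $dX_t^\dagger=FX_t^\dagger\,dt+\sqrt{\Sigma}\,dB_t^\dagger$, $dZ_t^\dagger=HX_t^\dagger\,dt+\sqrt{\Gamma}\,dW_t^\dagger$, where $B^\dagger,W^\dagger$ are standard Brownian motions independent of each other and of the initial datum $X_0^\dagger$. The optimal filtering distribution $\bar\pi_t^\nu$ is the conditional law of $X_t^\dagger$ given $(Z_s^\dagger)_{s\le t}$ and $X_0^\dagger\sim\nu$. Continuous-time mean-field ensemble Kalman filter: with $X_0\sim\mu$, $$dX_t=FX_t\,dt+\sqrt{\Sigma}\,dB_t-\mathrm{Cov}(\pi_t^\mu)H^T\Gamma^{-1}\left(HX_t\,dt+\sqrt{\Gamma}\,dW_t-dZ_t^\dagger\right),$$ where $B,W$ are standard Brownian motions independent of each other, of $X_0$, and of the observation $Z^\dagger$ (and $X_0$ is independent of $Z^\dagger$), and $\pi_t^\mu$ is the conditional law of $X_t$ given $(Z_s^\dagger)_{s\le t}$. *)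

theory Defs
  imports "HOL-Probability.Probability"
begin

definition spd :: "real^'n^'n \<Rightarrow> bool" where
  "spd A \<longleftrightarrow> transpose A = A \<and> (\<forall>x. x \<noteq> 0 \<longrightarrow> x \<bullet> (A *v x) > 0)"

definition is_psd_sqrt :: "real^'n^'n \<Rightarrow> real^'n^'n \<Rightarrow> bool" where
  "is_psd_sqrt S A \<longleftrightarrow> transpose S = S \<and> (\<forall>x. x \<bullet> (S *v x) \<ge> 0) \<and> S ** S = A"

definition complex_eigenvalue :: "real^'n^'n \<Rightarrow> complex \<Rightarrow> bool" where
  "complex_eigenvalue A l \<longleftrightarrow>
     (\<exists>v :: complex^'n. v \<noteq> 0 \<and> map_matrix complex_of_real A *v v = l *s v)"

definition c_detectable :: "real^'d^'k \<Rightarrow> real^'d^'d \<Rightarrow> bool" where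
  "c_detectable H F \<longleftrightarrow>
     (\<exists>K :: real^'k^'d. \<forall>l. complex_eigenvalue (F - K ** H) l \<longrightarrow> Re l < 0)"

definition P2 :: "(real^'d) measure set" where
  "P2 = {m \<in> space (prob_algebra borel). integrable m (\<lambda>x. (norm x)\<^sup>2)}"

definition mean_vector :: "(real^'d) measure \<Rightarrow> real^'d" where
  "mean_vector m = (\<integral>x. x \<partial>m)"

definition cov_matrix :: "(real^'d) measure \<Rightarrow> real^'d^'d" where
  "cov_matrix m =
     (\<chi> i j. \<integral>x. (x $ i - mean_vector m $ i) * (x $ j - mean_vector m $ j) \<partial>m)"

(* Continuity on [0,oo) for the (Wasserstein-2) topology of P2, in its description by
   test functions of at most quadratic growth. *)
definition P2_continuous :: "(real \<Rightarrow> (real^'d) measure) \<Rightarrow> bool" where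
  "P2_continuous p \<longleftrightarrow>
     (\<forall>t\<ge>0. p t \<in> P2) \<and>
     (\<forall>\<phi> :: real^'d \<Rightarrow> real.
        continuous_on UNIV \<phi> \<and> (\<exists>c. \<forall>x. \<bar>\<phi> x\<bar> \<le> c * (1 + (norm x)\<^sup>2)) \<longrightarrow>
        continuous_on {0..} (\<lambda>t. \<integral>x. \<phi> x \<partial>(p t)))"

definition proc_sigma ::
  "'a measure \<Rightarrow> (real \<Rightarrow> 'a \<Rightarrow> 'b::topological_space) \<Rightarrow> real set \<Rightarrow> 'a measure" where
  "proc_sigma M Y T = sigma (space M) {Y t -` A \<inter> space M | t A. t \<in> T \<and> A \<in> sets borel}"

definition mutually_indep :: "'a measure \<Rightarrow> 'a measure list \<Rightarrow> bool" where
  "mutually_indep M Gs \<longleftrightarrow> prob_space.indep_sets M (\<lambda>i. sets (Gs ! i)) {..<length Gs}"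

definition standard_BM :: "'a measure \<Rightarrow> (real \<Rightarrow> 'a \<Rightarrow> real^'n) \<Rightarrow> bool" where
  "standard_BM M B \<longleftrightarrow>
     (\<forall>t\<ge>0. B t \<in> borel_measurable M) \<and>
     (AE \<omega> in M. B 0 \<omega> = 0) \<and>
     (AE \<omega> in M. continuous_on {0..} (\<lambda>t. B t \<omega>)) \<and>
     (\<forall>s t. 0 \<le> s \<and> s < t \<longrightarrow>
        (\<forall>i. distributed M lborel (\<lambda>\<omega>. (B t \<omega> - B s \<omega>) $ i) (normal_density 0 (sqrt (t - s)))) \<and>
        prob_space.indep_vars M (\<lambda>_. borel) (\<lambda>i \<omega>. (B t \<omega> - B s \<omega>) $ i) UNIV \<and>
        prob_space.indep_set M (sets (proc_sigma M B {0..s}))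
          (sets (vimage_algebra (space M) (\<lambda>\<omega>. B t \<omega> - B s \<omega>) borel)))"

(* J is the stochastic integral over [0,t] of the integrand K against V.  For a continuous
   adapted integrand and a continuous semimartingale integrator, the Ito integral is the limit in
   probability, as the mesh tends to 0, of the left-endpoint Riemann sums.  The event E makes
   this meaningful without assuming M complete: the integrator may be measurable only up to
   a null set, and measure would be 0 on a non-measurable event. *)
definition has_ito_integral ::
  "'a measure \<Rightarrow> (real \<Rightarrow> 'a \<Rightarrow> real^'k^'d) \<Rightarrow> (real \<Rightarrow> 'a \<Rightarrow> real^'k) \<Rightarrow> real
     \<Rightarrow> ('a \<Rightarrow> real^'d) \<Rightarrow> bool" where
  "has_ito_integral M K V t J \<longleftrightarrow>
     (\<forall>\<epsilon>>0. \<exists>\<delta>>0. \<forall>n. \<forall>p :: nat \<Rightarrow> real.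
        p 0 = 0 \<and> p n = t \<and> (\<forall>i<n. p i \<le> p (Suc i) \<and> p (Suc i) - p i < \<delta>) \<longrightarrow>
        (\<exists>E\<in>sets M. measure M E < \<epsilon> \<and>
           {\<omega> \<in> space M.
              norm ((\<Sum>i<n. K (p i) \<omega> *v (V (p (Suc i)) \<omega> - V (p i) \<omega>)) - J \<omega>) > \<epsilon>} \<subseteq> E))"

(* dX = F X dt + SS dB,  dZ = H X dt + GG dW,  Z_0 = 0,  X_0 distributed as \<nu>;
   SS and GG are the square roots of the noise covariances. *)
definition signal_observation ::
  "'a measure \<Rightarrow> real^'d^'d \<Rightarrow> real^'d^'d \<Rightarrow> real^'d^'k \<Rightarrow> real^'k^'k \<Rightarrow> (real^'d) measure
     \<Rightarrow> (real \<Rightarrow> 'a \<Rightarrow> real^'d) \<Rightarrow> (real \<Rightarrow> 'a \<Rightarrow> real^'k)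
     \<Rightarrow> (real \<Rightarrow> 'a \<Rightarrow> real^'d) \<Rightarrow> (real \<Rightarrow> 'a \<Rightarrow> real^'k) \<Rightarrow> bool" where
  "signal_observation M F SS H GG \<nu> B W X Z \<longleftrightarrow>
     standard_BM M B \<and> standard_BM M W \<and>
     (\<forall>t\<ge>0. X t \<in> borel_measurable M) \<and> (\<forall>t\<ge>0. Z t \<in> borel_measurable M) \<and>
     mutually_indep M [proc_sigma M X {0}, proc_sigma M B {0..}, proc_sigma M W {0..}] \<and>
     distr M borel (X 0) = \<nu> \<and>
     (AE \<omega> in M. continuous_on {0..} (\<lambda>t. X t \<omega>)) \<and>
     (AE \<omega> in M. \<forall>t\<ge>0. X t \<omega> = X 0 \<omega> + integral {0..t} (\<lambda>s. F *v X s \<omega>) + SS *v B t \<omega>) \<and>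
     (AE \<omega> in M. \<forall>t\<ge>0. Z t \<omega> = integral {0..t} (\<lambda>s. H *v X s \<omega>) + GG *v W t \<omega>)"

(* \<pi> t is a regular conditional law of X t given (Z_s) for s \<le> t.  Conditional laws are
   determined only up to a null set for each t, so a version with P2-continuous paths is
   selected.  Measurability of the kernel is asked with respect to M, since the second
   condition determines it up to null sets anyway; thus it is immaterial whether the
   observation filtration is completed. *)
definition conditional_law_process ::
  "'a measure \<Rightarrow> (real \<Rightarrow> 'a \<Rightarrow> real^'d) \<Rightarrow> (real \<Rightarrow> 'a \<Rightarrow> real^'k)
     \<Rightarrow> (real \<Rightarrow> 'a \<Rightarrow> (real^'d) measure) \<Rightarrow> bool" where
  "conditional_law_process M X Z \<pi> \<longleftrightarrow>
     (\<forall>t\<ge>0. \<pi> t \<in> M \<rightarrow>\<^sub>M prob_algebra borel) \<and>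
     (\<forall>t\<ge>0. \<forall>A\<in>sets borel. AE \<omega> in M. measure (\<pi> t \<omega>) A
        = real_cond_exp M (proc_sigma M Z {0..t}) (\<lambda>\<omega>'. indicator A (X t \<omega>')) \<omega>) \<and>
     (AE \<omega> in M. P2_continuous (\<lambda>t. \<pi> t \<omega>))"

(* The equation is dX = F X dt + SS dB - K dV with gain K = Cov(\<pi>) H^T G^-1 and
   dV = H X dt + GG dW - dZ;  J is the integral process of K against V. *)
definition mean_field_EnKF ::
  "'a measure \<Rightarrow> real^'d^'d \<Rightarrow> real^'d^'d \<Rightarrow> real^'d^'k \<Rightarrow> real^'k^'k \<Rightarrow> real^'k^'k
     \<Rightarrow> (real^'d) measure \<Rightarrow> (real \<Rightarrow> 'a \<Rightarrow> real^'k)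
     \<Rightarrow> (real \<Rightarrow> 'a \<Rightarrow> real^'d) \<Rightarrow> (real \<Rightarrow> 'a \<Rightarrow> real^'k)
     \<Rightarrow> (real \<Rightarrow> 'a \<Rightarrow> real^'d) \<Rightarrow> (real \<Rightarrow> 'a \<Rightarrow> (real^'d) measure) \<Rightarrow> bool" where
  "mean_field_EnKF M F SS H G GG \<mu> Z B W X \<pi> \<longleftrightarrow>
     standard_BM M B \<and> standard_BM M W \<and>
     (\<forall>t\<ge>0. X t \<in> borel_measurable M) \<and>
     mutually_indep M
       [proc_sigma M X {0}, proc_sigma M B {0..}, proc_sigma M W {0..}, proc_sigma M Z {0..}] \<and>
     distr M borel (X 0) = \<mu> \<and>
     (AE \<omega> in M. continuous_on {0..} (\<lambda>t. X t \<omega>)) \<and>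
     conditional_law_process M X Z \<pi> \<and>
     (\<exists>J. (\<forall>t\<ge>0. has_ito_integral M
               (\<lambda>s \<omega>. cov_matrix (\<pi> s \<omega>) ** transpose H ** matrix_inv G)
               (\<lambda>s \<omega>. integral {0..s} (\<lambda>r. H *v X r \<omega>) + GG *v W s \<omega> - Z s \<omega>) t (J t)) \<and>
          (AE \<omega> in M. \<forall>t\<ge>0. X t \<omega> =
             X 0 \<omega> + integral {0..t} (\<lambda>s. F *v X s \<omega>) + SS *v B t \<omega> - J t \<omega>))"

end

theory Submission
 imports Defs "HOL-Computational_Algebra.Fundamental_Theorem_Algebra"
begin

text \<open>Conditionally on the observations, each filter is the law of \<open>m + e + g\<close>: the mean path \<open>m\<close> is
 a function of the observations, \<open>e\<close> is the initial state transported by the Riccati flow and \<open>g\<close> is a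
 Gaussian noise independent of the observations. For the optimal filter \<open>m\<close> and \<open>g\<close> belong to the
 solution \<open>R\<close> of the Riccati equation with \<open>R 0 = 0\<close>; the noise is orthogonal, hence independent, to all
 linear functionals of the observations. For the ensemble filter they belong to the solution \<open>C\<close> with
 \<open>C 0 = Cov(\<mu>)\<close>: the random covariance is found to solve the Riccati equation by expanding the modulus of
 the conditional characteristic function to second order, since conditionally on the observations the
 driving noises stay Gaussian. Detectability makes the flow exponentially stable, so \<open>C - R\<close>, the
 difference of the means and the \<open>L\<^sup>1\<close> distance of the noises tend to 0, and a maximal inequality
 bounds the conditional expectations of the initial states over all rational times.\<close>

text \<open>Two obstacles shape the proof. The Ito integral of the ensemble equation is given only
  as a limit in probability at each fixed time, and its random gain is known to be continuous, not
  differentiable. Hence the covariance is identified first, from characteristic functions at fixed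
  times. Only then is the gain deterministic and C1; from there on stochastic integrals are
  pathwise, and the filters are compared by differential equations driven by continuous paths. The
  initial law \<nu> is arbitrary in \<open>P2\<close>, so the optimal filter need not be Gaussian.
  Starting \<open>R\<close> at 0 puts the whole initial state into the flow part, and the remaining
  noise is independent of that state as well. The noises of the two filters live on different
  Brownian motions and can agree only in law; the comparison therefore passes through the noise for
  \<open>C\<close> realized on the signal side. Conditional laws and covariance identities hold
  almost surely at each fixed time, hence simultaneously at all rational times, and continuity of
  paths extends them to all times.\<close>

notation LIMSEQ ("((_)/ ----> (_))" [60, 60] 60)

declare transpose_matrix_vector [simp del] vector_transpose_matrix [simp del]

section \<open>Matrices\<close>

text \<open>The norm of the type \<open>real^'n^'m\<close> is Euclidean in the rows and in the
  entries, that is, the Frobenius norm; Cauchy-Schwarz in every row then gives the operator bound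
  with constant 1.\<close>

lemma norm_matrix_vector_le:
 fixes A :: "real^'n^'m"
 shows "norm (A *v x) <= norm A * norm x"
proof -
 have "(norm (A *v x))^2 = (SUM i:UNIV. (A $ i \<bullet> x)^2)"
  by (simp add: norm_vec_def L2_set_def matrix_vector_mul_component sum_nonneg)
 also have "... <= (SUM i:UNIV. (norm (A $ i))^2 * (norm x)^2)"
  by (intro sum_mono) (metis Cauchy_Schwarz_ineq power2_norm_eq_inner)
 also have "... = (norm A * norm x)^2"
  by (simp add: norm_vec_def[of A] L2_set_def sum_nonneg power_mult_distrib sum_distrib_right)
 finally show ?thesis
  by (rule power2_le_imp_le) simp
qed

lemma norm_transpose [simp]:
 fixes A :: "real^'n^'m"
 shows "norm (transpose A) = norm A"
proof -
 have "(norm (transpose A))^2 = (norm A)^2"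
  unfolding norm_vec_def L2_set_def transpose_def
  by (simp add: sum_nonneg) (rule sum.swap)
 thus ?thesis by simp
qed

lemma transpose_add: "transpose (A + B) = transpose A + transpose (B :: 'a::plus^'n^'m)"
 by (simp add: transpose_def vec_eq_iff)

lemma transpose_diff: "transpose (A - B) = transpose A - transpose (B :: 'a::minus^'n^'m)"
 by (simp add: transpose_def vec_eq_iff)

lemma inner_matrix:
 fixes A :: "real^'n^'m"
 shows "x \<bullet> (A *v y) = (transpose A *v x) \<bullet> y"
 by (simp add: dot_lmul_matrix transpose_matrix_vector)

lemma norm_matrix_mult_le:
 fixes A :: "real^'n^'m" and B :: "real^'p^'n"
 shows "norm (A ** B) <= norm A * norm B"
proof -
 have row: "(A ** B) $ i = transpose B *v (A $ i)" for i
  by (simp add: vec_eq_iff matrix_matrix_mult_def matrix_vector_mult_def transpose_def mult.commute)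
 have "(norm (A ** B))^2 = (SUM i:UNIV. (norm (transpose B *v (A $ i)))^2)"
  by (simp add: norm_vec_def[of "A ** B"] L2_set_def sum_nonneg row)
 also have "... <= (SUM i:UNIV. (norm B * norm (A $ i))^2)"
  by (intro sum_mono power_mono) (use norm_matrix_vector_le[of "transpose B"] in auto)
 also have "... = (norm A * norm B)^2"
  by (simp add: norm_vec_def[of A] L2_set_def sum_nonneg power_mult_distrib sum_distrib_left mult.commute)
 finally show ?thesis
  by (rule power2_le_imp_le) simp
qed

lemma bilinear_matrix_vector:
 "bounded_bilinear ((*v) :: real^'n^'m => real^'n => real^'m)"
proof
 show "EX K. ALL (a :: real^'n^'m) b. norm (a *v b) <= norm a * norm b * K"
  by (rule exI[of _ 1]) (simp add: norm_matrix_vector_le)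
qed (simp_all add: algebra_simps matrix_vector_mult_scaleR scaleR_matrix_vector_assoc)

lemma bilinear_matrix_mult:
 "bounded_bilinear ((**) :: real^'n^'m => real^'p^'n => real^'p^'m)"
proof
 show "EX K. ALL (a :: real^'n^'m) (b :: real^'p^'n). norm (a ** b) <= norm a * norm b * K"
  by (rule exI[of _ 1]) (simp add: norm_matrix_mult_le)
qed (simp_all add: vec_eq_iff matrix_matrix_mult_def algebra_simps sum.distrib sum_distrib_left)

lemmas matrix_vector_derivative =
 bounded_bilinear.has_vector_derivative[OF bilinear_matrix_vector]
lemmas matrix_mult_has_vector_derivative =
 bounded_bilinear.has_vector_derivative[OF bilinear_matrix_mult]
lemmas inner_derivative =
 bounded_bilinear.has_vector_derivative[OF bounded_bilinear_inner]

lemmas continuous_on_matrix_vector [continuous_intros] =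
 bounded_bilinear.continuous_on[OF bilinear_matrix_vector]
lemmas continuous_on_matrix_mult [continuous_intros] =
 bounded_bilinear.continuous_on[OF bilinear_matrix_mult]

lemma bounded_linear_transpose: "bounded_linear (transpose :: real^'n^'m => real^'m^'n)"
 by (rule bounded_linear_intro[where K = 1]) (auto simp: transpose_add transpose_scalar)

lemmas continuous_on_transpose [continuous_intros] =
 bounded_linear.continuous_on[OF bounded_linear_transpose]

section \<open>Integrals of continuous functions\<close>

lemma has_integral_deriv_le:
 fixes g :: "real => real"
 assumes "a <= b" "!!s. s : {a..b} ==> (g has_real_derivative g' s) (at s within {a..b})"
  and "!!s. s : {a..b} ==> g' s <= 0"
 shows "g b <= g a"
proof -
 have "(g' has_integral (g b - g a)) {a..b}"
  using assms(2) by (intro fundamental_theorem_of_calculus[OF assms(1)])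
   (simp flip: has_real_derivative_iff_has_vector_derivative)
 from has_integral_neg[OF this] have "0 <= - (g b - g a)"
  by (rule has_integral_nonneg) (use assms(3) in auto)
 thus ?thesis by simp
qed

lemma integral_exp_le:
 fixes c t :: real
 assumes "c > 0" "0 <= t"
 shows "integral {0..t} (%s. exp (c * s)) = (exp (c * t) - 1) / c"
proof -
 have "((%s. exp (c * s)) has_integral (exp (c * t) / c - exp (c * 0) / c)) {0..t}"
  using assms by (intro fundamental_theorem_of_calculus[where f = "%s. exp (c * s) / c"])
  (auto intro!: derivative_eq_intros simp flip: has_real_derivative_iff_has_vector_derivative simp del: exp_zero mult_zero_right)
 thus ?thesis
  using assms by (simp add: integral_unique diff_divide_distrib)
qed

lemma norm_integral_le:
 fixes f :: "real => 'a::euclidean_space"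
 assumes "continuous_on {a..b} f" "continuous_on {a..b} g" "!!s. s : {a..b} ==> norm (f s) <= g s"
 shows "norm (integral {a..b} f) <= integral {a..b} g"
 by (rule integral_norm_bound_integral) (use assms in "auto intro: integrable_continuous_real")

text \<open>The integral form applies to merely continuous \<open>u\<close>. The right-hand side of
  the inequality, multiplied by the integrating factor \<open>exp (- b * t)\<close>, is
  differentiable, and the inequality says that its derivative is not positive.\<close>

lemma gronwall:
 fixes u :: "real => real"
 assumes u: "continuous_on {0..T} u" and b: "0 <= b"
  and le: "!!t. t : {0..T} ==> u t <= a + b * integral {0..t} u"
  and t: "t : {0..T}"
 shows "u t <= a * exp (b * t)"
proof -
 define g where "g t = (a + b * integral {0..t} u) * exp (- b * t)" for t
 have ut: "continuous_on {0..t} u"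
  using u t by (auto intro: continuous_on_subset)
 have "g t <= g 0"
 proof (rule has_integral_deriv_le[where g = g])
  show "(g has_real_derivative (b * u s * exp (- b * s)
      + (a + b * integral {0..s} u) * (- b * exp (- b * s)))) (at s within {0..t})"
   if "s : {0..t}" for s
   unfolding g_def using integral_has_real_derivative[OF ut that]
   by (auto intro!: derivative_eq_intros)
  show "b * u s * exp (- b * s) + (a + b * integral {0..s} u) * (- b * exp (- b * s)) <= 0"
   if "s : {0..t}" for s
  proof -
   have "b * (u s - (a + b * integral {0..s} u)) * exp (- b * s) <= 0"
    using le[of s] that t b by (intro mult_nonpos_nonneg mult_nonneg_nonpos) auto
   thus ?thesis by (simp add: algebra_simps)
  qed
 qed (use t in auto)
 hence "(a + b * integral {0..t} u) * exp (- b * t) * exp (b * t) <= a * exp (b * t)"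
  by (intro mult_right_mono) (auto simp: g_def)
 thus ?thesis
  using le[OF t] by (simp add: mult.assoc flip: exp_add)
qed

lemma partition_in:
 assumes "i <= n" "0 <= t"
 shows "real i * t / real n : {0..t}"
proof (cases "n = 0")
 case False
 have "real i * t <= real n * t" using assms by (intro mult_right_mono) auto
 thus ?thesis using False assms by (auto simp: field_simps)
qed (use assms in auto)

lemma integral_uniform_partition:
 fixes f :: "real => 'a::banach"
 assumes f: "f integrable_on {0..t}" and t: "0 <= t" and n: "0 < n"
 shows "integral {0..t} f = (SUM i<n. integral {real i * t / n .. real (Suc i) * t / n} f)"
proof -
 have "(SUM i<m. integral {real i * t / n .. real (Suc i) * t / n} f) = integral {0..real m * t / n} f"
  if "m <= n" for m
  using that
 proof (induction m)
  case (Suc m)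
  have "integral {0..real m * t / n} f + integral {real m * t / n..real (Suc m) * t / n} f
    = integral {0..real (Suc m) * t / n} f"
  proof (rule Henstock_Kurzweil_Integration.integral_combine)
   show "f integrable_on {0..real (Suc m) * t / n}"
    by (rule integrable_on_subinterval[OF f]) (use partition_in[OF Suc.prems t] in auto)
  qed (use t n in "auto simp: field_simps")
  with Suc show ?case by simp
 qed simp
 from this[of n] show ?thesis using n by simp
qed

section \<open>Linear Volterra equations\<close>

text \<open>The bilinear product \<open>p\<close> is a parameter so that one construction serves
  vector equations and the Hamiltonian system of the Riccati equation. The inhomogeneity
  \<open>f\<close> is added to the solution rather than to its derivative, so that it may contain a
  Brownian path.\<close>

primrec picard :: "('b => 'a => 'a) => (real => 'b) => (real => 'a::euclidean_space) => nat => real => 'a" where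
 "picard p A f 0 t = f t"
| "picard p A f (Suc n) t = f t + integral {0..t} (%s. p (A s) (picard p A f n s))"

text \<open>A limit of explicit iterates instead of a chosen solution: this makes the solution
  measurable when \<open>A\<close> and \<open>f\<close> depend measurably on a sample point.\<close>

definition vsol :: "('b => 'a => 'a) => (real => 'b) => (real => 'a::euclidean_space) => real => 'a" where
 "vsol p A f t = lim (%n. picard p A f n t)"

lemma continuous_on_integral_upper:
 fixes f :: "real => 'a::banach"
 assumes "continuous_on {0..T} f"
 shows "continuous_on {0..T} (%t. integral {0..t} f)"
 by (intro indefinite_integral_continuous_1 integrable_continuous_real assms)

lemma bounded_bilinear_bound:
 fixes A :: "real => 'b::real_normed_vector"
 assumes "bounded_bilinear p" "continuous_on {0..T} A"
 obtains L where "0 < L" "!!s x. s : {0..T} ==> norm (p (A s) x) <= L * norm x"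
proof -
 obtain K where K: "K > 0" "!!a b. norm (p a b) <= norm a * norm b * K"
  using bounded_bilinear.pos_bounded[OF assms(1)] by metis
 have "bounded (A ` {0..T})"
  by (intro compact_imp_bounded compact_continuous_image assms) simp
 then obtain M where M: "M > 0" "!!s. s : {0..T} ==> norm (A s) <= M"
  unfolding bounded_pos by auto
 show thesis
 proof (rule that[of "M * K"])
  fix s x assume "s : {0..T}"
  have "norm (p (A s) x) <= norm (A s) * norm x * K" by (rule K)
  also have "... <= M * norm x * K"
   using M(2)[OF \<open>s : {0..T}\<close>] K(1) by (intro mult_right_mono) auto
  finally show "norm (p (A s) x) <= M * K * norm x" by (simp add: mult_ac)
 qed (use M K in auto)
qed

lemma picard_continuous:
 assumes p: "bounded_bilinear p" and A: "continuous_on {0..T} A" and f: "continuous_on {0..T} f"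
 shows "continuous_on {0..T} (picard p A f n)"
proof (induction n)
 case 0 thus ?case using f by (simp cong: continuous_on_cong)
next
 case (Suc n)
 show ?case
  unfolding picard.simps
  by (intro continuous_on_add f continuous_on_integral_upper bounded_bilinear.continuous_on[OF p] A Suc)
qed

text \<open>Measured with the weight \<open>exp (2 * L * t)\<close>, an increment of the iteration
  is halved by every integration, so the increments are summable on \<open>{0..T}\<close> for every
  \<open>T\<close> at once.\<close>

lemma picard_uniform_limit:
 assumes p: "bounded_bilinear p" and A: "continuous_on {0..T} A" and f: "continuous_on {0..T} f"
 shows "uniform_limit {0..T} (picard p A f) (vsol p A f) sequentially"
proof -
 obtain L where L: "0 < L" "!!s x. s : {0..T} ==> norm (p (A s) x) <= L * norm x"
  using bounded_bilinear_bound[OF p A] by metis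
 have "bounded (f ` {0..T})"
  by (intro compact_imp_bounded compact_continuous_image f) simp
 then obtain D where D: "D > 0" "!!s. s : {0..T} ==> norm (f s) <= D"
  unfolding bounded_pos by auto
 define d where "d n t = picard p A f (Suc n) t - picard p A f n t" for n t
 have cont: "continuous_on {0..T} (%s. p (A s) (picard p A f n s))" for n
  by (intro bounded_bilinear.continuous_on[OF p] A picard_continuous[OF p A f])
 have intg: "(%s. p (A s) (picard p A f n s)) integrable_on {0..t}" if "t : {0..T}" for n t
  by (rule integrable_continuous_real, rule continuous_on_subset[OF cont]) (use that in auto)
 have dcont: "continuous_on {0..T} (d n)" for n
  unfolding d_def by (intro continuous_on_diff picard_continuous[OF p A f])
 have dSuc: "d (Suc n) t = integral {0..t} (%s. p (A s) (d n s))" if "t : {0..T}" for n t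
  using intg[OF that, of n] intg[OF that, of "Suc n"]
  by (simp add: d_def integral_diff bounded_bilinear.diff_right[OF p])
 have expint: "integral {0..t} (%s. L * (c * exp (2 * L * s))) <= c / 2 * exp (2 * L * t)"
  if "0 <= t" "0 <= c" for t c
 proof -
  have "integral {0..t} (%s. L * (c * exp (2 * L * s))) = L * (c * ((exp (2 * L * t) - 1) / (2 * L)))"
   using integral_exp_le[of "2 * L" t] L(1) that by simp
  also have "... = c / 2 * (exp (2 * L * t) - 1)" using L(1) by (simp add: field_simps)
  also have "... <= c / 2 * exp (2 * L * t)" using that by (intro mult_left_mono) auto
  finally show ?thesis .
 qed
 have bound: "norm (d n t) <= D * (1/2)^n * exp (2 * L * t)" if "t : {0..T}" for n t
  using that
 proof (induction n arbitrary: t)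
  case 0
  \<comment> \<open>The constant is \<open>2 * D\<close> because \<open>expint\<close> halves it to
    the \<open>D\<close> of the claim.\<close>
  have "norm (d 0 t) <= integral {0..t} (%s. L * (2 * D * exp (2 * L * s)))"
   unfolding d_def picard.simps add_diff_cancel_left'
  proof (rule norm_integral_le)
   fix s assume s: "s : {0..t}"
   have "norm (p (A s) (f s)) <= L * norm (f s)" using s 0 by (intro L) auto
   also have "... <= L * (2 * D * exp (2 * L * s))"
   proof (intro mult_left_mono)
    have "1 <= exp (2 * L * s)" using L s by auto
    hence "D * 1 <= 2 * D * exp (2 * L * s)" using D by (intro mult_mono) auto
    thus "norm (f s) <= 2 * D * exp (2 * L * s)" using D(2)[of s] s 0 by auto
   qed (use L in auto)
   finally show "norm (p (A s) (f s)) <= L * (2 * D * exp (2 * L * s))" .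
  qed (use cont[of 0] 0 in "auto intro!: continuous_intros elim: continuous_on_subset")
  also have "... <= 2 * D / 2 * exp (2 * L * t)" by (rule expint) (use 0 D in auto)
  finally show ?case by simp
 next
  case (Suc n)
  have "norm (d (Suc n) t) <= integral {0..t} (%s. L * (D * (1/2)^n * exp (2 * L * s)))"
   unfolding dSuc[OF Suc.prems]
  proof (rule norm_integral_le)
   fix s assume s: "s : {0..t}"
   hence s': "s : {0..T}" using Suc.prems by auto
   have "norm (p (A s) (d n s)) <= L * norm (d n s)" by (rule L(2)[OF s'])
   also have "... <= L * (D * (1/2)^n * exp (2 * L * s))"
    using Suc.IH[OF s'] L(1) by (intro mult_left_mono) auto
   finally show "norm (p (A s) (d n s)) <= L * (D * (1/2)^n * exp (2 * L * s))" .
  next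
   have "continuous_on {0..T} (%s. p (A s) (d n s))"
    by (intro bounded_bilinear.continuous_on[OF p] A dcont)
   thus "continuous_on {0..t} (%s. p (A s) (d n s))"
    by (rule continuous_on_subset) (use Suc.prems in auto)
  qed (auto intro!: continuous_intros)
  also have "... <= D * (1/2)^n / 2 * exp (2 * L * t)" by (rule expint) (use Suc.prems D in auto)
  finally show ?case by (simp add: field_simps)
 qed
 have ul: "uniform_limit {0..T} (%n t. SUM i<n. d i t) (%t. \<Sum>i. d i t) sequentially"
 proof (rule Weierstrass_m_test)
  fix n t assume t: "t : {0..T}"
  have "norm (d n t) <= D * (1/2)^n * exp (2 * L * t)" by (rule bound[OF t])
  also have "... <= D * (1/2)^n * exp (2 * L * T)"
   using D L t by (intro mult_left_mono) auto
  finally show "norm (d n t) <= D * exp (2 * L * T) * (1/2)^n" by (simp add: mult_ac)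
 next
  show "summable (%n. D * exp (2 * L * T) * (1/2)^n)"
   by (intro summable_mult summable_geometric) auto
 qed
 have pic: "picard p A f n t = f t + (SUM i<n. d i t)" for n t
  by (induction n) (auto simp: d_def)
 have ul2: "uniform_limit {0..T} (picard p A f) (%t. f t + (\<Sum>i. d i t)) sequentially"
  using uniform_limit_add[OF uniform_limit_const ul, of f] by (simp add: pic[abs_def])
 have "vsol p A f t = f t + (\<Sum>i. d i t)" if "t : {0..T}" for t
  unfolding vsol_def using tendsto_uniform_limitI[OF ul2 that] by (rule limI)
 with ul2 show ?thesis
  by (subst uniform_limit_cong'[OF refl, of _ _ "%t. f t + (\<Sum>i. d i t)"]) auto
qed

lemma vsol_continuous:
 assumes p: "bounded_bilinear p" and A: "continuous_on {0..T} A" and f: "continuous_on {0..T} f"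
 shows "continuous_on {0..T} (vsol p A f)"
 by (rule uniform_limit_theorem[OF _ picard_uniform_limit[OF assms]])
  (auto intro!: always_eventually picard_continuous[OF assms])

lemma vsol_eq:
 assumes p: "bounded_bilinear p" and A: "continuous_on {0..T} A" and f: "continuous_on {0..T} f"
  and t: "t : {0..T}"
 shows "vsol p A f t = f t + integral {0..t} (%s. p (A s) (vsol p A f s))"
proof -
 obtain L where L: "0 < L" "!!s x. s : {0..T} ==> norm (p (A s) x) <= L * norm x"
  using bounded_bilinear_bound[OF p A] by metis
 have "uniform_limit {0..t} (%n s. p (A s) (picard p A f n s)) (%s. p (A s) (vsol p A f s)) sequentially"
 proof (rule uniform_limitI)
  fix e :: real assume "e > 0"
  from uniform_limitD[OF picard_uniform_limit[OF p A f], of "e / L"]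
  have "\<forall>\<^sub>F n in sequentially. ALL x:{0..T}. dist (picard p A f n x) (vsol p A f x) < e / L"
   using \<open>e > 0\<close> L by auto
  thus "\<forall>\<^sub>F n in sequentially. ALL x:{0..t}. dist (p (A x) (picard p A f n x)) (p (A x) (vsol p A f x)) < e"
  proof eventually_elim
   case (elim n)
   show ?case
   proof
    fix x assume "x : {0..t}"
    hence x: "x : {0..T}" using t by auto
    have "dist (p (A x) (picard p A f n x)) (p (A x) (vsol p A f x))
      = norm (p (A x) (picard p A f n x - vsol p A f x))"
     by (simp add: dist_norm bounded_bilinear.diff_right[OF p])
    also have "... <= L * dist (picard p A f n x) (vsol p A f x)"
     unfolding dist_norm by (rule L(2)[OF x])
    also have "... < e" using elim x L by (auto simp: field_simps)
    finally show "dist (p (A x) (picard p A f n x)) (p (A x) (vsol p A f x)) < e" .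
   qed
  qed
 qed
 moreover have "continuous_on {0..t} (%s. p (A s) (picard p A f n s))" for n
  by (rule continuous_on_subset[OF bounded_bilinear.continuous_on[OF p A picard_continuous[OF p A f]]])
   (use t in auto)
 ultimately obtain I J where IJ: "!!n. ((%s. p (A s) (picard p A f n s)) has_integral I n) {0..t}"
  "((%s. p (A s) (vsol p A f s)) has_integral J) {0..t}" "I ----> J"
  by (rule uniform_limit_integral) auto
 have "(%n. integral {0..t} (%s. p (A s) (picard p A f n s)))
   ----> integral {0..t} (%s. p (A s) (vsol p A f s))"
  using IJ(3) by (simp add: integral_unique[OF IJ(1)] integral_unique[OF IJ(2)])
 from tendsto_add[OF tendsto_const this, of "f t"]
 have "(%n. picard p A f (Suc n) t) ----> f t + integral {0..t} (%s. p (A s) (vsol p A f s))"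
  by simp
 moreover have "(%n. picard p A f (Suc n) t) ----> vsol p A f t"
  by (rule LIMSEQ_Suc, rule tendsto_uniform_limitI[OF picard_uniform_limit[OF p A f] t])
 ultimately show ?thesis by (rule LIMSEQ_unique[rotated])
qed

lemma volterra_bound:
 fixes p :: "'b::real_normed_vector => 'a::euclidean_space => 'a" and y f :: "real => 'a"
 assumes p: "bounded_bilinear p" and y: "continuous_on {0..T} y"
  and A: "!!s x. s : {0..T} ==> norm (p (A s) x) <= L * norm x" "continuous_on {0..T} A" and L: "0 <= L"
  and eq: "!!t. t : {0..T} ==> y t = f t + integral {0..t} (%s. p (A s) (y s))"
  and f: "!!t. t : {0..T} ==> norm (f t) <= D"
  and t: "t : {0..T}"
 shows "norm (y t) <= D * exp (L * t)"
proof (rule gronwall[OF _ L _ t])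
 show "continuous_on {0..T} (%t. norm (y t))" by (intro continuous_on_norm y)
 fix t assume t: "t : {0..T}"
 have "norm (y t) <= norm (f t) + norm (integral {0..t} (%s. p (A s) (y s)))"
  by (subst eq[OF t]) (rule norm_triangle_ineq)
 also have "norm (integral {0..t} (%s. p (A s) (y s))) <= integral {0..t} (%s. L * norm (y s))"
 proof (rule norm_integral_le)
  have "continuous_on {0..T} (%s. p (A s) (y s))" "continuous_on {0..T} (%s. L * norm (y s))"
   by (intro bounded_bilinear.continuous_on[OF p] continuous_intros A y)+
  thus "continuous_on {0..t} (%s. p (A s) (y s))" "continuous_on {0..t} (%s. L * norm (y s))"
   using t by (auto elim: continuous_on_subset)
 qed (use A t in auto)
 also have "... = L * integral {0..t} (%s. norm (y s))" by simp
 finally show "norm (y t) <= D + L * integral {0..t} (%s. norm (y s))" using f[OF t] by simp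
qed

lemma volterra_unique:
 fixes p :: "'b::real_normed_vector => 'a::euclidean_space => 'a" and y z :: "real => 'a"
 assumes p: "bounded_bilinear p" and A: "continuous_on {0..T} A"
  and y: "continuous_on {0..T} y" "continuous_on {0..T} z"
  and eq: "!!t. t : {0..T} ==> y t = f t + integral {0..t} (%s. p (A s) (y s))"
   "!!t. t : {0..T} ==> z t = f t + integral {0..t} (%s. p (A s) (z s))"
  and t: "t : {0..T}"
 shows "y t = z t"
proof -
 obtain L where L: "0 < L" "!!s x. s : {0..T} ==> norm (p (A s) x) <= L * norm x"
  using bounded_bilinear_bound[OF p A] by metis
 have c: "continuous_on {0..t} (%s. p (A s) (y s))" "continuous_on {0..t} (%s. p (A s) (z s))"
  if "t : {0..T}" for t
  using continuous_on_subset[OF bounded_bilinear.continuous_on[OF p A y(1)], of "{0..t}"]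
   continuous_on_subset[OF bounded_bilinear.continuous_on[OF p A y(2)], of "{0..t}"] that by auto
 have "norm (y t - z t) <= 0 * exp (L * t)"
 proof (rule volterra_bound[OF p _ L(2) A _ _ _ t, where f = "%_. 0"])
  fix t assume t: "t : {0..T}"
  show "y t - z t = 0 + integral {0..t} (%s. p (A s) (y s - z s))"
   using eq[OF t] integrable_continuous_real[OF c(1)[OF t]] integrable_continuous_real[OF c(2)[OF t]]
   by (simp add: bounded_bilinear.diff_right[OF p] integral_diff)
 qed (use L y in "auto intro!: continuous_intros")
 thus ?thesis by simp
qed

lemma has_vector_derivative_slope:
 fixes f :: "real => 'a::real_normed_vector"
 shows "(f has_vector_derivative D) (at t within S) \<longleftrightarrow>
  ((%s. (f s - f t) /\<^sub>R (s - t)) \<longlongrightarrow> D) (at t within S)"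
proof -
 have "(f has_vector_derivative D) (at t within S) \<longleftrightarrow>
  ((%s. norm (f s - f t - (s - t) *\<^sub>R D) / norm (s - t)) \<longlongrightarrow> 0) (at t within S)"
  unfolding has_vector_derivative_def has_derivative_iff_norm
  by (simp add: bounded_linear_scaleR_left)
 also have "... \<longleftrightarrow> ((%s. norm ((f s - f t) /\<^sub>R (s - t) - D)) \<longlongrightarrow> 0) (at t within S)"
 proof (rule tendsto_cong, unfold eventually_at_filter, rule always_eventually, safe)
  fix s :: real assume "s ~= t"
  hence "(f s - f t) /\<^sub>R (s - t) - D = (f s - f t - (s - t) *\<^sub>R D) /\<^sub>R (s - t)"
   by (simp add: scaleR_diff_right)
  thus "norm (f s - f t - (s - t) *\<^sub>R D) / norm (s - t) = norm ((f s - f t) /\<^sub>R (s - t) - D)"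
   by (simp add: divide_inverse abs_inverse mult.commute)
 qed
 also have "... \<longleftrightarrow> ((%s. (f s - f t) /\<^sub>R (s - t)) \<longlongrightarrow> D) (at t within S)"
  by (subst tendsto_norm_zero_iff) (rule LIM_zero_iff)
 finally show ?thesis .
qed

lemma integral_derivative_atLeast:
 fixes f :: "real => 'a::banach"
 assumes "continuous_on {0..} f" "0 <= t"
 shows "((%t. integral {0..t} f) has_vector_derivative f t) (at t within {0..})"
proof -
 have "((%t. integral {0..t} f) has_vector_derivative f t) (at t within {0..t+1})"
  by (rule integral_has_vector_derivative) (use assms in "auto intro: continuous_on_subset")
 moreover have "at t within {0..t+1} = at t within {0..}"
  by (rule at_within_nhd[of t "{..<t+1}"]) auto
 ultimately show ?thesis by simp
qed

lemma continuous_on_atLeastI: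
 fixes f :: "real => 'a::topological_space"
 assumes "!!T. 0 <= T ==> continuous_on {0..T} f"
 shows "continuous_on {0..} f"
proof -
 have "continuous (at t within {0..}) f" if "0 <= t" for t
 proof -
  have "continuous (at t within {0..t+1}) f"
   using assms[of "t+1"] that by (simp add: continuous_on_eq_continuous_within)
  moreover have "at t within {0..t+1} = at t within {0..}"
   by (rule at_within_nhd[of t "{..<t+1}"]) auto
  ultimately show ?thesis by simp
 qed
 thus ?thesis by (simp add: continuous_on_eq_continuous_within)
qed

lemma continuous_Icc:
 fixes f :: "real => 'a::topological_space"
 shows "continuous_on {0..} f ==> continuous_on {0..T} f"
 by (erule continuous_on_subset) auto

lemma uniform_partition_subset:
 assumes "i < n" "0 <= t" "u : {real i * t / n .. real (Suc i) * t / n}"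
 shows "u : {0..t}"
 using assms partition_in[of "Suc i" n t] partition_in[of i n t]
 by (auto simp del: of_nat_Suc intro: order_trans[of 0 "real i * t / n" u])

text \<open>The two arguments of \<open>Ph\<close> may be evaluated at different points near the cell.\<close>
lemma tagged_sum_tendsto:
 fixes Ph :: "real => real => 'a::euclidean_space" and g :: "real => 'a" and N :: "nat => nat"
 assumes t: "0 <= t" and N: "!!n. 0 < N n" and Ph: "continuous_on ({0..t} \<times> {0..t}) (%z. Ph (fst z) (snd z))"
  and g: "continuous_on {0..t} g" and h: "h ----> 0"
  and tags: "!!n j. j < N n ==> \<tau> n j : {0..t}" "!!n j. j < N n ==> sig n j : {0..t}"
   "!!n j s. j < N n ==> s : {real j * t / N n..real (Suc j) * t / N n} ==> \<bar>\<tau> n j - s\<bar> <= h n"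
   "!!n j s. j < N n ==> s : {real j * t / N n..real (Suc j) * t / N n} ==> \<bar>sig n j - s\<bar> <= h n"
 shows "(%n. SUM j<N n. Ph (\<tau> n j) (sig n j)
   \<bullet> (integral {0..real (Suc j) * t / N n} g - integral {0..real j * t / N n} g)) ----> integral {0..t} (%s. Ph s s \<bullet> g s)"
proof (rule LIMSEQ_I)
 fix e :: real assume e: "0 < e"
 define G where "G = integral {0..t} (%s. norm (g s)) + 1"
 have gn: "continuous_on {0..t} (%s. norm (g s))" by (intro continuous_intros g)
 have G: "0 < G" unfolding G_def by (intro add_nonneg_pos integral_nonneg integrable_continuous_real gn) auto
 define eps where "eps = e / (2 * G)"
 have eps: "0 < eps" using e G by (simp add: eps_def)
 have "uniformly_continuous_on ({0..t} \<times> {0..t}) (%z. Ph (fst z) (snd z))"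
  by (rule compact_uniformly_continuous[OF Ph]) (intro compact_Times compact_Icc)
 then obtain dl where dl: "0 < dl" "!!x y x' y'. x : {0..t} ==> y : {0..t} ==> x' : {0..t} ==> y' : {0..t} ==>
   dist (x, y) (x', y') < dl ==> norm (Ph x y - Ph x' y') < eps"
  using eps unfolding uniformly_continuous_on_def dist_norm by (metis (no_types, lifting) fst_conv mem_Sigma_iff snd_conv)
 obtain n0 where n0: "!!n. n0 <= n ==> norm (h n - 0) < dl / 2" using LIMSEQ_D[OF h, of "dl / 2"] dl(1) by auto
 have "continuous_on {0..t} (%s. Ph (fst (s, s)) (snd (s, s)))"
  by (rule continuous_on_compose2[OF Ph]) (auto intro!: continuous_intros)
 from \<open>continuous_on {0..t} (%s. Ph (fst (s, s)) (snd (s, s)))\<close> have diag: "continuous_on {0..t} (%s. Ph s s)" by simp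
 show "EX no. ALL n>=no. norm ((SUM j<N n. Ph (\<tau> n j) (sig n j)
   \<bullet> (integral {0..real (Suc j) * t / N n} g - integral {0..real j * t / N n} g)) - integral {0..t} (%s. Ph s s \<bullet> g s)) < e"
 proof (intro exI allI impI)
  fix n assume n: "n0 <= n"
  note N0 = N[of n]
  let ?I = "%j. {real j * t / N n .. real (Suc j) * t / N n}"
  have sub: "?I j <= {0..t}" if "j < N n" for j using uniform_partition_subset[OF that t] by blast
  have cell: "integral {0..real (Suc j) * t / N n} g - integral {0..real j * t / N n} g = integral (?I j) g" if j: "j < N n" for j
  proof -
   have a: "0 <= real j * t / N n" "real j * t / N n <= real (Suc j) * t / N n" using t by (auto intro!: divide_right_mono mult_right_mono)
   hence "real (Suc j) * t / N n : {0..t}" using sub[OF j] by auto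
   hence "g integrable_on {0..real (Suc j) * t / N n}"
    by (intro integrable_continuous_real continuous_on_subset[OF g]) auto
   from Henstock_Kurzweil_Integration.integral_combine[OF a this] show ?thesis by (metis add_diff_cancel_left')
  qed
  have gi: "continuous_on (?I j) g" if "j < N n" for j by (rule continuous_on_subset[OF g sub[OF that]])
  have step: "norm (Ph (\<tau> n j) (sig n j) \<bullet> integral (?I j) g - integral (?I j) (%s. Ph s s \<bullet> g s))
   <= integral (?I j) (%s. eps * norm (g s))" if j: "j < N n" for j
  proof -
   let ?r = "\<tau> n j" and ?q = "sig n j"
   have close: "norm (Ph ?r ?q - Ph s s) < eps" if s: "s : ?I j" for s
   proof (rule dl(2))
    show "s : {0..t}" "s : {0..t}" using sub[OF j] s by auto
    show "?r : {0..t}" "?q : {0..t}" by (rule tags(1)[OF j] tags(2)[OF j])+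
    have "dist (?r, ?q) (s, s) <= \<bar>?r - s\<bar> + \<bar>?q - s\<bar>"
     using sqrt_sum_squares_le_sum_abs[of "?r - s" "?q - s"] by (simp add: dist_prod_def dist_real_def)
    also have "... < dl" using tags(3)[OF j s] tags(4)[OF j s] n0[OF n] by simp
    finally show "dist (?r, ?q) (s, s) < dl" .
   qed
   have "Ph ?r ?q \<bullet> integral (?I j) g - integral (?I j) (%s. Ph s s \<bullet> g s) = integral (?I j) (%s. (Ph ?r ?q - Ph s s) \<bullet> g s)"
   proof -
    have "(%s. Ph ?r ?q \<bullet> g s) integrable_on ?I j" "(%s. Ph s s \<bullet> g s) integrable_on ?I j"
     by (intro integrable_continuous_real continuous_intros gi[OF j] continuous_on_subset[OF diag sub[OF j]])+
    moreover have "Ph ?r ?q \<bullet> integral (?I j) g = integral (?I j) (%s. Ph ?r ?q \<bullet> g s)"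
     using integral_linear[OF integrable_continuous_real[OF gi[OF j]] bounded_linear_inner_right[of "Ph ?r ?q"]] by (simp add: o_def)
    ultimately show ?thesis by (simp add: inner_diff_left Henstock_Kurzweil_Integration.integral_diff)
   qed
   also have "norm ... <= integral (?I j) (%s. eps * norm (g s))"
   proof (rule norm_integral_le)
    show "norm ((Ph ?r ?q - Ph s s) \<bullet> g s) <= eps * norm (g s)" if "s : ?I j" for s
     using close[OF that] by (auto intro!: order_trans[OF Cauchy_Schwarz_ineq2] mult_right_mono)
   qed (intro continuous_intros gi[OF j] continuous_on_subset[OF diag sub[OF j]])+
   finally show ?thesis .
  qed
  have e1: "(SUM j<N n. Ph (\<tau> n j) (sig n j) \<bullet> (integral {0..real (Suc j) * t / N n} g - integral {0..real j * t / N n} g))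
    - integral {0..t} (%s. Ph s s \<bullet> g s)
   = (SUM j<N n. Ph (\<tau> n j) (sig n j) \<bullet> integral (?I j) g - integral (?I j) (%s. Ph s s \<bullet> g s))"
   unfolding integral_uniform_partition[OF integrable_continuous_real[OF continuous_on_inner[OF diag g]] t N0] sum_subtractf
   by (intro arg_cong2[where f = minus] sum.cong refl) (simp only: cell lessThan_iff)
  have "norm (SUM j<N n. Ph (\<tau> n j) (sig n j) \<bullet> integral (?I j) g - integral (?I j) (%s. Ph s s \<bullet> g s))
    <= (SUM j<N n. integral (?I j) (%s. eps * norm (g s)))"
   by (rule order_trans[OF norm_sum sum_mono]) (use step in auto)
  also have "... = integral {0..t} (%s. eps * norm (g s))"
   by (rule integral_uniform_partition[OF integrable_continuous_real[OF continuous_on_mult_left[OF gn]] t N0, symmetric])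
  also have "... <= eps * G" using eps by (simp add: G_def)
  also have "... < e" using e G by (simp add: eps_def)
  finally show "norm ((SUM j<N n. Ph (\<tau> n j) (sig n j)
   \<bullet> (integral {0..real (Suc j) * t / N n} g - integral {0..real j * t / N n} g)) - integral {0..t} (%s. Ph s s \<bullet> g s)) < e"
   unfolding e1 .
 qed
qed

text \<open>The integrator \<open>v\<close> is only continuous, as a Brownian path is, and the
  integrand \<open>a\<close> is C1. Summation by parts moves the increments to \<open>a\<close>, and
  \<open>v\<close> is then evaluated at the right endpoints of the cells.\<close>

lemma stieltjes_sum_tendsto_deriv:
 fixes a v al :: "real => 'a::euclidean_space"
 assumes t: "0 <= t" and v: "continuous_on {0..t} v" "v 0 = 0"
  and a: "!!s. s : {0..t} ==> (a has_vector_derivative al s) (at s within {0..t})"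
  and al: "continuous_on {0..t} al"
 shows "(%n. SUM i<n. a (real i * t / n) \<bullet> (v (real (Suc i) * t / n) - v (real i * t / n)))
  ----> a t \<bullet> v t - integral {0..t} (%u. al u \<bullet> v u)"
\<comment> \<open>With \<open>Suc n\<close> cells the partition is never empty.\<close>
proof (rule LIMSEQ_imp_Suc)
 let ?p = "%n i. real i * t / real (Suc n)"
 have "(%n. SUM i<Suc n. v (?p n (Suc i)) \<bullet> (integral {0..?p n (Suc i)} al - integral {0..?p n i} al)) ----> integral {0..t} (%u. v u \<bullet> al u)"
 proof (rule tagged_sum_tendsto[OF t _ _ al LIMSEQ_Suc[OF lim_const_over_n[of t]], where Ph = "%x _. v x"])
  show "continuous_on ({0..t} \<times> {0..t}) (%z. v (fst z))"
   by (intro continuous_on_compose2[OF v(1)] continuous_intros) auto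
  show "?p n (Suc j) : {0..t}" "?p n (Suc j) : {0..t}" if "j < Suc n" for n j
   using partition_in[of "Suc j" "Suc n" t] that t by auto
  have "?p n (Suc j) = ?p n j + t / real (Suc n)" for n j by (simp add: add_divide_distrib distrib_right)
  thus "\<bar>?p n (Suc j) - s\<bar> <= t / real (Suc n)" "\<bar>?p n (Suc j) - s\<bar> <= t / real (Suc n)"
   if "s : {?p n j..?p n (Suc j)}" for n j s
   using that by auto
 qed simp
 from tendsto_diff[OF tendsto_const this, of "a t \<bullet> v t"]
 show "(%n. SUM i<Suc n. a (?p n i) \<bullet> (v (?p n (Suc i)) - v (?p n i))) ----> a t \<bullet> v t - integral {0..t} (%u. al u \<bullet> v u)"
  unfolding inner_commute[of "al _"]
 proof (rule Lim_transform_eventually[OF _ always_eventually], intro allI)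
  fix n
  have I: "integral {0..r} al = a r - a 0" if "r : {0..t}" for r
   by (rule integral_unique[OF fundamental_theorem_of_calculus])
    (use that in "auto intro!: has_vector_derivative_within_subset[OF a]")
  have "integral {0..?p n (Suc i)} al - integral {0..?p n i} al = a (?p n (Suc i)) - a (?p n i)" if "i < Suc n" for i
   using I[OF partition_in[of "Suc i" "Suc n" t]] I[OF partition_in[of i "Suc n" t]] that t by simp
  hence "(SUM i<Suc n. v (?p n (Suc i)) \<bullet> (integral {0..?p n (Suc i)} al - integral {0..?p n i} al))
    = (SUM i<Suc n. v (?p n (Suc i)) \<bullet> (a (?p n (Suc i)) - a (?p n i)))"
   by (intro sum.cong refl) (simp only: lessThan_iff)
  moreover have "(SUM i<Suc n. a (?p n (Suc i)) \<bullet> v (?p n (Suc i)) - a (?p n i) \<bullet> v (?p n i)) = a t \<bullet> v t"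
   using sum_lessThan_telescope[of "%i. a (?p n i) \<bullet> v (?p n i)" "Suc n"] v(2) by simp
  moreover have "a (?p n i) \<bullet> (v (?p n (Suc i)) - v (?p n i))
    = (a (?p n (Suc i)) \<bullet> v (?p n (Suc i)) - a (?p n i) \<bullet> v (?p n i)) - v (?p n (Suc i)) \<bullet> (a (?p n (Suc i)) - a (?p n i))" for i
   by (simp add: inner_diff_left inner_diff_right inner_commute del: of_nat_Suc)
  hence "(SUM i<Suc n. a (?p n i) \<bullet> (v (?p n (Suc i)) - v (?p n i)))
    = (SUM i<Suc n. a (?p n (Suc i)) \<bullet> v (?p n (Suc i)) - a (?p n i) \<bullet> v (?p n i)) - (SUM i<Suc n. v (?p n (Suc i)) \<bullet> (a (?p n (Suc i)) - a (?p n i)))"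
   by (simp only: sum_subtractf)
  ultimately show "a t \<bullet> v t - (SUM i<Suc n. v (?p n (Suc i)) \<bullet> (integral {0..?p n (Suc i)} al - integral {0..?p n i} al))
    = (SUM i<Suc n. a (?p n i) \<bullet> (v (?p n (Suc i)) - v (?p n i)))" by simp
 qed
qed

lemma riemann_sum_tendsto:
 fixes f :: "real => 'a::euclidean_space"
 assumes f: "continuous_on {0..t} f" and t: "0 <= t"
 shows "(%n. SUM i<n. (t / n) *\<^sub>R f (real i * t / n)) ----> integral {0..t} f"
proof (rule LIMSEQ_imp_Suc, rule tendsto_componentwise_iff[THEN iffD2], rule ballI)
 fix b :: 'a assume b: "b : Basis"
 let ?p = "%n i. real i * t / real (Suc n)"
 have "(%n. SUM i<Suc n. (f (?p n i) \<bullet> b) \<bullet> (integral {0..?p n (Suc i)} (%_. 1::real) - integral {0..?p n i} (%_. 1)))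
  ----> integral {0..t} (%u. (f u \<bullet> b) \<bullet> 1)"
 proof (rule tagged_sum_tendsto[OF t _ _ continuous_on_const LIMSEQ_Suc[OF lim_const_over_n[of t]], where Ph = "%x _. f x \<bullet> b"])
  show "continuous_on ({0..t} \<times> {0..t}) (%z. f (fst z) \<bullet> b)"
   by (intro continuous_intros continuous_on_compose2[OF f]) auto
  show "?p n j : {0..t}" "?p n j : {0..t}" if "j < Suc n" for n j
   using partition_in[of j "Suc n" t] that t by auto
  have "?p n (Suc j) = ?p n j + t / real (Suc n)" for n j by (simp add: add_divide_distrib distrib_right)
  thus "\<bar>?p n j - s\<bar> <= t / real (Suc n)" "\<bar>?p n j - s\<bar> <= t / real (Suc n)"
   if "s : {?p n j..?p n (Suc j)}" for n j s
   using that by auto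
 qed simp
 moreover have "integral {0..?p n (Suc i)} (%_. 1::real) - integral {0..?p n i} (%_. 1) = t / real (Suc n)" for n i
  using t by (simp add: add_divide_distrib distrib_right)
 moreover have "integral {0..t} f \<bullet> b = integral {0..t} (%u. f u \<bullet> b)"
  using integral_component_eq[OF integrable_continuous_real[OF f], of b] by simp
 ultimately show "(%n. (SUM i<Suc n. (t / real (Suc n)) *\<^sub>R f (?p n i)) \<bullet> b) ----> integral {0..t} f \<bullet> b"
  by (simp add: inner_sum_left mult.commute del: sum.lessThan_Suc of_nat_Suc)
qed

section \<open>Measurability\<close>

text \<open>Since the paths are continuous, the integral is a pointwise limit of Riemann sums, and
  measurability at each fixed time passes to the limit.\<close>

lemma borel_measurable_integral_path:
 fixes g :: "real => 'w => 'a::euclidean_space"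
 assumes t: "0 <= t" and g: "!!s. s : {0..t} ==> g s : borel_measurable G"
  and c: "!!w. w : space G ==> continuous_on {0..t} (%s. g s w)"
 shows "(%w. integral {0..t} (%s. g s w)) : borel_measurable G"
proof (rule borel_measurable_LIMSEQ_metric)
 show "(%w. SUM i<n. (t / n) *\<^sub>R g (real i * t / n) w) : borel_measurable G" for n
  by (intro borel_measurable_sum borel_measurable_scaleR borel_measurable_const g partition_in)
   (use t in auto)
 show "(%n. SUM i<n. (t / n) *\<^sub>R g (real i * t / n) w) ----> integral {0..t} (%s. g s w)"
  if "w : space G" for w
  by (rule riemann_sum_tendsto[OF c[OF that] t])
qed

lemma borel_measurable_bounded_bilinear:
 fixes p :: "'b::{second_countable_topology, real_normed_vector} =>
   'a::{second_countable_topology, real_normed_vector} => 'c::real_normed_vector"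
 assumes "bounded_bilinear p" "f : borel_measurable G" "g : borel_measurable G"
 shows "(%w. p (f w) (g w)) : borel_measurable G"
 by (rule borel_measurable_continuous_Pair[OF assms(2,3)])
  (intro bounded_bilinear.continuous_on[OF assms(1)] continuous_intros)

lemma borel_measurable_vsol:
 fixes A :: "real => 'w => 'b::{second_countable_topology, real_normed_vector}"
  and f :: "real => 'w => 'a::euclidean_space"
 assumes p: "bounded_bilinear p" and t: "0 <= t"
  and A: "!!s. s : {0..t} ==> A s : borel_measurable G"
   "!!w. w : space G ==> continuous_on {0..t} (%s. A s w)"
  and f: "!!s. s : {0..t} ==> f s : borel_measurable G"
   "!!w. w : space G ==> continuous_on {0..t} (%s. f s w)"
 shows "(%w. vsol p (%s. A s w) (%s. f s w) t) : borel_measurable G"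
proof (rule borel_measurable_LIMSEQ_metric)
 have "(%w. picard p (%s. A s w) (%s. f s w) n s) : borel_measurable G" if "s : {0..t}" for n s
  using that
 proof (induction n arbitrary: s)
  case 0 thus ?case using f(1) by simp
 next
  case (Suc n)
  have "(%w. integral {0..s} (%u. p (A u w) (picard p (%s. A s w) (%s. f s w) n u))) : borel_measurable G"
  proof (rule borel_measurable_integral_path)
   show "(%w. p (A u w) (picard p (%s. A s w) (%s. f s w) n u)) : borel_measurable G"
    if "u : {0..s}" for u
    by (rule borel_measurable_bounded_bilinear[OF p A(1) Suc.IH]) (use Suc.prems that in auto)
   show "continuous_on {0..s} (%u. p (A u w) (picard p (%s. A s w) (%s. f s w) n u))"
    if "w : space G" for w
    by (rule continuous_on_subset[of "{0..t}"])
     (use Suc.prems that A f in "auto intro!: bounded_bilinear.continuous_on[OF p] picard_continuous[OF p]")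
  qed (use Suc.prems in auto)
  thus ?case
   using f(1)[OF Suc.prems] by simp
 qed
 thus "(%w. picard p (%s. A s w) (%s. f s w) n t) : borel_measurable G" for n
  using t by simp
 show "(%n. picard p (%s. A s w) (%s. f s w) n t) ----> vsol p (%s. A s w) (%s. f s w) t"
  if "w : space G" for w
  by (rule tendsto_uniform_limitI[OF picard_uniform_limit[OF p A(2)[OF that] f(2)[OF that]]]) (use t in auto)
qed

section \<open>Stable matrices\<close>

text \<open>The vector p(A) x, evaluated by the Horner scheme, so that only products of a matrix
  with a vector occur.\<close>

definition poly_op :: "complex^'n^'n => complex poly => complex^'n => complex^'n" where
 "poly_op A p x = fold_coeffs (%a y. a *s x + A *v y) p 0"

lemma poly_op_0 [simp]: "poly_op A 0 x = 0"
 by (simp add: poly_op_def)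

lemma poly_op_pCons [simp]: "poly_op A (pCons a p) x = a *s x + A *v poly_op A p x"
 by (cases "a = 0 & p = 0") (auto simp: poly_op_def fold_coeffs_pCons_not_0_0_eq)

lemma poly_op_add: "poly_op A (p + q) x = poly_op A p x + poly_op A q x"
 by (induction p q rule: poly_induct2) (simp_all add: matrix_vector_right_distrib vector_sadd_rdistrib algebra_simps)



lemma poly_op_smult: "poly_op A (smult c p) x = c *s poly_op A p x"
 by (induction p) (simp_all add: vector_add_ldistrib vector_smult_assoc vector_scalar_commute)

lemma poly_op_diff: "poly_op A (p - q) x = poly_op A p x - poly_op A q x"
 using poly_op_add[of A p "- q" x] poly_op_smult[of A "-1" q x] by (simp add: vec_eq_iff)

lemma poly_op_shift: "A *v poly_op A p x - c *s poly_op A p x = poly_op A p (A *v x - c *s x)"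
proof (induction p)
 case (pCons a p)
 have "A *v poly_op A (pCons a p) x - c *s poly_op A (pCons a p) x
  = a *s (A *v x - c *s x) + A *v (A *v poly_op A p x - c *s poly_op A p x)"
  by (simp add: vector_add_ldistrib vector_smult_assoc vector_scalar_commute
    matrix_vector_right_distrib matrix_vector_mult_diff_distrib vector_ssub_ldistrib mult.commute algebra_simps)
 thus ?case using pCons by simp
qed simp

lemma poly_op_mult_linear:
 "poly_op A ([:- c, 1:] * p) x = poly_op A p (A *v x - c *s x)"
 by (simp add: poly_op_diff poly_op_smult flip: poly_op_shift)

lemma poly_op_monom: "poly_op A (monom c i) x = c *s ((*v) A ^^ i) x"
 by (induction i) (simp_all add: monom_0 monom_Suc vector_scalar_commute)

lemma poly_op_sum: "poly_op A (sum p I) x = (SUM i:I. poly_op A (p i) x)"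
 by (induction I rule: infinite_finite_induct) (simp_all add: poly_op_add)

text \<open>The iterates of \<open>x\<close> under \<open>A\<close> up to the power \<open>N\<close>
  outnumber the real dimension \<open>N\<close> of the space, hence satisfy a linear relation, even
  with real coefficients.\<close>

lemma annihilating_poly:
 fixes A :: "complex^'n^'n"
 shows "EX p. p ~= 0 & poly_op A p x = 0"
proof -
 define f where "f i = ((*v) A ^^ i) x" for i
 define N where "N = DIM(complex^'n)"
 obtain c :: "nat => real" and i where c: "i <= N" "c i ~= 0" "(SUM i<=N. c i *\<^sub>R f i) = 0"
 proof (cases "inj_on f {..N}")
  case True
  hence "card (f ` {..N}) > N" by (simp add: card_image)
  hence "dependent (f ` {..N})"
   unfolding N_def by (intro dependent_biggerset) auto
  then obtain u v where u: "v : f ` {..N}" "u v ~= 0" "(SUM v:f ` {..N}. u v *\<^sub>R v) = 0"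
   using dependent_finite[of "f ` {..N}"] by auto
  then obtain i where "i <= N" "v = f i" by auto
  with u True show thesis
   by (intro that[of i "u \<circ> f"]) (auto simp: sum.reindex)
 next
  \<comment> \<open>Linear dependence is a property of the set of vectors, in which a repetition is
    invisible; a repeated vector gives the relation with coefficients 1 and -1 directly.\<close>
  case False
  then obtain i j where ij: "i <= N" "j <= N" "i ~= j" "f i = f j" unfolding inj_on_def by auto
  have "(SUM k<=N. (if k = i then 1 else if k = j then -1 else 0 :: real) *\<^sub>R f k)
   = (SUM k<=N. (if k = i then f i else 0) - (if k = j then f j else 0))"
   using ij by (intro sum.cong) auto
  also have "... = 0" using ij by (simp add: sum_subtractf sum.delta)
  finally show thesis using ij
   by (intro that[of i "%k. if k = i then 1 else if k = j then -1 else 0"]) auto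
 qed
 define p where "p = (SUM i<=N. monom (complex_of_real (c i)) i)"
 have "coeff p i = complex_of_real (c i)"
  using c(1) by (simp add: p_def coeff_sum)
 hence "p ~= 0" using c(2) by auto
 moreover have "poly_op A p x = (SUM i<=N. c i *\<^sub>R f i)"
  unfolding p_def poly_op_sum poly_op_monom f_def
  by (intro sum.cong refl, simp add: vec_eq_iff) (simp add: scaleR_conv_of_real)
 ultimately show ?thesis using c(3) by metis
qed

text \<open>This replaces the Jordan form: an annihilating polynomial of \<open>x\<close> is split
  into linear factors, and a root that is not an eigenvalue gives an injective factor, which can be
  cancelled because all factors commute.\<close>

lemma annihilating_eigenvalues:
 fixes A :: "complex^'n^'n"
 shows "EX ls. (ALL l:set ls. EX v. v ~= 0 & A *v v = l *s v)
     & foldr (%l y. A *v y - l *s y) ls x = 0"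
proof -
 have comm: "foldr (%l y. A *v y - l *s y) ls (A *v y - r *s y)
   = A *v foldr (%l y. A *v y - l *s y) ls y - r *s foldr (%l y. A *v y - l *s y) ls y" for ls y r
 proof (induction ls)
  case (Cons l ls)
  show ?case
   unfolding foldr.simps comp_apply Cons
   by (simp add: vec_eq_iff matrix_vector_mult_diff_distrib vector_scalar_commute algebra_simps)
 qed simp
 have "EX ls. (ALL l:set ls. EX v. v ~= 0 & A *v v = l *s v) & foldr (%l y. A *v y - l *s y) ls x = 0"
  if "p ~= 0" "poly_op A p x = 0" for p x
  using that
 proof (induction "degree p" arbitrary: p x)
  case 0
  then obtain c where "p = [:c:]" by (metis degree_eq_zeroE)
  with 0 have "x = 0" by simp
  thus ?case by (intro exI[of _ "[]"]) simp
 next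
  case (Suc n)
  then obtain r where "poly p r = 0"
   using fundamental_theorem_of_algebra[of p] by (auto simp: constant_degree)
  then obtain q where q: "p = [:- r, 1:] * q" by (metis poly_eq_0_iff_dvd dvdE)
  have q0: "q ~= 0" using Suc.prems q by auto
  have "degree p = degree [:- r, 1:] + degree q"
   unfolding q by (rule degree_mult_eq) (use q0 in auto)
  hence dq: "n = degree q" using Suc.hyps(2) by simp
  have qx: "poly_op A q (A *v x - r *s x) = 0"
   using Suc.prems q by (simp only: poly_op_mult_linear)
  obtain ls where ls: "ALL l:set ls. EX v. v ~= 0 & A *v v = l *s v"
    "foldr (%l y. A *v y - l *s y) ls (A *v x - r *s x) = 0"
   using Suc.hyps(1)[OF dq q0 qx] by blast
  show ?case
  proof (cases "EX v. v ~= 0 & A *v v = r *s v")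
   case True
   with ls show ?thesis by (intro exI[of _ "ls @ [r]"]) auto
  next
   case False
   define y where "y = foldr (%l y. A *v y - l *s y) ls x"
   have "A *v y - r *s y = 0" using ls(2) comm[of ls x r] by (simp add: y_def)
   hence "y = 0" using False by auto
   with ls(1) show ?thesis unfolding y_def by blast
  qed
 qed
 note * = this
 obtain p where "p ~= 0" "poly_op A p x = 0" using annihilating_poly by metis
 thus ?thesis by (rule *)
qed

lemma has_vector_derivative_vec_nth:
 "(f has_vector_derivative D) F ==> ((%t. f t $ i) has_vector_derivative D $ i) F"
 by (rule bounded_linear.has_vector_derivative[OF bounded_linear_vec_nth])

text \<open>Scalar variation of constants. The rate \<open>a\<close> of the forcing has to stay
  strictly below \<open>- Re l\<close>; at equality a factor \<open>t\<close> would appear.\<close>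

lemma exp_decay_eigen:
 fixes g w :: "real => complex"
 assumes g: "!!t. 0 <= t ==> (g has_vector_derivative l * g t + w t) (at t within {0..})"
  and w: "!!t. 0 <= t ==> norm (w t) <= c * exp (- a * t)" "continuous_on {0..} w"
  and l: "a < - Re l" "0 <= t" "0 <= c"
 shows "norm (g t) <= (norm (g 0) + c / (- Re l - a)) * exp (- a * t)"
proof -
 define rh where "rh = - Re l"
 have rh: "a < rh" using l by (simp add: rh_def)
 define h where "h t = exp (- l * of_real t) * g t" for t
 have h: "((%s. exp (- l * of_real s) * w s) has_integral (h t - h 0)) {0..t}"
 proof (rule fundamental_theorem_of_calculus)
  fix s assume s: "s : {0..t}"
  have e: "((%s. exp (- l * of_real s)) has_vector_derivative - l * exp (- l * of_real s)) (at s within {0..t})"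
  proof -
   have "((%z. exp (- l * z)) has_field_derivative - l * exp (- l * of_real s)) (at (of_real s))"
    by (auto intro!: derivative_eq_intros)
   from has_vector_derivative_real_field[OF this]
   show ?thesis by (rule has_vector_derivative_at_within)
  qed
  have "(h has_vector_derivative (exp (- l * of_real s) * (l * g s + w s)
    + - l * exp (- l * of_real s) * g s)) (at s within {0..t})"
   unfolding h_def using s
   by (intro has_vector_derivative_mult e has_vector_derivative_within_subset[OF g]) auto
  thus "(h has_vector_derivative exp (- l * of_real s) * w s) (at s within {0..t})"
   by (simp add: algebra_simps)
 qed (use l in auto)
 have bd: "norm (exp (- l * of_real s) * w s) <= c * exp ((rh - a) * s)" if "s : {0..t}" for s
 proof -
  have "norm (exp (- l * of_real s) * w s) = exp (rh * s) * norm (w s)"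
   by (simp add: norm_mult rh_def)
  also have "... <= exp (rh * s) * (c * exp (- a * s))"
   using w(1)[of s] that by (intro mult_left_mono) auto
  also have "... = c * exp ((rh - a) * s)" by (simp add: left_diff_distrib exp_diff exp_minus field_simps)
  finally show ?thesis .
 qed
 have "norm (h t - h 0) = norm (integral {0..t} (%s. exp (- l * of_real s) * w s))"
  using h by (simp add: integral_unique)
 also have "... <= integral {0..t} (%s. c * exp ((rh - a) * s))"
  by (rule norm_integral_le[OF _ _ bd]) (auto intro!: continuous_intros continuous_Icc[OF w(2)])
 also have "... = c * ((exp ((rh - a) * t) - 1) / (rh - a))"
  using integral_exp_le[of "rh - a" t] rh l(2) by simp
 also have "... <= c * (exp ((rh - a) * t) / (rh - a))"
  using rh l by (intro mult_left_mono divide_right_mono) auto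
 finally have 1: "norm (h t) <= norm (g 0) + c / (rh - a) * exp ((rh - a) * t)"
  using norm_triangle_ineq2[of "h t" "h 0"] by (simp add: h_def)
 have "norm (g t) = exp (- rh * t) * norm (h t)"
  by (simp add: h_def norm_mult rh_def norm_exp_eq_Re mult.assoc[symmetric] flip: exp_add)
 also have "... <= exp (- rh * t) * (norm (g 0) + c / (rh - a) * exp ((rh - a) * t))"
  by (intro mult_left_mono 1) auto
 also have "... = exp (- rh * t) * norm (g 0) + c / (rh - a) * (exp (- rh * t) * exp ((rh - a) * t))"
  by (simp add: algebra_simps)
 also have "exp (- rh * t) * exp ((rh - a) * t) = exp (- a * t)"
  by (simp add: algebra_simps flip: exp_add)
 also have "exp (- rh * t) * norm (g 0) <= exp (- a * t) * norm (g 0)"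
  using rh l by (intro mult_right_mono) (auto intro!: mult_right_mono)
 finally show ?thesis by (simp add: rh_def algebra_simps)
qed

lemma bounded_linear_matrix_shift:
 fixes A :: "complex^'n^'n"
 shows "bounded_linear (%x. A *v x - l *s x)"
proof (rule linear_conv_bounded_linear[THEN iffD1], rule linearI)
 show "A *v (r *\<^sub>R x) - l *s (r *\<^sub>R x) = r *\<^sub>R (A *v x - l *s x)" for r and x :: "complex^'n"
  by (subst linear_scale[OF matrix_vector_mul_linear]) (simp add: vec_eq_iff algebra_simps)
qed (simp add: vec_eq_iff matrix_vector_right_distrib algebra_simps)

text \<open>The function \<open>w = A v - l v\<close> solves the same equation and is annihilated by
  the shorter list, so it decays; each component of \<open>v\<close> then solves a scalar equation
  with exponent \<open>l\<close> that is forced by \<open>w\<close>. As \<open>foldr\<close> applies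
  the last factor first, the induction removes factors from the right.\<close>

lemma exp_decay_eigenvalue_list:
 fixes A :: "complex^'n^'n"
 assumes "!!t. 0 <= t ==> (v has_vector_derivative A *v v t) (at t within {0..})"
  and "!!t. 0 <= t ==> foldr (%l y. A *v y - l *s y) ls (v t) = 0"
  and "ALL l:set ls. Re l < 0"
 shows "EX c a. 0 <= c & 0 < a & (ALL t>=0. norm (v t) <= c * exp (- a * t))"
 using assms
proof (induction ls arbitrary: v rule: rev_induct)
 case Nil
 thus ?case by (intro exI[of _ 0] exI[of _ 1]) auto
next
 case (snoc l ls)
 define w where "w t = A *v v t - l *s v t" for t
 have bl: "bounded_linear (%x. A *v x - l *s x)"
  by (rule bounded_linear_matrix_shift)
 have w': "(w has_vector_derivative A *v w t) (at t within {0..})" if "0 <= t" for t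
  using bounded_linear.has_vector_derivative[OF bl snoc.prems(1)[OF that]]
  by (simp add: w_def[abs_def] matrix_vector_mult_diff_distrib vector_scalar_commute)
 obtain c a where ca: "0 <= c" "0 < a" "!!t. 0 <= t ==> norm (w t) <= c * exp (- a * t)"
  using snoc.IH[OF w'] snoc.prems(2,3) by (auto simp: w_def)
 \<comment> \<open>Half of \<open>- Re l\<close> keeps the rate strictly below that of the
   eigenvalue, as \<open>exp_decay_eigen\<close> demands.\<close>
 define b where "b = min a (- Re l / 2)"
 have b: "0 < b" "b < - Re l" "b <= a" using ca snoc.prems(3) by (auto simp: b_def)
 have wb: "norm (w t $ i) <= c * exp (- b * t)" if "0 <= t" for t i
 proof -
  have "norm (w t $ i) <= c * exp (- a * t)"
   using Finite_Cartesian_Product.norm_nth_le[of "w t" i] ca(3)[OF that] by linarith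
  also have "... <= c * exp (- b * t)"
   using b that ca(1) by (intro mult_left_mono) (auto intro!: mult_right_mono)
  finally show ?thesis .
 qed
 have cw: "continuous_on {0..} w"
  using w' by (auto simp: continuous_on_eq_continuous_within intro: has_vector_derivative_continuous)
 have "norm (v t $ i) <= (norm (v 0 $ i) + c / (- Re l - b)) * exp (- b * t)" if "0 <= t" for t i
 proof (rule exp_decay_eigen[where w = "%t. w t $ i"])
  show "((%t. v t $ i) has_vector_derivative l * v t $ i + w t $ i) (at t within {0..})" if "0 <= t" for t
   using has_vector_derivative_vec_nth[OF snoc.prems(1)[OF that], of i] by (simp add: w_def)
  show "continuous_on {0..} (%t. w t $ i)" by (intro continuous_intros cw)
 qed (use wb b ca that in auto)
 hence "norm (v t) <= (SUM i:UNIV. (norm (v 0 $ i) + c / (- Re l - b)) * exp (- b * t))" if "0 <= t" for t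
  using that unfolding norm_vec_def[of "v t"]
  by (intro order_trans[OF L2_set_le_sum]) (auto intro!: sum_mono)
 hence "ALL t>=0. norm (v t) <= (SUM i:UNIV. norm (v 0 $ i) + c / (- Re l - b)) * exp (- b * t)"
  by (simp only: sum_distrib_right) blast
 moreover have "0 <= (SUM i:UNIV. norm (v 0 $ i) + c / (- Re l - b))"
  using b ca by (intro sum_nonneg add_nonneg_nonneg divide_nonneg_pos) auto
 ultimately show ?case using b(1) by metis
qed

lemma ode_zero:
 fixes v :: "real => 'a::euclidean_space"
 assumes L: "bounded_linear L" and v: "!!t. 0 <= t ==> (v has_vector_derivative L (v t)) (at t within {0..})"
  and "v 0 = 0" "0 <= t"
 shows "v t = 0"
proof -
 have p: "bounded_bilinear (%(r::real) x. r *\<^sub>R L x)"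
  by (rule bounded_bilinear.comp[OF bounded_bilinear_scaleR bounded_linear_ident L])
 have c: "continuous_on {0..t} v"
  using v by (intro continuous_Icc) (auto simp: continuous_on_eq_continuous_within
    intro: has_vector_derivative_continuous)
 show ?thesis
 proof (rule volterra_unique[OF p, of t "%_. 1" v "%_. 0" "%_. 0"])
  fix s assume s: "s : {0..t}"
  have "((%r. L (v r)) has_integral (v s - v 0)) {0..s}"
   by (rule fundamental_theorem_of_calculus) (use s v in "auto intro!: has_vector_derivative_within_subset[OF v]")
  thus "v s = 0 + integral {0..s} (%s. 1 *\<^sub>R L (v s))"
   using assms(3) by (simp add: integral_unique)
 next
  show "0 = 0 + integral {0..s} (%s. 1 *\<^sub>R L 0)" for s
   using L by (simp add: bounded_linear.linear linear_0)
 qed (use assms c in auto)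
qed

lemma stable_matrix_solution_decay:
 fixes A :: "real^'n^'n"
 assumes ev: "ALL l. complex_eigenvalue A l --> Re l < 0"
  and y: "!!t. 0 <= t ==> (y has_vector_derivative A *v y t) (at t within {0..})"
 shows "EX c a. 0 <= c & 0 < a & (ALL t>=0. norm (y t) <= c * exp (- a * t))"
proof -
 define Ac where "Ac = map_matrix complex_of_real A"
 define cx :: "real^'n => complex^'n" where "cx x = (\<chi> i. complex_of_real (x $ i))" for x
 have cxA: "cx (A *v x) = Ac *v cx x" for x
  by (simp add: cx_def Ac_def vec_eq_iff matrix_vector_mult_def map_matrix_def)
 have blc: "bounded_linear cx"
  by (intro linear_conv_bounded_linear[THEN iffD1] linearI, simp_all add: cx_def vec_eq_iff)
   (simp add: scaleR_conv_of_real)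
 have normc: "norm (cx x) = norm x" for x
  by (simp add: norm_vec_def cx_def)
 define u where "u t = cx (y t)" for t
 have u: "(u has_vector_derivative Ac *v u t) (at t within {0..})" if "0 <= t" for t
  using bounded_linear.has_vector_derivative[OF blc y[OF that]] by (simp add: u_def[abs_def] cxA)
 obtain ls where ls: "ALL l:set ls. EX v. v ~= 0 & Ac *v v = l *s v"
  "foldr (%l y. Ac *v y - l *s y) ls (u 0) = 0"
  using annihilating_eigenvalues by blast
 have bl: "bounded_linear (foldr (%l y. Ac *v y - l *s y) ls)"
  for ls
 proof (induction ls)
  case (Cons l ls)
  have "bounded_linear (%x. Ac *v x - l *s x)"
   by (rule bounded_linear_matrix_shift)
  from bounded_linear_compose[OF this Cons] show ?case by (simp add: o_def)
 qed (simp add: bounded_linear_ident id_def)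
 have comm: "foldr (%l y. Ac *v y - l *s y) ls (Ac *v y) = Ac *v foldr (%l y. Ac *v y - l *s y) ls y" for ls y
  by (induction ls) (simp_all add: matrix_vector_mult_diff_distrib vector_scalar_commute)
 \<comment> \<open>The product of the factors commutes with the matrix, so it maps the solution to a
   solution, and the initial value of that solution is 0.\<close>
 have "foldr (%l y. Ac *v y - l *s y) ls (u t) = 0" if "0 <= t" for t
  by (rule ode_zero[where L = "(*v) Ac" and v = "%t. foldr (%l y. Ac *v y - l *s y) ls (u t)"])
   (use bounded_linear.has_vector_derivative[OF bl u] comm ls that in auto)
 from exp_decay_eigenvalue_list[OF u this]
 have "EX c a. 0 <= c & 0 < a & (ALL t>=0. norm (u t) <= c * exp (- a * t))"
  using ls(1) ev unfolding complex_eigenvalue_def Ac_def by auto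
 thus ?thesis by (simp add: u_def normc)
qed

section \<open>Linear differential equations\<close>

lemma derivative_continuous_on:
 assumes "!!t. t : S ==> (f has_vector_derivative f' t) (at t within S)"
 shows "continuous_on S f"
 unfolding continuous_on_eq_continuous_within using assms has_vector_derivative_continuous by blast

text \<open>For a merely continuous \<open>f\<close> only the difference of the solution and
  \<open>f\<close> is differentiable. This is the form in which equations with noise are treated
  later.\<close>

lemma vsol_eq_atLeast:
 assumes p: "bounded_bilinear p" and A: "continuous_on {0..} A" and f: "continuous_on {0..} f"
 shows "continuous_on {0..} (vsol p A f)"
  and "0 <= t ==> vsol p A f t = f t + integral {0..t} (%s. p (A s) (vsol p A f s))"
  and "0 <= t ==> ((%t. vsol p A f t - f t) has_vector_derivative p (A t) (vsol p A f t)) (at t within {0..})"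
proof -
 show c: "continuous_on {0..} (vsol p A f)"
  by (rule continuous_on_atLeastI, rule vsol_continuous[OF p])
   (rule continuous_Icc[OF A] continuous_Icc[OF f])+
 show eq: "vsol p A f t = f t + integral {0..t} (%s. p (A s) (vsol p A f s))" if "0 <= t" for t
  by (rule vsol_eq[OF p continuous_Icc[OF A] continuous_Icc[OF f]]) (use that in auto)
 assume t: "0 <= t"
 have "continuous_on {0..} (%s. p (A s) (vsol p A f s))"
  by (intro bounded_bilinear.continuous_on[OF p] A c)
 from integral_derivative_atLeast[OF this t]
 show "((%t. vsol p A f t - f t) has_vector_derivative p (A t) (vsol p A f t)) (at t within {0..})"
  by (rule has_vector_derivative_transform[rotated 2]) (use t eq in auto)
qed

lemma linear_ode_exists:
 fixes A :: "real => real^'n^'n"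
 assumes "continuous_on {0..} A"
 shows "EX y. y 0 = x & (ALL t>=0. (y has_vector_derivative A t *v y t) (at t within {0..}))"
proof -
 note v = vsol_eq_atLeast[OF bilinear_matrix_vector assms continuous_on_const[of _ x]]
 have "((%t. vsol (*v) A (%_. x) t - x + x) has_vector_derivative A t *v vsol (*v) A (%_. x) t) (at t within {0..})"
  if "0 <= t" for t
  using has_vector_derivative_add[OF v(3)[OF that] has_vector_derivative_const[of x]] by simp
 thus ?thesis using v(2)[of 0] by (intro exI[of _ "vsol (*v) A (%_. x)"]) auto
qed

text \<open>Solves the terminal value problem y' = - A y, y(t) = x by reversing time. It is explicit
  so that it stays measurable when \<open>A\<close> is random.\<close>

definition backward_sol :: "(real => real^'n^'n) => real => real^'n => real => real^'n" where
 "backward_sol A t x s = vsol (*v) (%r. A (t - r)) (%_. x) (t - s)"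

lemma backward_sol:
 fixes A :: "real => real^'n^'n"
 assumes A: "continuous_on {0..t} A" and t: "0 <= t"
 shows "backward_sol A t x t = x"
  and "s : {0..t} ==> (backward_sol A t x has_vector_derivative - (A s *v backward_sol A t x s)) (at s within {0..t})"
proof -
 define y where "y = vsol (*v) (%r. A (t - r)) (%_. x)"
 have b: "backward_sol A t x = y \<circ> (%s. t - s)" by (simp add: fun_eq_iff backward_sol_def y_def)
 have A': "continuous_on {0..t} (%r. A (t - r))"
  by (rule continuous_on_compose2[OF A]) (auto intro!: continuous_intros)
 have y: "continuous_on {0..t} y" "!!s. s : {0..t} ==> y s = x + integral {0..s} (%s. A (t - s) *v y s)"
  unfolding y_def
  by (rule vsol_continuous[OF bilinear_matrix_vector A'] vsol_eq[OF bilinear_matrix_vector A'];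
    auto)+
 have y': "(y has_vector_derivative A (t - s) *v y s) (at s within {0..t})" if "s : {0..t}" for s
 proof -
  have "continuous_on {0..t} (%s. A (t - s) *v y s)"
   by (intro continuous_on_matrix_vector A' y)
  from has_vector_derivative_add[OF has_vector_derivative_const[of x] integral_has_vector_derivative[OF this that]]
  have "((%s. x + integral {0..s} (%s. A (t - s) *v y s)) has_vector_derivative A (t - s) *v y s) (at s within {0..t})"
   by simp
  thus ?thesis
   by (rule has_vector_derivative_transform[rotated 2]) (use that y(2) in auto)
 qed
 show "backward_sol A t x t = x" using y(2)[of 0] t by (simp add: b)
 assume s: "s : {0..t}"
 have im: "(%s. t - s) ` {0..t} = {0..t}" by (auto simp: image_iff intro!: bexI[of _ "t - _"])
 have "((y \<circ> (%s. t - s)) has_vector_derivative (-1) *\<^sub>R (A (t - (t - s)) *v y (t - s))) (at s within {0..t})"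
 proof (rule vector_diff_chain_within)
  show "((%s. t - s) has_vector_derivative -1) (at s within {0..t})"
   by (auto intro!: derivative_eq_intros simp flip: has_real_derivative_iff_has_vector_derivative)
  show "(y has_vector_derivative A (t - (t - s)) *v y (t - s)) (at (t - s) within (%s. t - s) ` {0..t})"
   unfolding im by (rule y') (use s in auto)
 qed
 thus "(backward_sol A t x has_vector_derivative - (A s *v backward_sol A t x s)) (at s within {0..t})"
  by (simp add: b)
qed

text \<open>The constants must not depend on the solution. Every solution is a combination of those
  starting at the unit vectors, and the worst rate among these is taken.\<close>

lemma stable_matrix_decay:
 fixes A :: "real^'n^'n"
 assumes ev: "ALL l. complex_eigenvalue A l --> Re l < 0"
 shows "EX c a. 0 <= c & 0 < a & (ALL y. (ALL t>=0. (y has_vector_derivative A *v y t) (at t within {0..})) -->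
     (ALL t>=0. norm (y t) <= c * exp (- a * t) * norm (y 0)))"
proof -
 have "EX z. z 0 = axis j 1 & (ALL t>=0. (z has_vector_derivative A *v z t) (at t within {0..}))" for j
  using linear_ode_exists[of "%_. A" "axis j 1"] by simp
 then obtain z where z: "!!j. z j 0 = axis j 1"
  "!!j t. 0 <= t ==> (z j has_vector_derivative A *v z j t) (at t within {0..})"
  by metis
 have "EX c a. 0 <= c & 0 < a & (ALL t>=0. norm (z j t) <= c * exp (- a * t))" for j
  by (rule stable_matrix_solution_decay[OF ev z(2)])
 then obtain c a where ca: "!!j. 0 <= c j" "!!j. 0 < a j"
  "!!j t. 0 <= t ==> norm (z j t) <= c j * exp (- a j * t)"
  by metis
 define b where "b = Min (range a)"
 have b: "0 < b" "!!j. b <= a j" using ca(2) by (auto simp: b_def)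
 have "norm (y t) <= sum c UNIV * exp (- b * t) * norm (y 0)"
  if y: "!!t. 0 <= t ==> (y has_vector_derivative A *v y t) (at t within {0..})" and t: "0 <= t" for y t
 proof -
  define v where "v t = y t - (SUM j:UNIV. (y 0 $ j) *\<^sub>R z j t)" for t
  have "v t = 0"
  proof (rule ode_zero[OF matrix_vector_mul_bounded_linear[of A] _ _ t])
   fix s :: real assume s: "0 <= s"
   have "(v has_vector_derivative A *v y s - (SUM j:UNIV. (y 0 $ j) *\<^sub>R (A *v z j s))) (at s within {0..})"
    unfolding v_def
    by (intro has_vector_derivative_diff y s has_vector_derivative_sum
      bounded_linear.has_vector_derivative[OF bounded_linear_scaleR_right] z)
   thus "(v has_vector_derivative A *v v s) (at s within {0..})"
    by (simp add: v_def matrix_vector_mult_diff_distrib linear_sum[OF matrix_vector_mul_linear] matrix_vector_mult_scaleR)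
  qed (simp add: v_def z basis_expansion scalar_mult_eq_scaleR[symmetric])
  hence "norm (y t) = norm (SUM j:UNIV. (y 0 $ j) *\<^sub>R z j t)" by (simp add: v_def)
  also have "... <= (SUM j:UNIV. norm (y 0) * (c j * exp (- b * t)))"
  proof (intro sum_norm_le)
   fix j
   have "c j * exp (- a j * t) <= c j * exp (- b * t)"
    using b ca t by (intro mult_left_mono) (auto intro!: mult_right_mono)
   hence "norm (z j t) <= c j * exp (- b * t)" using ca(3)[OF t] order_trans by blast
   thus "norm ((y 0 $ j) *\<^sub>R z j t) <= norm (y 0) * (c j * exp (- b * t))"
    using component_le_norm_cart[of "y 0" j] by (simp add: mult_mono)
  qed
  also have "... = sum c UNIV * exp (- b * t) * norm (y 0)"
   by (simp add: sum_distrib_left sum_distrib_right mult_ac)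
  finally show ?thesis .
 qed
 moreover have "0 <= sum c UNIV" using ca by (simp add: sum_nonneg)
 ultimately show ?thesis using b by metis
qed

lemma matrix_inv_works:
 fixes A :: "real^'n^'n"
 assumes "invertible A"
 shows "A ** matrix_inv A = mat 1" "matrix_inv A ** A = mat 1"
proof -
 have "EX A'. A ** A' = mat 1 & A' ** A = mat 1" using assms by (simp add: invertible_def)
 from someI_ex[OF this] show "A ** matrix_inv A = mat 1" "matrix_inv A ** A = mat 1"
  by (simp_all add: matrix_inv_def)
qed

lemma invertible_iff_ker:
 fixes A :: "'a::field^'n^'n"
 shows "invertible A \<longleftrightarrow> (ALL x. A *v x = 0 --> x = 0)"
 by (simp add: invertible_left_inverse matrix_left_invertible_ker)

text \<open>An eigenvalue is a shift that makes the matrix singular, and determinants are invariant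
  under transposition.\<close>

lemma complex_eigenvalue_transpose:
 "complex_eigenvalue (transpose A) l \<longleftrightarrow> complex_eigenvalue A l"
proof -
 have ev: "complex_eigenvalue A l \<longleftrightarrow> ~  invertible (map_matrix complex_of_real A - mat l)" for A :: "real^'n^'n"
 proof -
  have "mat l *v v = l *s v" for v :: "complex^'n"
   by (simp add: vec_eq_iff mat_def matrix_vector_mult_def if_distrib if_distribR cong: if_cong)
  thus ?thesis
   by (auto simp: complex_eigenvalue_def invertible_iff_ker matrix_vector_mult_diff_rdistrib)
 qed
 have "map_matrix complex_of_real (transpose A) - mat l = transpose (map_matrix complex_of_real A - mat l)"
  by (simp add: vec_eq_iff map_matrix_def transpose_def mat_def)
 thus ?thesis
  by (simp add: ev invertible_det_nz)
qed

text \<open>The difference of the inverses is \<open>matrix_inv (X s)\<close> times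
  \<open>X t - X s\<close> times \<open>B\<close>. Near \<open>t\<close> this identity first bounds
  the norm of \<open>matrix_inv (X s)\<close> by twice that of \<open>B\<close>, and then gives the
  convergence.\<close>

lemma tendsto_matrix_inv:
 fixes X :: "real => real^'n^'n"
 assumes X: "(X \<longlongrightarrow> X t) (at t within S)" and inv: "!!s. s : S ==> invertible (X s)" and t: "t : S"
 shows "((%s. matrix_inv (X s)) \<longlongrightarrow> matrix_inv (X t)) (at t within S)"
proof -
 define B where "B = matrix_inv (X t)"
 define e where "e s = norm (X t - X s) * norm B" for s
 have "((%s. norm (X t - X s) * norm B) \<longlongrightarrow> norm (X t - X t) * norm B) (at t within S)"
  by (intro tendsto_intros X)
 hence e0: "(e \<longlongrightarrow> 0) (at t within S)" by (simp add: e_def[abs_def])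
 hence "\<forall>\<^sub>F s in at t within S. e s < 1/2" by (rule order_tendstoD) simp
 moreover have "\<forall>\<^sub>F s in at t within S. s : S" by (simp add: eventually_at_filter)
 ultimately have "\<forall>\<^sub>F s in at t within S. norm (matrix_inv (X s) - B) <= 2 * norm B * e s"
 proof eventually_elim
  case (elim s)
  have "matrix_inv (X s) - B = matrix_inv (X s) ** (X t ** B) - (matrix_inv (X s) ** X s) ** B"
   using matrix_inv_works[OF inv[OF elim(2)]] matrix_inv_works[OF inv[OF t]] by (simp add: B_def)
  also have "... = matrix_inv (X s) ** ((X t - X s) ** B)"
   by (simp add: matrix_mul_assoc bounded_bilinear.diff_left[OF bilinear_matrix_mult]
     bounded_bilinear.diff_right[OF bilinear_matrix_mult])
  finally have "norm (matrix_inv (X s) - B) <= norm (matrix_inv (X s)) * norm ((X t - X s) ** B)"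
   using norm_matrix_mult_le by metis
  also have "... <= norm (matrix_inv (X s)) * e s"
   unfolding e_def by (intro mult_left_mono norm_matrix_mult_le) auto
  finally have 1: "norm (matrix_inv (X s) - B) <= norm (matrix_inv (X s)) * e s" .
  also have "... <= norm (matrix_inv (X s)) * (1/2)"
   using elim by (intro mult_left_mono) auto
  finally have "norm (matrix_inv (X s)) <= 2 * norm B"
   using norm_triangle_ineq2[of "matrix_inv (X s)" B] by simp
  hence "norm (matrix_inv (X s)) * e s <= 2 * norm B * e s"
   by (intro mult_right_mono) (auto simp: e_def)
  with 1 show ?case by linarith
 qed
 moreover have "((%s. 2 * norm B * e s) \<longlongrightarrow> 0) (at t within S)"
  using tendsto_mult_right_zero[OF e0] by simp
 ultimately have "((%s. matrix_inv (X s) - B) \<longlongrightarrow> 0) (at t within S)"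
  by (rule Lim_null_comparison)
 thus ?thesis unfolding B_def by (rule LIM_zero_cancel)
qed

section \<open>The matrix Riccati equation\<close>

lemma spd_invertible: "spd A ==> invertible A"
 unfolding invertible_iff_ker spd_def by (metis inner_zero_right less_irrefl)

lemma spd_lower_bound:
 fixes A :: "real^'n^'n"
 assumes "spd A"
 obtains sig where "0 < sig" "!!x. sig * (norm x)^2 <= x \<bullet> (A *v x)"
proof -
 have "EX x:sphere 0 1. ALL y:sphere 0 1. x \<bullet> (A *v x) <= y \<bullet> (A *v y)"
  by (rule continuous_attains_inf) (auto intro!: continuous_intros)
 then obtain x where x: "norm x = 1" "!!y. norm y = 1 ==> x \<bullet> (A *v x) <= y \<bullet> (A *v y)" by auto
 show thesis
 proof (rule that[of "x \<bullet> (A *v x)"])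
  show "0 < x \<bullet> (A *v x)" using assms x(1) unfolding spd_def by (metis norm_zero zero_neq_one)
  fix y :: "real^'n"
  show "x \<bullet> (A *v x) * (norm y)^2 <= y \<bullet> (A *v y)"
  proof (cases "y = 0")
   case False
   have "x \<bullet> (A *v x) <= (y /\<^sub>R norm y) \<bullet> (A *v (y /\<^sub>R norm y))"
    by (rule x(2)) (use False in auto)
   thus ?thesis
    using False by (simp add: matrix_vector_mult_scaleR field_simps power2_eq_square)
  qed simp
 qed
qed

lemma norm_matrix_le_sum_inner:
 fixes D :: "real^'n^'m"
 assumes "!!i j. \<bar>axis i 1 \<bullet> (D *v axis j 1)\<bar> <= r"
 shows "norm D <= real CARD('m) * (real CARD('n) * r)"
proof -
 have D: "\<bar>D $ i $ j\<bar> <= r" for i j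
  using assms[of i j] by (simp add: inner_axis' matrix_vector_mult_basis column_def)
 have "norm (D $ i) <= real CARD('n) * r" for i
 proof -
  have "norm (D $ i) <= (SUM j:UNIV. \<bar>D $ i $ j\<bar>)" by (rule norm_le_l1_cart)
  also have "... <= real CARD('n) * r" by (rule sum_bounded_above) (rule D)
  finally show ?thesis .
 qed
 hence "(SUM i:UNIV. norm (D $ i)) <= real CARD('m) * (real CARD('n) * r)"
  by (intro sum_bounded_above) auto
 moreover have "norm D <= (SUM i:UNIV. norm (D $ i))"
  unfolding norm_vec_def[of D] by (rule L2_set_le_sum) auto
 ultimately show ?thesis by linarith
qed

text \<open>Polarization.\<close>
lemma norm_symmetric_matrix_le:
 fixes D :: "real^'n^'n"
 assumes sym: "transpose D = D"
  and r: "!!i j. \<bar>(axis i 1 + axis j 1) \<bullet> (D *v (axis i 1 + axis j 1))\<bar> <= r"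
 shows "norm D <= real CARD('n) * (real CARD('n) * r)"
proof (rule norm_matrix_le_sum_inner)
 fix i j :: 'n
 let ?q = "%i j. (axis i 1 + axis j 1) \<bullet> (D *v (axis i 1 + axis j 1))"
 have s: "axis j 1 \<bullet> (D *v axis i 1) = axis i 1 \<bullet> (D *v axis j 1)"
  by (metis inner_matrix sym inner_commute)
 have qij: "?q i j = axis i 1 \<bullet> (D *v axis i 1) + 2 * (axis i 1 \<bullet> (D *v axis j 1)) + axis j 1 \<bullet> (D *v axis j 1)"
  by (simp add: matrix_vector_right_distrib inner_add_left inner_add_right s)
 have qk: "?q k k = 4 * (axis k 1 \<bullet> (D *v axis k 1))" for k
  unfolding scaleR_2[symmetric] matrix_vector_mult_scaleR by simp
 have "axis i 1 \<bullet> (D *v axis j 1) = ?q i j / 2 - ?q i i / 8 - ?q j j / 8"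
  unfolding qij qk by (simp add: field_simps)
 thus "\<bar>axis i 1 \<bullet> (D *v axis j 1)\<bar> <= r"
  using r[of i j] r[of i i] r[of j j] by linarith
qed

lemma matrix_eqI_inner:
 fixes A B :: "real^'n^'m"
 assumes "!!x y. x \<bullet> (A *v y) = x \<bullet> (B *v y)"
 shows "A = B"
 by (metis assms matrix_eq vector_eq_ldot)

lemma bilinear_form_has_derivative:
 fixes P :: "real => real^'n^'n"
 assumes "(w has_vector_derivative w') (at s within T)" "(v has_vector_derivative v') (at s within T)"
  and "(P has_vector_derivative P') (at s within T)"
 shows "((%s. w s \<bullet> (P s *v v s)) has_real_derivative
  (w' \<bullet> (P s *v v s) + w s \<bullet> (P' *v v s) + w s \<bullet> (P s *v v'))) (at s within T)"
 using inner_derivative[OF assms(1) matrix_vector_derivative[OF assms(3,2)]]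
 by (simp add: has_real_derivative_iff_has_vector_derivative inner_add_right algebra_simps)

lemma has_integral_derivative_atLeast:
 fixes f :: "real => 'a::banach"
 assumes "!!s. 0 <= s ==> (f has_vector_derivative f' s) (at s within {0..})" "0 <= t"
 shows "(f' has_integral (f t - f 0)) {0..t}"
 by (rule fundamental_theorem_of_calculus[OF assms(2)])
  (rule has_vector_derivative_within_subset[OF assms(1)], auto)

lemma has_integral_real_derivative_atLeast:
 assumes "!!s. 0 <= s ==> (f has_real_derivative f' s) (at s within {0..})" "0 <= t"
 shows "(f' has_integral (f t - f 0)) {0..t}"
 by (rule has_integral_derivative_atLeast[OF _ assms(2)])
  (simp add: assms(1) flip: has_real_derivative_iff_has_vector_derivative)

locale riccati_data =
 fixes F \<Sigma> :: "real^'d^'d" and H :: "real^'d^'k" and \<Gamma> :: "real^'k^'k"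
 assumes spd_\<Sigma>: "spd \<Sigma>" and spd_\<Gamma>: "spd \<Gamma>"
begin

definition S :: "real^'d^'d" where "S = transpose H ** matrix_inv \<Gamma> ** H"

definition rhs :: "real^'d^'d => real^'d^'d" where
 "rhs P = F ** P + P ** transpose F + \<Sigma> - P ** S ** P"

definition drift :: "(real => real^'d^'d) => real => real^'d^'d" where
 "drift P t = F - P t ** S"

definition gain :: "(real => real^'d^'d) => real => real^'k^'d" where
 "gain P t = P t ** transpose H ** matrix_inv \<Gamma>"

text \<open>The time derivative of \<open>gain P\<close> along a solution of the Riccati equation.
  It is named because integrals against the gain are defined by partial integration.\<close>

definition gain' :: "(real => real^'d^'d) => real => real^'k^'d" where
 "gain' P t = rhs (P t) ** transpose H ** matrix_inv \<Gamma>"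

definition riccati :: "(real => real^'d^'d) => bool" where
 "riccati P \<longleftrightarrow> (ALL t>=0. (P has_vector_derivative rhs (P t)) (at t within {0..}) &
   transpose (P t) = P t & (ALL x. 0 <= x \<bullet> (P t *v x)))"

lemma transpose_\<Sigma> [simp]: "transpose \<Sigma> = \<Sigma>"
 using spd_\<Sigma> by (simp add: spd_def)

lemma transpose_\<Gamma> [simp]: "transpose \<Gamma> = \<Gamma>"
 using spd_\<Gamma> by (simp add: spd_def)

lemma \<Gamma>_inv [simp]: "\<Gamma> ** matrix_inv \<Gamma> = mat 1" "matrix_inv \<Gamma> ** \<Gamma> = mat 1"
 using matrix_inv_works[OF spd_invertible[OF spd_\<Gamma>]] by simp_all

lemma transpose_inv_\<Gamma> [simp]: "transpose (matrix_inv \<Gamma>) = matrix_inv \<Gamma>"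
proof -
 have "transpose (matrix_inv \<Gamma>) ** \<Gamma> = mat 1"
  by (metis \<Gamma>_inv(1) matrix_transpose_mul transpose_\<Gamma> transpose_mat)
 hence "transpose (matrix_inv \<Gamma>) ** \<Gamma> ** matrix_inv \<Gamma> = matrix_inv \<Gamma>" by simp
 thus ?thesis by (simp add: matrix_mul_assoc[symmetric])
qed

lemma transpose_S [simp]: "transpose S = S"
 by (simp add: S_def matrix_transpose_mul matrix_mul_assoc)

lemma S_inner: "x \<bullet> (S *v y) = (H *v x) \<bullet> (matrix_inv \<Gamma> *v (H *v y))"
 by (simp add: S_def matrix_vector_mul_assoc[symmetric] inner_matrix)

lemma inv_\<Gamma>_nonneg: "0 <= y \<bullet> (matrix_inv \<Gamma> *v y)"
proof -
 define z where "z = matrix_inv \<Gamma> *v y"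
 have "y = \<Gamma> *v z" by (simp add: z_def matrix_vector_mul_assoc)
 moreover have "0 <= z \<bullet> (\<Gamma> *v z)" using spd_\<Gamma> by (cases "z = 0") (auto simp: spd_def less_imp_le)
 ultimately show ?thesis by (simp add: z_def inner_commute)
qed

lemma S_nonneg: "0 <= x \<bullet> (S *v x)"
 by (simp add: S_inner inv_\<Gamma>_nonneg)

lemma S_commute: "x \<bullet> (S *v y) = y \<bullet> (S *v x)"
 by (metis inner_commute inner_matrix transpose_S)

lemma gain_mult_H: "gain P t ** H = P t ** S"
 by (simp add: gain_def S_def matrix_mul_assoc)

lemma transpose_drift:
 assumes "transpose (P t) = P t"
 shows "transpose (drift P t) *v w = transpose F *v w - S *v (P t *v w)"
 by (simp add: drift_def transpose_diff matrix_transpose_mul assms matrix_vector_mult_diff_rdistrib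
   matrix_vector_mul_assoc)

lemma inner_rhs:
 assumes sym: "transpose P = P"
 shows "x \<bullet> (rhs P *v y) = (transpose F *v x) \<bullet> (P *v y) + (P *v x) \<bullet> (transpose F *v y)
  + x \<bullet> (\<Sigma> *v y) - (P *v x) \<bullet> (S *v (P *v y))"
proof -
 have P: "x \<bullet> (P *v y) = (P *v x) \<bullet> y" for x y by (metis sym inner_matrix)
 show ?thesis
  by (simp add: rhs_def matrix_vector_mult_diff_rdistrib matrix_vector_mult_add_rdistrib inner_add_right
    inner_diff_right matrix_vector_mul_assoc[symmetric] P[of x "transpose F *v y"]
    P[of x "S *v (P *v y)"] inner_matrix[of x F])
qed

text \<open>A Riccati solution is \<open>Y ** X\<inverse>\<close> for a solution of the linear Hamiltonian system. Since
 \<open>(X u) \<bullet> (Y u)\<close> is nondecreasing with rate at least \<open>(X u) \<bullet> \<Sigma> (X u)\<close>, the matrix \<open>X\<close> stays invertible.\<close>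
lemma riccati_exists:
 assumes sym: "transpose P0 = P0" and psd: "!!x. 0 <= x \<bullet> (P0 *v x)"
 shows "EX P. riccati P & P 0 = P0"
proof -
 define ham :: "(real^'d^'d) \<times> (real^'d^'d) => (real^'d^'d) \<times> (real^'d^'d)" where
  "ham z = (S ** snd z - transpose F ** fst z, \<Sigma> ** fst z + F ** snd z)" for z
 have blm: "bounded_linear (%z. A ** snd z)" "bounded_linear (%z. A ** fst z)"
  for A :: "real^'d^'d"
  by (rule bounded_linear_compose[OF bounded_bilinear.bounded_linear_right[OF bilinear_matrix_mult]
     bounded_linear_snd] bounded_linear_compose[OF bounded_bilinear.bounded_linear_right[OF bilinear_matrix_mult]
     bounded_linear_fst])+
 have "bounded_linear ham"
  unfolding ham_def[abs_def] by (intro bounded_linear_Pair bounded_linear_sub bounded_linear_add blm)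
 \<comment> \<open>Multiplication by a real number, constantly 1 below, presents the autonomous
   linear system as a bilinear one.\<close>
 hence p: "bounded_bilinear (%(r::real) z. r *\<^sub>R ham z)"
  by (rule bounded_bilinear.comp[OF bounded_bilinear_scaleR bounded_linear_ident])
 define Z where "Z = vsol (%(r::real) z. r *\<^sub>R ham z) (%_. 1) (%_. (mat 1, P0))"
 note Zp = vsol_eq_atLeast[OF p continuous_on_const[of _ 1] continuous_on_const[of _ "(mat 1, P0)"], folded Z_def]
 have Z': "(Z has_vector_derivative ham (Z t)) (at t within {0..})" if "0 <= t" for t
  using has_vector_derivative_add[OF Zp(3)[OF that] has_vector_derivative_const[of "(mat 1, P0)"]] by simp
 define X where "X t = fst (Z t)" for t
 define Y where "Y t = snd (Z t)" for t
 have X': "(X has_vector_derivative S ** Y t - transpose F ** X t) (at t within {0..})"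
  and Y': "(Y has_vector_derivative \<Sigma> ** X t + F ** Y t) (at t within {0..})" if "0 <= t" for t
  using bounded_linear.has_vector_derivative[OF bounded_linear_fst Z'[OF that]]
   bounded_linear.has_vector_derivative[OF bounded_linear_snd Z'[OF that]]
  by (simp_all add: X_def[abs_def] Y_def[abs_def] ham_def)
 have X0: "X 0 = mat 1" and Y0: "Y 0 = P0" using Zp(2)[of 0] by (simp_all add: X_def Y_def)
 have cX: "continuous_on {0..} X" and cY: "continuous_on {0..} Y"
  using X' Y' by (auto intro!: derivative_continuous_on)
 have XY': "((%t. (X t *v u) \<bullet> (Y t *v v)) has_real_derivative
   ((Y t *v u) \<bullet> (S *v (Y t *v v)) + (X t *v u) \<bullet> (\<Sigma> *v (X t *v v)))) (at t within {0..})"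
  if "0 <= t" for t u v
 proof -
  have "((%t. (X t *v u) \<bullet> (Y t *v v)) has_vector_derivative
   (X t *v u) \<bullet> ((\<Sigma> ** X t + F ** Y t) *v v) + ((S ** Y t - transpose F ** X t) *v u) \<bullet> (Y t *v v)) (at t within {0..})"
   using inner_derivative[OF matrix_vector_derivative[OF X'[OF that] has_vector_derivative_const[of u]]
    matrix_vector_derivative[OF Y'[OF that] has_vector_derivative_const[of v]]]
   by simp
  moreover have "(X t *v u) \<bullet> ((\<Sigma> ** X t + F ** Y t) *v v) + ((S ** Y t - transpose F ** X t) *v u) \<bullet> (Y t *v v)
   = (Y t *v u) \<bullet> (S *v (Y t *v v)) + (X t *v u) \<bullet> (\<Sigma> *v (X t *v v))"
   using inner_matrix[of "X t *v u" F "Y t *v v"] inner_matrix[of "Y t *v u" S "Y t *v v"]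
   by (simp add: matrix_vector_mult_diff_rdistrib matrix_vector_mult_add_rdistrib
     matrix_vector_mul_assoc[symmetric] inner_add_right inner_diff_left)
  ultimately show ?thesis by (simp add: has_real_derivative_iff_has_vector_derivative)
 qed
 \<comment> \<open>The Hamiltonian flow conserves this antisymmetric expression, which vanishes
   initially; it expresses the symmetry of the later \<open>P\<close>.\<close>
 have symXY: "(X t *v u) \<bullet> (Y t *v v) = (X t *v v) \<bullet> (Y t *v u)" if t: "0 <= t" for t u v
 proof -
  have \<Sigma>c: "x \<bullet> (\<Sigma> *v y) = y \<bullet> (\<Sigma> *v x)" for x y
   by (metis inner_commute inner_matrix transpose_\<Sigma>)
  have "((%t. (X t *v u) \<bullet> (Y t *v v) - (X t *v v) \<bullet> (Y t *v u)) has_vector_derivative 0) (at s within {0..t})"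
   if "s : {0..t}" for s
  proof -
   have "((%t. (X t *v u) \<bullet> (Y t *v v) - (X t *v v) \<bullet> (Y t *v u)) has_real_derivative 0) (at s within {0..})"
    using DERIV_diff[OF XY'[of s u v] XY'[of s v u]] that S_commute[of "Y s *v u"] \<Sigma>c[of "X s *v u"] by simp
   thus ?thesis
    by (auto simp: has_real_derivative_iff_has_vector_derivative intro: has_vector_derivative_within_subset)
  qed
  from fundamental_theorem_of_calculus[OF t this]
  have "(X t *v u) \<bullet> (Y t *v v) - (X t *v v) \<bullet> (Y t *v u) = u \<bullet> (P0 *v v) - v \<bullet> (P0 *v u)"
   by (simp add: X0 Y0)
  also have "... = 0" by (metis inner_commute inner_matrix sym right_minus_eq)
  finally show ?thesis by simp
 qed
 have mono: "integral {0..t} (%s. (X s *v u) \<bullet> (\<Sigma> *v (X s *v u))) <= (X t *v u) \<bullet> (Y t *v u)"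
  if t: "0 <= t" for t u
 proof -
  have "((%s. (Y s *v u) \<bullet> (S *v (Y s *v u)) + (X s *v u) \<bullet> (\<Sigma> *v (X s *v u))) has_integral
   ((X t *v u) \<bullet> (Y t *v u) - (X 0 *v u) \<bullet> (Y 0 *v u))) {0..t}"
   by (rule has_integral_real_derivative_atLeast[OF _ t]) (rule XY')
  moreover have "(%s. (X s *v u) \<bullet> (\<Sigma> *v (X s *v u))) integrable_on {0..t}"
   by (intro integrable_continuous_real continuous_intros continuous_Icc[OF cX])
  ultimately have "integral {0..t} (%s. (X s *v u) \<bullet> (\<Sigma> *v (X s *v u)))
    <= (X t *v u) \<bullet> (Y t *v u) - (X 0 *v u) \<bullet> (Y 0 *v u)"
   by (intro has_integral_le[OF integrable_integral]) (auto simp: S_nonneg)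
  also have "... <= (X t *v u) \<bullet> (Y t *v u)" using psd[of u] by (simp add: X0 Y0)
  finally show ?thesis .
 qed
 have \<Sigma>0: "0 <= x \<bullet> (\<Sigma> *v x)" for x
  using spd_\<Sigma> by (cases "x = 0") (auto simp: spd_def less_imp_le)
 have cq: "continuous_on {0..t} (%s. (X s *v u) \<bullet> (\<Sigma> *v (X s *v u)))" for t u
  by (intro continuous_intros continuous_Icc[OF cX])
 have psdXY: "0 <= (X t *v u) \<bullet> (Y t *v u)" if "0 <= t" for t u
  by (rule order_trans[OF _ mono[OF that]]) (intro integral_nonneg integrable_continuous_real cq \<Sigma>0)
 have inv: "invertible (X t)" if t: "0 <= t" for t
  unfolding invertible_iff_ker
 proof (intro allI impI)
  fix u assume u: "X t *v u = 0"
  show "u = 0"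
  proof (cases "t = 0")
   case True thus ?thesis using u X0 by simp
  next
   case False
   have "integral {0..t} (%s. (X s *v u) \<bullet> (\<Sigma> *v (X s *v u))) <= 0" using mono[OF t, of u] u by simp
   moreover have "0 <= integral {0..t} (%s. (X s *v u) \<bullet> (\<Sigma> *v (X s *v u)))"
    by (intro integral_nonneg integrable_continuous_real cq \<Sigma>0)
   \<comment> \<open>A continuous nonnegative integrand with integral 0 vanishes throughout, in
     particular at time 0, where \<open>X\<close> is the identity.\<close>
   ultimately have "ALL s:{0..t}. (X s *v u) \<bullet> (\<Sigma> *v (X s *v u)) = 0"
    using integral_eq_0_iff[OF cq[of t u]] False t \<Sigma>0 by auto
   from bspec[OF this, of 0] t have "u \<bullet> (\<Sigma> *v u) = 0" by (simp add: X0)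
   thus ?thesis using spd_\<Sigma> by (auto simp: spd_def)
  qed
 qed
 define P where "P t = Y t ** matrix_inv (X t)" for t
 have PX: "P t ** X t = Y t" if "0 <= t" for t
  using matrix_inv_works[OF inv[OF that]] by (simp add: P_def matrix_mul_assoc[symmetric])
 have XX: "X t *v (matrix_inv (X t) *v x) = x" if "0 <= t" for t x
  using matrix_inv_works[OF inv[OF that]] by (simp add: matrix_vector_mul_assoc)
 have Px: "P t *v x = Y t *v (matrix_inv (X t) *v x)" for t x
  by (simp add: P_def matrix_vector_mul_assoc)
 have Psym: "transpose (P t) = P t" if "0 <= t" for t
 proof (rule matrix_eqI_inner)
  fix x y
  have "x \<bullet> (transpose (P t) *v y) = y \<bullet> (P t *v x)"
   by (metis inner_commute inner_matrix transpose_transpose)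
  also have "... = x \<bullet> (P t *v y)"
   using symXY[OF that, of "matrix_inv (X t) *v y" "matrix_inv (X t) *v x"] by (simp add: XX[OF that] Px)
  finally show "x \<bullet> (transpose (P t) *v y) = x \<bullet> (P t *v y)" .
 qed
 have Ppsd: "0 <= x \<bullet> (P t *v x)" if "0 <= t" for t x
  using psdXY[OF that, of "matrix_inv (X t) *v x"] by (simp add: XX[OF that] Px)
 have P': "(P has_vector_derivative rhs (P t)) (at t within {0..})" if t: "0 <= t" for t
 proof -
  \<comment> \<open>\<open>N\<close> vanishes at \<open>t\<close>, and \<open>P s - P t\<close>
    equals \<open>N s ** matrix_inv (X s)\<close>. So the difference quotient of \<open>P\<close>
    converges as soon as the inverse is continuous; the derivative of the inverse never
    appears.\<close>
  define N where "N s = Y s - P t ** X s" for s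
  have N: "(N has_vector_derivative (\<Sigma> ** X t + F ** Y t) - P t ** (S ** Y t - transpose F ** X t)) (at t within {0..})"
   unfolding N_def
   using has_vector_derivative_diff[OF Y'[OF t] matrix_mult_has_vector_derivative[OF has_vector_derivative_const[of "P t"] X'[OF t]]]
   by simp
  have N0: "N t = 0" using PX[OF t] by (simp add: N_def)
  have Xi: "((%s. matrix_inv (X s)) \<longlongrightarrow> matrix_inv (X t)) (at t within {0..})"
   by (rule tendsto_matrix_inv) (use cX t inv in "auto simp: continuous_on_def")
  have "((%s. ((N s - N t) /\<^sub>R (s - t)) ** matrix_inv (X s)) \<longlongrightarrow>
   ((\<Sigma> ** X t + F ** Y t) - P t ** (S ** Y t - transpose F ** X t)) ** matrix_inv (X t)) (at t within {0..})"
   using N unfolding has_vector_derivative_slope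
   by (intro bounded_bilinear.tendsto[OF bilinear_matrix_mult] Xi)
  moreover have "\<forall>\<^sub>F s in at t within {0..}. ((N s - N t) /\<^sub>R (s - t)) ** matrix_inv (X s) = (P s - P t) /\<^sub>R (s - t)"
   unfolding eventually_at_filter
  proof (rule always_eventually, safe)
   fix s :: real assume s: "0 <= s" "s ~= t"
   have "P t ** X s ** matrix_inv (X s) = P t"
    using matrix_inv_works[OF inv[OF s(1)]] by (simp add: matrix_mul_assoc[symmetric])
   thus "((N s - N t) /\<^sub>R (s - t)) ** matrix_inv (X s) = (P s - P t) /\<^sub>R (s - t)"
    by (simp add: PX[OF t] N_def P_def[of s] bounded_bilinear.scaleR_left[OF bilinear_matrix_mult]
      bounded_bilinear.diff_left[OF bilinear_matrix_mult])
  qed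
  ultimately have "((%s. (P s - P t) /\<^sub>R (s - t)) \<longlongrightarrow>
   ((\<Sigma> ** X t + F ** Y t) - P t ** (S ** Y t - transpose F ** X t)) ** matrix_inv (X t)) (at t within {0..})"
   by (rule Lim_transform_eventually)
  moreover have "((\<Sigma> ** X t + F ** Y t) - P t ** (S ** Y t - transpose F ** X t)) ** matrix_inv (X t) = rhs (P t)"
  proof -
   have e: "\<Sigma> ** X t + F ** Y t - P t ** (S ** Y t - transpose F ** X t) = rhs (P t) ** X t"
    by (simp add: rhs_def PX[OF t, symmetric] matrix_mul_assoc
      bounded_bilinear.diff_left[OF bilinear_matrix_mult] bounded_bilinear.add_left[OF bilinear_matrix_mult]
      bounded_bilinear.diff_right[OF bilinear_matrix_mult] algebra_simps)
   show ?thesis unfolding e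
    using matrix_inv_works[OF inv[OF t]] by (simp add: matrix_mul_assoc[symmetric])
  qed
  ultimately show ?thesis unfolding has_vector_derivative_slope by simp
 qed
 have "P 0 = P0"
  using PX[of 0] X0 Y0 by simp
 moreover have "riccati P" using P' Psym Ppsd by (simp add: riccati_def)
 ultimately show ?thesis by blast
qed

lemma riccatiD:
 assumes "riccati P" "0 <= t"
 shows "(P has_vector_derivative rhs (P t)) (at t within {0..})" "transpose (P t) = P t" "0 <= x \<bullet> (P t *v x)"
 using assms by (auto simp: riccati_def)

lemma riccati_continuous:
 assumes "riccati P"
 shows "continuous_on {0..} P" "continuous_on {0..} (%t. rhs (P t))" "continuous_on {0..} (drift P)"
  "continuous_on {0..} (gain P)" "continuous_on {0..} (gain' P)"
proof -
 show P: "continuous_on {0..} P"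
  by (rule derivative_continuous_on) (use riccatiD(1)[OF assms] in auto)
 thus "continuous_on {0..} (%t. rhs (P t))" unfolding rhs_def by (intro continuous_intros)
 thus "continuous_on {0..} (gain' P)" unfolding gain'_def[abs_def] by (intro continuous_intros)
 show "continuous_on {0..} (drift P)" unfolding drift_def[abs_def] by (intro continuous_intros P)
 show "continuous_on {0..} (gain P)" unfolding gain_def[abs_def] by (intro continuous_intros P)
qed

lemma gain_has_vector_derivative:
 assumes "riccati P" "0 <= t"
 shows "(gain P has_vector_derivative gain' P t) (at t within {0..})"
 unfolding gain_def gain'_def
 using matrix_mult_has_vector_derivative[OF matrix_mult_has_vector_derivative[OF riccatiD(1)[OF assms]
  has_vector_derivative_const] has_vector_derivative_const] by simp

end

section \<open>Stability of the dual equation and boundedness of Riccati solutions\<close>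

context riccati_data
begin

lemma backward_solution_exists:
 assumes P: "riccati P" and t: "0 <= t"
 shows "EX w. w t = x & (ALL s:{0..t}. (w has_vector_derivative - (transpose (drift P s) *v w s)) (at s within {0..t}))"
proof -
 have "continuous_on {0..t} (%s. transpose (drift P s))"
  by (intro continuous_intros continuous_Icc[OF riccati_continuous(3)[OF P]])
 from backward_sol[OF this t] show ?thesis by blast
qed

lemma riccati_backward_form:
 assumes P: "riccati P" and s: "0 <= s" "s <= t"
  and w: "(w has_vector_derivative w') (at s within {0..t})"
 shows "((%s. w s \<bullet> (P s *v w s)) has_real_derivative
  2 * (w' \<bullet> (P s *v w s)) + 2 * ((transpose F *v w s) \<bullet> (P s *v w s)) + w s \<bullet> (\<Sigma> *v w s)
   - (P s *v w s) \<bullet> (S *v (P s *v w s))) (at s within {0..t})"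
proof -
 have P': "(P has_vector_derivative rhs (P s)) (at s within {0..t})"
  by (rule has_vector_derivative_within_subset[OF riccatiD(1)[OF P s(1)]]) auto
 have sym: "w s \<bullet> (P s *v w') = w' \<bullet> (P s *v w s)"
  by (metis inner_commute inner_matrix riccatiD(2)[OF P s(1)])
 show ?thesis
  using bilinear_form_has_derivative[OF w w P'] inner_rhs[OF riccatiD(2)[OF P s(1)], of "w s" "w s"]
  by (simp add: sym inner_commute algebra_simps)
qed

text \<open>A Lyapunov argument: along solutions of the dual equation the form given by
  \<open>P\<close> grows at least at the rate given by \<Sigma>. Since \<open>P\<close> may be
  singular, as it is for \<open>R\<close> at time 0, a small multiple of the squared norm is added
  to make the form definite.\<close>

lemma backward_decay:
 assumes P: "riccati P" and rh: "!!t. 0 <= t ==> norm (P t) <= rh"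
 shows "EX c al. 0 <= c & 0 < al & (ALL t>=0. ALL w. (ALL s:{0..t}. (w has_vector_derivative
  - (transpose (drift P s) *v w s)) (at s within {0..t})) -->
  (ALL s:{0..t}. norm (w s) <= c * exp (- al * (t - s)) * norm (w t)))"
proof -
 obtain sig where sig: "0 < sig" "!!x. sig * (norm x)^2 <= x \<bullet> (\<Sigma> *v x)"
  using spd_lower_bound[OF spd_\<Sigma>] by metis
 have rh0: "0 <= rh" using rh[of 0] norm_ge_zero order_trans by blast
 define a where "a = norm F + rh * norm S + 1"
 have a: "1 <= a" using rh0 by (simp add: a_def)
 have Ale: "norm (transpose (drift P s) *v x) <= a * norm x" if "0 <= s" for s x
 proof -
  have "norm (drift P s) <= norm F + norm (P s ** S)" unfolding drift_def by (rule norm_triangle_ineq4)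
  also have "norm (P s ** S) <= rh * norm S"
   using norm_matrix_mult_le[of "P s" S] rh[OF that] by (meson mult_right_mono norm_ge_zero order_trans)
  finally have "norm (transpose (drift P s)) <= a" by (simp add: a_def)
  thus ?thesis using norm_matrix_vector_le[of "transpose (drift P s)" x]
   by (meson mult_right_mono norm_ge_zero order_trans)
 qed
 \<comment> \<open>With \<open>eps * a = sig / 4\<close> the added term costs at most half of
   \<open>sig\<close>. The other half becomes the rate \<open>bt\<close>, because \<open>V\<close>
   is at most \<open>rh + eps\<close> times the squared norm.\<close>
 define eps where "eps = sig / (4 * a)"
 have eps: "0 < eps" "eps * a = sig / 4" using sig a by (auto simp: eps_def)
 define bt where "bt = sig / (2 * (rh + eps))"
 have bt: "0 < bt" "bt * (rh + eps) = sig / 2" using sig rh0 eps by (auto simp: bt_def field_simps)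
 define c where "c = sqrt ((rh + eps) / eps)"
 have "norm (w s) <= c * exp (- (bt / 2) * (t - s)) * norm (w t)"
  if t: "0 <= t" and w: "!!s. s : {0..t} ==> (w has_vector_derivative - (transpose (drift P s) *v w s)) (at s within {0..t})"
   and s: "s : {0..t}" for t w s
 proof -
  define V where "V s = w s \<bullet> (P s *v w s) + eps * (w s \<bullet> w s)" for s
  define V' where "V' s = w s \<bullet> (\<Sigma> *v w s) + (P s *v w s) \<bullet> (S *v (P s *v w s))
    - 2 * eps * (w s \<bullet> (transpose (drift P s) *v w s))" for s
  have V': "(V has_real_derivative V' s) (at s within {0..t})" if s: "s : {0..t}" for s
  proof -
   have s0: "0 <= s" "s <= t" using s by auto
   have 1: "((%s. w s \<bullet> w s) has_real_derivative - 2 * (w s \<bullet> (transpose (drift P s) *v w s))) (at s within {0..t})"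
    using inner_derivative[OF w[OF s] w[OF s]]
    by (simp add: has_real_derivative_iff_has_vector_derivative inner_commute)
   have "(S *v (P s *v w s)) \<bullet> (P s *v w s) = (P s *v w s) \<bullet> (S *v (P s *v w s))" by (rule inner_commute)
   thus ?thesis
    unfolding V_def[abs_def]
    using DERIV_add[OF riccati_backward_form[OF P s0 w[OF s]] DERIV_cmult[OF 1, of eps]]
    by (simp add: V'_def transpose_drift riccatiD(2)[OF P s0(1)] inner_diff_left algebra_simps)
  qed
  have Vle: "V s <= (rh + eps) * (norm (w s))^2" "eps * (norm (w s))^2 <= V s" if s: "s : {0..t}" for s
  proof -
   have "w s \<bullet> (P s *v w s) <= norm (w s) * norm (P s *v w s)" by (rule norm_cauchy_schwarz)
   also have "... <= norm (w s) * (rh * norm (w s))"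
    using norm_matrix_vector_le[of "P s" "w s"] rh[of s] s
    by (intro mult_left_mono) (auto intro: order_trans[OF _ mult_right_mono])
   finally show "V s <= (rh + eps) * (norm (w s))^2"
    by (simp add: V_def power2_norm_eq_inner[symmetric] algebra_simps power2_eq_square)
   show "eps * (norm (w s))^2 <= V s"
    using riccatiD(3)[OF P, of s "w s"] s by (simp add: V_def power2_norm_eq_inner[symmetric])
  qed
  have V'ge: "bt * V s <= V' s" if s: "s : {0..t}" for s
  proof -
   have "\<bar>w s \<bullet> (transpose (drift P s) *v w s)\<bar> <= norm (w s) * norm (transpose (drift P s) *v w s)"
    by (rule Cauchy_Schwarz_ineq2)
   also have "... <= norm (w s) * (a * norm (w s))" using Ale s by (intro mult_left_mono) auto
   finally have "w s \<bullet> (transpose (drift P s) *v w s) <= a * (norm (w s))^2"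
    by (simp add: power2_eq_square algebra_simps)
   hence "eps * (w s \<bullet> (transpose (drift P s) *v w s)) <= eps * (a * (norm (w s))^2)"
    using eps by (intro mult_left_mono) auto
   also have "... = sig / 4 * (norm (w s))^2" using eps(2) by (simp flip: mult.assoc)
   finally have "sig / 2 * (norm (w s))^2 <= V' s"
    using sig(2)[of "w s"] S_nonneg[of "P s *v w s"] by (simp add: V'_def)
   moreover have "bt * V s <= bt * ((rh + eps) * (norm (w s))^2)"
    using bt Vle(1)[OF s] by (intro mult_left_mono) auto
   ultimately show ?thesis using bt(2) by (simp flip: mult.assoc)
  qed
  have "- V t * exp (- bt * t) <= - V s * exp (- bt * s)"
  proof (rule has_integral_deriv_le[where g = "%s. - V s * exp (- bt * s)"])
   show "((%s. - V s * exp (- bt * s)) has_real_derivative - (V' r - bt * V r) * exp (- bt * r)) (at r within {s..t})"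
    if "r : {s..t}" for r
   proof -
    have r: "r : {0..t}" using that s by auto
    have Vd: "(V has_real_derivative V' r) (at r within {s..t})"
     by (rule DERIV_subset[OF V'[OF r]]) (use s in auto)
    show ?thesis by (auto intro!: derivative_eq_intros Vd simp: algebra_simps)
   qed
   show "- (V' r - bt * V r) * exp (- bt * r) <= 0" if "r : {s..t}" for r
    using V'ge[of r] that s by (auto intro!: mult_nonpos_nonneg)
  qed (use s in auto)
  hence "V s * exp (- bt * s) * exp (bt * s) <= V t * exp (- bt * t) * exp (bt * s)"
   by (intro mult_right_mono) auto
  hence "V s <= V t * exp (- bt * (t - s))"
   by (simp add: mult.assoc algebra_simps flip: exp_add)
  also have "... <= (rh + eps) * (norm (w t))^2 * exp (- bt * (t - s))"
   using Vle(1)[of t] t by (intro mult_right_mono) auto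
  finally have "eps * (norm (w s))^2 <= (rh + eps) * (norm (w t))^2 * exp (- bt * (t - s))"
   using Vle(2)[OF s] by linarith
  hence "(norm (w s))^2 <= (rh + eps) / eps * ((norm (w t))^2 * exp (- bt * (t - s)))"
   using eps(1) by (simp add: field_simps)
  also have "... = (c * exp (- (bt / 2) * (t - s)) * norm (w t))^2"
  proof -
   have "exp (- bt * (t - s)) = (exp (- (bt / 2) * (t - s)))^2"
    by (simp add: power2_eq_square flip: exp_add)
   moreover have "c^2 = (rh + eps) / eps" using rh0 eps by (simp add: c_def)
   ultimately show ?thesis by (simp add: power_mult_distrib)
  qed
  finally show ?thesis
   by (rule power2_le_imp_le) (use rh0 eps in "auto simp: c_def")
 qed
 moreover have "0 <= c" using rh0 eps by (simp add: c_def)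
 moreover have "0 < bt / 2" using bt by simp
 ultimately show ?thesis by blast
qed

text \<open>The error covariance of the optimal filter is bounded by that of the constant-gain observer
 provided by detectability.\<close>
lemma riccati_bounded:
 assumes det: "c_detectable H F" and P: "riccati P"
 shows "EX rh. ALL t>=0. norm (P t) <= rh"
proof -
 obtain K where K: "ALL l. complex_eigenvalue (F - K ** H) l --> Re l < 0"
  using det by (auto simp: c_detectable_def)
 define A where "A = F - K ** H"
 have "ALL l. complex_eigenvalue (transpose A) l --> Re l < 0"
  using K by (simp add: complex_eigenvalue_transpose A_def)
 from stable_matrix_decay[OF this] obtain c a where ca: "0 <= c" "0 < a"
  "!!y t. (!!t. 0 <= t ==> (y has_vector_derivative transpose A *v y t) (at t within {0..})) ==> 0 <= t ==>
     norm (y t) <= c * exp (- a * t) * norm (y 0)"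
  by blast
 \<comment> \<open>The matrix \<Sigma> + K \<Gamma> K^T is the noise intensity in the error of the
   observer with constant gain \<open>K\<close>. The two terms of \<open>rh\<close> bound the
   transported initial covariance and the accumulated noise.\<close>
 define q where "q = norm (\<Sigma> + K ** \<Gamma> ** transpose K)"
 define rh where "rh = c^2 * norm (P 0) + q * c^2 / (2 * a)"
 have main: "x \<bullet> (P t *v x) <= rh * (norm x)^2" if t: "0 <= t" for t x
 proof -
  obtain y where y: "y 0 = x" "!!t. 0 <= t ==> (y has_vector_derivative transpose A *v y t) (at t within {0..})"
   using linear_ode_exists[of "%_. transpose A" x] by auto
  define w where "w s = y (t - s)" for s
  have yc: "continuous_on {0..} y"
   by (rule derivative_continuous_on) (use y in auto)
  have wc: "continuous_on {0..t} w"
   unfolding w_def by (rule continuous_on_compose2[OF yc]) (auto intro!: continuous_intros)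
  have w: "(w has_vector_derivative - (transpose A *v w s)) (at s within {0..t})" if s: "s : {0..t}" for s
  proof -
   have "((y \<circ> (%s. t - s)) has_vector_derivative (-1) *\<^sub>R (transpose A *v y (t - s))) (at s within {0..t})"
   proof (rule vector_diff_chain_within)
    show "((%s. t - s) has_vector_derivative -1) (at s within {0..t})"
     by (auto intro!: derivative_eq_intros simp flip: has_real_derivative_iff_has_vector_derivative)
    show "(y has_vector_derivative transpose A *v y (t - s)) (at (t - s) within (%s. t - s) ` {0..t})"
     by (rule has_vector_derivative_within_subset[OF y(2)]) (use s in auto)
   qed
   thus ?thesis by (simp add: w_def[abs_def] o_def)
  qed
  have wb: "(norm (w s))^2 <= c^2 * exp (- 2 * a * (t - s)) * (norm x)^2" if s: "s : {0..t}" for s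
  proof -
   have "norm (w s) <= c * exp (- a * (t - s)) * norm x"
    unfolding w_def y(1)[symmetric] by (rule ca(3)[OF y(2)]) (use s in auto)
   hence "(norm (w s))^2 <= (c * exp (- a * (t - s)) * norm x)^2" by (intro power_mono) auto
   also have "... = c^2 * (exp (- a * (t - s)))^2 * (norm x)^2" by (simp add: power_mult_distrib)
   also have "(exp (- a * (t - s)))^2 = exp (- 2 * a * (t - s))" by (simp add: power2_eq_square flip: exp_add)
   finally show ?thesis .
  qed
  define g where "g s = w s \<bullet> (P s *v w s)" for s
  define g' where "g' s = 2 * (- (transpose A *v w s) \<bullet> (P s *v w s)) + 2 * ((transpose F *v w s) \<bullet> (P s *v w s))
   + w s \<bullet> (\<Sigma> *v w s) - (P s *v w s) \<bullet> (S *v (P s *v w s))" for s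
  have g: "(g' has_integral (g t - g 0)) {0..t}"
  proof (rule fundamental_theorem_of_calculus[OF t])
   fix s assume s: "s : {0..t}"
   show "(g has_vector_derivative g' s) (at s within {0..t})"
    using riccati_backward_form[OF P _ _ w[OF s]] s
    by (simp add: g_def[abs_def] g'_def has_real_derivative_iff_has_vector_derivative)
  qed
  have g'le: "g' s <= q * (norm (w s))^2" for s
  proof -
   define k where "k = transpose K *v w s"
   define h where "h = H *v (P s *v w s)"
   have e1: "(transpose F *v w s) \<bullet> (P s *v w s) - (transpose A *v w s) \<bullet> (P s *v w s) = k \<bullet> h"
   proof -
    have "transpose A *v w s = transpose F *v w s - transpose H *v k"
     by (simp add: A_def transpose_diff matrix_transpose_mul matrix_vector_mult_diff_rdistrib
       k_def matrix_vector_mul_assoc)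
    moreover have "(transpose H *v k) \<bullet> (P s *v w s) = k \<bullet> h"
     by (simp add: h_def inner_matrix[of k H])
    ultimately show ?thesis by (simp add: inner_diff_left)
   qed
   have e2: "(P s *v w s) \<bullet> (S *v (P s *v w s)) = h \<bullet> (matrix_inv \<Gamma> *v h)"
    by (simp add: S_inner h_def)
   \<comment> \<open>Completing the square in the gain: the quadratic term of the Riccati equation
     corresponds to the optimal gain, and this square is the loss incurred by using
     \<open>K\<close>.\<close>
   have "0 <= (\<Gamma> *v k - h) \<bullet> (matrix_inv \<Gamma> *v (\<Gamma> *v k - h))" by (rule inv_\<Gamma>_nonneg)
   also have "... = k \<bullet> (\<Gamma> *v k) - 2 * (k \<bullet> h) + h \<bullet> (matrix_inv \<Gamma> *v h)"
   proof -
    have 1: "matrix_inv \<Gamma> *v (\<Gamma> *v k) = k" by (simp add: matrix_vector_mul_assoc)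
    have "(\<Gamma> *v k) \<bullet> (matrix_inv \<Gamma> *v h) = (matrix_inv \<Gamma> *v (\<Gamma> *v k)) \<bullet> h"
     by (simp add: inner_matrix)
    hence 2: "(\<Gamma> *v k) \<bullet> (matrix_inv \<Gamma> *v h) = k \<bullet> h" by (simp add: 1)
    show ?thesis
     by (simp add: matrix_vector_mult_diff_distrib inner_diff_left inner_diff_right 1 2 inner_commute)
   qed
   finally have "g' s <= w s \<bullet> (\<Sigma> *v w s) + k \<bullet> (\<Gamma> *v k)"
    using e1 e2 by (simp add: g'_def)
   also have "... = w s \<bullet> ((\<Sigma> + K ** \<Gamma> ** transpose K) *v w s)"
    by (simp add: matrix_vector_mult_add_rdistrib inner_add_right k_def matrix_vector_mul_assoc[symmetric]
      inner_matrix[of "w s" K])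
   also have "... <= norm (w s) * norm ((\<Sigma> + K ** \<Gamma> ** transpose K) *v w s)" by (rule norm_cauchy_schwarz)
   also have "... <= norm (w s) * (q * norm (w s))"
    unfolding q_def by (intro mult_left_mono norm_matrix_vector_le) auto
   finally show ?thesis by (simp add: power2_eq_square mult_ac)
  qed
  have "g t - g 0 <= integral {0..t} (%s. q * (c^2 * exp (- 2 * a * (t - s)) * (norm x)^2))"
  proof (rule has_integral_le[OF g integrable_integral])
   fix s assume s: "s : {0..t}"
   show "g' s <= q * (c^2 * exp (- 2 * a * (t - s)) * (norm x)^2)"
    using g'le[of s] mult_left_mono[OF wb[OF s], of q] by (simp add: q_def)
  qed (intro integrable_continuous_real continuous_intros)
  also have "... = q * c^2 * (norm x)^2 * exp (- 2 * a * t) * integral {0..t} (%s. exp (2 * a * s))"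
   by (simp add: algebra_simps exp_diff exp_minus field_simps exp_add flip: integral_mult_right)
  also have "integral {0..t} (%s. exp (2 * a * s)) = (exp (2 * a * t) - 1) / (2 * a)"
   by (rule integral_exp_le) (use ca t in auto)
  also have "q * c^2 * (norm x)^2 * exp (- 2 * a * t) * ((exp (2 * a * t) - 1) / (2 * a))
    <= q * c^2 * (norm x)^2 * exp (- 2 * a * t) * (exp (2 * a * t) / (2 * a))"
   using ca by (intro mult_left_mono divide_right_mono) (auto simp: q_def)
  also have "... = q * c^2 / (2 * a) * (norm x)^2" by (simp add: exp_minus)
  finally have 1: "g t - g 0 <= q * c^2 / (2 * a) * (norm x)^2" .
  have "g 0 <= norm (w 0) * norm (P 0 *v w 0)" unfolding g_def by (rule norm_cauchy_schwarz)
  also have "... <= norm (w 0) * (norm (P 0) * norm (w 0))"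
   by (intro mult_left_mono norm_matrix_vector_le) auto
  also have "... = norm (P 0) * (norm (w 0))^2" by (simp add: power2_eq_square)
  also have "... <= norm (P 0) * (c^2 * exp (- 2 * a * (t - 0)) * (norm x)^2)"
   using wb[of 0] t by (intro mult_left_mono) auto
  also have "... <= norm (P 0) * (c^2 * 1 * (norm x)^2)"
   using ca t by (intro mult_left_mono mult_right_mono) auto
  finally have "g 0 <= c^2 * norm (P 0) * (norm x)^2" by (simp add: mult_ac)
  with 1 have "g t <= rh * (norm x)^2" by (simp add: rh_def distrib_right)
  thus ?thesis by (simp add: g_def w_def y(1))
 qed
 have rh0: "0 <= rh" using ca by (auto simp: rh_def q_def)
 \<comment> \<open>The factor 4 bounds the squared norm of a sum of two unit vectors, on which
   polarization evaluates the form.\<close>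
 have "norm (P t) <= real CARD('d) * (real CARD('d) * (rh * 4))" if t: "0 <= t" for t
 proof (rule norm_symmetric_matrix_le[OF riccatiD(2)[OF P t]])
  fix i j :: 'd
  let ?v = "axis i 1 + axis j 1 :: real^'d"
  have "norm ?v <= 2" using norm_triangle_ineq[of "axis i (1::real)" "axis j 1"] by simp
  hence "(norm ?v)^2 <= 2^2" by (intro power_mono) auto
  hence "rh * (norm ?v)^2 <= rh * 4" using rh0 by (intro mult_left_mono) auto
  thus "\<bar>?v \<bullet> (P t *v ?v)\<bar> <= rh * 4"
   using main[OF t, of ?v] riccatiD(3)[OF P t, of ?v] by linarith
 qed
 thus ?thesis by blast
qed

end

section \<open>Exponential growth rates\<close>

text \<open>One notion for three uses: decay for negative \<open>k\<close>, boundedness for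
  \<open>k = 0\<close>, and subexponential growth when it holds for every positive
  \<open>k\<close>.\<close>

definition exp_bounded :: "(real => 'a::real_normed_vector) => real => bool" where
 "exp_bounded f k \<longleftrightarrow> (EX c. ALL t>=0. norm (f t) <= c * exp (k * t))"

lemma exp_boundedE:
 assumes "exp_bounded f k"
 obtains c where "0 <= c" "!!t. 0 <= t ==> norm (f t) <= c * exp (k * t)"
proof -
 obtain c where c: "!!t. 0 <= t ==> norm (f t) <= c * exp (k * t)"
  using assms by (auto simp: exp_bounded_def)
 from c[of 0] have "0 <= c" by (simp add: order_trans[OF norm_ge_zero])
 with c that show thesis by blast
qed

lemma exp_bounded_add:
 assumes "exp_bounded f k" "exp_bounded g k" shows "exp_bounded (%t. f t + g t) k"
proof -
 obtain c d where "!!t. 0 <= t ==> norm (f t) <= c * exp (k * t)" "!!t. 0 <= t ==> norm (g t) <= d * exp (k * t)"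
  using assms by (auto simp: exp_bounded_def)
 hence "norm (f t + g t) <= (c + d) * exp (k * t)" if "0 <= t" for t
  using that norm_triangle_ineq[of "f t" "g t"] by (fastforce simp: distrib_right)
 thus ?thesis by (auto simp: exp_bounded_def)
qed

lemma exp_bounded_uminus: "exp_bounded f k ==> exp_bounded (%t. - f t) k"
 by (simp add: exp_bounded_def)

lemma exp_bounded_diff:
 "exp_bounded f k ==> exp_bounded g k ==> exp_bounded (%t. f t - g t) k"
 using exp_bounded_add[of f k "%t. - g t"] by (simp add: exp_bounded_uminus)

lemma exp_bounded_const: "0 <= k ==> exp_bounded (%_. a) k"
 unfolding exp_bounded_def by (intro exI[of _ "norm a"]) (auto intro!: mult_right_le_imp_le simp: mult_le_cancel_left1)

lemma exp_bounded_prod: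
 assumes p: "!!a b. norm (p a b) <= norm a * norm b"
  and "exp_bounded f k" "exp_bounded g l" "k + l <= m"
 shows "exp_bounded (%t. p (f t) (g t)) m"
proof -
 obtain c where c: "0 <= c" "!!t. 0 <= t ==> norm (f t) <= c * exp (k * t)"
  using assms(2) by (rule exp_boundedE) blast
 obtain d where d: "0 <= d" "!!t. 0 <= t ==> norm (g t) <= d * exp (l * t)"
  using assms(3) by (rule exp_boundedE) blast
 have "norm (p (f t) (g t)) <= (c * d) * exp (m * t)" if t: "0 <= t" for t
 proof -
  have "norm (p (f t) (g t)) <= norm (f t) * norm (g t)" by (rule p)
  also have "... <= (c * exp (k * t)) * (d * exp (l * t))"
   using c d t by (intro mult_mono) auto
  also have "... = (c * d) * exp ((k + l) * t)" by (simp only: distrib_right exp_add) (simp add: mult_ac)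
  also have "... <= (c * d) * exp (m * t)"
   using c d assms(4) t by (intro mult_left_mono) (auto intro!: mult_right_mono)
  finally show ?thesis .
 qed
 thus ?thesis by (auto simp: exp_bounded_def)
qed

lemmas exp_bounded_matrix_vector = exp_bounded_prod[where p = "(*v)", OF norm_matrix_vector_le]
lemmas exp_bounded_matrix_mult = exp_bounded_prod[where p = "(**)", OF norm_matrix_mult_le]

lemma exp_bounded_matrix_mult_0:
 "exp_bounded f 0 ==> exp_bounded g 0 ==> exp_bounded (%t. f t ** g t :: real^'n^'m) 0"
 by (erule exp_bounded_matrix_mult) auto

lemma exp_bounded_tendsto_0:
 assumes "exp_bounded f k" "k < 0"
 shows "(f \<longlongrightarrow> 0) at_top"
proof -
 obtain c where c: "0 <= c" "!!t. 0 <= t ==> norm (f t) <= c * exp (k * t)"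
  using assms(1) by (rule exp_boundedE) blast
 have "((%t. c * exp (k * t)) \<longlongrightarrow> 0) at_top"
  using assms(2) by real_asymp
 thus ?thesis
  by (rule Lim_null_comparison[OF eventually_mono[OF eventually_ge_at_top[of 0]], rotated]) (rule c(2))
qed

section \<open>Stability of the filter equation\<close>

text \<open>For differentiable \<open>K\<close> and continuous \<open>v\<close> with \<open>v 0 = 0\<close>, this is the integral of \<open>K\<close> against \<open>v\<close>,
 defined by partial integration.\<close>
definition sint :: "(real => real^'k^'d) => (real => real^'k^'d) => (real => real^'k) => real => real^'d" where
 "sint K K' v t = K t *v v t - integral {0..t} (%s. K' s *v v s)"

lemma continuous_on_integral_atLeast:
 fixes f :: "real => 'a::banach"
 assumes "continuous_on {0..} f"
 shows "continuous_on {0..} (%t. integral {0..t} f)"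
 by (rule continuous_on_atLeastI, rule continuous_on_integral_upper, rule continuous_Icc[OF assms])

lemma sint_continuous:
 assumes "continuous_on {0..} K" "continuous_on {0..} K'" "continuous_on {0..} v"
 shows "continuous_on {0..} (sint K K' v)"
 unfolding sint_def[abs_def]
 by (intro continuous_on_diff continuous_on_matrix_vector continuous_on_integral_atLeast assms)

context riccati_data
begin

text \<open>The solution of \<open>dy = A y dt + SS db - K GG dw\<close>, \<open>y 0 = 0\<close>, where \<open>K\<close> is the gain and
 \<open>A = F - K H\<close> the drift associated with the covariance path \<open>P\<close>.\<close>
definition noise_path :: "(real => real^'d^'d) => real^'d^'d => real^'k^'k => (real => real^'d) => (real => real^'k)
  => real => real^'d" where
 "noise_path P SS GG b w = vsol (*v) (drift P) (%t. SS *v b t - sint (gain P) (gain' P) (%s. GG *v w s) t)"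

text \<open>Stability is formulated for the dual equation, which runs backwards, since that is what
  the Lyapunov function yields; \<open>duhamel_bound\<close> transfers it to forward
  equations.\<close>

definition exp_stable :: "(real => real^'d^'d) => real => real => bool" where
 "exp_stable P c al \<longleftrightarrow> 0 <= c & 0 < al & (ALL t>=0. ALL w. (ALL s:{0..t}. (w has_vector_derivative
  - (transpose (drift P s) *v w s)) (at s within {0..t})) -->
  (ALL s:{0..t}. norm (w s) <= c * exp (- al * (t - s)) * norm (w t)))"

lemma riccati_bounds:
 assumes det: "c_detectable H F" and P: "riccati P"
 shows "exp_bounded P 0" and "EX c al. exp_stable P c al"
proof -
 obtain rh where rh: "ALL t>=0. norm (P t) <= rh" using riccati_bounded[OF det P] by blast
 thus "exp_bounded P 0" by (auto simp: exp_bounded_def)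
 show "EX c al. exp_stable P c al"
  unfolding exp_stable_def by (rule backward_decay[OF P]) (use rh in blast)
qed

text \<open>Pair \<open>z\<close> with the dual solution \<open>w\<close> that ends in
  \<open>z t\<close>. The derivative of their inner product is that of \<open>w\<close> and
  \<open>f\<close>, so an estimate of the squared norm of \<open>z t\<close> results, in which one
  factor cancels.\<close>

lemma duhamel_bound:
 assumes P: "riccati P" and st: "exp_stable P c al"
  and z: "!!t. 0 <= t ==> (z has_vector_derivative drift P t *v z t + f t) (at t within {0..})"
  and f: "continuous_on {0..} f" and t: "0 <= t"
 shows "norm (z t) <= c * (exp (- al * t) * norm (z 0) + integral {0..t} (%s. exp (- al * (t - s)) * norm (f s)))"
proof (cases "z t = 0")
 case True
 have "0 <= integral {0..t} (%s. exp (- al * (t - s)) * norm (f s))"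
  by (intro integral_nonneg integrable_continuous_real continuous_intros continuous_Icc[OF f]) auto
 thus ?thesis using True st by (simp add: exp_stable_def)
next
 case False
 obtain w where w: "w t = z t"
  "!!s. s : {0..t} ==> (w has_vector_derivative - (transpose (drift P s) *v w s)) (at s within {0..t})"
  using backward_solution_exists[OF P t, of "z t"] by blast
 have wle: "norm (w s) <= c * exp (- al * (t - s)) * norm (z t)" if "s : {0..t}" for s
  using st t w that unfolding exp_stable_def by metis
 have wc: "continuous_on {0..t} w"
  by (rule derivative_continuous_on) (rule w(2))
 have "((%s. w s \<bullet> f s) has_integral (w t \<bullet> z t - w 0 \<bullet> z 0)) {0..t}"
 proof (rule fundamental_theorem_of_calculus[OF t])
  fix s assume s: "s : {0..t}"
  have "(z has_vector_derivative drift P s *v z s + f s) (at s within {0..t})"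
   by (rule has_vector_derivative_within_subset[OF z]) (use s in auto)
  from inner_derivative[OF w(2)[OF s] this]
  show "((%s. w s \<bullet> z s) has_vector_derivative w s \<bullet> f s) (at s within {0..t})"
   by (simp add: inner_add_right inner_matrix)
 qed
 hence "w t \<bullet> z t = w 0 \<bullet> z 0 + integral {0..t} (%s. w s \<bullet> f s)"
  by (simp add: integral_unique)
 hence "norm (z t) * norm (z t) = w 0 \<bullet> z 0 + integral {0..t} (%s. w s \<bullet> f s)"
  by (metis w(1) power2_norm_eq_inner power2_eq_square)
 also have "w 0 \<bullet> z 0 <= norm (w 0) * norm (z 0)" by (rule norm_cauchy_schwarz)
 also have "... <= (c * exp (- al * (t - 0)) * norm (z t)) * norm (z 0)"
  using t by (intro mult_right_mono wle) auto
 also have "integral {0..t} (%s. w s \<bullet> f s)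
   <= integral {0..t} (%s. norm (z t) * (c * (exp (- al * (t - s)) * norm (f s))))"
 proof (rule integral_le)
  fix s assume s: "s : {0..t}"
  have "w s \<bullet> f s <= norm (w s) * norm (f s)" by (rule norm_cauchy_schwarz)
  also have "... <= (c * exp (- al * (t - s)) * norm (z t)) * norm (f s)"
   by (intro mult_right_mono wle[OF s]) auto
  finally show "w s \<bullet> f s <= norm (z t) * (c * (exp (- al * (t - s)) * norm (f s)))" by (simp add: mult_ac)
 qed (intro integrable_continuous_real continuous_intros wc continuous_Icc[OF f])+
 also have "... = norm (z t) * (c * integral {0..t} (%s. exp (- al * (t - s)) * norm (f s)))"
  by simp
 finally have "norm (z t) * norm (z t)
  <= norm (z t) * (c * (exp (- al * t) * norm (z 0) + integral {0..t} (%s. exp (- al * (t - s)) * norm (f s))))"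
  by (simp add: algebra_simps)
 thus ?thesis using False by simp
qed

lemma duhamel_exp_bounded:
 assumes P: "riccati P" and st: "exp_stable P c al"
  and z: "!!t. 0 <= t ==> (z has_vector_derivative drift P t *v z t + f t) (at t within {0..})"
  and f: "continuous_on {0..} f" "exp_bounded f k" and k: "0 < k"
 shows "exp_bounded z k"
proof -
 obtain d where d: "0 <= d" "!!t. 0 <= t ==> norm (f t) <= d * exp (k * t)"
  using f(2) by (rule exp_boundedE) blast
 have c: "0 <= c" "0 < al" using st by (auto simp: exp_stable_def)
 have "norm (z t) <= c * (norm (z 0) + d / k) * exp (k * t)" if t: "0 <= t" for t
 proof -
  have "integral {0..t} (%s. exp (- al * (t - s)) * norm (f s)) <= integral {0..t} (%s. d * exp (k * s))"
  proof (rule integral_le)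
   fix s assume s: "s : {0..t}"
   have "exp (- al * (t - s)) * norm (f s) <= 1 * (d * exp (k * s))"
    using c s d by (intro mult_mono) (auto intro!: mult_nonneg_nonneg)
   thus "exp (- al * (t - s)) * norm (f s) <= d * exp (k * s)" by simp
  qed (intro integrable_continuous_real continuous_intros continuous_Icc[OF f(1)])+
  also have "... = d * ((exp (k * t) - 1) / k)" using integral_exp_le[OF k t] by simp
  also have "... <= d * (exp (k * t) / k)" using k d by (intro mult_left_mono divide_right_mono) auto
  finally have 1: "integral {0..t} (%s. exp (- al * (t - s)) * norm (f s)) <= d / k * exp (k * t)" by simp
  have "exp (- al * t) * norm (z 0) <= exp (k * t) * norm (z 0)"
   using c k t by (intro mult_right_mono) (auto intro: order_trans[of _ 0])
  with 1 have "exp (- al * t) * norm (z 0) + integral {0..t} (%s. exp (- al * (t - s)) * norm (f s))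
    <= (norm (z 0) + d / k) * exp (k * t)" by (simp add: algebra_simps)
  hence "c * (exp (- al * t) * norm (z 0) + integral {0..t} (%s. exp (- al * (t - s)) * norm (f s)))
    <= c * ((norm (z 0) + d / k) * exp (k * t))" by (rule mult_left_mono[OF _ c(1)])
  with duhamel_bound[OF P st z f(1) t] show ?thesis by (simp add: mult_ac)
 qed
 thus ?thesis by (auto simp: exp_bounded_def)
qed

lemma duhamel_tendsto_0:
 assumes P: "riccati P" and st: "exp_stable P c al"
  and z: "!!t. 0 <= t ==> (z has_vector_derivative drift P t *v z t + f t) (at t within {0..})"
  and f: "continuous_on {0..} f" "exp_bounded f (- k)" and k: "0 < k"
 shows "(z \<longlongrightarrow> 0) at_top"
proof -
 obtain d where d: "0 <= d" "!!t. 0 <= t ==> norm (f t) <= d * exp (- k * t)"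
  using f(2) by (rule exp_boundedE) blast
 have c: "0 <= c" "0 < al" using st by (auto simp: exp_stable_def)
 \<comment> \<open>At the smaller of the two rates the convolution is at most
   \<open>d * t * exp (- m * t)\<close>; the factor \<open>t\<close> also covers coinciding
   rates.\<close>
 define m where "m = min al k"
 have m: "0 < m" "m <= al" "m <= k" using c k by (auto simp: m_def)
 have bd: "norm (z t) <= c * (exp (- al * t) * norm (z 0) + d * t * exp (- m * t))" if t: "0 <= t" for t
 proof -
  have "integral {0..t} (%s. exp (- al * (t - s)) * norm (f s)) <= integral {0..t} (%s. d * exp (- m * t))"
  proof (rule integral_le)
   fix s assume s: "s : {0..t}"
   have "exp (- al * (t - s)) * norm (f s) <= exp (- m * (t - s)) * (d * exp (- m * s))"
   proof (intro mult_mono)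
    show "exp (- al * (t - s)) <= exp (- m * (t - s))" using m s by (auto intro!: mult_right_mono)
    have "norm (f s) <= d * exp (- k * s)" using d s by auto
    also have "... <= d * exp (- m * s)" using m s d by (intro mult_left_mono) (auto intro!: mult_right_mono)
    finally show "norm (f s) <= d * exp (- m * s)" .
   qed auto
   also have "... = d * exp (- m * t)" by (simp add: algebra_simps flip: exp_add)
   finally show "exp (- al * (t - s)) * norm (f s) <= d * exp (- m * t)" .
  qed (intro integrable_continuous_real continuous_intros continuous_Icc[OF f(1)])+
  also have "... = d * t * exp (- m * t)" using t by simp
  finally have "c * (exp (- al * t) * norm (z 0) + integral {0..t} (%s. exp (- al * (t - s)) * norm (f s)))
    <= c * (exp (- al * t) * norm (z 0) + d * t * exp (- m * t))" using c by (intro mult_left_mono) auto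
  with duhamel_bound[OF P st z f(1) t] show ?thesis by linarith
 qed
 have lim: "((%t. c * (exp (- al * t) * norm (z 0) + d * t * exp (- m * t))) \<longlongrightarrow> 0) at_top"
 proof -
  have "((%t. exp (- al * t)) \<longlongrightarrow> 0) at_top" "((%t. t * exp (- m * t)) \<longlongrightarrow> 0) at_top"
   using c(2) m(1) by real_asymp+
  from tendsto_add[OF tendsto_mult_left_zero[OF this(1), of "norm (z 0)"] tendsto_mult_right_zero[OF this(2), of d]]
  show ?thesis by (intro tendsto_mult_right_zero) (simp add: mult.assoc)
 qed
 show ?thesis
  by (rule Lim_null_comparison[OF eventually_mono[OF eventually_ge_at_top[of 0] bd] lim])
qed

text \<open>The difference D = C - R satisfies a linear equation with \<open>drift C\<close> on its
  left and the transpose of \<open>drift R\<close> on its right. Hence the bilinear form of D,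
  evaluated at a dual solution for \<open>C\<close> and one for \<open>R\<close>, is constant in
  time, and its value at \<open>t\<close> can be read off at 0, where the dual solutions are
  controlled.\<close>

lemma riccati_diff_exp_bounded:
 assumes C: "riccati C" "exp_stable C c al" and R: "riccati R" "exp_stable R c' al'"
 shows "exp_bounded (%t. C t - R t) (- al)"
proof -
 have cs: "0 <= c" "0 < al" "0 <= c'" "0 < al'" using C R by (auto simp: exp_stable_def)
 define r where "r = c * c' * norm (C 0 - R 0)"
 have "norm (C t - R t) <= real CARD('d) * (real CARD('d) * (r * exp (- al * t)))" if t: "0 <= t" for t
 proof (rule norm_matrix_le_sum_inner)
  fix i j :: 'd
  obtain w where w: "w t = axis i 1"
   "!!s. s : {0..t} ==> (w has_vector_derivative - (transpose (drift C s) *v w s)) (at s within {0..t})"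
   using backward_solution_exists[OF C(1) t, of "axis i 1"] by blast
  obtain v where v: "v t = axis j 1"
   "!!s. s : {0..t} ==> (v has_vector_derivative - (transpose (drift R s) *v v s)) (at s within {0..t})"
   using backward_solution_exists[OF R(1) t, of "axis j 1"] by blast
  have wle: "norm (w 0) <= c * exp (- al * t)"
   using C(2) t w unfolding exp_stable_def by (metis atLeastAtMost_iff diff_zero mult_cancel_left2 norm_axis_1 order_refl)
  have "norm (v 0) <= c' * exp (- al' * t)"
   using R(2) t v unfolding exp_stable_def by (metis atLeastAtMost_iff diff_zero mult_cancel_left2 norm_axis_1 order_refl)
  \<comment> \<open>One of the two decay rates suffices; of \<open>v\<close> only the bound is
    kept.\<close>
  also have "... <= c' * 1" using cs t by (intro mult_left_mono) auto
  finally have vle: "norm (v 0) <= c'" by simp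
  have "((%_. 0) has_integral (w t \<bullet> ((C t - R t) *v v t) - w 0 \<bullet> ((C 0 - R 0) *v v 0))) {0..t}"
  proof (rule fundamental_theorem_of_calculus[OF t])
   fix s assume s: "s : {0..t}"
   hence s0: "0 <= s" by simp
   have Cs: "transpose (C s) = C s" and Rs: "transpose (R s) = R s" using riccatiD(2) C R s0 by auto
   have D: "((%s. C s - R s) has_vector_derivative rhs (C s) - rhs (R s)) (at s within {0..t})"
    by (rule has_vector_derivative_within_subset[of _ _ _ "{0..}"],
      rule has_vector_derivative_diff[OF riccatiD(1)[OF C(1) s0] riccatiD(1)[OF R(1) s0]]) auto
   have sC: "x \<bullet> (C s *v y) = (C s *v x) \<bullet> y" and sR: "x \<bullet> (R s *v y) = (R s *v x) \<bullet> y" for x y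
    by (metis Cs inner_matrix) (metis Rs inner_matrix)
   have sS: "(S *v x) \<bullet> y = x \<bullet> (S *v y)" for x y
    by (metis inner_matrix transpose_S)
   have "- (transpose (drift C s) *v w s) \<bullet> ((C s - R s) *v v s) + w s \<bullet> ((rhs (C s) - rhs (R s)) *v v s)
     + w s \<bullet> ((C s - R s) *v - (transpose (drift R s) *v v s)) = 0"
    unfolding transpose_drift[of C s, OF Cs] transpose_drift[of R s, OF Rs] matrix_vector_mult_diff_rdistrib
     inner_diff_right inner_rhs[OF Cs] inner_rhs[OF Rs]
    by (simp add: inner_diff_left inner_diff_right matrix_vector_mult_diff_distrib sS sC[of "w s"] sR[of "w s"]
     algebra_simps)
   thus "((%s. w s \<bullet> ((C s - R s) *v v s)) has_vector_derivative 0) (at s within {0..t})"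
    using bilinear_form_has_derivative[OF w(2)[OF s] v(2)[OF s] D]
    by (simp add: has_real_derivative_iff_has_vector_derivative)
  qed
  hence "\<bar>axis i 1 \<bullet> ((C t - R t) *v axis j 1)\<bar> = \<bar>w 0 \<bullet> ((C 0 - R 0) *v v 0)\<bar>"
   by (simp add: w(1) v(1))
  also have "... <= norm (w 0) * norm ((C 0 - R 0) *v v 0)" by (rule Cauchy_Schwarz_ineq2)
  also have "... <= (c * exp (- al * t)) * (norm (C 0 - R 0) * c')"
   using cs by (intro mult_mono wle order_trans[OF norm_matrix_vector_le] vle) auto
  finally show "\<bar>axis i 1 \<bullet> ((C t - R t) *v axis j 1)\<bar> <= r * exp (- al * t)" by (simp add: r_def mult_ac)
 qed
 hence "norm (C t - R t) <= (real CARD('d) * (real CARD('d) * r)) * exp (- al * t)" if "0 <= t" for t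
  using that by (simp add: mult.assoc)
 thus ?thesis by (auto simp: exp_bounded_def)
qed

lemma noise_path_props:
 assumes P: "riccati P" and b: "continuous_on {0..} b" "b 0 = 0" and w: "continuous_on {0..} w" "w 0 = 0"
 shows "continuous_on {0..} (noise_path P SS GG b w)"
  and "0 <= t ==> noise_path P SS GG b w t = SS *v b t - sint (gain P) (gain' P) (%s. GG *v w s) t
    + integral {0..t} (%s. drift P s *v noise_path P SS GG b w s)"
  and "0 <= t ==> ((%t. noise_path P SS GG b w t - (SS *v b t - gain P t *v (GG *v w t)))
   has_vector_derivative drift P t *v noise_path P SS GG b w t + gain' P t *v (GG *v w t)) (at t within {0..})"
  and "noise_path P SS GG b w 0 = 0"
proof -
 note cont = riccati_continuous[OF P]
 have n: "continuous_on {0..} (%t. SS *v b t - sint (gain P) (gain' P) (%s. GG *v w s) t)"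
  by (intro continuous_intros sint_continuous b w cont)
 note v = vsol_eq_atLeast[OF bilinear_matrix_vector cont(3) n, folded noise_path_def]
 show "continuous_on {0..} (noise_path P SS GG b w)" by (rule v(1))
 show "noise_path P SS GG b w t = SS *v b t - sint (gain P) (gain' P) (%s. GG *v w s) t
    + integral {0..t} (%s. drift P s *v noise_path P SS GG b w s)" if "0 <= t" for t
  using v(2)[OF that] .
 show "noise_path P SS GG b w 0 = 0"
  using v(2)[of 0] b w by (simp add: sint_def)
 assume t: "0 <= t"
 have "continuous_on {0..} (%s. gain' P s *v (GG *v w s))" by (intro continuous_intros w cont)
 from has_vector_derivative_add[OF v(3)[OF t] integral_derivative_atLeast[OF this t]]
 show "((%t. noise_path P SS GG b w t - (SS *v b t - gain P t *v (GG *v w t)))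
   has_vector_derivative drift P t *v noise_path P SS GG b w t + gain' P t *v (GG *v w t)) (at t within {0..})"
  by (simp add: sint_def algebra_simps)
qed

lemma riccati_coefficients_bounded:
 assumes "exp_bounded P 0"
 shows "exp_bounded (drift P) 0" "exp_bounded (gain P) 0" "exp_bounded (gain' P) 0"
 unfolding drift_def[abs_def] gain_def[abs_def] gain'_def[abs_def] rhs_def
 by (intro exp_bounded_diff exp_bounded_add exp_bounded_matrix_mult_0 assms exp_bounded_const order_refl)+

lemma noise_path_exp_bounded:
 assumes P: "riccati P" "exp_bounded P 0" and st: "exp_stable P c al"
  and b: "continuous_on {0..} b" "b 0 = 0" "exp_bounded b eps"
  and w: "continuous_on {0..} w" "w 0 = 0" "exp_bounded w eps" and eps: "0 < eps"
 shows "exp_bounded (noise_path P SS GG b w) eps"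
proof -
 note np = noise_path_props[OF P(1) b(1,2) w(1,2), where SS = SS and GG = GG]
 note bd = riccati_coefficients_bounded[OF P(2)]
 note cont = riccati_continuous[OF P(1)]
 define u where "u t = SS *v b t - gain P t *v (GG *v w t)" for t
 define z where "z t = noise_path P SS GG b w t - u t" for t
 define f where "f t = drift P t *v u t + gain' P t *v (GG *v w t)" for t
 have u: "exp_bounded u eps" unfolding u_def[abs_def]
  by (intro exp_bounded_diff exp_bounded_matrix_vector[of _ 0 _ eps] exp_bounded_const b w bd) auto
 have "exp_bounded z eps"
 proof (rule duhamel_exp_bounded[OF P(1) st _ _ _ eps, of z f])
  show "(z has_vector_derivative drift P t *v z t + f t) (at t within {0..})" if "0 <= t" for t
   using np(3)[OF that]
   by (simp add: z_def[abs_def] u_def f_def matrix_vector_mult_diff_distrib matrix_vector_right_distrib algebra_simps)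
  show "continuous_on {0..} f" unfolding f_def u_def by (intro continuous_intros cont b w)
  show "exp_bounded f eps" unfolding f_def[abs_def]
   by (intro exp_bounded_add exp_bounded_matrix_vector[of _ 0 _ eps] exp_bounded_const w bd u) auto
 qed
 from exp_bounded_add[OF this u] show ?thesis by (simp add: z_def)
qed

text \<open>The coefficients of the two equations differ by a term decaying at the rate
  \<open>al\<close>, while the driving paths and the noise grow more slowly than any exponential.
  With \<open>eps = al / 2\<close> for the growth, the forcing of the difference still
  decays.\<close>

lemma noise_path_diff_tendsto_0:
 assumes C: "riccati C" "exp_bounded C 0" "exp_stable C c al"
  and R: "riccati R" "exp_bounded R 0" "exp_stable R c' al'"
  and b: "continuous_on {0..} b" "b 0 = 0" "!!eps. 0 < eps ==> exp_bounded b eps"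
  and w: "continuous_on {0..} w" "w 0 = 0" "!!eps. 0 < eps ==> exp_bounded w eps"
 shows "((%t. noise_path R SS GG b w t - noise_path C SS GG b w t) \<longlongrightarrow> 0) at_top"
proof -
 have al: "0 < al" using C(3) by (simp add: exp_stable_def)
 define eps where "eps = al / 2"
 have eps: "0 < eps" "- al + eps <= - eps" using al by (auto simp: eps_def)
 note npC = noise_path_props[OF C(1) b(1,2) w(1,2), where SS = SS and GG = GG]
 note npR = noise_path_props[OF R(1) b(1,2) w(1,2), where SS = SS and GG = GG]
 note contC = riccati_continuous[OF C(1)] and contR = riccati_continuous[OF R(1)]
 note bdR = riccati_coefficients_bounded[OF R(2)]
 define gC where "gC = noise_path C SS GG b w"
 define gR where "gR = noise_path R SS GG b w"
 define D where "D t = C t - R t" for t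
 have D: "exp_bounded D (- al)" unfolding D_def[abs_def] by (rule riccati_diff_exp_bounded[OF C(1,3) R(1,3)])
 have KD: "gain C t - gain R t = D t ** transpose H ** matrix_inv \<Gamma>" for t
  by (simp add: gain_def D_def bounded_bilinear.diff_left[OF bilinear_matrix_mult])
 have K: "exp_bounded (%t. gain C t - gain R t) (- al)"
  unfolding KD by (intro exp_bounded_matrix_mult[of _ "- al" _ 0] exp_bounded_const D) auto
 have rD: "rhs (C t) - rhs (R t) = F ** D t + D t ** transpose F - (C t ** S ** D t + D t ** S ** R t)" for t
  by (simp add: rhs_def D_def bounded_bilinear.diff_left[OF bilinear_matrix_mult]
    bounded_bilinear.diff_right[OF bilinear_matrix_mult] algebra_simps)
 have KD': "gain' C t - gain' R t = (rhs (C t) - rhs (R t)) ** transpose H ** matrix_inv \<Gamma>" for t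
  by (simp add: gain'_def bounded_bilinear.diff_left[OF bilinear_matrix_mult])
 have K': "exp_bounded (%t. gain' C t - gain' R t) (- al)"
  unfolding KD' rD
  by (intro exp_bounded_matrix_mult[of _ "- al" _ 0] exp_bounded_diff exp_bounded_add
   exp_bounded_matrix_mult[of _ 0 D "- al"]  exp_bounded_matrix_mult[of _ 0 "%_. S" 0] exp_bounded_const D C(2) R(2)) auto
 \<comment> \<open>The driving paths are not differentiable. \<open>h\<close> collects the rough
   part of the difference, so that the remainder \<open>z\<close> satisfies a differential
   equation.\<close>
 define h where "h t = (gain C t - gain R t) *v (GG *v w t)" for t
 have h: "exp_bounded h (- eps)" unfolding h_def[abs_def]
  by (intro exp_bounded_matrix_vector[OF K, of _ eps] exp_bounded_matrix_vector[of _ 0 w eps] exp_bounded_const w eps) auto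
 define f where "f t = drift R t *v h t + D t *v (S *v gC t) - (gain' C t - gain' R t) *v (GG *v w t)" for t
 have gCb: "exp_bounded gC eps" unfolding gC_def
  by (intro noise_path_exp_bounded[OF C] b w eps)
 have f: "exp_bounded f (- eps)" unfolding f_def[abs_def]
  by (intro exp_bounded_diff exp_bounded_add exp_bounded_matrix_vector[OF K', of _ eps]
    exp_bounded_matrix_vector[OF D, of _ eps] exp_bounded_matrix_vector[OF bdR(1) h]
    exp_bounded_matrix_vector[of _ 0 w eps] exp_bounded_matrix_vector[of _ 0 gC eps] exp_bounded_const w eps gCb) auto
 define z where "z t = gR t - gC t - h t" for t
 have "(z \<longlongrightarrow> 0) at_top"
 proof (rule duhamel_tendsto_0[OF R(1,3) _ _ f eps(1)])
  show "continuous_on {0..} f"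
   unfolding f_def h_def D_def gC_def by (intro continuous_intros contC contR w npC)
  fix t :: real assume t: "0 <= t"
  have "(z has_vector_derivative (drift R t *v gR t + gain' R t *v (GG *v w t))
    - (drift C t *v gC t + gain' C t *v (GG *v w t))) (at t within {0..})"
   using has_vector_derivative_diff[OF npR(3)[OF t] npC(3)[OF t]]
   by (simp add: z_def[abs_def] gR_def gC_def h_def matrix_vector_mult_diff_rdistrib algebra_simps)
  moreover have dC: "drift C t = drift R t - D t ** S"
   by (simp add: drift_def D_def bounded_bilinear.diff_left[OF bilinear_matrix_mult])
  have "(drift R t *v gR t + gain' R t *v (GG *v w t)) - (drift C t *v gC t + gain' C t *v (GG *v w t))
    = drift R t *v z t + f t"
   unfolding dC
   by (simp add: z_def f_def matrix_vector_mult_diff_rdistrib matrix_vector_mult_diff_distrib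
     matrix_vector_mul_assoc[symmetric] algebra_simps)
  ultimately show "(z has_vector_derivative drift R t *v z t + f t) (at t within {0..})" by metis
 qed
 from tendsto_add[OF this exp_bounded_tendsto_0[OF h]] eps
 show ?thesis by (simp add: z_def gR_def gC_def)
qed

lemma forward_decay:
 assumes P: "riccati P" and st: "exp_stable P c al"
  and y: "!!t. 0 <= t ==> (y has_vector_derivative drift P t *v y t) (at t within {0..})" and t: "0 <= t"
 shows "norm (y t) <= c * exp (- al * t) * norm (y 0)"
 using duhamel_bound[OF P st, of y "%_. 0"] y t by (simp add: mult.assoc)

end

section \<open>Sub-sigma-algebras and independence\<close>

text \<open>Only events of \<open>M\<close> are added, namely those equal to an event of
  \<open>G\<close> up to a null set, so that the result remains a subalgebra of \<open>M\<close>. It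
  is needed because path properties hold almost surely and exceptional points are redefined.\<close>

definition null_ext :: "'a measure => 'a measure => 'a measure" where
 "null_ext M G = sigma (space M) {A : sets M. EX B:sets G. AE w in M. w : A \<longleftrightarrow> w : B}"

lemma space_null_ext [simp]: "space (null_ext M G) = space M"
 unfolding null_ext_def by (rule space_measure_of) (auto dest: sets.sets_into_space)

lemma sets_null_ext:
 assumes G: "subalgebra M G"
 shows "sets (null_ext M G) = {A : sets M. EX B:sets G. AE w in M. w : A \<longleftrightarrow> w : B}"
  (is "_ = ?E")
proof -
 have "sigma_algebra (space M) ?E"
  unfolding sigma_algebra_iff2
 proof (intro conjI ballI allI impI)
  show "?E <= Pow (space M)" by (auto dest: sets.sets_into_space)
  show "{} : ?E" by auto
  fix A assume "A : ?E"
  then obtain B where B: "A : sets M" "B : sets G" "AE w in M. w : A \<longleftrightarrow> w : B" by auto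
  have "space M - B : sets G" using sets.compl_sets[OF B(2)] G by (simp add: subalgebra_def)
  moreover have "AE w in M. w : space M - A \<longleftrightarrow> w : space M - B" using B(3) by auto
  ultimately show "space M - A : ?E"
   using B(1) by (intro CollectI conjI) (blast, rule bexI[rotated])
 next
  fix A :: "nat => 'a set" assume "range A <= ?E"
  hence "ALL i. EX B. A i : sets M & B : sets G & (AE w in M. w : A i \<longleftrightarrow> w : B)" by blast
  then obtain B where B: "!!i. A i : sets M" "!!i. B i : sets G" "!!i. AE w in M. w : A i \<longleftrightarrow> w : B i"
   by metis
  have "AE w in M. ALL i. w : A i \<longleftrightarrow> w : B i" using B(3) by (simp add: AE_all_countable)
  hence "AE w in M. w : (\<Union>i. A i) \<longleftrightarrow> w : (\<Union>i. B i)" by eventually_elim auto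
  moreover have "(\<Union>i. A i) : sets M" "(\<Union>i. B i) : sets G" using B by auto
  ultimately show "(\<Union>i. A i) : ?E" by blast
 qed
 thus ?thesis
  unfolding null_ext_def by (rule sigma_algebra.sets_measure_of_eq)
qed

lemma subalgebra_null_ext: "subalgebra M G ==> subalgebra M (null_ext M G)"
 by (auto simp: subalgebra_def sets_null_ext[unfolded subalgebra_def])

lemma sets_subset_null_ext: "subalgebra M G ==> A : sets G ==> A : sets (null_ext M G)"
 by (auto simp: sets_null_ext) (auto simp: subalgebra_def intro!: bexI[of _ A])

lemma null_extE:
 assumes "subalgebra M G" "A : sets (null_ext M G)"
 obtains B where "A : sets M" "B : sets G" "B : sets M" "AE w in M. w : A \<longleftrightarrow> w : B"
proof -
 obtain B where "A : sets M" "B : sets G" "AE w in M. w : A \<longleftrightarrow> w : B"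
  using assms(2) unfolding sets_null_ext[OF assms(1)] by blast
 moreover from this(2) have "B : sets M" using assms(1) by (auto simp: subalgebra_def)
 ultimately show thesis using that by blast
qed

lemma measurable_null_extI:
 assumes G: "subalgebra M G" and f: "f : measurable M N" and g: "g : measurable G N"
  and eq: "AE w in M. f w = g w"
 shows "f : measurable (null_ext M G) N"
proof (rule measurableI)
 show "f w : space N" if "w : space (null_ext M G)" for w
  using measurable_space[OF f] that by simp
 fix A assume A: "A : sets N"
 have "g -` A \<inter> space M : sets G" using measurable_sets[OF g A] G by (simp add: subalgebra_def)
 moreover have "AE w in M. w : f -` A \<inter> space M \<longleftrightarrow> w : g -` A \<inter> space M"
  using eq by eventually_elim auto
 ultimately have "EX B:sets G. AE w in M. w : f -` A \<inter> space M \<longleftrightarrow> w : B"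
  by (rule bexI[rotated])
 thus "f -` A \<inter> space (null_ext M G) : sets (null_ext M G)"
  using measurable_sets[OF f A] unfolding sets_null_ext[OF G] space_null_ext by blast
qed

lemma measurable_null_ext_mono:
 assumes "subalgebra M G" "f : measurable G N"
 shows "f : measurable (null_ext M G) N"
 using assms by (intro measurable_null_extI[of M G f N f]) (auto intro: measurable_from_subalg)

lemma sets_null_ext_AE:
 assumes G: "subalgebra M G" and A: "A : sets M" and "AE w in M. w : A"
 shows "A : sets (null_ext M G)"
proof -
 have "space M : sets G" using G sets.top[of G] by (simp add: subalgebra_def)
 moreover have "AE w in M. w : A \<longleftrightarrow> w : space M"
  using assms(3) A sets.sets_into_space by (auto intro: AE_mp)
 ultimately show ?thesis using A unfolding sets_null_ext[OF G] by blast
qed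

lemma null_ext_least:
 assumes "subalgebra M G" "subalgebra M G'" "sets G <= sets (null_ext M G')"
 shows "sets (null_ext M G) <= sets (null_ext M G')"
proof
 fix A assume "A : sets (null_ext M G)"
 then obtain B where B: "A : sets M" "B : sets G" "AE w in M. w : A \<longleftrightarrow> w : B"
  by (rule null_extE[OF assms(1)])
 hence "B : sets (null_ext M G')" using assms(3) by auto
 then obtain C where C: "C : sets G'" "AE w in M. w : B \<longleftrightarrow> w : C"
  by (rule null_extE[OF assms(2)])
 have "AE w in M. w : A \<longleftrightarrow> w : C" using B(3) C(2) by eventually_elim auto
 with B(1) C(1) show "A : sets (null_ext M G')" unfolding sets_null_ext[OF assms(2)] by blast
qed

lemma (in prob_space) indep_set_null_ext:
 assumes ind: "indep_set (sets G) (sets H)" and G: "subalgebra M G" and H: "subalgebra M H"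
 shows "indep_set (sets (null_ext M G)) (sets (null_ext M H))"
 unfolding indep_sets2_eq
proof (intro conjI ballI)
 show "sets (null_ext M G) <= events" "sets (null_ext M H) <= events"
  using subalgebra_null_ext[OF G] subalgebra_null_ext[OF H] by (auto simp: subalgebra_def)
 fix a b assume a: "a : sets (null_ext M G)" and b: "b : sets (null_ext M H)"
 obtain A where A: "a : events" "A : sets G" "A : events" "AE w in M. w : a \<longleftrightarrow> w : A"
  by (rule null_extE[OF G a])
 obtain B where B: "b : events" "B : sets H" "B : events" "AE w in M. w : b \<longleftrightarrow> w : B"
  by (rule null_extE[OF H b])
 have "AE w in M. w : a \<inter> b \<longleftrightarrow> w : A \<inter> B" using A(4) B(4) by eventually_elim auto
 hence "prob (a \<inter> b) = prob (A \<inter> B)"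
  by (rule finite_measure_eq_AE) (use A B in auto)
 also have "... = prob A * prob B" using ind A B by (auto simp: indep_sets2_eq)
 also have "prob A = prob a" by (rule finite_measure_eq_AE) (use A in auto)
 also have "prob B = prob b" by (rule finite_measure_eq_AE) (use B in auto)
 finally show "prob (a \<inter> b) = prob a * prob b" .
qed

lemma (in prob_space) indep_set_mono:
 assumes "indep_set A B" "A' <= A" "B' <= B"
 shows "indep_set A' B'"
 using assms unfolding indep_sets2_eq by blast

text \<open>Independence of \<open>G\<close> and \<open>H\<close> says that the image of \<open>M\<close> under \<open>w \<mapsto> (w, w)\<close> is a product measure on
 \<open>G \<Otimes> H\<close>: the parts of an expression that depend on \<open>G\<close> and on \<open>H\<close> can be integrated separately.\<close>
lemma (in prob_space) indep_set_integral_split: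
 fixes f :: "'a \<times> 'a => 'b::{banach, second_countable_topology}"
 assumes G: "subalgebra M G" and H: "subalgebra M H" and ind: "indep_set (sets G) (sets H)"
  and f[measurable]: "f : borel_measurable (G \<Otimes>\<^sub>M H)" and bd: "!!x y. norm (f (x, y)) <= C"
 shows "(LINT w|M. f (w, w)) = (LINT w|M. (LINT w'|M. f (w, w')))"
  and "(%w. LINT w'|M. f (w, w')) : borel_measurable G"
proof -
 define G' where "G' = restr_to_subalg M G"
 define H' where "H' = restr_to_subalg M H"
 have sG: "sets G' = sets G" "space G' = space M" and sH: "sets H' = sets H" "space H' = space M"
  using G H by (auto simp: G'_def H'_def sets_restr_to_subalg space_restr_to_subalg)
 have [measurable_cong]: "sets G' = sets G" "sets H' = sets H" by (fact sG sH)+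
 interpret PG: prob_space G' unfolding G'_def by (rule prob_space_restr_to_subalg[OF G prob_space_axioms])
 interpret PH: prob_space H' unfolding H'_def by (rule prob_space_restr_to_subalg[OF H prob_space_axioms])
 interpret P: pair_prob_space G' H' ..
 have idG: "(%x. x) : measurable M G'" and idH: "(%x. x) : measurable M H'"
  using G H by (auto intro!: measurableI simp: sG sH subalgebra_def)
 have dG: "distr M G' (%x. x) = G'"
 proof (rule measure_eqI)
  fix A assume A: "A : sets (distr M G' (%x. x))"
  hence "A : sets G" by (simp add: sG)
  thus "emeasure (distr M G' (%x. x)) A = emeasure G' A"
   using emeasure_distr[OF idG, of A] sets.sets_into_space[of A M] G
   by (auto simp: sG G'_def emeasure_restr_to_subalg subalgebra_def Int_absorb2)
 qed simp
 have dH: "distr M H' (%x. x) = H'"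
 proof (rule measure_eqI)
  fix A assume A: "A : sets (distr M H' (%x. x))"
  hence "A : sets H" by (simp add: sH)
  thus "emeasure (distr M H' (%x. x)) A = emeasure H' A"
   using emeasure_distr[OF idH, of A] sets.sets_into_space[of A M] H
   by (auto simp: sH H'_def emeasure_restr_to_subalg subalgebra_def Int_absorb2)
 qed simp
 \<comment> \<open>The identity, read once as a map into \<open>G'\<close> and once as a map into
   \<open>H'\<close>, is a pair of independent random variables.\<close>
 have "indep_var G' (%x. x) H' (%x. x)"
  unfolding indep_var_eq
 proof (intro conjI idG idH indep_set_sigma_sets)
  have e: "{(%x. x) -` A \<inter> space M |A. A : sets N} = sets N" if "space N = space M" for N
  proof -
   have "A \<inter> space M = A" if "A : sets N" for A
    using sets.sets_into_space[OF that] \<open>space N = space M\<close> by auto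
   thus ?thesis by auto
  qed
  show "indep_set {(%x. x) -` A \<inter> space M |A. A : sets G'} {(%x. x) -` A \<inter> space M |A. A : sets H'}"
   by (subst e[OF sG(2)], subst e[OF sH(2)]) (simp add: sG sH ind)
  show "Int_stable {(%x. x) -` A \<inter> space M |A. A : sets G'}" "Int_stable {(%x. x) -` A \<inter> space M |A. A : sets H'}"
   unfolding e[OF sG(2)] e[OF sH(2)] by (rule sets.Int_stable)+
 qed
 hence D: "G' \<Otimes>\<^sub>M H' = distr M (G' \<Otimes>\<^sub>M H') (%x. (x, x))"
  unfolding indep_var_distribution_eq dG dH by simp
 have f': "f : borel_measurable (G' \<Otimes>\<^sub>M H')" by measurable
 have intf: "integrable (G' \<Otimes>\<^sub>M H') f"
  by (rule P.integrable_const_bound[of _ C]) (use bd in auto)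
 have inner: "(LINT w'|H'. f (w, w')) = (LINT w'|M. f (w, w'))" if "w : space M" for w
  unfolding H'_def
 proof (rule integral_subalgebra2[OF H])
  have "w : space G" using that G by (simp add: subalgebra_def)
  thus "(%w'. f (w, w')) : borel_measurable H" by measurable
 qed
 have "(%w. LINT w'|H'. f (w, w')) : borel_measurable G" by measurable
 thus mG: "(%w. LINT w'|M. f (w, w')) : borel_measurable G"
  by (rule measurable_cong[THEN iffD1, rotated]) (use inner G in "simp add: subalgebra_def")
 have "(LINT w|M. f (w, w)) = (\<integral>z. f z \<partial>distr M (G' \<Otimes>\<^sub>M H') (%x. (x, x)))"
  by (rule integral_distr[symmetric]) (use idG idH in measurable)
 also have "... = (LINT w|G'. (LINT w'|H'. f (w, w')))"
  unfolding D[symmetric] by (rule P.integral_fst'[symmetric, OF intf])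
 also have "... = (LINT w|G'. (LINT w'|M. f (w, w')))"
  by (rule Bochner_Integration.integral_cong) (use inner sG in auto)
 also have "... = (LINT w|M. (LINT w'|M. f (w, w')))"
  unfolding G'_def by (rule integral_subalgebra2[OF G mG])
 finally show "(LINT w|M. f (w, w)) = (LINT w|M. (LINT w'|M. f (w, w')))" .
qed

lemma (in prob_space) indep_set_integral_mult:
 fixes f g :: "'a => complex"
 assumes G: "subalgebra M G" and H: "subalgebra M H" and ind: "indep_set (sets G) (sets H)"
  and f[measurable]: "f : borel_measurable G" and g[measurable]: "g : borel_measurable H"
  and bd: "!!x. norm (f x) <= C" "!!x. norm (g x) <= D"
 shows "(LINT w|M. f w * g w) = (LINT w|M. f w) * (LINT w|M. g w)"
proof -
 have C: "0 <= C" "0 <= D" using order_trans[OF norm_ge_zero bd(1)] order_trans[OF norm_ge_zero bd(2)] by auto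
 have "(LINT w|M. (%(x, y). f x * g y) (w, w)) = (LINT w|M. (LINT w'|M. (%(x, y). f x * g y) (w, w')))"
  by (rule indep_set_integral_split[OF G H ind, of _ "C * D"])
   (use C bd in "auto simp: norm_mult intro!: mult_mono")
 thus ?thesis by simp
qed

section \<open>Characteristic functions determine distributions\<close>

lemma borel_measurable_cis [measurable]:
 "f : borel_measurable M ==> (%x. cis (f x)) : borel_measurable M"
 by (rule measurable_compose[OF _ borel_measurable_continuous_onI]) (auto intro: continuous_intros)

text \<open>The signed density \<open>h\<close> is turned into the probability density
  \<open>1 + h / C\<close>. Under it \<open>Y\<close> has the same characteristic function as under
  \<open>M\<close>, so that the uniqueness theorem of Levy applies; the case \<open>u = 0\<close>
  shows that the total mass is 1.\<close>

lemma (in prob_space) cis_integral_zero_real: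
 fixes h Y :: "'a => real"
 assumes h[measurable]: "h : borel_measurable M" and hC: "!!w. \<bar>h w\<bar> <= C" "0 < C"
  and Y[measurable]: "Y : borel_measurable M"
  and zero: "!!u. (LINT w|M. h w *\<^sub>R cis (u * Y w)) = 0" and A[measurable]: "A : sets borel"
 shows "(LINT w|M. h w * indicator A (Y w)) = 0"
proof -
 define f where "f w = 1 + h w / C" for w
 have [measurable]: "f : borel_measurable M" unfolding f_def[abs_def] by measurable
 have f0: "0 <= f w" for w using hC(1)[of w] hC(2) by (simp add: f_def field_simps abs_le_iff)
 have hi: "integrable M (%w. h w *\<^sub>R g w)" if [measurable]: "g : borel_measurable M" and "!!w. norm (g w) <= 1"
  for g :: "'a => 'b::{banach, second_countable_topology}"
  by (rule integrable_const_bound[of _ C]) (use mult_mono[OF hC(1) that(2)] hC(2) in auto)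
 have split: "(LINT w|M. f w *\<^sub>R g w) = (LINT w|M. g w) + (LINT w|M. h w *\<^sub>R g w) /\<^sub>R C"
  if [measurable]: "g : borel_measurable M" and "!!w. norm (g w) <= 1" for g :: "'a => 'b::{banach, second_countable_topology}"
 proof -
  have "integrable M g" by (rule integrable_const_bound[of _ 1]) (use that in auto)
  moreover have "f w *\<^sub>R g w = g w + (h w *\<^sub>R g w) /\<^sub>R C" for w by (simp add: f_def scaleR_left_distrib divide_inverse mult.commute)
  ultimately show ?thesis using hi[OF that] by (simp del: scaleR_scaleR)
 qed
 have "complex_of_real (LINT w|M. h w) = 0" using zero[of 0] by (simp add: scaleR_conv_of_real)
 hence "(LINT w|M. f w) = 1" using split[of "%_. 1::real"] by (simp add: prob_space)
 moreover have "integrable M f" unfolding f_def[abs_def] using hi[of "%_. 1::real"] by simp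
 ultimately have "(\<integral>\<^sup>+w. ennreal (f w) \<partial>M) = 1" by (subst nn_integral_eq_integral) (auto simp: f0)
 then interpret N: prob_space "density M f" by (intro prob_spaceI) (simp add: emeasure_density cong: nn_integral_cong_simp)
 let ?D = "%N. distr N borel Y"
 have D: "real_distribution (?D M)" "real_distribution (?D (density M f))"
  by (auto simp: real_distribution_def real_distribution_axioms_def intro!: prob_space_distr N.prob_space_distr)
 have E: "(\<integral>x. g x \<partial>?D (density M f)) = (\<integral>x. g x \<partial>?D M) + (LINT w|M. h w *\<^sub>R g (Y w)) /\<^sub>R C"
  if [measurable]: "g : borel_measurable borel" and "!!x. norm (g x) <= 1" for g :: "real => 'b::{banach, second_countable_topology}"
  using split[of "%w. g (Y w)"] that by (simp add: integral_distr integral_density f0)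
 have "?D (density M f) = ?D M"
 proof (rule Levy_uniqueness[OF D(2,1)], rule ext)
  show "char (?D (density M f)) u = char (?D M) u" for u
   unfolding char_def using zero[of u] by (subst E) (auto simp: cis_conv_exp)
 qed
 thus ?thesis using E[of "%x. indicator A x :: real"] hC(2) by (simp add: indicator_def mult.commute)
qed

text \<open>Reduction to the real part of \<open>w * h\<close>, whose transform at \<open>u\<close>
  combines those of \<open>h\<close> at \<open>u\<close> and at \<open>- u\<close>. The choices 1
  and - \<i> for \<open>w\<close> then give the real and the imaginary part of the claim.\<close>

lemma (in prob_space) cis_integral_zero:
 fixes h :: "'a => complex" and Y :: "'a => real"
 assumes h[measurable]: "h : borel_measurable M" and hC: "!!x. norm (h x) <= C" "0 < C"
  and Y[measurable]: "Y : borel_measurable M"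
  and zero: "!!u. (LINT x|M. h x * cis (u * Y x)) = 0" and A[measurable]: "A : sets borel"
 shows "(LINT x|M. h x * indicator A (Y x)) = 0"
proof -
 have i: "integrable M (%x. h x * g x)" if [measurable]: "g : borel_measurable M" and "!!x. norm (g x) <= 1" for g
  by (rule integrable_const_bound[of _ C]) (use mult_mono[OF hC(1) that(2)] hC(2) in "auto simp: norm_mult")
 have Re: "Re (w * (LINT x|M. h x * indicator A (Y x))) = 0" if w: "norm w = 1" for w
 proof -
  have "(LINT x|M. Re (w * h x) * indicator A (Y x)) = 0"
  proof (rule cis_integral_zero_real[OF _ _ hC(2) Y _ A])
   show "\<bar>Re (w * h x)\<bar> <= C" for x using abs_Re_le_cmod[of "w * h x"] hC(1)[of x] w by (simp add: norm_mult)
   fix u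
   have "(LINT x|M. Re (w * h x) *\<^sub>R cis (u * Y x)) = (LINT x|M. (w * (h x * cis (u * Y x)) + cnj (w * (h x * cis (- u * Y x)))) / 2)"
    by (rule Bochner_Integration.integral_cong) (simp_all add: complex_eq_iff field_simps)
   also have "... = (w * (LINT x|M. h x * cis (u * Y x)) + cnj (w * (LINT x|M. h x * cis (- u * Y x)))) / 2"
    unfolding Bochner_Integration.integral_mult_right_zero[symmetric] Bochner_Integration.integral_cnj[symmetric]
    using i[of "%x. cis (u * Y x)"] i[of "%x. cis (- u * Y x)"] by (simp del: complex_cnj_mult)
   finally show "(LINT x|M. Re (w * h x) *\<^sub>R cis (u * Y x)) = 0" unfolding zero by simp
  qed measurable
  moreover have "integrable M (%x. w * (h x * indicator A (Y x)))"
   by (intro integrable_mult_right i) (auto simp: indicator_def)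
  from integral_Re[OF this] have "Re (w * (LINT x|M. h x * indicator A (Y x))) = (LINT x|M. Re (w * (h x * indicator A (Y x))))"
   by (simp del: times_complex.sel)
  moreover have "Re (w * (z * indicator A y)) = Re (w * z) * indicator A y" for z y by (simp add: indicator_def)
  ultimately show ?thesis by simp
 qed
 show ?thesis using Re[of 1] Re[of "- \<i>"] by (simp add: complex_eq_iff)
qed

text \<open>Uniqueness for many variables follows from the one-dimensional case, one variable at a
  time. The class \<open>V\<close> of densities orthogonal to all trigonometric products is
  preserved under multiplication by the indicator of an event in a single variable, and the events
  with this invariance form a sigma-algebra.\<close>

lemma (in prob_space) cis_integral_zero_sigma:
 fixes h :: "'a => complex" and Y :: "'i => 'a => real"
 assumes h: "h : borel_measurable M" "!!x. norm (h x) <= C" "0 < C" and Y: "!!i. i : I ==> Y i : borel_measurable M"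
  and zero: "!!(n::nat) ys u. (!!j. j < n ==> ys j : I) ==> (LINT x|M. h x * cis (SUM j<n. u j * Y (ys j) x)) = 0"
  and A: "A : sigma_sets (space M) {Y i -` B \<inter> space M | i B. i : I & B : sets borel}"
 shows "(LINT x:A|M. h x) = 0"
proof -
 define V where "V h \<longleftrightarrow> h : borel_measurable M & (ALL x. norm (h x) <= C) & (ALL (n::nat) ys u. (ALL j<n. ys j : I) -->
  (LINT x|M. h x * cis (SUM j<n. u j * Y (ys j) x)) = 0)" for h :: "'a => complex"
 have sm: "(%x. SUM j<n. u j * Y (ys j) x) : borel_measurable M" if "ALL j<n. ys j : I" for n :: nat and u ys
  using Y that by (intro borel_measurable_sum borel_measurable_times) auto
 have int: "integrable M (%x. h x * cis (SUM j<n. u j * Y (ys j) x))" if "V h" "ALL j<n. ys j : I" for h and n :: nat and ys u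
  by (rule integrable_const_bound[of _ C]) (use that sm[OF that(2), of u] in "auto simp: V_def norm_mult")
 have ind: "norm (indicat_real A x *\<^sub>R h x) <= C" if "V h" for A h x
  using that h(3) by (auto simp: V_def indicator_def)
 have eq: "V h'" if "V h1" "V h2" "V h3" "A : sets M" "V h" "h' = (%x. indicat_real A x *\<^sub>R h x)"
  "!!x. x : space M ==> h' x = h1 x + h2 x - h3 x" for h' h h1 h2 h3 A
 proof -
  have "(LINT x|M. h' x * cis (SUM j<n. u j * Y (ys j) x)) = 0" if "ALL j<n. ys j : I" for n :: nat and u ys
  proof -
   let ?c = "%x. cis (SUM j<n. u j * Y (ys j) x)"
   have "(LINT x|M. h' x * ?c x) = (LINT x|M. h1 x * ?c x + h2 x * ?c x - h3 x * ?c x)"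
    by (rule Bochner_Integration.integral_cong) (simp_all add: \<open>!!x. x : space M ==> h' x = _ x\<close> algebra_simps)
   also have "... = 0" using int[OF _ that] \<open>V h1\<close> \<open>V h2\<close> \<open>V h3\<close> that by (simp add: V_def)
   finally show ?thesis .
  qed
  thus ?thesis using that(4-5) ind[OF \<open>V h\<close>, of A] unfolding that(6) by (auto simp: V_def)
 qed
 have V0: "V (%_. 0)" using h(3) by (simp add: V_def)
 have "A : sets M & (ALL h. V h --> V (%x. indicat_real A x *\<^sub>R h x))" using A
 proof (induction rule: sigma_sets.induct)
  case (Basic A)
  then obtain i B where A: "A = Y i -` B \<inter> space M" and i: "i : I" and B: "B : sets borel" by auto
  have AM: "A : sets M" unfolding A using Y[OF i] B by (rule measurable_sets)
  have "(LINT x|M. (indicat_real A x *\<^sub>R h x) * cis (SUM j<n. u j * Y (ys j) x)) = 0"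
   if h: "V h" and ys: "ALL j<n. ys j : I" for h and n :: nat and ys u
  proof -
   have "(LINT x|M. (h x * cis (SUM j<n. u j * Y (ys j) x)) * indicator B (Y i x)) = 0"
   proof (rule cis_integral_zero[OF _ _ \<open>0 < C\<close> Y[OF i] _ B])
    fix v
    have "cis (SUM j<n. u j * Y (ys j) x) * cis (v * Y i x) = cis (SUM j<Suc n. (u(n := v)) j * Y ((ys(n := i)) j) x)" for x
     by (simp add: cis_mult)
    moreover have "ALL j<Suc n. (ys(n := i)) j : I" using ys i by (auto simp: less_Suc_eq)
    ultimately show "(LINT x|M. h x * cis (SUM j<n. u j * Y (ys j) x) * cis (v * Y i x)) = 0"
     using h unfolding V_def by (simp only: mult.assoc)
   qed (use h int[OF h ys, of u] in "auto simp: V_def norm_mult")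
   moreover have "(indicat_real A x *\<^sub>R h x) * z = h x * z * indicator B (Y i x)" if "x : space M" for x z
    using that by (simp add: A indicator_def)
   ultimately show ?thesis by (simp cong: Bochner_Integration.integral_cong)
  qed
  thus ?case using AM ind by (auto simp: V_def)
 next
  case Empty
  show ?case using V0 by simp
 next
  case (Compl A)
  show ?case
  proof (intro conjI allI impI)
   fix h assume h: "V h"
   show "V (%x. indicat_real (space M - A) x *\<^sub>R h x)"
    by (rule eq[OF h V0 Compl.IH[THEN conjunct2, rule_format, OF h] _ h refl]) (use Compl in "auto simp: indicator_def")
  qed (use Compl in auto)
 next
  case (Union A)
  have AM: "A i : sets M" for i using Union by auto
  \<comment> \<open>Inclusion-exclusion: the density subtracted is the indicator of
    \<open>A n\<close> times the density for the partial union, and hence in \<open>V\<close>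
    again.\<close>
  have fin: "V (%x. indicat_real (\<Union>i<n. A i) x *\<^sub>R h x)" if h: "V h" for h and n :: nat
  proof (induction n)
   case 0
   thus ?case using V0 by simp
  next
   case (Suc n)
   show ?case
    by (rule eq[OF Suc Union.IH[THEN conjunct2, rule_format, OF h, of n] Union.IH[THEN conjunct2, rule_format, OF Suc, of n] _ h refl])
     (use AM in "auto simp: indicator_def less_Suc_eq")
  qed
  have "(LINT x|M. (indicat_real (\<Union>i. A i) x *\<^sub>R h x) * cis (SUM j<n. u j * Y (ys j) x)) = 0"
   if h: "V h" and ys: "ALL j<n. ys j : I" for h and n :: nat and ys u
  proof (rule LIMSEQ_unique)
   let ?c = "%x. cis (SUM j<n. u j * Y (ys j) x)"
   have "?c : borel_measurable M" using sm[OF ys, of u] by measurable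
   moreover have "(%k. indicat_real (\<Union>i<k. A i) x) ----> indicat_real (\<Union>i. A i) x" for x
    by (rule LIMSEQ_indicator_UN)
   ultimately show "(%k. LINT x|M. (indicat_real (\<Union>i<k. A i) x *\<^sub>R h x) * ?c x) ----> (LINT x|M. (indicat_real (\<Union>i. A i) x *\<^sub>R h x) * ?c x)"
    using h AM ind[OF h] by (intro integral_dominated_convergence[where w = "%_. C"])
     (auto simp: V_def norm_mult intro!: tendsto_intros)
   show "(%k. LINT x|M. (indicat_real (\<Union>i<k. A i) x *\<^sub>R h x) * ?c x) ----> 0"
    using fin[OF h] ys by (simp add: V_def)
  qed
  thus ?case using AM ind by (auto simp: V_def)
 qed
 moreover have "V h" using h zero by (simp add: V_def)
 ultimately have "V (%x. indicat_real A x *\<^sub>R h x)" by blast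
 \<comment> \<open>The empty trigonometric sum, whose factor is 1, is the test function that gives
   the claim.\<close>
 hence "(LINT x|M. (indicat_real A x *\<^sub>R h x) * cis (SUM j<(0::nat). undefined j * Y (undefined j) x)) = 0"
  unfolding V_def by blast
 thus ?thesis by (simp add: set_lebesgue_integral_def)
qed

text \<open>The families are treated in turn: a trigonometric function of the \<open>X\<close>, once
  centred, is orthogonal to the events of the \<open>Y\<close>; then the centred indicator of such
  an event is orthogonal to the events of the \<open>X\<close>.\<close>

lemma (in prob_space) indep_set_cis:
 fixes X :: "'i => 'a => real" and Y :: "'j => 'a => real"
 assumes X: "!!i. i : I ==> X i : borel_measurable M" and Y: "!!j. j : J ==> Y j : borel_measurable M"
  and eq: "!!(n::nat) (m::nat) xs ys u v. (!!j. j < n ==> xs j : I) ==> (!!j. j < m ==> ys j : J) ==>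
   (LINT w|M. cis (SUM j<n. u j * X (xs j) w) * cis (SUM j<m. v j * Y (ys j) w))
   = (LINT w|M. cis (SUM j<n. u j * X (xs j) w)) * (LINT w|M. cis (SUM j<m. v j * Y (ys j) w))"
 shows "indep_set (sigma_sets (space M) {X i -` B \<inter> space M | i B. i : I & B : sets borel})
  (sigma_sets (space M) {Y j -` B \<inter> space M | j B. j : J & B : sets borel})"
  (is "indep_set ?SX ?SY")
 unfolding indep_sets2_eq
proof (intro conjI ballI)
 have gX: "?SX <= sets M"
  by (rule sets.sigma_sets_subset) (use X in "auto intro: measurable_sets")
 have gY: "?SY <= sets M"
  by (rule sets.sigma_sets_subset) (use Y in "auto intro: measurable_sets")
 show "?SX <= events" "?SY <= events" by fact+
 fix A B assume A: "A : ?SX" and B: "B : ?SY"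
 have [measurable]: "A : sets M" "B : sets M" using A B gX gY by auto
 have int_cis: "integrable M (%w. cis (f w))" if [measurable]: "f : borel_measurable M" for f
  by (rule integrable_const_bound[of _ 1]) auto
 have sX[measurable]: "(%w. SUM j<n. u j * X (xs j) w) : borel_measurable M"
  if "!!j. j < n ==> xs j : I" for n :: nat and xs u
  using X that by (intro borel_measurable_sum borel_measurable_times) auto
 have sY[measurable]: "(%w. SUM j<n. u j * Y (ys j) w) : borel_measurable M"
  if "!!j. j < n ==> ys j : J" for n :: nat and ys u
  using Y that by (intro borel_measurable_sum borel_measurable_times) auto
 have 1: "(LINT w:B|M. cis (SUM j<n. u j * X (xs j) w)) = (LINT w|M. cis (SUM j<n. u j * X (xs j) w)) * prob B"
  if xs: "!!j. j < n ==> xs j : I" for n :: nat and xs u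
 proof -
  let ?c = "%w. cis (SUM j<n. u j * X (xs j) w)"
  have ic: "integrable M ?c" using sX xs by (intro int_cis) auto
  have "(LINT w:B|M. ?c w - (LINT w|M. ?c w)) = 0"
  proof (rule cis_integral_zero_sigma[where C = 2, OF _ _ _ Y _ B])
   fix m :: nat and ys v assume ys: "!!j. j < m ==> ys j : J"
   let ?d = "%w. cis (SUM j<m. v j * Y (ys j) w)"
   have "integrable M (%w. ?c w * ?d w)"
    by (rule integrable_const_bound[of _ 1]) (use sX[of n xs u] sY[of m ys v] xs ys in "auto simp: norm_mult")
   moreover have "integrable M ?d" using sY ys by (intro int_cis) auto
   ultimately show "(LINT w|M. (?c w - (LINT w|M. ?c w)) * ?d w) = 0"
    using eq[of n xs m ys u v] xs ys by (simp add: left_diff_distrib)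
  next
   have "norm (LINT w|M. ?c w) <= (LINT w|M. norm (?c w))" by (rule integral_norm_bound)
   thus "norm (?c w - (LINT w|M. ?c w)) <= 2" for w
    using norm_triangle_ineq4[of "?c w" "\<integral>w. ?c w \<partial>M"] by (simp add: prob_space)
  qed (use ic in auto)
  moreover have "(LINT w:B|M. ?c w - (LINT w|M. ?c w)) = (LINT w:B|M. ?c w) - (LINT w:B|M. (LINT w|M. ?c w))"
   by (rule set_integral_diff) (use ic in "auto simp: set_integrable_def intro!: integrable_mult_indicator")
  moreover have "(LINT w:B|M. (LINT w|M. ?c w)) = (LINT w|M. ?c w) * prob B"
   by (simp add: set_lebesgue_integral_def scaleR_conv_of_real mult.commute)
  ultimately show ?thesis by simp
 qed
 have "(LINT w:A|M. complex_of_real (indicator B w - prob B)) = 0"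
 proof (rule cis_integral_zero_sigma[where C = 1, OF _ _ _ X _ A])
  fix n :: nat and xs u assume xs: "!!j. j < n ==> xs j : I"
  let ?c = "%w. cis (SUM j<n. u j * X (xs j) w)"
  have ic: "integrable M ?c" using sX xs by (intro int_cis) auto
  have "(LINT w|M. complex_of_real (indicator B w - prob B) * ?c w)
   = (LINT w|M. indicat_real B w *\<^sub>R ?c w - ?c w * prob B)"
   by (intro Bochner_Integration.integral_cong refl) (simp add: algebra_simps scaleR_conv_of_real)
  also have "... = (LINT w:B|M. ?c w) - (LINT w|M. ?c w) * prob B"
   unfolding set_lebesgue_integral_def using ic
   by (subst Bochner_Integration.integral_diff) (auto intro!: integrable_mult_indicator)
  finally show "(LINT w|M. complex_of_real (indicator B w - prob B) * ?c w) = 0"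
   using 1[OF xs] by simp
 next
  show "norm (complex_of_real (indicator B w - prob B)) <= 1" for w
   using prob_le_1[of B] measure_nonneg[of M B] unfolding norm_of_real by (auto simp: indicator_def)
 qed auto
 moreover have "complex_of_real (LINT w|M. indicator A w * (indicator B w - prob B))
   = (LINT w:A|M. complex_of_real (indicator B w - prob B))"
  unfolding set_lebesgue_integral_def integral_complex_of_real[symmetric]
  by (intro Bochner_Integration.integral_cong refl) (simp add: scaleR_conv_of_real)
 ultimately have "complex_of_real (LINT w|M. indicator A w * (indicator B w - prob B)) = 0" by simp
 hence "(LINT w|M. indicator A w * (indicator B w - prob B)) = 0" by (simp only: of_real_eq_0_iff)
 moreover have "(LINT w|M. indicator A w * (indicator B w - prob B)) = (LINT w|M. indicator (A \<inter> B) w - prob B * indicator A w)"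
  by (intro Bochner_Integration.integral_cong refl) (simp add: indicator_def)
 moreover have "(LINT w|M. indicator (A \<inter> B) w - prob B * indicator A w) = prob (A \<inter> B) - prob B * prob A"
  by (subst Bochner_Integration.integral_diff) (auto intro!: integrable_const_bound[of _ 1])
 ultimately show "prob (A \<inter> B) = prob A * prob B" by simp
qed

text \<open>An independent fair coin decides between \<open>X\<close> and \<open>Y\<close>, and
  \<open>h\<close> is its sign. Equality of the characteristic functions says that \<open>h\<close>
  is orthogonal to all trigonometric functions of the selected vector \<open>Z\<close>, hence to all
  its events.\<close>

lemma (in prob_space) distr_eq_cis:
 fixes X Y :: "'a => 'v::euclidean_space"
 assumes X[measurable]: "X : borel_measurable M" and Y[measurable]: "Y : borel_measurable M"
  and eq: "!!v. (LINT w|M. cis (v \<bullet> X w)) = (LINT w|M. cis (v \<bullet> Y w))"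
 shows "distr M borel X = distr M borel Y"
proof -
 define Q where "Q = measure_pmf (bernoulli_pmf (1/2)) \<Otimes>\<^sub>M M"
 interpret Q: pair_prob_space "measure_pmf (bernoulli_pmf (1/2))" M ..
 interpret PQ: prob_space Q unfolding Q_def by (rule Q.prob_space_axioms)
 define Z where "Z = (%(b, w). if b then X w else Y w)"
 have Z[measurable]: "Z : borel_measurable Q" unfolding Z_def Q_def by measurable
 define h :: "bool \<times> 'a => complex" where "h = (%(b, w). if b then 1 else -1)"
 have h[measurable]: "h : borel_measurable Q" unfolding h_def Q_def by measurable
 have hn: "norm (h z) = 1" for z by (cases z) (auto simp: h_def)
 have split: "(LINT z|Q. h z * f (Z z)) = ((LINT w|M. f (X w)) - (LINT w|M. f (Y w))) / 2"
  if [measurable]: "f : borel_measurable borel" and f: "!!x. norm (f x) <= 1" for f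
 proof -
  have "integrable Q (%z. h z * f (Z z))"
   by (rule PQ.integrable_const_bound[of _ 1]) (auto simp: norm_mult hn f)
  hence "(LINT z|Q. h z * f (Z z)) = (LINT b|measure_pmf (bernoulli_pmf (1/2)). (LINT w|M. h (b, w) * f (Z (b, w))))"
   unfolding Q_def by (subst Q.integral_fst'[symmetric]) auto
  also have "... = ((LINT w|M. f (X w)) - (LINT w|M. f (Y w))) / 2"
   by (subst integral_measure_pmf[of UNIV]) (auto simp: h_def Z_def UNIV_bool scaleR_conv_of_real field_simps)
  finally show ?thesis .
 qed
 show ?thesis
 proof (rule measure_eqI)
  fix A assume "A : sets (distr M borel X)"
  hence A[measurable]: "A : sets borel" by simp
  let ?gens = "{(%z. Z z \<bullet> v) -` B \<inter> space Q | v B. v : UNIV & B : sets borel}"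
  have gens: "?gens <= Pow (space Q)" by auto
  have sg: "sets (sigma (space Q) ?gens) = sigma_sets (space Q) ?gens" "space (sigma (space Q) ?gens) = space Q"
   by (rule sets_measure_of[OF gens], rule space_measure_of[OF gens])
  have "Z : borel_measurable (sigma (space Q) ?gens)"
  proof (rule borel_measurable_euclidean_space[THEN iffD2], rule ballI)
   fix b :: 'v assume "b : Basis"
   show "(%z. Z z \<bullet> b) : borel_measurable (sigma (space Q) ?gens)"
   proof (rule measurableI)
    fix B assume B: "B : sets (borel :: real measure)"
    have "(%z. Z z \<bullet> b) -` B \<inter> space Q : ?gens"
     by (rule CollectI, rule exI[of _ b], rule exI[of _ B], rule conjI[OF refl], rule conjI[OF UNIV_I B])
    thus "(%z. Z z \<bullet> b) -` B \<inter> space (sigma (space Q) ?gens) : sets (sigma (space Q) ?gens)"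
     unfolding sg by (rule sigma_sets.Basic)
   qed simp
  qed
  from measurable_sets[OF this A]
  have "Z -` A \<inter> space Q : sigma_sets (space Q) ?gens"
   unfolding sg .
  hence "(LINT z:(Z -` A \<inter> space Q)|Q. h z) = 0"
  proof (rule PQ.cis_integral_zero_sigma[where C = 1, rotated 5])
   show "norm (h z) <= 1" for z by (simp add: hn)
   fix n :: nat and ys :: "nat => 'v" and u :: "nat => real"
   have "(SUM j<n. u j * (Z z \<bullet> ys j)) = (SUM j<n. u j *\<^sub>R ys j) \<bullet> Z z" for z
    unfolding inner_commute[of _ "Z z"] by (simp add: inner_sum_right)
   thus "(LINT z|Q. h z * cis (SUM j<n. u j * (Z z \<bullet> ys j))) = 0"
    using split[of "%x. cis ((SUM j<n. u j *\<^sub>R ys j) \<bullet> x)"] eq by simp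
  qed measurable
  moreover have "(LINT z:(Z -` A \<inter> space Q)|Q. h z) = (LINT z|Q. h z * indicator A (Z z))"
   unfolding set_lebesgue_integral_def
   by (intro Bochner_Integration.integral_cong refl) (auto simp: indicator_def)
  moreover have "(LINT z|Q. h z * indicator A (Z z))
    = ((LINT w|M. indicator A (X w)) - (LINT w|M. indicator A (Y w))) / 2"
   by (rule split) (auto simp: indicator_def)
  moreover have "(LINT w|M. indicator A (V w)) = complex_of_real (measure (distr M borel V) A)"
   if [measurable]: "V : borel_measurable M" for V
  proof -
   have "complex_of_real (measure (distr M borel V) A) = complex_of_real (LINT x|distr M borel V. indicator A x)"
    by simp
   also have "(LINT x|distr M borel V. indicator A x) = (LINT w|M. indicat_real A (V w))"
    by (rule integral_distr) auto
   also have "complex_of_real ... = (LINT w|M. complex_of_real (indicat_real A (V w)))"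
    by simp
   also have "(%w. complex_of_real (indicat_real A (V w))) = (%w. indicator A (V w))"
    by (auto simp: indicator_def)
   finally show ?thesis by (rule sym)
  qed
  ultimately have mA: "measure (distr M borel X) A = measure (distr M borel Y) A"
   by simp
  interpret DX: prob_space "distr M borel X" by (rule prob_space_distr) simp
  interpret DY: prob_space "distr M borel Y" by (rule prob_space_distr) simp
  show "emeasure (distr M borel X) A = emeasure (distr M borel Y) A"
   by (simp add: mA DX.emeasure_eq_measure DY.emeasure_eq_measure)
 qed simp
qed

lemma sin_scaled_tendsto: "(%n. real (Suc n) * sin (z / real (Suc n))) ----> z"
 by real_asymp

lemma cos_scaled_tendsto: "(%n. (real (Suc n))^2 * (1 - cos (z / real (Suc n)))) ----> z^2 / 2"
 by (real_asymp simp: power2_eq_square)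

lemma cos_scaled_le: "(real (Suc n))^2 * (1 - cos (z / real (Suc n))) <= z^2 / 2"
proof -
 have "\<bar>sin (z / real (Suc n) / 2)\<bar> <= \<bar>z / real (Suc n) / 2\<bar>" by (rule abs_sin_x_le_abs_x)
 hence "(sin (z / real (Suc n) / 2))^2 <= (z / real (Suc n) / 2)^2" by (simp only: abs_le_square_iff)
 hence "1 - cos (z / real (Suc n)) <= z^2 / 2 / (real (Suc n))^2"
  using cos_double_sin[of "z / real (Suc n) / 2"] by (simp add: power_divide del: of_nat_Suc)
 thus ?thesis by (simp add: field_simps del: of_nat_Suc)
qed

text \<open>By Fatou's lemma, since \<open>2 (1 - cos (u y)) / u\<^sup>2\<close> tends to \<open>y\<^sup>2\<close> as \<open>u \<rightarrow> 0\<close>.\<close>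
lemma (in prob_space) gaussian_second_moment:
 fixes Y :: "'a => real"
 assumes Y[measurable]: "Y : borel_measurable M" and v: "0 <= v"
  and chi: "!!u. (LINT w|M. cis (u * Y w)) = exp (- (u^2 * v / 2))"
 shows "integrable M (%w. (Y w)^2)" "(LINT w|M. (Y w)^2) <= v"
proof -
 have "integrable M (%w. cis (u * Y w))" for u
  by (rule integrable_const_bound[of _ 1]) auto
 hence co: "(LINT w|M. cos (u * Y w)) = exp (- (u^2 * v / 2))" for u
  using arg_cong[OF chi[of u], of Re] by (simp flip: integral_Re)
 define g where "g n y = 2 * (1 - cos (y / real (Suc n))) * (real (Suc n))^2" for n and y :: real
 have gnn: "0 <= g n y" for n y by (simp add: g_def)
 have gb: "(\<integral>\<^sup>+w. ennreal (g n (Y w)) \<partial>M) <= ennreal v" for n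
 proof -
  have i: "integrable M (%w. g n (Y w))" unfolding g_def
   by (intro integrable_mult_left integrable_mult_right Bochner_Integration.integrable_diff)
    (auto intro!: integrable_const_bound[of _ 1])
  have "integrable M (%w. cos (Y w / real (Suc n)))" by (auto intro!: integrable_const_bound[of _ 1])
  hence "(LINT w|M. g n (Y w)) = 2 * (1 - exp (- ((1 / real (Suc n))^2 * v / 2))) * (real (Suc n))^2"
   unfolding g_def using co[of "1 / real (Suc n)"] by (simp add: prob_space del: of_nat_Suc)
  also have "... <= 2 * ((1 / real (Suc n))^2 * v / 2) * (real (Suc n))^2"
   using exp_ge_add_one_self[of "- ((1 / real (Suc n))^2 * v / 2)"] by (intro mult_right_mono mult_left_mono) auto
  also have "... = v" by (simp add: power_divide)
  finally have "(LINT w|M. g n (Y w)) <= v" .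
  thus ?thesis
   using nn_integral_eq_integral[OF i] gnn by (simp add: ennreal_leI)
 qed
 have lim: "(%n. g n y) ----> y^2" for y
  using tendsto_mult_left[OF cos_scaled_tendsto[of y], of 2] by (simp add: g_def algebra_simps del: of_nat_Suc)
 have "(\<integral>\<^sup>+w. ennreal ((Y w)^2) \<partial>M) = (\<integral>\<^sup>+w. liminf (%n. ennreal (g n (Y w))) \<partial>M)"
 proof (rule nn_integral_cong)
  fix w
  have "(%n. ennreal (g n (Y w))) ----> ennreal ((Y w)^2)" by (intro tendsto_ennrealI lim)
  from lim_imp_Liminf[OF _ this] show "ennreal ((Y w)^2) = liminf (%n. ennreal (g n (Y w)))" by simp
 qed
 also have "... <= liminf (%n. \<integral>\<^sup>+w. ennreal (g n (Y w)) \<partial>M)"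
  by (rule nn_integral_liminf) (simp add: g_def)
 also have "... <= liminf (%n. ennreal v)" by (rule Liminf_mono) (simp add: gb)
 also have "... = ennreal v" by (simp add: Liminf_const)
 finally have le: "(\<integral>\<^sup>+w. ennreal ((Y w)^2) \<partial>M) <= ennreal v" .
 show int: "integrable M (%w. (Y w)^2)"
  by (rule integrableI_nonneg) (use le in "auto simp: le_less_trans[OF _ ennreal_less_top]")
 show "(LINT w|M. (Y w)^2) <= v"
  using le v by (simp add: nn_integral_eq_integral[OF int])
qed

text \<open>From the inequality \<open>\<bar>y\<bar> <= dl + y^2 / dl\<close>. The parameter stays
  free so that a variance tending to 0 forces the first absolute moment to 0.\<close>

lemma (in prob_space) gaussian_first_moment:
 fixes Y :: "'a => real"
 assumes Y[measurable]: "Y : borel_measurable M" and v: "0 <= v"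
  and chi: "!!u. (LINT w|M. cis (u * Y w)) = exp (- (u^2 * v / 2))" and dl: "0 < dl"
 shows "integrable M Y" "(LINT w|M. \<bar>Y w\<bar>) <= dl + v / dl"
proof -
 note s = gaussian_second_moment[OF Y v chi]
 have le: "\<bar>y\<bar> <= dl + y^2 / dl" for y
 proof (cases "\<bar>y\<bar> <= dl")
  case False
  hence "dl * \<bar>y\<bar> <= \<bar>y\<bar> * \<bar>y\<bar>" by (intro mult_right_mono) auto
  thus ?thesis using dl by (simp add: field_simps power2_eq_square) (smt (verit) mult_pos_pos)
 qed (use dl in "simp add: add_increasing2")
 have i: "integrable M (%w. dl + (Y w)^2 / dl)" using s by auto
 show iY: "integrable M Y"
  by (rule Bochner_Integration.integrable_bound[OF i]) (use le dl in auto)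
 have "(LINT w|M. \<bar>Y w\<bar>) <= (LINT w|M. dl + (Y w)^2 / dl)"
  by (rule integral_mono) (use iY i le in auto)
 also have "... = dl + (LINT w|M. (Y w)^2) / dl" using s by (simp add: prob_space)
 also have "... <= dl + v / dl" using s dl by (simp add: divide_right_mono)
 finally show "(LINT w|M. \<bar>Y w\<bar>) <= dl + v / dl" .
qed

section \<open>Brownian motion\<close>

lemma sets_proc_sigma:
 "sets (proc_sigma M Y T) = sigma_sets (space M) {Y t -` A \<inter> space M | t A. t : T & A : sets borel}"
 unfolding proc_sigma_def by (rule sets_measure_of) auto

lemma space_proc_sigma [simp]: "space (proc_sigma M Y T) = space M"
 unfolding proc_sigma_def by (rule space_measure_of) auto

lemma subalgebra_proc_sigma:
 assumes "!!t. t : T ==> Y t : borel_measurable M"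
 shows "subalgebra M (proc_sigma M Y T)"
 unfolding subalgebra_def sets_proc_sigma
proof
 show "sigma_sets (space M) {Y t -` A \<inter> space M | t A. t : T & A : sets borel} <= sets M"
  by (rule sets.sigma_sets_subset) (auto intro: measurable_sets assms)
qed simp

lemma measurable_proc_sigma:
 assumes "t : T"
 shows "Y t : borel_measurable (proc_sigma M Y T)"
proof (rule measurableI)
 fix A :: "'b set" assume "A : sets borel"
 hence "Y t -` A \<inter> space M : {Y t -` A \<inter> space M | t A. t : T & A : sets borel}"
  using assms by blast
 thus "Y t -` A \<inter> space (proc_sigma M Y T) : sets (proc_sigma M Y T)"
  unfolding sets_proc_sigma space_proc_sigma by (rule sigma_sets.Basic)
qed simp

lemma sets_proc_sigma_mono: "S <= T ==> sets (proc_sigma M Y S) <= sets (proc_sigma M Y T)"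
 unfolding sets_proc_sigma by (intro sigma_sets_mono') blast

lemma (in prob_space) normal_cis:
 assumes D: "distributed M lborel Y (normal_density 0 sig)" and sig: "0 < sig"
 shows "(LINT w|M. cis (u * Y w)) = exp (- (u^2 * sig^2 / 2))"
proof -
 have D': "distributed M lborel (%x. Y x / sig) std_normal_density"
  using normal_standard_normal_convert[OF sig, of Y 0] D by simp
 hence d: "distr M lborel (%x. Y x / sig) = std_normal_distribution"
  by (simp add: distributed_def)
 have [measurable]: "(%x. Y x / sig) : borel_measurable M"
  using D' by (simp add: distributed_def)
 have "(LINT w|M. cis (u * Y w)) = (LINT w|M. iexp ((u * sig) * (Y w / sig)))"
  using sig by (simp add: cis_conv_exp)
 also have "... = (\<integral>x. iexp ((u * sig) * x) \<partial>distr M lborel (%x. Y x / sig))"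
  by (rule integral_distr[symmetric]) auto
 also have "... = char std_normal_distribution (u * sig)"
  unfolding d char_def ..
 also have "... = exp (- (u^2 * sig^2 / 2))"
  by (simp add: char_std_normal_distribution power_mult_distrib exp_of_real)
 finally show ?thesis .
qed

lemma BM_measurable: "standard_BM M B ==> 0 <= t ==> B t : borel_measurable M"
 by (simp add: standard_BM_def)

lemma (in prob_space) standard_BM_increment_cis:
 assumes B: "standard_BM M B" and s: "0 <= s" "s <= t"
 shows "(LINT w|M. cis (th \<bullet> (B t w - B s w))) = exp (- ((norm th)^2 * (t - s) / 2))"
proof (cases "s = t")
 case True
 thus ?thesis by (simp add: prob_space)
next
 case False
 hence st: "s < t" using s by simp
 define D where "D i w = (B t w - B s w) $ i" for i w
 have D: "!!i. distributed M lborel (D i) (normal_density 0 (sqrt (t - s)))"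
  and ind: "indep_vars (%_. borel) D UNIV"
  using B s(1) st unfolding standard_BM_def D_def[abs_def] by blast+
 have ind': "indep_vars (%_. borel) (%i w. cis (th $ i * D i w)) UNIV"
  using indep_vars_compose2[OF ind, of "%i x. cis (th $ i * x)" "%_. borel"] by simp
 have "(LINT w|M. cis (th \<bullet> (B t w - B s w))) = (LINT w|M. (\<Prod>i\<in>UNIV. cis (th $ i * D i w)))"
  by (simp add: inner_vec_def D_def cis_conv_exp exp_sum sum_distrib_left)
 also have "... = (\<Prod>i\<in>UNIV. LINT w|M. cis (th $ i * D i w))"
 proof (rule indep_vars_lebesgue_integral[OF _ ind'])
  show "integrable M (%w. cis (th $ i * D i w))" for i
   by (rule integrable_const_bound[of _ 1]) (use ind' in "auto simp: indep_vars_def")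
 qed simp
 also have "... = (\<Prod>i\<in>UNIV. complex_of_real (exp (- ((th $ i)^2 * (t - s) / 2))))"
  by (intro prod.cong refl) (use normal_cis[OF D] st in simp)
 also have "... = exp (- ((norm th)^2 * (t - s) / 2))"
 proof -
  have n: "(norm th)^2 = (SUM i:UNIV. (th $ i)^2)"
   unfolding power2_norm_eq_inner inner_vec_def by (simp add: power2_eq_square)
  have "(\<Prod>i\<in>UNIV. exp (- ((th $ i)^2 * (t - s) / 2))) = exp (- ((norm th)^2 * (t - s) / 2))"
   unfolding n by (simp add: exp_sum[symmetric] sum_negf sum_distrib_right sum_divide_distrib)
  thus ?thesis by (metis of_real_prod)
 qed
 finally show ?thesis .
qed

lemma (in prob_space) standard_BM_cis:
 fixes p :: "nat => real"
 assumes B: "standard_BM M B" and p: "0 <= p 0" "!!i. i < n ==> p i <= p (Suc i)"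
 shows "(LINT w|M. cis (SUM i<n. th i \<bullet> (B (p (Suc i)) w - B (p i) w)))
  = exp (- (SUM i<n. (norm (th i))^2 * (p (Suc i) - p i)) / 2)"
 using p
proof (induction n)
 case 0
 thus ?case by (simp add: prob_space)
next
 case (Suc n)
 have mono: "p i <= p j" if "i <= j" "j <= Suc n" for i j
  using that(1)
 proof (induction rule: dec_induct)
  case (step m)
  hence "p m <= p (Suc m)" using that(2) Suc.prems(2) by auto
  with step show ?case by linarith
 qed simp
 have p0: "0 <= p i & p i <= p n" if "i <= n" for i
  using mono[of 0 i] mono[of i n] Suc.prems(1) that by auto
 have le: "p n <= p (Suc n)" using Suc.prems by auto
 have IH: "(LINT w|M. cis (SUM i<n. th i \<bullet> (B (p (Suc i)) w - B (p i) w)))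
  = exp (- (SUM i<n. (norm (th i))^2 * (p (Suc i) - p i)) / 2)"
  using Suc by auto
 have split: "cis (SUM i<Suc n. th i \<bullet> (B (p (Suc i)) w - B (p i) w))
  = cis (SUM i<n. th i \<bullet> (B (p (Suc i)) w - B (p i) w)) * cis (th n \<bullet> (B (p (Suc n)) w - B (p n) w))" for w
  by (simp add: cis_mult)
 have "(LINT w|M. cis (SUM i<Suc n. th i \<bullet> (B (p (Suc i)) w - B (p i) w)))
  = (LINT w|M. cis (SUM i<n. th i \<bullet> (B (p (Suc i)) w - B (p i) w))) * (LINT w|M. cis (th n \<bullet> (B (p (Suc n)) w - B (p n) w)))"
 \<comment> \<open>\<open>standard_BM\<close> speaks of increments over proper intervals only; over
   a degenerate one the last factor is 1.\<close>
 proof (cases "p n = p (Suc n)")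
  case True
  thus ?thesis unfolding split by (simp add: prob_space)
 next
  case False
  define G where "G = proc_sigma M B {0..p n}"
  define V where "V = vimage_algebra (space M) (%w. B (p (Suc n)) w - B (p n) w) borel"
  have Bm: "B (p i) : borel_measurable M" if "i <= Suc n" for i
   using that p0 le by (intro BM_measurable[OF B]) (cases "i = Suc n"; force)
  have G: "subalgebra M G"
   unfolding G_def by (rule subalgebra_proc_sigma) (use B in "auto intro: BM_measurable")
  have Dm: "(%w. B (p (Suc n)) w - B (p n) w) : borel_measurable M"
   using Bm by auto
  have V: "subalgebra M V"
   unfolding V_def subalgebra_def sets_vimage_algebra space_vimage_algebra
   by (rule conjI[OF refl], rule sets.sigma_sets_subset) (auto intro: measurable_sets[OF Dm])
  have "indep_set (sets G) (sets V)"
   using B p0[of n] False le unfolding standard_BM_def G_def V_def by simp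
  moreover have "(%w. cis (SUM i<n. th i \<bullet> (B (p (Suc i)) w - B (p i) w))) : borel_measurable G"
  proof -
   have "B (p i) : borel_measurable G" if "i <= n" for i
    unfolding G_def by (rule measurable_proc_sigma) (use p0 that in auto)
   thus ?thesis by (intro borel_measurable_cis borel_measurable_sum borel_measurable_inner borel_measurable_const borel_measurable_diff) auto
  qed
  moreover have "(%w. B (p (Suc n)) w - B (p n) w) : measurable V borel"
   unfolding V_def by (rule measurable_vimage_algebra1) auto
  hence "(%w. cis (th n \<bullet> (B (p (Suc n)) w - B (p n) w))) : borel_measurable V" by measurable
  ultimately show ?thesis
   unfolding split by (intro indep_set_integral_mult[OF G V, of _ _ 1 1]) auto
 qed
 also have "... = complex_of_real (exp (- (SUM i<n. (norm (th i))^2 * (p (Suc i) - p i)) / 2)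
   * exp (- ((norm (th n))^2 * (p (Suc n) - p n) / 2)))"
  unfolding IH standard_BM_increment_cis[OF B conjunct1[OF p0[OF order_refl]] le] by simp
 also have "... = exp (- (SUM i<Suc n. (norm (th i))^2 * (p (Suc i) - p i)) / 2)"
  by (simp add: add_divide_distrib flip: exp_add)
 finally show ?case .
qed

section \<open>A maximal inequality\<close>

text \<open>Doob's argument, split according to the first passage above \<open>c\<close>. The
  hypothesis \<open>le\<close> is the part of the submartingale property that this needs; it fits
  moduli of Brownian components, dominated by their terminal value, and conditional expectations of
  one variable.\<close>

lemma (in prob_space) maximal_inequality:
 fixes Y :: "real => 'a => real" and G :: "real => 'a measure"
 assumes T: "finite T" and G: "!!t. t : T ==> subalgebra M (G t)"
  and mono: "!!s t. s : T ==> t : T ==> s <= t ==> sets (G s) <= sets (G t)"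
  and Y: "!!t. t : T ==> Y t : borel_measurable (G t)" "!!t. t : T ==> integrable M (Y t)"
  and ksi: "integrable M ksi" "!!w. 0 <= ksi w"
  and le: "!!t A. t : T ==> A : sets (G t) ==> (LINT w:A|M. Y t w) <= (LINT w:A|M. ksi w)"
 shows "c * prob {w : space M. EX t:T. c < Y t w} <= (LINT w|M. ksi w)"
proof -
 define A where "A t = {w : space M. c < Y t w & (ALL s:T. s < t --> Y s w <= c)}" for t
 have spG: "space (G t) = space M" if "t : T" for t using G[OF that] by (simp add: subalgebra_def)
 have AG: "A t : sets (G t)" if t: "t : T" for t
 proof -
  have m: "Y s : borel_measurable (G t)" if "s : T" "s <= t" for s
  proof (rule measurable_from_subalg[OF _ Y(1)[OF that(1)]])
   show "subalgebra (G t) (G s)"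
    unfolding subalgebra_def using mono[OF that(1) t that(2)] spG that(1) t by simp
  qed
  have "A t = {w : space (G t). c < Y t w} \<inter> {w : space (G t). ALL s:{s : T. s < t}. Y s w <= c}"
   by (auto simp: A_def spG[OF t])
  also have "... : sets (G t)"
   using T m t by (intro sets.Int sets.sets_Collect_finite_All borel_measurable_less borel_measurable_le) auto
  finally show ?thesis .
 qed
 have AM[measurable]: "A t : sets M" if "t : T" for t using AG[OF that] G[OF that] by (auto simp: subalgebra_def)
 have disj: "disjoint_family_on A T"
 proof (unfold disjoint_family_on_def, intro ballI impI)
  fix s t assume "s : T" "t : T" "s ~= t"
  thus "A s \<inter> A t = {}" by (cases "s < t") (auto simp: A_def not_le[symmetric] dest: bspec)
 qed
 have Un: "{w : space M. EX t:T. c < Y t w} = (\<Union>t\<in>T. A t)"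
 proof
  show "{w : space M. EX t:T. c < Y t w} <= (\<Union>t\<in>T. A t)"
  proof
   fix w assume w: "w : {w : space M. EX t:T. c < Y t w}"
   define S where "S = {t : T. c < Y t w}"
   have "finite S" "S ~= {}" using T w by (auto simp: S_def)
   hence "Min S : S" by (rule Min_in)
   moreover have "Y s w <= c" if "s : T" "s < Min S" for s
   proof (rule ccontr)
    assume "~  Y s w <= c"
    hence "s : S" using that by (simp add: S_def)
    thus False using Min_le[OF \<open>finite S\<close>] that(2) by force
   qed
   ultimately
   show "w : (\<Union>t\<in>T. A t)" using w by (intro UN_I[of "Min S"]) (auto simp: S_def A_def)
  qed
 qed (auto simp: A_def)
 have iA: "integrable M (%w. indicator (A t) w *\<^sub>R ksi w)" if "t : T" for t
  by (rule integrable_mult_indicator[OF AM[OF that] ksi(1)])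
 have "c * prob (\<Union>t\<in>T. A t) = (SUM t:T. c * prob (A t))"
 proof -
  have "A ` T <= events" using AM by auto
  thus ?thesis using finite_measure_finite_Union[OF T _ disj] by (simp add: sum_distrib_left)
 qed
 also have "... <= (SUM t:T. (LINT w:A t|M. ksi w))"
 proof (rule sum_mono)
  fix t assume t: "t : T"
  have "c * prob (A t) = (LINT w:A t|M. c)" using AM[OF t] by (simp add: set_lebesgue_integral_def)
  also have "... <= (LINT w:A t|M. Y t w)"
   unfolding set_lebesgue_integral_def
  proof (rule integral_mono)
   show "integrable M (%w. indicat_real (A t) w *\<^sub>R c)"
    by (rule integrable_mult_indicator[OF AM[OF t]]) simp
   show "integrable M (%w. indicat_real (A t) w *\<^sub>R Y t w)"
    by (rule integrable_mult_indicator[OF AM[OF t] Y(2)[OF t]])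
  qed (auto simp: indicator_def A_def)
  also have "... <= (LINT w:A t|M. ksi w)" by (rule le[OF t AG[OF t]])
  finally show "c * prob (A t) <= (LINT w:A t|M. ksi w)" .
 qed
 also have "... = (LINT w|M. (SUM t:T. indicator (A t) w *\<^sub>R ksi w))"
  unfolding set_lebesgue_integral_def
  by (rule Bochner_Integration.integral_sum[symmetric], rule iA)
 also have "... <= (LINT w|M. ksi w)"
 proof (rule integral_mono)
  show "integrable M (%w. SUM t:T. indicator (A t) w *\<^sub>R ksi w)"
   by (rule Bochner_Integration.integrable_sum, rule iA)
  fix w
  have "(SUM t:T. indicator (A t) w *\<^sub>R ksi w) = indicator (\<Union>t\<in>T. A t) w * ksi w"
   by (simp add: sum_distrib_right[symmetric] indicator_UN_disjoint[OF T disj])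
  also have "... <= ksi w" using ksi(2) by (simp add: indicator_def)
  finally show "(SUM t:T. indicator (A t) w *\<^sub>R ksi w) <= ksi w" .
 qed (rule ksi)
 finally show ?thesis by (simp add: Un)
qed

lemma (in prob_space) maximal_inequality_countable:
 fixes Y :: "real => 'a => real" and G :: "real => 'a measure"
 assumes T: "countable T" and G: "!!t. t : T ==> subalgebra M (G t)"
  and mono: "!!s t. s : T ==> t : T ==> s <= t ==> sets (G s) <= sets (G t)"
  and Y: "!!t. t : T ==> Y t : borel_measurable (G t)" "!!t. t : T ==> integrable M (Y t)"
  and ksi: "integrable M ksi" "!!w. 0 <= ksi w"
  and le: "!!t A. t : T ==> A : sets (G t) ==> (LINT w:A|M. Y t w) <= (LINT w:A|M. ksi w)"
 shows "c * prob {w : space M. EX t:T. c < Y t w} <= (LINT w|M. ksi w)"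
proof (cases "T = {}")
 case True
 thus ?thesis using ksi by simp
next
 case False
 define T' where "T' n = from_nat_into T ` {..<n}" for n :: nat
 have T': "finite (T' n)" "T' n <= T" for n
  using from_nat_into[OF False] by (auto simp: T'_def)
 define E where "E n = {w : space M. EX t:T' n. c < Y t w}" for n
 have Ym: "Y t : borel_measurable M" if "t : T" for t using Y(2)[OF that] by auto
 have E: "E n : sets M" for n
  unfolding E_def using T' Ym by (intro sets.sets_Collect_finite_Ex borel_measurable_less) auto
 have "incseq E" by (auto simp: E_def T'_def incseq_def)
 moreover have "range E <= sets M" using E by auto
 ultimately have "(%n. prob (E n)) ----> prob (\<Union>n. E n)"
  by (intro finite_Lim_measure_incseq)
 hence "(%n. c * prob (E n)) ----> c * prob (\<Union>n. E n)" by (intro tendsto_intros)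
 moreover have "c * prob (E n) <= (LINT w|M. ksi w)" for n
  unfolding E_def by (rule maximal_inequality[OF T'(1) G mono Y ksi le]) (use T'(2) in auto)
 ultimately have "c * prob (\<Union>n. E n) <= (LINT w|M. ksi w)"
  by (intro LIMSEQ_le_const2) auto
 moreover have "(\<Union>n. E n) = {w : space M. EX t:T. c < Y t w}"
 proof -
  have "T <= (\<Union>n. T' n)"
   using from_nat_into_surj[OF T] by (fastforce simp: T'_def)
  thus ?thesis using T'(2) by (auto simp: E_def) blast
 qed
 ultimately show ?thesis by simp
qed

section \<open>Growth of Brownian paths\<close>

lemma borel_measurable_vec_component [measurable]:
 fixes f :: "'a => real^'n"
 shows "f : borel_measurable M ==> (%x. f x $ i) : borel_measurable M"
 by (rule measurable_compose[OF _ borel_measurable_continuous_onI]) (auto intro: continuous_intros)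

lemma (in prob_space) indep_var_subalgebraI:
 assumes G: "subalgebra M G" and H: "subalgebra M H" and ind: "indep_set (sets G) (sets H)"
  and X: "X : measurable G N" and Y: "Y : measurable H L"
 shows "indep_var N X L Y"
 unfolding indep_var_eq
proof (intro conjI measurable_from_subalg[OF G X] measurable_from_subalg[OF H Y])
 have sp: "space G = space M" "space H = space M" using G H by (auto simp: subalgebra_def)
 show "indep_set (sigma_sets (space M) {X -` A \<inter> space M |A. A : sets N})
  (sigma_sets (space M) {Y -` A \<inter> space M |A. A : sets L})"
 proof (rule indep_set_mono[OF ind])
  show "sigma_sets (space M) {X -` A \<inter> space M |A. A : sets N} <= sets G"
   using sets.sigma_sets_subset[of "{X -` A \<inter> space M |A. A : sets N}" G] measurable_sets[OF X] sp by auto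
  show "sigma_sets (space M) {Y -` A \<inter> space M |A. A : sets L} <= sets H"
   using sets.sigma_sets_subset[of "{Y -` A \<inter> space M |A. A : sets L}" H] measurable_sets[OF Y] sp by auto
 qed
qed

lemma (in prob_space) standard_BM_component:
 assumes B: "standard_BM M B" and t: "0 <= t"
 shows "integrable M (%w. B t w $ i)" "(LINT w|M. \<bar>B t w $ i\<bar>) <= 1 + t"
proof -
 have [measurable]: "B t : borel_measurable M" "B 0 : borel_measurable M"
  using t by (auto intro: BM_measurable[OF B])
 have B0: "AE w in M. B 0 w = 0" using B by (simp add: standard_BM_def)
 have "(LINT w|M. cis (u * B t w $ i)) = exp (- (u^2 * t / 2))" for u
 proof -
  have "(LINT w|M. cis (u * B t w $ i)) = (LINT w|M. cis ((u *\<^sub>R axis i 1) \<bullet> (B t w - B 0 w)))"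
   by (rule integral_cong_AE) (use B0 in "auto elim!: eventually_mono simp: inner_axis'")
  also have "... = exp (- ((norm (u *\<^sub>R axis i 1 :: real^'b))^2 * (t - 0) / 2))"
   by (rule standard_BM_increment_cis[OF B _ t]) simp
  finally show ?thesis by simp
 qed
 from gaussian_first_moment[OF _ t this, of 1]
 show "integrable M (%w. B t w $ i)" "(LINT w|M. \<bar>B t w $ i\<bar>) <= 1 + t" by simp_all
qed

text \<open>The modulus at time \<open>s\<close> is the value times its sign. The sign is known at
  \<open>s\<close> and the later increment is centred and independent, so the value at
  \<open>s\<close> may be replaced by that at \<open>t\<close>; dropping the sign can only increase
  the integral.\<close>

lemma (in prob_space) standard_BM_submartingale:
 assumes B: "standard_BM M B" and s: "0 <= s" "s <= t" and A: "A : sets (proc_sigma M B {0..s})"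
 shows "(LINT w:A|M. \<bar>B s w $ i\<bar>) <= (LINT w:A|M. \<bar>B t w $ i\<bar>)"
proof (cases "s = t")
 case False
 hence st: "s < t" using s by simp
 define G where "G = proc_sigma M B {0..s}"
 define V where "V = vimage_algebra (space M) (%w. B t w - B s w) borel"
 have Bm[measurable]: "B s : borel_measurable M" "B t : borel_measurable M"
  using s by (auto intro: BM_measurable[OF B])
 have G: "subalgebra M G"
  unfolding G_def by (rule subalgebra_proc_sigma) (use B in "auto intro: BM_measurable")
 have Dm: "(%w. B t w - B s w) : borel_measurable M" by measurable
 have V: "subalgebra M V"
  unfolding V_def subalgebra_def sets_vimage_algebra space_vimage_algebra
  by (rule conjI[OF refl], rule sets.sigma_sets_subset) (auto intro: measurable_sets[OF Dm])
 have ind: "indep_set (sets G) (sets V)" and dist: "distributed M lborel (%w. (B t w - B s w) $ i) (normal_density 0 (sqrt (t - s)))"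
  using B s(1) st unfolding standard_BM_def G_def V_def by blast+
 define X where "X w = sgn (B s w $ i) * indicator A w" for w
 define D where "D w = (B t w - B s w) $ i" for w
 have [measurable]: "A : sets M" using A G by (auto simp: subalgebra_def G_def)
 have "B s : borel_measurable G" unfolding G_def by (rule measurable_proc_sigma) (use s in auto)
 from measurable_compose[OF borel_measurable_vec_component[OF this], of sgn borel i]
 have XG: "X : borel_measurable G"
  unfolding X_def by (intro borel_measurable_times borel_measurable_indicator[OF A[folded G_def]]) simp
 have "(%w. B t w - B s w) : measurable V borel"
  unfolding V_def by (rule measurable_vimage_algebra1) auto
 hence DV: "D : borel_measurable V" unfolding D_def by measurable
 have iD: "integrable M D"
  unfolding D_def using standard_BM_component(1)[OF B, of t i] standard_BM_component(1)[OF B s(1), of i] s by simp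
 have [measurable]: "X : borel_measurable M" by (rule measurable_from_subalg[OF G XG])
 have Xb: "\<bar>X w\<bar> <= 1" for w by (simp add: X_def indicator_def sgn_real_def)
 have iX: "integrable M X" by (rule integrable_const_bound[of _ 1]) (use Xb in auto)
 have "(LINT w|M. X w * D w) = (LINT w|M. X w) * (LINT w|M. D w)"
  by (rule indep_var_lebesgue_integral[OF indep_var_subalgebraI[OF G V ind XG DV] iX iD])
 also have "(LINT w|M. D w) = 0"
  using normal_distributed_expectation[OF _ dist] st by (simp add: D_def)
 finally have XD: "(LINT w|M. X w * D w) = 0" by simp
 have iXB: "integrable M (%w. X w * (B r w $ i))" if "0 <= r" "B r : borel_measurable M" for r
 proof (rule Bochner_Integration.integrable_bound[OF standard_BM_component(1)[OF B that(1), of i]])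
  show "AE w in M. norm (X w * B r w $ i) <= norm (B r w $ i)"
   using Xb by (auto simp: abs_mult intro!: mult_left_le_one_le)
 qed (use that in measurable)
 have "(LINT w:A|M. \<bar>B s w $ i\<bar>) = (LINT w|M. X w * (B s w $ i))"
  unfolding set_lebesgue_integral_def
  by (intro Bochner_Integration.integral_cong refl) (simp add: X_def indicator_def sgn_real_def)
 also have "... = (LINT w|M. X w * (B t w $ i))"
  using XD iXB[OF s(1) Bm(1)] iXB[OF _ Bm(2)] s by (simp add: D_def right_diff_distrib)
 also have "... <= (LINT w:A|M. \<bar>B t w $ i\<bar>)"
  unfolding set_lebesgue_integral_def
 proof (rule integral_mono[OF iXB])
  show "integrable M (%w. indicat_real A w *\<^sub>R \<bar>B t w $ i\<bar>)"
   by (intro integrable_mult_indicator integrable_abs standard_BM_component(1)[OF B]) (use s in auto)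
  show "X w * B t w $ i <= indicat_real A w *\<^sub>R \<bar>B t w $ i\<bar>" for w
   by (auto simp: X_def indicator_def sgn_real_def)
 qed (use s in auto)
 finally show ?thesis .
qed simp

text \<open>What holds almost surely at each fixed time holds almost surely at all rational times
  together; this lemma then passes to all times.\<close>

lemma continuous_le_on_rationals:
 fixes f :: "real => real"
 assumes f: "continuous_on {0..} f" and le: "!!t. t : \<rat> ==> a <= t ==> t <= b ==> f t <= c"
  and ab: "0 <= a" "a < b" and t: "a <= t" "t <= b"
 shows "f t <= c"
proof (rule ccontr)
 assume "~  f t <= c"
 hence fc: "c < f t" by simp
 have "continuous (at t within {a..b}) f"
  using f t ab continuous_on_subset[OF f, of "{a..b}"] by (auto simp: continuous_on_eq_continuous_within)
 hence "\<forall>\<^sub>F s in at t within {a..b}. c < f s"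
  using fc by (auto simp: continuous_within intro: order_tendstoD)
 then obtain d where d: "d > 0" "!!s. s : {a..b} ==> s ~= t ==> dist s t < d ==> c < f s"
  unfolding eventually_at by blast
 hence d': "c < f s" if "s : {a..b}" "dist s t < d" for s
  using that fc by (cases "s = t") auto
 have "max a (t - d) < min b (t + d)" using ab t d by auto
 then obtain q where q: "q : \<rat>" "max a (t - d) < q" "q < min b (t + d)"
  using Rats_dense_in_real by blast
 hence "q : {a..b}" "dist q t < d" by (auto simp: dist_real_def abs_less_iff)
 with d' le[of q] q(1) show False by fastforce
qed

text \<open>By the maximal inequality the modulus exceeds \<open>exp (eps * real n)\<close> at a
  rational time up to \<open>n\<close> with probability at most
  \<open>(1 + real n) * exp (- eps * real n)\<close>. This is summable, so the Borel-Cantelli lemma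
  applies.\<close>

lemma (in prob_space) standard_BM_growth_component:
 assumes B: "standard_BM M B" and eps: "0 < eps"
 shows "AE w in M. exp_bounded (%t. B t w $ i) eps"
proof -
 define E where "E n = {w : space M. EX t:\<rat> \<inter> {0..real n}. exp (eps * real n) < \<bar>B t w $ i\<bar>}" for n :: nat
 have Bm[measurable]: "B t : borel_measurable M" if "0 <= t" for t using BM_measurable[OF B that] .
 have cQ: "countable (\<rat> \<inter> {0..real n})" for n by (simp add: countable_rat)
 have EM: "E n : sets M" for n
  unfolding E_def using Bm by (intro sets.sets_Collect_countable_Ex'[OF _ cQ]) auto
 have PE: "prob (E n) <= (1 + real n) * exp (- eps * real n)" for n
 proof -
  have "exp (eps * real n) * prob (E n) <= (LINT w|M. \<bar>B (real n) w $ i\<bar>)"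
   unfolding E_def
  proof (rule maximal_inequality_countable[where G = "%t. proc_sigma M B {0..t}", OF cQ])
   fix t assume t: "t : \<rat> \<inter> {0..real n}"
   show "subalgebra M (proc_sigma M B {0..t})" by (rule subalgebra_proc_sigma) auto
   have "B t : borel_measurable (proc_sigma M B {0..t})" by (rule measurable_proc_sigma) (use t in auto)
   thus "(%w. \<bar>B t w $ i\<bar>) : borel_measurable (proc_sigma M B {0..t})" by measurable
   show "integrable M (%w. \<bar>B t w $ i\<bar>)"
    using standard_BM_component(1)[OF B, of t i] t by auto
   show "(LINT w:A|M. \<bar>B t w $ i\<bar>) <= (LINT w:A|M. \<bar>B (real n) w $ i\<bar>)"
    if "A : sets (proc_sigma M B {0..t})" for A
    by (rule standard_BM_submartingale[OF B _ _ that]) (use t in auto)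
  next
   show "integrable M (%w. \<bar>B (real n) w $ i\<bar>)" using standard_BM_component(1)[OF B, of "real n" i] by auto
  next
   fix s t :: real assume "s <= t"
   thus "sets (proc_sigma M B {0..s}) <= sets (proc_sigma M B {0..t})"
    by (intro sets_proc_sigma_mono) auto
  qed auto
  also have "... <= 1 + real n" by (rule standard_BM_component(2)[OF B]) simp
  finally have "exp (- eps * real n) * (exp (eps * real n) * prob (E n)) <= exp (- eps * real n) * (1 + real n)"
   by (rule mult_left_mono) simp
  moreover have "exp (- eps * real n) * (exp (eps * real n) * prob (E n)) = prob (E n)"
   by (simp flip: mult.assoc exp_add)
  ultimately show ?thesis by (simp only: mult.commute[of "exp (- eps * real n)" "1 + real n"])
 qed
 have "summable (%n. (1 + real n) * exp (- eps * real n))"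
 proof (rule summable_comparison_test_bigo)
  show "summable (%n. norm ((exp (- eps / 2)) ^ n))" using eps by (simp add: summable_geometric)
  have "(%n. (1 + real n) * exp (- eps * real n)) : O(%n. exp (- eps / 2 * real n))" using eps by real_asymp
  thus "(%n. (1 + real n) * exp (- eps * real n)) : O(%n. (exp (- eps / 2)) ^ n)"
   by (simp add: exp_of_nat_mult[symmetric] mult.commute)
 qed
 hence "summable (%n. prob (E n))"
  by (rule summable_comparison_test[rotated]) (use PE in auto)
 hence "AE w in M. \<forall>\<^sub>F n in sequentially. w : space M - E n"
  by (intro borel_cantelli_AE1 EM) (auto simp: emeasure_eq_measure)
 moreover have "AE w in M. continuous_on {0..} (%t. B t w)" using B by (simp add: standard_BM_def)
 ultimately show ?thesis
 proof eventually_elim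
  case (elim w)
  then obtain N where N: "!!n. N <= n ==> w : space M - E n" by (auto simp: eventually_sequentially)
  have c: "continuous_on {0..} (%t. B t w $ i)" using elim by (intro continuous_intros)
  hence c': "continuous_on {0..} (%t. \<bar>B t w $ i\<bar>)" by (rule continuous_on_rabs)
  have le: "\<bar>B t w $ i\<bar> <= exp (eps * real n)" if "max N 1 <= n" "0 <= t" "t <= real n" for n t
  proof (rule continuous_le_on_rationals[OF c', of 0 "real n"])
   fix s :: real assume "s : \<rat>" "0 <= s" "s <= real n"
   thus "\<bar>B s w $ i\<bar> <= exp (eps * real n)" using N[of n] that(1) by (auto simp: E_def not_less)
  qed (use that in auto)
  have "norm (B t w $ i) <= exp (eps * (real N + 2)) * exp (eps * t)" if t: "0 <= t" for t
  proof -
   \<comment> \<open>Rounding \<open>t\<close> up to an integer that is also at least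
     \<open>N\<close> and 1 costs at most \<open>N + 2\<close>, which is where the constant comes
     from.\<close>
   define n where "n = max (max N 1) (nat \<lceil>t\<rceil>)"
   have "\<bar>B t w $ i\<bar> <= exp (eps * real n)" by (rule le) (use t in "auto simp: n_def", linarith)
   also have "real n <= real N + 2 + t" using t by (auto simp: n_def) linarith
   hence "exp (eps * real n) <= exp (eps * (real N + 2)) * exp (eps * t)"
    using eps by (simp flip: exp_add distrib_left)
   finally show ?thesis by simp
  qed
  thus ?case by (auto simp: exp_bounded_def)
 qed
qed

lemma exp_bounded_vec:
 fixes f :: "real => real^'n"
 assumes "!!i. exp_bounded (%t. f t $ i) k"
 shows "exp_bounded f k"
proof -
 have "ALL i. EX c. ALL t>=0. norm (f t $ i) <= c * exp (k * t)" using assms by (simp add: exp_bounded_def)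
 then obtain c where c: "!!i t. 0 <= t ==> norm (f t $ i) <= c i * exp (k * t)" by metis
 have "norm (f t) <= sum c UNIV * exp (k * t)" if t: "0 <= t" for t
 proof -
  have "norm (f t) <= (SUM i:UNIV. \<bar>f t $ i\<bar>)" by (rule norm_le_l1_cart)
  also have "... <= (SUM i:UNIV. c i * exp (k * t))" by (rule sum_mono) (use c t in auto)
  finally show ?thesis by (simp add: sum_distrib_right)
 qed
 thus ?thesis by (auto simp: exp_bounded_def)
qed

lemma exp_bounded_mono:
 assumes "exp_bounded f k" "k <= l" shows "exp_bounded f l"
proof -
 obtain c where c: "0 <= c" "!!t. 0 <= t ==> norm (f t) <= c * exp (k * t)"
  using assms(1) by (rule exp_boundedE) blast
 have "norm (f t) <= c * exp (l * t)" if "0 <= t" for t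
  by (rule order_trans[OF c(2)[OF that]]) (use c assms(2) that in "auto intro!: mult_left_mono mult_right_mono")
 thus ?thesis by (auto simp: exp_bounded_def)
qed

lemma (in prob_space) standard_BM_growth:
 assumes B: "standard_BM M B"
 shows "AE w in M. ALL eps>0. exp_bounded (%t. B t w) eps"
proof -
 have "AE w in M. ALL n i. exp_bounded (%t. B t w $ i) (1 / real (Suc n))"
  unfolding AE_all_countable
  by (intro allI standard_BM_growth_component[OF B]) simp
 thus ?thesis
 proof eventually_elim
  case (elim w)
  show ?case
  proof (intro allI impI)
   fix eps :: real assume "0 < eps"
   then obtain n where "1 / real (Suc n) < eps" using nat_approx_posE by metis
   thus "exp_bounded (%t. B t w) eps"
    using elim by (intro exp_bounded_mono[OF exp_bounded_vec, of _ "1 / real (Suc n)"]) auto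
  qed
 qed
qed

section \<open>Wiener functionals\<close>

definition sigma_join :: "'a measure => 'a measure list => 'a measure" where
 "sigma_join M Gs = sigma (space M) (\<Union>G\<in>set Gs. sets G)"

lemma
 assumes "!!G. G : set Gs ==> subalgebra M G"
 shows sets_sigma_join: "sets (sigma_join M Gs) = sigma_sets (space M) (\<Union>G\<in>set Gs. sets G)"
  and space_sigma_join: "space (sigma_join M Gs) = space M"
  and subalgebra_sigma_join: "subalgebra M (sigma_join M Gs)"
  and subalgebra_sigma_join_member: "G : set Gs ==> subalgebra (sigma_join M Gs) G"
proof -
 have sub: "(\<Union>G\<in>set Gs. sets G) <= Pow (space M)" "(\<Union>G\<in>set Gs. sets G) <= sets M"
  using assms sets.sets_into_space by (auto simp: subalgebra_def) blast+
 show s: "sets (sigma_join M Gs) = sigma_sets (space M) (\<Union>G\<in>set Gs. sets G)"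
  unfolding sigma_join_def by (rule sets_measure_of[OF sub(1)])
 show p: "space (sigma_join M Gs) = space M"
  unfolding sigma_join_def by (rule space_measure_of[OF sub(1)])
 show "subalgebra M (sigma_join M Gs)"
  unfolding subalgebra_def s p using sets.sigma_sets_subset[OF sub(2)] by simp
 show "subalgebra (sigma_join M Gs) G" if "G : set Gs"
  unfolding subalgebra_def s p using assms[OF that] that by (auto simp: subalgebra_def)
qed

lemma (in prob_space) mutually_indep_join:
 assumes ind: "mutually_indep M (As @ Bs @ Cs)"
  and sub: "!!G. G : set (As @ Bs @ Cs) ==> subalgebra M G"
 shows "indep_set (sets (sigma_join M As)) (sets (sigma_join M Bs))"
proof -
 let ?Gs = "As @ Bs @ Cs"
 define I where "I = case_bool {..<length As} {length As..<length As + length Bs}"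
 have "indep_sets (%i. sets (?Gs ! i)) (\<Union>j\<in>UNIV. I j)"
  using ind unfolding mutually_indep_def
  by (rule indep_sets_mono_index[rotated]) (auto simp: I_def UNIV_bool)
 hence "indep_sets (%j. sigma_sets (space M) (\<Union>i\<in>I j. sets (?Gs ! i))) UNIV"
  by (rule indep_sets_collect_sigma)
   (auto simp: sets.Int_stable disjoint_family_on_def I_def UNIV_bool)
 moreover have "(\<Union>i\<in>I True. sets (?Gs ! i)) = (\<Union>G\<in>set As. sets G)"
  by (auto simp: I_def set_conv_nth nth_append)
 moreover have "(\<Union>i\<in>I False. sets (?Gs ! i)) = (\<Union>G\<in>set Bs. sets G)"
 proof -
  have "(\<Union>i\<in>{length As..<length As + length Bs}. sets (?Gs ! i)) = (\<Union>i\<in>{..<length Bs}. sets (Bs ! i))"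
  proof (intro set_eqI iffI)
   fix A assume "A : (\<Union>i\<in>{length As..<length As + length Bs}. sets (?Gs ! i))"
   then obtain i where "length As <= i" "i < length As + length Bs" "A : sets (?Gs ! i)" by auto
   thus "A : (\<Union>i\<in>{..<length Bs}. sets (Bs ! i))"
    by (intro UN_I[of "i - length As"]) (auto simp: nth_append split: if_splits)
  next
   fix A assume "A : (\<Union>i\<in>{..<length Bs}. sets (Bs ! i))"
   then obtain i where "i < length Bs" "A : sets (Bs ! i)" by auto
   thus "A : (\<Union>i\<in>{length As..<length As + length Bs}. sets (?Gs ! i))"
    by (intro UN_I[of "i + length As"]) (auto simp: nth_append)
  qed
  also have "... = (\<Union>G\<in>set Bs. sets G)" by (auto simp: set_conv_nth)
  finally show ?thesis by (simp add: I_def)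
 qed
 ultimately have "indep_sets (case_bool (sets (sigma_join M As)) (sets (sigma_join M Bs))) UNIV"
  using sub by (elim indep_sets_cong[THEN iffD1, rotated 2]) (auto simp: sets_sigma_join split: bool.split)
 thus ?thesis by (simp add: indep_set_def)
qed

lemma (in prob_space) noise_cis:
 fixes f :: "'a => complex" and p :: "nat => real"
 assumes ind: "mutually_indep M (G # proc_sigma M B {0..} # proc_sigma M W {0..} # Gs)"
  and sub: "!!G'. G' : set (G # Gs) ==> subalgebra M G'"
  and B: "standard_BM M B" and W: "standard_BM M W"
  and f: "f : borel_measurable G" "!!x. norm (f x) <= 1"
  and p: "0 <= p 0" "!!i. i < n ==> p i <= p (Suc i)"
 shows "(LINT x|M. f x * cis ((SUM i<n. a i \<bullet> (B (p (Suc i)) x - B (p i) x)) + (SUM i<n. c i \<bullet> (W (p (Suc i)) x - W (p i) x))))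
  = (LINT x|M. f x) * exp (- (SUM i<n. ((norm (a i))^2 + (norm (c i))^2) * (p (Suc i) - p i)) / 2)"
proof -
 let ?B = "proc_sigma M B {0..}" and ?W = "proc_sigma M W {0..}"
 have sB: "subalgebra M ?B" by (rule subalgebra_proc_sigma) (auto intro: BM_measurable[OF B])
 have sW: "subalgebra M ?W" by (rule subalgebra_proc_sigma) (auto intro: BM_measurable[OF W])
 have sub': "subalgebra M G'" if "G' : set (G # ?B # ?W # Gs)" for G' using that sB sW sub by auto
 \<comment> \<open>\<open>W\<close> is split off from the pair of \<open>G\<close> and
   \<open>B\<close>, and then \<open>B\<close> from \<open>G\<close>; each step uses independence of
   two sigma-algebras only.\<close>
 have ind1: "indep_set (sets (sigma_join M [G, ?B])) (sets (sigma_join M [?W]))"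
  by (rule mutually_indep_join[of "[G, ?B]" "[?W]" Gs]) (use ind sub' in auto)
 have ind2: "indep_set (sets (sigma_join M [G])) (sets (sigma_join M [?B]))"
  by (rule mutually_indep_join[of "[G]" "[?B]" "?W # Gs"]) (use ind sub' in auto)
 have s: "subalgebra M (sigma_join M [G, ?B])" "subalgebra M (sigma_join M [?W])"
  "subalgebra M (sigma_join M [G])" "subalgebra M (sigma_join M [?B])"
  by (rule subalgebra_sigma_join; use sub' in auto)+
 have m: "subalgebra (sigma_join M [G, ?B]) G" "subalgebra (sigma_join M [G, ?B]) ?B"
  "subalgebra (sigma_join M [G]) G" "subalgebra (sigma_join M [?B]) ?B" "subalgebra (sigma_join M [?W]) ?W"
  by (rule subalgebra_sigma_join_member; use sub' in auto)+
 have p0: "0 <= p i" if "i <= n" for i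
  using that by (induction i) (use p in "auto intro: order_trans")
 define b where "b x = cis (SUM i<n. a i \<bullet> (B (p (Suc i)) x - B (p i) x))" for x
 define w where "w x = cis (SUM i<n. c i \<bullet> (W (p (Suc i)) x - W (p i) x))" for x
 have bw: "norm (b x) = 1" "norm (w x) = 1" for x by (simp_all add: b_def w_def)
 have bm: "b : borel_measurable ?B"
 proof -
  have "B (p i) : borel_measurable ?B" if "i <= n" for i by (rule measurable_proc_sigma) (use p0 that in auto)
  thus ?thesis unfolding b_def
   by (intro borel_measurable_cis borel_measurable_sum borel_measurable_inner borel_measurable_const borel_measurable_diff) auto
 qed
 have wm: "w : borel_measurable ?W"
 proof -
  have "W (p i) : borel_measurable ?W" if "i <= n" for i by (rule measurable_proc_sigma) (use p0 that in auto)
  thus ?thesis unfolding w_def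
   by (intro borel_measurable_cis borel_measurable_sum borel_measurable_inner borel_measurable_const borel_measurable_diff) auto
 qed
 have "(LINT x|M. f x * cis ((SUM i<n. a i \<bullet> (B (p (Suc i)) x - B (p i) x)) + (SUM i<n. c i \<bullet> (W (p (Suc i)) x - W (p i) x))))
  = (LINT x|M. (f x * b x) * w x)"
  by (simp add: b_def w_def cis_mult mult.assoc)
 also have "... = (LINT x|M. f x * b x) * (LINT x|M. w x)"
 proof (rule indep_set_integral_mult[OF s(1,2) ind1, of _ _ 1 1])
  show "(%x. f x * b x) : borel_measurable (sigma_join M [G, ?B])"
   by (intro borel_measurable_times measurable_from_subalg[OF m(1) f(1)] measurable_from_subalg[OF m(2) bm])
 qed (use f(2) measurable_from_subalg[OF m(5) wm] in "auto simp: norm_mult bw")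
 also have "(LINT x|M. f x * b x) = (LINT x|M. f x) * (LINT x|M. b x)"
  by (rule indep_set_integral_mult[OF s(3,4) ind2, of _ _ 1 1])
   (use f(2) measurable_from_subalg[OF m(3) f(1)] measurable_from_subalg[OF m(4) bm] in "auto simp: bw")
 also have "(LINT x|M. b x) = exp (- (SUM i<n. (norm (a i))^2 * (p (Suc i) - p i)) / 2)"
  unfolding b_def by (rule standard_BM_cis[OF B p]) auto
 also have "(LINT x|M. w x) = exp (- (SUM i<n. (norm (c i))^2 * (p (Suc i) - p i)) / 2)"
  unfolding w_def by (rule standard_BM_cis[OF W p]) auto
 moreover have "exp (- (SUM i<n. ((norm (a i))^2 + (norm (c i))^2) * (p (Suc i) - p i)) / 2)
  = exp (- (SUM i<n. (norm (a i))^2 * (p (Suc i) - p i)) / 2) * exp (- (SUM i<n. (norm (c i))^2 * (p (Suc i) - p i)) / 2)"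
  by (simp add: distrib_right sum.distrib add_divide_distrib flip: exp_add)
 ultimately show ?thesis by (simp add: mult.assoc)
qed

text \<open>The functional \<open>r \<bullet> X + \<integral> a dB + \<integral> c dW\<close> on \<open>[0, t]\<close>, as the limit of the sums over uniform partitions.\<close>
definition wiener_sum :: "(real => 'a => 'u::real_inner) => real => (real => 'u) => nat => 'a => real" where
 "wiener_sum B t a n w = (SUM i<n. a (real i * t / n) \<bullet> (B (real (Suc i) * t / n) w - B (real i * t / n) w))"

definition is_wiener :: "'a measure => ('a => 'x::real_inner) => (real => 'a => 'u::real_inner) => (real => 'a => 'v::real_inner)
  => real => 'x => (real => 'u) => (real => 'v) => ('a => real) => bool" where
 "is_wiener M X B W t r a c Y \<longleftrightarrow>
  (AE w in M. (%n. r \<bullet> X w + (wiener_sum B t a n w + wiener_sum W t c n w)) ----> Y w)"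

lemma wiener_sum_add: "wiener_sum B t (%s. a s + a' s) n w = wiener_sum B t a n w + wiener_sum B t a' n w"
 by (simp add: wiener_sum_def inner_add_left sum.distrib)

lemma wiener_sum_cmult: "wiener_sum B t (%s. u *\<^sub>R a s) n w = u * wiener_sum B t a n w"
 by (simp add: wiener_sum_def sum_distrib_left)

lemma is_wiener_add:
 assumes "is_wiener M X B W t r a c Y" "is_wiener M X B W t r' a' c' Y'"
 shows "is_wiener M X B W t (r + r') (%s. a s + a' s) (%s. c s + c' s) (%w. Y w + Y' w)"
 using assms unfolding is_wiener_def
proof eventually_elim
 case (elim w)
 from tendsto_add[OF elim] show ?case
  by (simp add: wiener_sum_add inner_add_left algebra_simps)
qed

lemma is_wiener_cmult:
 assumes "is_wiener M X B W t r a c Y"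
 shows "is_wiener M X B W t (u *\<^sub>R r) (%s. u *\<^sub>R a s) (%s. u *\<^sub>R c s) (%w. u * Y w)"
 using assms unfolding is_wiener_def
proof eventually_elim
 case (elim w)
 from tendsto_mult[OF tendsto_const elim, of u] show ?case
  by (simp add: wiener_sum_cmult distrib_left)
qed

text \<open>The characteristic function is kept as a limit of explicit exponentials. In this form
  the orthogonality lemma can add two functionals and take the limit of their cross terms
  alone.\<close>

lemma (in prob_space) is_wiener_cis_tendsto:
 fixes X :: "real => 'a => real^'x"
 assumes ind: "mutually_indep M (proc_sigma M X {0} # proc_sigma M B {0..} # proc_sigma M W {0..} # Gs)"
  and sub: "!!G. G : set Gs ==> subalgebra M G" and X: "X 0 : borel_measurable M"
  and B: "standard_BM M B" and W: "standard_BM M W" and t: "0 <= t"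
  and Y: "is_wiener M (X 0) B W t r a c Y" and Ym: "Y : borel_measurable M"
 shows "(%n. (LINT x|M. cis (r \<bullet> X 0 x)) * exp (- (SUM i<n. ((norm (a (real i * t / n)))^2 + (norm (c (real i * t / n)))^2) * (t / n)) / 2))
  ----> (LINT x|M. cis (Y x))"
proof -
 have p0: "0 <= real i * t / n" "real i * t / n <= real (Suc i) * t / n" for i n :: nat
  using t by (auto intro!: divide_right_mono mult_right_mono)
 have Bm[measurable]: "B (real i * t / n) : borel_measurable M" and Wm[measurable]: "W (real i * t / n) : borel_measurable M"
  for i n :: nat using p0 by (auto intro: BM_measurable[OF B] BM_measurable[OF W])
 have Bm'[measurable]: "B (real (Suc i) * t / n) : borel_measurable M" and Wm'[measurable]: "W (real (Suc i) * t / n) : borel_measurable M"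
  for i n :: nat by (rule Bm Wm)+
 have [measurable]: "wiener_sum B t a n : borel_measurable M" "wiener_sum W t c n : borel_measurable M" for n
  unfolding wiener_sum_def by measurable
 have "(%n. LINT x|M. cis (r \<bullet> X 0 x + (wiener_sum B t a n x + wiener_sum W t c n x))) ----> (LINT x|M. cis (Y x))"
 proof (rule integral_dominated_convergence[where w = "%_. 1"])
  show "AE x in M. (%n. cis (r \<bullet> X 0 x + (wiener_sum B t a n x + wiener_sum W t c n x))) ----> cis (Y x)"
   using Y unfolding is_wiener_def by eventually_elim (intro tendsto_intros)
 next
  note [measurable] = X Ym
  show "(%x. cis (r \<bullet> X 0 x + (wiener_sum B t a n x + wiener_sum W t c n x))) : borel_measurable M" for n
   by measurable
  show "(%x. cis (Y x)) : borel_measurable M" by measurable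
 qed auto
 moreover have "(LINT x|M. cis (r \<bullet> X 0 x + (wiener_sum B t a n x + wiener_sum W t c n x)))
  = (LINT x|M. cis (r \<bullet> X 0 x)) * exp (- (SUM i<n. ((norm (a (real i * t / n)))^2 + (norm (c (real i * t / n)))^2) * (t / n)) / 2)" for n
 proof -
  have step: "real (Suc i) * t / n - real i * t / n = t / n" for i by (simp add: diff_divide_distrib[symmetric] algebra_simps)
  have Xs: "subalgebra M (proc_sigma M X {0})" by (rule subalgebra_proc_sigma) (use X in auto)
  have "(LINT x|M. cis (r \<bullet> X 0 x) * cis (wiener_sum B t a n x + wiener_sum W t c n x))
   = (LINT x|M. cis (r \<bullet> X 0 x)) * exp (- (SUM i<n. ((norm (a (real i * t / n)))^2 + (norm (c (real i * t / n)))^2)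
      * (real (Suc i) * t / n - real i * t / n)) / 2)"
   unfolding wiener_sum_def
   by (rule noise_cis[OF ind _ B W, where p = "%i. real i * t / n" and a = "%i. a (real i * t / n)" and c = "%i. c (real i * t / n)"])
    (use sub Xs p0 measurable_proc_sigma[of 0 "{0}" X M] in "auto intro!: borel_measurable_cis borel_measurable_inner")
  thus ?thesis by (simp add: cis_mult step del: of_nat_Suc)
 qed
 ultimately show ?thesis by simp
qed

text \<open>The exponent of the sum of the two functionals is the sum of their exponents plus a
  cross term, which tends to 0. Since \<open>Z\<close> has no initial part, the factor from
  \<open>X 0\<close> belongs to \<open>Y\<close> alone.\<close>

lemma (in prob_space) is_wiener_orthogonal:
 fixes X :: "real => 'a => real^'x"
 assumes ind: "mutually_indep M (proc_sigma M X {0} # proc_sigma M B {0..} # proc_sigma M W {0..} # Gs)"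
  and sub: "!!G. G : set Gs ==> subalgebra M G" and X: "X 0 : borel_measurable M"
  and B: "standard_BM M B" and W: "standard_BM M W" and t: "0 <= t"
  and Y: "is_wiener M (X 0) B W t r a c Y" and Ym: "Y : borel_measurable M"
  and Z: "is_wiener M (X 0) B W t 0 a' c' Z" and Zm: "Z : borel_measurable M"
  and cross: "(%n. SUM i<n. (a (real i * t / n) \<bullet> a' (real i * t / n) + c (real i * t / n) \<bullet> c' (real i * t / n)) * (t / n)) ----> 0"
 shows "(LINT w|M. cis (Z w) * cis (Y w)) = (LINT w|M. cis (Z w)) * (LINT w|M. cis (Y w))"
proof -
 define q where "q n = exp (- (SUM i<n. ((norm (a (real i * t / n)))^2 + (norm (c (real i * t / n)))^2) * (t / n)) / 2)" for n
 define q' where "q' n = exp (- (SUM i<n. ((norm (a' (real i * t / n)))^2 + (norm (c' (real i * t / n)))^2) * (t / n)) / 2)" for n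
 define x where "x n = (SUM i<n. (a (real i * t / n) \<bullet> a' (real i * t / n) + c (real i * t / n) \<bullet> c' (real i * t / n)) * (t / n))" for n
 let ?E = "\<integral>w. cis (r \<bullet> X 0 w) \<partial>M"
 note lim = is_wiener_cis_tendsto[OF ind sub X B W t]
 have 1: "(%n. ?E * complex_of_real (q n)) ----> (LINT w|M. cis (Y w))"
  using lim[OF _ Y Ym] by (simp add: q_def)
 have 2: "(%n. complex_of_real (q' n)) ----> (LINT w|M. cis (Z w))"
  using lim[OF _ Z Zm] by (simp add: q'_def prob_space)
 have "(%n. exp (- x n)) ----> exp (- 0)" using cross unfolding x_def by (intro tendsto_intros)
 hence "(%n. complex_of_real (exp (- x n))) ----> complex_of_real 1" by (intro tendsto_of_real) simp
 from tendsto_mult[OF tendsto_mult[OF 2 1] this]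
 have "(%n. complex_of_real (q' n) * (?E * complex_of_real (q n)) * complex_of_real (exp (- x n)))
  ----> (LINT w|M. cis (Z w)) * (LINT w|M. cis (Y w))" by simp
 moreover have "(%n. ?E * complex_of_real (q n * q' n * exp (- x n))) ----> (LINT w|M. cis (Y w + Z w))"
 proof -
  have W2: "is_wiener M (X 0) B W t r (%s. a s + a' s) (%s. c s + c' s) (%w. Y w + Z w)"
   using is_wiener_add[OF Y Z] by simp
  have "q n * q' n * exp (- x n) = exp (- (SUM i<n. ((norm (a (real i * t / n) + a' (real i * t / n)))^2
    + (norm (c (real i * t / n) + c' (real i * t / n)))^2) * (t / n)) / 2)" for n
  proof -
   have e: "((norm (a s + a' s))^2 + (norm (c s + c' s))^2) * d = ((norm (a s))^2 + (norm (c s))^2) * d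
    + ((norm (a' s))^2 + (norm (c' s))^2) * d + 2 * ((a s \<bullet> a' s + c s \<bullet> c' s) * d)" for s d
    by (simp add: power2_norm_eq_inner inner_add_left inner_add_right inner_commute algebra_simps)
   have x2: "(SUM i<n. 2 * ((a (real i * t / n) \<bullet> a' (real i * t / n) + c (real i * t / n) \<bullet> c' (real i * t / n)) * (t / n))) = 2 * x n"
    unfolding x_def by (simp only: sum_distrib_left)
   show ?thesis
    unfolding e sum.distrib x2 q_def q'_def exp_add[symmetric] by (simp add: add_divide_distrib)
  qed
  thus ?thesis using lim[OF _ W2] Ym Zm by simp
 qed
 ultimately have "(LINT w|M. cis (Y w + Z w)) = (LINT w|M. cis (Z w)) * (LINT w|M. cis (Y w))"
  by (intro LIMSEQ_unique) (simp_all add: mult_ac)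
 thus ?thesis by (simp add: cis_mult add.commute)
qed

lemma (in prob_space) is_wiener_gaussian:
 fixes X :: "real => 'a => real^'x" and a :: "real => real^'u" and c :: "real => real^'v"
 assumes ind: "mutually_indep M (proc_sigma M X {0} # proc_sigma M B {0..} # proc_sigma M W {0..} # Gs)"
  and sub: "!!G. G : set Gs ==> subalgebra M G" and X: "X 0 : borel_measurable M"
  and B: "standard_BM M B" and W: "standard_BM M W" and t: "0 <= t"
  and Y: "is_wiener M (X 0) B W t 0 a c Y" and Ym: "Y : borel_measurable M"
  and a: "continuous_on {0..t} a" and c: "continuous_on {0..t} c"
 defines "v == integral {0..t} (%s. (norm (a s))^2 + (norm (c s))^2)"
 shows "(LINT w|M. cis (u * Y w)) = exp (- (u^2 * v / 2))" and "0 <= v"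
proof -
 let ?f = "%s. (norm (a s))^2 + (norm (c s))^2"
 have cf: "continuous_on {0..t} ?f" by (intro continuous_intros a c)
 show "0 <= v" unfolding v_def by (intro integral_nonneg integrable_continuous_real cf) auto
 have "is_wiener M (X 0) B W t 0 (%s. u *\<^sub>R a s) (%s. u *\<^sub>R c s) (%w. u * Y w)"
  using is_wiener_cmult[OF Y, of u] by simp
 from is_wiener_cis_tendsto[OF ind sub X B W t this] Ym
 have "(%n. complex_of_real (exp (- (SUM i<n. ((norm (u *\<^sub>R a (real i * t / n)))^2 + (norm (u *\<^sub>R c (real i * t / n)))^2) * (t / n)) / 2)))
  ----> (LINT w|M. cis (u * Y w))" by (simp add: prob_space)
 moreover have "(SUM i<n. ((norm (u *\<^sub>R a (real i * t / n)))^2 + (norm (u *\<^sub>R c (real i * t / n)))^2) * (t / n))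
  = u^2 * (SUM i<n. (t / n) *\<^sub>R ?f (real i * t / n))" for n
  by (simp add: sum_distrib_left power_mult_distrib algebra_simps)
 ultimately have 1: "(%n. complex_of_real (exp (- (u^2 * (SUM i<n. (t / n) *\<^sub>R ?f (real i * t / n))) / 2)))
  ----> (LINT w|M. cis (u * Y w))" by simp
 have "(%n. complex_of_real (exp (- (u^2 * (SUM i<n. (t / n) *\<^sub>R ?f (real i * t / n))) / 2)))
  ----> complex_of_real (exp (- (u^2 * v) / 2))"
  unfolding v_def by (intro tendsto_of_real tendsto_intros riemann_sum_tendsto cf t) simp
 with 1 show "(LINT w|M. cis (u * Y w)) = exp (- (u^2 * v / 2))"
  using LIMSEQ_unique by fastforce
qed

section \<open>Path decomposition and dual equations\<close>

lemma sint_add_diff: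
 assumes "continuous_on {0..} K'" "continuous_on {0..} u" "continuous_on {0..} v" "0 <= t"
 shows "sint K K' (%s. u s + v s) t = sint K K' u t + sint K K' v t"
  and "sint K K' (%s. u s - v s) t = sint K K' u t - sint K K' v t"
proof -
 have i: "(%s. K' s *v u s) integrable_on {0..t}" "(%s. K' s *v v s) integrable_on {0..t}"
  by (intro integrable_continuous_real continuous_intros continuous_Icc assms)+
 show "sint K K' (%s. u s + v s) t = sint K K' u t + sint K K' v t"
  using Henstock_Kurzweil_Integration.integral_add[OF i] by (simp add: sint_def matrix_vector_right_distrib)
 show "sint K K' (%s. u s - v s) t = sint K K' u t - sint K K' v t"
  using Henstock_Kurzweil_Integration.integral_diff[OF i] by (simp add: sint_def matrix_vector_mult_diff_distrib)
qed

lemma matrix_vector_mult_minus_right: "A *v (- x) = - (A *v (x :: real^'n))"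
 using matrix_vector_mult_diff_distrib[of A 0 x] by simp

lemma sint_integral:
 assumes K: "!!t. 0 <= t ==> (K has_vector_derivative K' t) (at t within {0..})"
  and K': "continuous_on {0..} K'" and v: "continuous_on {0..} v" and t: "0 <= t"
 shows "sint K K' (%t. integral {0..t} v) t = integral {0..t} (%s. K s *v v s)"
proof -
 have Kc: "continuous_on {0..} K" by (rule derivative_continuous_on) (use K in auto)
 have "((%s. K s *v v s + K' s *v integral {0..s} v) has_integral
  (K t *v integral {0..t} v - K 0 *v integral {0..0} v)) {0..t}"
  by (rule has_integral_derivative_atLeast[OF _ t])
   (rule matrix_vector_derivative[OF K integral_derivative_atLeast[OF v]])
 hence "integral {0..t} (%s. K s *v v s + K' s *v integral {0..s} v) = K t *v integral {0..t} v"
  by (simp add: integral_unique)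
 moreover have "(%s. K s *v v s) integrable_on {0..t}" "(%s. K' s *v integral {0..s} v) integrable_on {0..t}"
  by (intro integrable_continuous_real continuous_intros continuous_Icc K' Kc v
    continuous_on_integral_atLeast)+
 ultimately show ?thesis
  by (simp add: sint_def Henstock_Kurzweil_Integration.integral_add algebra_simps)
qed

context riccati_data
begin

definition flow :: "(real => real^'d^'d) => real => real^'d => real^'d" where
 "flow P t x = vsol (*v) (drift P) (%_. x) t"

text \<open>The Kalman-Bucy mean equation dm = (F - K H) m dt + K dz with m(0) = 0 and gain K,
  solved for a single observation path.\<close>

definition mean_path :: "(real => real^'d^'d) => (real => real^'k) => real => real^'d" where
 "mean_path P z = vsol (*v) (drift P) (sint (gain P) (gain' P) z)"

lemma flow_decay:
 assumes P: "riccati P" and st: "exp_stable P c al" and t: "0 <= t"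
 shows "norm (flow P t x) <= c * exp (- al * t) * norm x"
proof -
 note v = vsol_eq_atLeast[OF bilinear_matrix_vector riccati_continuous(3)[OF P] continuous_on_const[of _ x]]
 have "((%t. vsol (*v) (drift P) (%_. x) t - x + x) has_vector_derivative drift P t *v vsol (*v) (drift P) (%_. x) t) (at t within {0..})"
  if "0 <= t" for t
  using has_vector_derivative_add[OF v(3)[OF that] has_vector_derivative_const[of x]] by simp
 hence "((%t. flow P t x) has_vector_derivative drift P t *v flow P t x) (at t within {0..})" if "0 <= t" for t
  using that by (simp add: flow_def)
 from forward_decay[OF P st this t] v(2)[of 0] show ?thesis by (simp add: flow_def)
qed

text \<open>Moving the term K H y of the correction to the drift leaves a linear equation driven
  separately by the initial value, the observation path and the noises. The sum of the three
  solutions solves it, and uniqueness concludes. For the signal the correction is identically 0, so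
  the statement covers both filters.\<close>

lemma path_decomposition:
 assumes P: "riccati P" and b: "continuous_on {0..} b" "b 0 = 0" and w: "continuous_on {0..} w" "w 0 = 0"
  and z: "continuous_on {0..} z" and y: "continuous_on {0..} y"
  and eq: "!!t. 0 <= t ==> y t = y 0 + integral {0..t} (%s. F *v y s) + SS *v b t
   - sint (gain P) (gain' P) (%t. integral {0..t} (%s. H *v y s) + GG *v w t - z t) t"
  and t: "0 <= t"
 shows "y t = flow P t (y 0) + mean_path P z t + noise_path P SS GG b w t"
proof -
 note cont = riccati_continuous[OF P]
 note np = noise_path_props[OF P b w, where SS = SS and GG = GG]
 have sz: "continuous_on {0..} (sint (gain P) (gain' P) z)" by (intro sint_continuous cont z)
 note fl = vsol_eq_atLeast[OF bilinear_matrix_vector cont(3) continuous_on_const[of _ "y 0"]]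
 note mp = vsol_eq_atLeast[OF bilinear_matrix_vector cont(3) sz]
 define f where "f t = y 0 + sint (gain P) (gain' P) z t + (SS *v b t - sint (gain P) (gain' P) (%s. GG *v w s) t)" for t
 define x where "x t = flow P t (y 0) + mean_path P z t + noise_path P SS GG b w t" for t
 have xc: "continuous_on {0..} x"
  unfolding x_def flow_def mean_path_def by (intro continuous_intros fl(1) mp(1) np(1))
 show ?thesis unfolding x_def[symmetric]
 proof (rule volterra_unique[OF bilinear_matrix_vector, where T = t and A = "drift P" and y = y and z = x and f = f])
  fix s assume "s : {0..t}"
  hence s: "0 <= s" by simp
  have i: "(%s. F *v y s) integrable_on {0..s}" "(%s. (P s ** S) *v y s) integrable_on {0..s}"
   by (intro integrable_continuous_real continuous_intros continuous_Icc y cont)+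
  have cH: "continuous_on {0..} (%s. H *v y s)" by (intro continuous_intros y)
  have cIH: "continuous_on {0..} (%t. integral {0..t} (%s. H *v y s))"
   by (intro continuous_on_integral_atLeast cH)
  have cw: "continuous_on {0..} (%t. GG *v w t)" by (intro continuous_intros w)
  have "sint (gain P) (gain' P) (%t. integral {0..t} (%s. H *v y s) + GG *v w t - z t) s
   = integral {0..s} (%s. (P s ** S) *v y s) + sint (gain P) (gain' P) (%t. GG *v w t) s - sint (gain P) (gain' P) z s"
   using sint_add_diff(2)[OF cont(5) continuous_on_add[OF cIH cw] z s, where K = "gain P"] sint_add_diff(1)[OF cont(5) cIH cw s, where K = "gain P"]
    sint_integral[OF gain_has_vector_derivative[OF P] cont(5) cH s]
   by (simp add: matrix_vector_mul_assoc gain_mult_H)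
  thus "y s = f s + integral {0..s} (%s. drift P s *v y s)"
   using eq[OF s] Henstock_Kurzweil_Integration.integral_diff[OF i]
   by (simp add: f_def drift_def matrix_vector_mult_diff_rdistrib)
  have i: "(%r. drift P r *v flow P r (y 0)) integrable_on {0..s}" "(%r. drift P r *v mean_path P z r) integrable_on {0..s}"
   "(%r. drift P r *v noise_path P SS GG b w r) integrable_on {0..s}"
   unfolding flow_def mean_path_def
   by (intro integrable_continuous_real continuous_intros continuous_Icc cont fl(1) mp(1) np(1))+
  show "x s = f s + integral {0..s} (%s. drift P s *v x s)"
   using fl(2)[OF s] mp(2)[OF s] np(2)[OF s]
   using Henstock_Kurzweil_Integration.integral_add[OF integrable_add[OF i(1,2)] i(3)]
    Henstock_Kurzweil_Integration.integral_add[OF i(1,2)]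
   by (simp add: x_def f_def matrix_vector_right_distrib flow_def mean_path_def)
 qed (use t in "auto intro: continuous_Icc cont y xc")
qed

text \<open>Solving the equation backwards turns \<open>p t \<bullet> noise_path\<close> into a Wiener integral.\<close>
lemma noise_path_dual:
 assumes P: "riccati P" and b: "continuous_on {0..} b" "b 0 = 0" and w: "continuous_on {0..} w" "w 0 = 0"
  and SS: "transpose SS = SS" and GG: "transpose GG = GG" and t: "0 <= t"
  and p: "!!s. s : {0..t} ==> (p has_vector_derivative - (transpose (drift P s) *v p s)) (at s within {0..t})"
 shows "(%n. (SUM i<n. (SS *v p (real i * t / n)) \<bullet> (b (real (Suc i) * t / n) - b (real i * t / n)))
   + (SUM i<n. (- (GG *v (transpose (gain P (real i * t / n)) *v p (real i * t / n)))) \<bullet> (w (real (Suc i) * t / n) - w (real i * t / n))))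
  ----> p t \<bullet> noise_path P SS GG b w t"
proof -
 note cont = riccati_continuous[OF P, THEN continuous_Icc]
 note np = noise_path_props[OF P b w, where SS = SS and GG = GG]
 note npc = continuous_Icc[OF np(1)]
 note bc = continuous_Icc[OF b(1)] and wc = continuous_Icc[OF w(1)]
 have pc: "continuous_on {0..t} p" by (rule derivative_continuous_on[OF p])
 have S1: "(SS *v x) \<bullet> y = x \<bullet> (SS *v y)" for x y by (metis inner_matrix SS)
 have G1: "(GG *v x) \<bullet> y = x \<bullet> (GG *v y)" for x y by (metis inner_matrix GG)
 have T1: "(transpose A *v x) \<bullet> y = x \<bullet> (A *v y)" for A :: "real^'m^'n" and x y
  by (simp add: inner_matrix)
 define al where "al s = - (SS *v (transpose (drift P s) *v p s))" for s
 define bt where "bt s = - (GG *v (transpose (gain' P s) *v p s - transpose (gain P s) *v (transpose (drift P s) *v p s)))" for s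
 have 1: "(%n. SUM i<n. (SS *v p (real i * t / n)) \<bullet> (b (real (Suc i) * t / n) - b (real i * t / n)))
  ----> (SS *v p t) \<bullet> b t - integral {0..t} (%u. al u \<bullet> b u)"
 proof (rule stieltjes_sum_tendsto_deriv[OF t bc b(2)])
  show "((%s. SS *v p s) has_vector_derivative al s) (at s within {0..t})" if "s : {0..t}" for s
   using matrix_vector_derivative[OF has_vector_derivative_const[of SS] p[OF that]]
   by (simp add: al_def matrix_vector_mult_minus_right)
  show "continuous_on {0..t} al" unfolding al_def by (intro continuous_intros cont pc)
 qed
 have 2: "(%n. SUM i<n. (- (GG *v (transpose (gain P (real i * t / n)) *v p (real i * t / n)))) \<bullet> (w (real (Suc i) * t / n) - w (real i * t / n)))
  ----> (- (GG *v (transpose (gain P t) *v p t))) \<bullet> w t - integral {0..t} (%u. bt u \<bullet> w u)"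
 proof (rule stieltjes_sum_tendsto_deriv[OF t wc w(2), where a = "%s. - (GG *v (transpose (gain P s) *v p s))"])
  show "((%s. - (GG *v (transpose (gain P s) *v p s))) has_vector_derivative bt s) (at s within {0..t})" if s: "s : {0..t}" for s
  proof -
   have "(gain P has_vector_derivative gain' P s) (at s within {0..t})"
    by (rule has_vector_derivative_within_subset[OF gain_has_vector_derivative[OF P]]) (use s in auto)
   hence "((%s. transpose (gain P s)) has_vector_derivative transpose (gain' P s)) (at s within {0..t})"
    by (rule bounded_linear.has_vector_derivative[OF bounded_linear_transpose])
   from has_vector_derivative_minus[OF matrix_vector_derivative[OF has_vector_derivative_const[of GG] matrix_vector_derivative[OF this p[OF s]]]]
   show ?thesis by (simp add: bt_def matrix_vector_mult_minus_right)
  qed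
  show "continuous_on {0..t} bt" unfolding bt_def by (intro continuous_intros cont pc)
 qed
 \<comment> \<open>Without its rough part the noise path is differentiable, and the product rule
   with \<open>p\<close> applies.\<close>
 let ?z = "%t. noise_path P SS GG b w t - (SS *v b t - gain P t *v (GG *v w t))"
 have "((%s. p s \<bullet> (drift P s *v noise_path P SS GG b w s + gain' P s *v (GG *v w s)) + (- (transpose (drift P s) *v p s)) \<bullet> ?z s)
  has_integral (p t \<bullet> ?z t - p 0 \<bullet> ?z 0)) {0..t}"
  by (rule fundamental_theorem_of_calculus[OF t], rule inner_derivative[OF p])
   (auto intro!: has_vector_derivative_within_subset[OF np(3)])
 moreover have "p s \<bullet> (drift P s *v noise_path P SS GG b w s + gain' P s *v (GG *v w s)) + (- (transpose (drift P s) *v p s)) \<bullet> ?z s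
  = - (al s \<bullet> b s) - bt s \<bullet> w s" for s
  by (simp add: al_def bt_def S1 G1 T1 inner_add_right inner_diff_right inner_diff_left matrix_vector_mult_diff_distrib)
 moreover have "?z 0 = 0" using b w np(4) by simp
 ultimately have I: "((%s. - (al s \<bullet> b s) - bt s \<bullet> w s) has_integral p t \<bullet> ?z t) {0..t}" by simp
 have "(%s. al s \<bullet> b s) integrable_on {0..t}" "(%s. bt s \<bullet> w s) integrable_on {0..t}"
  unfolding al_def bt_def by (intro integrable_continuous_real continuous_intros cont pc bc wc)+
 hence "((%s. - (al s \<bullet> b s) - bt s \<bullet> w s) has_integral - integral {0..t} (%s. al s \<bullet> b s) - integral {0..t} (%s. bt s \<bullet> w s)) {0..t}"
  by (intro has_integral_diff has_integral_neg integrable_integral)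
 with I have "p t \<bullet> ?z t = - integral {0..t} (%s. al s \<bullet> b s) - integral {0..t} (%s. bt s \<bullet> w s)"
  by (rule has_integral_unique)
 hence "(SS *v p t) \<bullet> b t - integral {0..t} (%u. al u \<bullet> b u)
   + ((- (GG *v (transpose (gain P t) *v p t))) \<bullet> w t - integral {0..t} (%u. bt u \<bullet> w u)) = p t \<bullet> noise_path P SS GG b w t"
  by (simp add: S1 G1 T1 inner_diff_right inner_add_right algebra_simps)
 with tendsto_add[OF 1 2] show ?thesis by (simp only:)
qed

text \<open>The integrands dual to \<open>noise_path R\<close> and to the observations are orthogonal: their inner
 product is the derivative of \<open>p \<bullet> R q\<close>, which vanishes at both ends.\<close>
lemma dual_orthogonal:
 assumes R: "riccati R" "R 0 = 0" and t: "0 <= t"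
  and SS: "transpose SS = SS" "SS ** SS = \<Sigma>" and GG: "transpose GG = GG" "GG ** GG = \<Gamma>"
  and p: "!!s. s : {0..t} ==> (p has_vector_derivative - (transpose (drift R s) *v p s)) (at s within {0..t})"
  and q: "!!s. s : {0..t} ==> (q has_vector_derivative - (transpose F *v q s) - transpose H *v et s) (at s within {0..t})" "q t = 0"
  and et: "continuous_on {0..t} et"
 shows "(%n. SUM i<n. ((SS *v q (real i * t / n)) \<bullet> (SS *v p (real i * t / n))
   + (GG *v et (real i * t / n)) \<bullet> (- (GG *v (transpose (gain R (real i * t / n)) *v p (real i * t / n))))) * (t / n)) ----> 0"
proof -
 note cont = riccati_continuous[OF R(1), THEN continuous_Icc]
 have pc: "continuous_on {0..t} p" by (rule derivative_continuous_on[OF p])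
 have qc: "continuous_on {0..t} q" by (rule derivative_continuous_on[OF q(1)])
 have T1: "(transpose A *v x) \<bullet> y = x \<bullet> (A *v y)" for A :: "real^'m^'n" and x y
  by (simp add: inner_matrix)
 define f where "f s = (SS *v q s) \<bullet> (SS *v p s) + (GG *v et s) \<bullet> (- (GG *v (transpose (gain R s) *v p s)))" for s
 have fc: "continuous_on {0..t} f" unfolding f_def by (intro continuous_intros cont pc qc et)
 have "((%s. (- (transpose (drift R s) *v p s)) \<bullet> (R s *v q s) + p s \<bullet> (rhs (R s) *v q s) + p s \<bullet> (R s *v (- (transpose F *v q s) - transpose H *v et s)))
  has_integral (p t \<bullet> (R t *v q t) - p 0 \<bullet> (R 0 *v q 0))) {0..t}"
  by (rule fundamental_theorem_of_calculus[OF t], subst has_real_derivative_iff_has_vector_derivative[symmetric],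
   rule bilinear_form_has_derivative[OF p q(1)])
   (auto intro!: has_vector_derivative_within_subset[OF riccatiD(1)[OF R(1)]])
 moreover have "(- (transpose (drift R s) *v p s)) \<bullet> (R s *v q s) + p s \<bullet> (rhs (R s) *v q s) + p s \<bullet> (R s *v (- (transpose F *v q s) - transpose H *v et s)) = f s"
  if s: "s : {0..t}" for s
 proof -
  have sym: "transpose (R s) = R s" using riccatiD(2)[OF R(1)] s by auto
  have P: "p s \<bullet> (R s *v y) = (R s *v p s) \<bullet> y" for y by (metis sym inner_matrix)
  have e1: "(SS *v q s) \<bullet> (SS *v p s) = p s \<bullet> (\<Sigma> *v q s)"
   unfolding SS(2)[symmetric] matrix_vector_mul_assoc[symmetric] by (metis inner_commute inner_matrix SS(1))
  have "(GG *v et s) \<bullet> (GG *v (transpose (gain R s) *v p s)) = et s \<bullet> (\<Gamma> *v (transpose (gain R s) *v p s))"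
   unfolding GG(2)[symmetric] matrix_vector_mul_assoc[symmetric] by (metis inner_matrix GG(1))
  also have "\<Gamma> *v (transpose (gain R s) *v p s) = H *v (R s *v p s)"
   by (simp add: gain_def matrix_transpose_mul sym matrix_vector_mul_assoc matrix_mul_assoc)
  finally have e2: "(GG *v et s) \<bullet> (GG *v (transpose (gain R s) *v p s)) = (R s *v p s) \<bullet> (transpose H *v et s)"
   using inner_matrix[of "et s" H "R s *v p s"] by (simp only: inner_commute)
  have "(S *v (R s *v p s)) \<bullet> (R s *v q s) = (R s *v p s) \<bullet> (S *v (R s *v q s))"
   by (simp add: inner_matrix)
  thus ?thesis
   by (simp add: f_def e1 e2 inner_rhs[OF sym] transpose_drift[of R s, OF sym] P inner_diff_left inner_diff_right algebra_simps)
 qed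
 ultimately have "(f has_integral (p t \<bullet> (R t *v q t) - p 0 \<bullet> (R 0 *v q 0))) {0..t}"
  using has_integral_eq by (metis (no_types, lifting))
 hence "integral {0..t} f = 0" using q(2) R(2) by (simp add: integral_unique)
 with riemann_sum_tendsto[OF fc t] show ?thesis by (simp add: f_def mult.commute)
qed


lemma observation_dual_exists:
 assumes et: "continuous_on {0..t} et" and t: "0 <= t"
 shows "EX q. q t = 0 & (ALL s:{0..t}. (q has_vector_derivative - (transpose F *v q s) - transpose H *v et s) (at s within {0..t}))"
proof -
 \<comment> \<open>\<open>max 0\<close> continues the forcing beyond \<open>r = t\<close>, since the
   solution lemmas are stated on the half-line.\<close>
 define g where "g r = transpose H *v et (max 0 (t - r))" for r
 have g: "continuous_on {0..} g" unfolding g_def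
  by (intro continuous_intros continuous_on_compose2[OF et]) (use t in auto)
 define f where "f u = integral {0..u} g" for u
 have f: "continuous_on {0..} f" unfolding f_def by (rule continuous_on_integral_atLeast[OF g])
 define y where "y = vsol (*v) (%_. transpose F) f"
 note v = vsol_eq_atLeast[OF bilinear_matrix_vector continuous_on_const[of _ "transpose F"] f, folded y_def]
 have y': "(y has_vector_derivative transpose F *v y u + g u) (at u within {0..})" if "0 <= u" for u
  using has_vector_derivative_add[OF v(3)[OF that] integral_derivative_atLeast[OF g that]]
  by (simp add: f_def)
 have "((%s. y (t - s)) has_vector_derivative - (transpose F *v y (t - s)) - transpose H *v et s) (at s within {0..t})"
  if s: "s : {0..t}" for s
 proof -
  have "((%s. t - s) has_vector_derivative -1) (at s within {0..t})" by (auto intro!: derivative_eq_intros)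
  moreover have "(y has_vector_derivative transpose F *v y (t - s) + g (t - s)) (at (t - s) within (%s. t - s) ` {0..t})"
   by (rule has_vector_derivative_within_subset[OF y']) (use s in auto)
  ultimately show ?thesis
   using vector_diff_chain_within[of "%s. t - s" "-1" s "{0..t}" y "transpose F *v y (t - s) + g (t - s)"]
   using s by (simp add: g_def o_def)
 qed
 moreover have "y (t - t) = 0" using v(2)[of 0] by (simp add: f_def)
 ultimately show ?thesis by (intro exI[of _ "%s. y (t - s)"]) auto
qed

text \<open>It turns a time integral of the observations into an initial term plus integrals against
  the two driving paths. The integrand against \<open>w\<close> comes from the primitive
  \<open>et\<close> of \<open>f\<close> taken from the terminal time; the one against
  \<open>b\<close> comes from the dual signal equation forced by \<open>et\<close>.\<close>

lemma observation_dual: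
 fixes x b :: "real => real^'d" and z w f :: "real => real^'k"
 assumes b: "continuous_on {0..} b" "b 0 = 0" and w: "continuous_on {0..} w" "w 0 = 0"
  and x: "continuous_on {0..} x" "!!t. 0 <= t ==> x t = x 0 + integral {0..t} (%s. F *v x s) + SS *v b t"
  and z: "!!t. 0 <= t ==> z t = integral {0..t} (%s. H *v x s) + GG *v w t"
  and SS: "transpose SS = SS" and GG: "transpose GG = GG" and t: "0 <= t" and f: "continuous_on {0..t} f"
  and et: "!!s. s : {0..t} ==> (et has_vector_derivative - f s) (at s within {0..t})" "et t = 0"
  and q: "!!s. s : {0..t} ==> (q has_vector_derivative - (transpose F *v q s) - transpose H *v et s) (at s within {0..t})" "q t = 0"
 shows "(%n. (SUM i<n. (SS *v q (real i * t / n)) \<bullet> (b (real (Suc i) * t / n) - b (real i * t / n)))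
   + (SUM i<n. (GG *v et (real i * t / n)) \<bullet> (w (real (Suc i) * t / n) - w (real i * t / n))))
  ----> integral {0..t} (%u. f u \<bullet> z u) - q 0 \<bullet> x 0"
proof -
 note bc = continuous_Icc[OF b(1)] and wc = continuous_Icc[OF w(1)] and xc = continuous_Icc[OF x(1)]
 have qc: "continuous_on {0..t} q" by (rule derivative_continuous_on[OF q(1)])
 have etc: "continuous_on {0..t} et" by (rule derivative_continuous_on[OF et(1)])
 have S1: "(SS *v x) \<bullet> y = x \<bullet> (SS *v y)" for x y by (metis inner_matrix SS)
 have G1: "(GG *v x) \<bullet> y = x \<bullet> (GG *v y)" for x y by (metis inner_matrix GG)
 have T1: "(transpose A *v x) \<bullet> y = x \<bullet> (A *v y)" for A :: "real^'m^'n" and x y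
  by (simp add: inner_matrix)
 define N where "N u = integral {0..u} (%s. H *v x s)" for u
 have cHx: "continuous_on {0..} (%s. H *v x s)" and cFx: "continuous_on {0..} (%s. F *v x s)" by (intro continuous_intros x)+
 have Nc: "continuous_on {0..t} N" unfolding N_def by (rule continuous_Icc[OF continuous_on_integral_atLeast[OF cHx]])
 define al where "al u = SS *v (- (transpose F *v q u) - transpose H *v et u)" for u
 have alc: "continuous_on {0..t} al" unfolding al_def by (intro continuous_intros qc etc)
 have 1: "(%n. SUM i<n. (SS *v q (real i * t / n)) \<bullet> (b (real (Suc i) * t / n) - b (real i * t / n)))
  ----> (SS *v q t) \<bullet> b t - integral {0..t} (%u. al u \<bullet> b u)"
 proof (rule stieltjes_sum_tendsto_deriv[OF t bc b(2) _ alc])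
  show "((%s. SS *v q s) has_vector_derivative al s) (at s within {0..t})" if "s : {0..t}" for s
   using matrix_vector_derivative[OF has_vector_derivative_const[of SS] q(1)[OF that]]
   by (simp add: al_def)
 qed
 have 2: "(%n. SUM i<n. (GG *v et (real i * t / n)) \<bullet> (w (real (Suc i) * t / n) - w (real i * t / n)))
  ----> (GG *v et t) \<bullet> w t - integral {0..t} (%u. (GG *v (- f u)) \<bullet> w u)"
 proof (rule stieltjes_sum_tendsto_deriv[OF t wc w(2)])
  show "((%s. GG *v et s) has_vector_derivative GG *v (- f s)) (at s within {0..t})" if "s : {0..t}" for s
   using matrix_vector_derivative[OF has_vector_derivative_const[of GG] et(1)[OF that]] by simp
 qed (intro continuous_intros f)
 let ?Ph = "%u. q u \<bullet> (x u - SS *v b u) + et u \<bullet> N u"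
 have "((%u. - (al u \<bullet> b u) - f u \<bullet> N u) has_integral ?Ph t - ?Ph 0) {0..t}"
 proof (rule fundamental_theorem_of_calculus[OF t])
  fix u assume u: "u : {0..t}"
  have "(N has_vector_derivative H *v x u) (at u within {0..t})"
   using integral_derivative_atLeast[OF cHx, of u] u unfolding N_def
   by (auto intro: has_vector_derivative_within_subset)
  moreover have "((%t. x 0 + integral {0..t} (%s. F *v x s)) has_vector_derivative 0 + F *v x u) (at u within {0..})"
   by (intro has_vector_derivative_add has_vector_derivative_const integral_derivative_atLeast cFx) (use u in auto)
  hence d: "((%t. x 0 + integral {0..t} (%s. F *v x s)) has_vector_derivative F *v x u) (at u within {0..t})"
   by (auto intro: has_vector_derivative_within_subset)
  have "((%t. x t - SS *v b t) has_vector_derivative F *v x u) (at u within {0..t})"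
   by (rule has_vector_derivative_transform[OF u _ d]) (metis add_diff_cancel_right' atLeastAtMost_iff x(2))
  ultimately have "(?Ph has_vector_derivative (q u \<bullet> (F *v x u) + (- (transpose F *v q u) - transpose H *v et u) \<bullet> (x u - SS *v b u))
    + (et u \<bullet> (H *v x u) + (- f u) \<bullet> N u)) (at u within {0..t})"
   by (intro has_vector_derivative_add inner_derivative et(1) q(1) u)
  moreover have "(q u \<bullet> (F *v x u) + (- (transpose F *v q u) - transpose H *v et u) \<bullet> (x u - SS *v b u))
    + (et u \<bullet> (H *v x u) + (- f u) \<bullet> N u) = - (al u \<bullet> b u) - f u \<bullet> N u"
   by (simp add: al_def S1 T1 inner_diff_left inner_diff_right)
  ultimately show "(?Ph has_vector_derivative - (al u \<bullet> b u) - f u \<bullet> N u) (at u within {0..t})" by (simp only:)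
 qed
 from integral_unique[OF this] have "integral {0..t} (%u. - (al u \<bullet> b u) - f u \<bullet> N u) = - (q 0 \<bullet> x 0)"
  using q(2) et(2) b(2) by (simp add: N_def)
 moreover have i: "(%u. al u \<bullet> b u) integrable_on {0..t}" "(%u. f u \<bullet> N u) integrable_on {0..t}" "(%u. f u \<bullet> (GG *v w u)) integrable_on {0..t}"
  by (intro integrable_continuous_real continuous_intros alc bc f Nc wc)+
 have "integral {0..t} (%u. f u \<bullet> z u) = integral {0..t} (%u. f u \<bullet> N u + f u \<bullet> (GG *v w u))"
  by (rule Henstock_Kurzweil_Integration.integral_cong) (simp add: z N_def inner_add_right)
 moreover have "(GG *v (- f u)) \<bullet> w u = - (f u \<bullet> (GG *v w u))" for u by (simp add: G1)
 ultimately have "(SS *v q t) \<bullet> b t - integral {0..t} (%u. al u \<bullet> b u) + ((GG *v et t) \<bullet> w t - integral {0..t} (%u. (GG *v (- f u)) \<bullet> w u))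
  = integral {0..t} (%u. f u \<bullet> z u) - q 0 \<bullet> x 0"
  using q(2) et(2) Henstock_Kurzweil_Integration.integral_diff[OF integrable_neg[OF i(1)] i(2)]
   Henstock_Kurzweil_Integration.integral_add[OF i(2,3)] by simp
 with tendsto_add[OF 1 2] show ?thesis by (simp only:)
qed

end

text \<open>Setting a path to 0 outside an event of full measure makes every path continuous, so
  that pathwise constructions make sense, and can be shown to be measurable, at every sample
  point.\<close>

definition on_event :: "'a set => ('t => 'a => 'b::zero) => 't => 'a => 'b" where
 "on_event A Y t w = (if w : A then Y t w else 0)"

lemma measurable_on_event:
 assumes "subalgebra M G" "A : sets M" "AE w in M. w : A" "Y t : borel_measurable G"
 shows "on_event A Y t : borel_measurable (null_ext M G)"
proof -
 have "A \<inter> space (null_ext M G) : sets (null_ext M G)"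
  using sets_null_ext_AE[OF assms(1-3)] by blast
 moreover have "Y t : borel_measurable (null_ext M G)" by (rule measurable_null_ext_mono[OF assms(1,4)])
 ultimately show ?thesis unfolding on_event_def[abs_def] by (intro measurable_If_set) auto
qed

lemma on_event_continuous:
 assumes "!!w. w : A ==> continuous_on S (%s. Y s w)"
 shows "continuous_on S (%s. on_event A Y s w :: 'b::topological_monoid_add)"
 using assms by (cases "w : A") (auto simp: on_event_def)

lemma borel_measurable_matrix_vector:
 fixes f :: "'w => real^'n"
 assumes "f : borel_measurable G"
 shows "(%w. A *v f w) : borel_measurable G"
 by (rule borel_measurable_bounded_bilinear[OF bilinear_matrix_vector _ assms]) simp

lemma borel_measurable_sint:
 assumes K': "continuous_on {0..} K'" and t: "0 <= t"
  and v: "!!s. 0 <= s ==> s <= t ==> v s : borel_measurable G" "!!w. continuous_on {0..} (%s. v s w)"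
 shows "(%w. sint K K' (%s. v s w) t) : borel_measurable G"
 unfolding sint_def
proof (intro borel_measurable_diff borel_measurable_matrix_vector borel_measurable_integral_path t)
 show "continuous_on {0..t} (%s. K' s *v v s w)" for w
  by (intro continuous_intros continuous_Icc K' v(2))
qed (use t v(1) in auto)

context riccati_data
begin

lemma mean_path_measurable:
 assumes P: "riccati P" and t: "0 <= t"
  and v: "!!s. 0 <= s ==> s <= t ==> v s : borel_measurable G" "!!w. continuous_on {0..} (%s. v s w)"
 shows "(%w. mean_path P (%s. v s w) t) : borel_measurable G"
 unfolding mean_path_def
proof (rule borel_measurable_vsol[OF bilinear_matrix_vector t])
 note cont = riccati_continuous[OF P]
 show "(%w. sint (gain P) (gain' P) (%s. v s w) s) : borel_measurable G" if "s : {0..t}" for s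
  by (rule borel_measurable_sint[OF cont(5)]) (use that v in auto)
 show "continuous_on {0..t} (sint (gain P) (gain' P) (%s. v s w))" for w
  by (intro continuous_Icc sint_continuous cont v)
qed (auto intro: continuous_Icc riccati_continuous[OF P])

end

text \<open>The part common to the signal and to an ensemble member. \<open>Gs\<close> lists further
  sigma-algebras independent of the initial state and the noises: none for the signal, the
  observations for the ensemble. The path properties are required on one event \<open>Om\<close>,
  which both instances will share.\<close>

locale noise_model = prob_space M + riccati_data F \<Sigma> H \<Gamma>
 for M :: "'a measure" and F \<Sigma> :: "real^'d^'d" and H :: "real^'d^'k" and \<Gamma> :: "real^'k^'k" +
 fixes SS :: "real^'d^'d" and GG :: "real^'k^'k" and B X :: "real => 'a => real^'d" and W :: "real => 'a => real^'k"
  and Gs :: "'a measure list" and Om :: "'a set"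
 assumes SS: "is_psd_sqrt SS \<Sigma>" and GG: "is_psd_sqrt GG \<Gamma>"
  and B: "standard_BM M B" and W: "standard_BM M W" and X0: "X 0 : borel_measurable M"
  and ind: "mutually_indep M (proc_sigma M X {0} # proc_sigma M B {0..} # proc_sigma M W {0..} # Gs)"
  and sub: "!!G. G : set Gs ==> subalgebra M G"
  and Om: "Om : sets M" "AE w in M. w : Om"
  and B_path: "!!w. w : Om ==> continuous_on {0..} (%s. B s w)" "!!w. w : Om ==> B 0 w = 0"
  and W_path: "!!w. w : Om ==> continuous_on {0..} (%s. W s w)" "!!w. w : Om ==> W 0 w = 0"
begin

lemma SS_props: "transpose SS = SS" "SS ** SS = \<Sigma>" and GG_props: "transpose GG = GG" "GG ** GG = \<Gamma>"
 using SS GG by (auto simp: is_psd_sqrt_def)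

definition source :: "'a measure" where
 "source = sigma_join M [proc_sigma M X {0}, proc_sigma M B {0..}, proc_sigma M W {0..}]"

lemma sub_proc: "subalgebra M (proc_sigma M X {0})" "subalgebra M (proc_sigma M B {0..})" "subalgebra M (proc_sigma M W {0..})"
 by (rule subalgebra_proc_sigma; use X0 BM_measurable[OF B] BM_measurable[OF W] in auto)+

lemma sub_source: "subalgebra M source" "subalgebra source (proc_sigma M X {0})"
 "subalgebra source (proc_sigma M B {0..})" "subalgebra source (proc_sigma M W {0..})"
 unfolding source_def by (rule subalgebra_sigma_join subalgebra_sigma_join_member; use sub_proc in auto)+

lemma source_measurable:
 shows "X 0 : borel_measurable source" and "0 <= t ==> B t : borel_measurable source" and "0 <= t ==> W t : borel_measurable source"
 by (rule measurable_from_subalg[OF sub_source(2) measurable_proc_sigma] measurable_from_subalg[OF sub_source(3) measurable_proc_sigma]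
   measurable_from_subalg[OF sub_source(4) measurable_proc_sigma]; simp)+

lemma noise_path_on_event:
 "continuous_on {0..} (%s. on_event Om B s w)" "on_event Om B 0 w = 0"
 "continuous_on {0..} (%s. on_event Om W s w)" "on_event Om W 0 w = 0"
 using B_path W_path by (cases "w : Om"; simp add: on_event_def)+

definition noise :: "(real => real^'d^'d) => real => 'a => real^'d" where
 "noise P t w = noise_path P SS GG (%s. on_event Om B s w) (%s. on_event Om W s w) t"

lemma noise_measurable:
 assumes P: "riccati P" and t: "0 <= t"
 shows "noise P t : borel_measurable (null_ext M source)"
 unfolding noise_def[abs_def] noise_path_def
proof (rule borel_measurable_vsol[OF bilinear_matrix_vector t])
 note cont = riccati_continuous[OF P]
 have W': "continuous_on {0..} (%s. GG *v on_event Om W s w)" for w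
  by (intro continuous_intros noise_path_on_event)
 show "(%w. SS *v on_event Om B s w - sint (gain P) (gain' P) (%s. GG *v on_event Om W s w) s)
   : borel_measurable (null_ext M source)" if "s : {0..t}" for s
  by (intro borel_measurable_diff borel_measurable_matrix_vector borel_measurable_sint cont W'
    measurable_on_event sub_source Om source_measurable) (use that in auto)
 show "continuous_on {0..t} (%s. SS *v on_event Om B s w - sint (gain P) (gain' P) (%s. GG *v on_event Om W s w) s)" for w
  by (intro continuous_intros continuous_Icc[OF sint_continuous] continuous_Icc[OF noise_path_on_event(1)] cont W')
qed (auto intro: continuous_Icc riccati_continuous[OF P])

lemma noise_measurable_M: "riccati P ==> 0 <= t ==> noise P t : borel_measurable M"
 by (rule measurable_from_subalg[OF subalgebra_null_ext[OF sub_source(1)] noise_measurable])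

lemma noise_is_wiener:
 assumes P: "riccati P" and t: "0 <= t"
  and p: "!!s. s : {0..t} ==> (p has_vector_derivative - (transpose (drift P s) *v p s)) (at s within {0..t})"
 shows "is_wiener M (X 0) B W t 0 (%s. SS *v p s) (%s. - (GG *v (transpose (gain P s) *v p s))) (%w. p t \<bullet> noise P t w)"
 unfolding is_wiener_def using Om(2)
proof eventually_elim
 case (elim w)
 from noise_path_dual[OF P noise_path_on_event[of w] SS_props(1) GG_props(1) t p] elim
 show ?case unfolding wiener_sum_def noise_def by (simp add: on_event_def del: of_nat_Suc)
qed

lemma noise_continuous_coeffs:
 assumes P: "riccati P"
  and p: "!!s. s : {0..t} ==> (p has_vector_derivative - (transpose (drift P s) *v p s)) (at s within {0..t})"
 shows "continuous_on {0..t} (%s. SS *v p s)" "continuous_on {0..t} (%s. - (GG *v (transpose (gain P s) *v p s)))"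
proof -
 have pc: "continuous_on {0..t} p" by (rule derivative_continuous_on[OF p])
 show "continuous_on {0..t} (%s. SS *v p s)" "continuous_on {0..t} (%s. - (GG *v (transpose (gain P s) *v p s)))"
  by (intro continuous_intros pc continuous_Icc riccati_continuous[OF P])+
qed

lemma noise_cis_eq:
 assumes P: "riccati P" and t: "0 <= t"
  and p: "!!s. s : {0..t} ==> (p has_vector_derivative - (transpose (drift P s) *v p s)) (at s within {0..t})"
 shows "(LINT w|M. cis (p t \<bullet> noise P t w))
  = exp (- (integral {0..t} (%s. (norm (SS *v p s))^2 + (norm (- (GG *v (transpose (gain P s) *v p s))))^2) / 2))"
 using is_wiener_gaussian(1)[OF ind sub X0 B W t noise_is_wiener[OF P t p] _ noise_continuous_coeffs[OF P p], of 1]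
  noise_measurable_M[OF P t] by simp

lemma noise_diff_gaussian:
 assumes P: "riccati P" and Q: "riccati Q" and t: "0 <= t"
 shows "EX v>=0. ALL u. (LINT w|M. cis (u * (l \<bullet> (noise P t w - noise Q t w)))) = exp (- (u^2 * v / 2))"
proof -
 obtain p where p: "p t = l" "!!s. s : {0..t} ==> (p has_vector_derivative - (transpose (drift P s) *v p s)) (at s within {0..t})"
  using backward_solution_exists[OF P t] by blast
 obtain q where q: "q t = l" "!!s. s : {0..t} ==> (q has_vector_derivative - (transpose (drift Q s) *v q s)) (at s within {0..t})"
  using backward_solution_exists[OF Q t] by blast
 note W1 = noise_is_wiener[OF P t p(2)] and W2 = is_wiener_cmult[OF noise_is_wiener[OF Q t q(2)], of "-1"]
 have W3: "is_wiener M (X 0) B W t 0 (%s. SS *v p s + (-1) *\<^sub>R (SS *v q s))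
  (%s. - (GG *v (transpose (gain P s) *v p s)) + (-1) *\<^sub>R - (GG *v (transpose (gain Q s) *v q s))) (%w. l \<bullet> (noise P t w - noise Q t w))"
  using is_wiener_add[OF W1 W2] by (simp add: p(1) q(1) inner_diff_right)
 have m: "(%w. l \<bullet> (noise P t w - noise Q t w)) : borel_measurable M"
  by (intro borel_measurable_inner borel_measurable_const borel_measurable_diff noise_measurable_M P Q t)
 have c1: "continuous_on {0..t} (%s. SS *v p s + (-1) *\<^sub>R (SS *v q s))"
  by (intro continuous_intros noise_continuous_coeffs(1)[OF P p(2)] noise_continuous_coeffs(1)[OF Q q(2)])
 have c2: "continuous_on {0..t} (%s. - (GG *v (transpose (gain P s) *v p s)) + (-1) *\<^sub>R - (GG *v (transpose (gain Q s) *v q s)))"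
  by (intro continuous_on_add continuous_on_scaleR continuous_on_const noise_continuous_coeffs(2)[OF P p(2)] noise_continuous_coeffs(2)[OF Q q(2)])
 show ?thesis
  using is_wiener_gaussian[OF ind sub X0 B W t W3 m c1 c2] by blast
qed

lemma noise_diff_tendsto:
 assumes det: "c_detectable H F" and P: "riccati P" and Q: "riccati Q"
 shows "AE w in M. ((%t. noise P t w - noise Q t w) \<longlongrightarrow> 0) at_top"
proof -
 obtain c al c' al' where st: "exp_stable P c al" "exp_stable Q c' al'"
  using riccati_bounds(2)[OF det P] riccati_bounds(2)[OF det Q] by blast
 show ?thesis using Om(2) standard_BM_growth[OF B] standard_BM_growth[OF W]
 proof eventually_elim
  case (elim w)
  show ?case unfolding noise_def
   by (rule noise_path_diff_tendsto_0[OF Q riccati_bounds(1)[OF det Q] st(2) P riccati_bounds(1)[OF det P] st(1)])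
    (use noise_path_on_event[of w] elim in "auto simp: on_event_def")
 qed
qed

text \<open>Almost sure convergence to 0 makes the characteristic function at 1 tend to 1. For a
  centred Gaussian this forces the variance to 0, and with it the first absolute moment.\<close>

lemma noise_diff_mean_tendsto:
 assumes det: "c_detectable H F" and P: "riccati P" and Q: "riccati Q"
 shows "0 <= t ==> integrable M (%x. norm (noise P t x - noise Q t x))"
  and "((%t. LINT x|M. norm (noise P t x - noise Q t x)) \<longlongrightarrow> 0) at_top"
proof -
 define Y where "Y t i x = axis i 1 \<bullet> (noise P t x - noise Q t x)" for t i x
 have Ym: "Y t i : borel_measurable M" if "0 <= t" for t i
  unfolding Y_def[abs_def] by (intro borel_measurable_inner borel_measurable_const borel_measurable_diff noise_measurable_M P Q that)
 define v where "v t i = (SOME v. 0 <= v & (ALL u. (LINT x|M. cis (u * Y t i x)) = exp (- (u^2 * v / 2))))" for t i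
 have v: "0 <= v t i" "(LINT x|M. cis (u * Y t i x)) = exp (- (u^2 * v t i / 2))" if "0 <= t" for t i u
  using someI_ex[OF noise_diff_gaussian[OF P Q that, of "axis i 1", folded Y_def], folded v_def] by simp_all
 have mom: "integrable M (Y t i)" "!!dl. 0 < dl ==> (LINT x|M. \<bar>Y t i x\<bar>) <= dl + v t i / dl" if "0 <= t" for t i
  by (rule gaussian_first_moment(1)[OF Ym[OF that] v[OF that] zero_less_one], rule gaussian_first_moment(2)[OF Ym[OF that] v[OF that]])
 have le: "norm (noise P t x - noise Q t x) <= (SUM i:UNIV. \<bar>Y t i x\<bar>)" for t x
  using norm_le_l1_cart[of "noise P t x - noise Q t x"] by (simp add: Y_def inner_axis')
 have int: "integrable M (%x. SUM i:UNIV. \<bar>Y t i x\<bar>)" if "0 <= t" for t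
  using mom(1)[OF that] by auto
 show I: "integrable M (%x. norm (noise P t x - noise Q t x))" if "0 <= t" for t
  by (rule Bochner_Integration.integrable_bound[OF int[OF that]])
   (use le noise_measurable_M[OF P that] noise_measurable_M[OF Q that] in "auto intro!: AE_I2 order_trans[OF le]")
 have v0: "((%t. v t i) \<longlongrightarrow> 0) at_top" for i
 proof -
  have v1: "(LINT x|M. cis (1 * Y t i x)) = exp (- (1^2 * v t i / 2))" if "0 <= t" for t
   by (rule v(2)[OF that])
  \<comment> \<open>Measurability is known for nonnegative times only; \<open>max 0\<close> extends
    the family without changing its limit.\<close>
  define X where "X t x = cis (Y (max 0 t) i x)" for t x
  have "((%t. LINT x|M. X t x) \<longlongrightarrow> (LINT x|M. 1)) at_top"
  proof (rule integral_dominated_convergence_at_top[where w = "%_. 1"])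
   show "AE x in M. ((%t. X t x) \<longlongrightarrow> 1) at_top"
    using noise_diff_tendsto[OF det P Q]
   proof eventually_elim
    case (elim x)
    have "((%t. cis (Y t i x)) \<longlongrightarrow> cis (axis i 1 \<bullet> (0::real^'d))) at_top"
     unfolding Y_def by (intro tendsto_intros elim)
    moreover have "\<forall>\<^sub>F t in at_top. cis (Y t i x) = X t x"
     using eventually_ge_at_top[of 0] by eventually_elim (simp add: X_def max_def)
    ultimately show ?case by (auto dest: Lim_transform_eventually)
   qed
   show "\<forall>\<^sub>F t in at_top. AE x in M. norm (X t x) <= 1" by (simp add: X_def)
   show "X t : borel_measurable M" for t unfolding X_def[abs_def] by (intro borel_measurable_cis Ym) simp
  qed auto
  moreover have "\<forall>\<^sub>F t in at_top. (LINT x|M. X t x) = complex_of_real (exp (- v t i / 2))"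
   using eventually_ge_at_top[of 0] by eventually_elim (simp add: X_def max_def v1[simplified])
  ultimately have "((%t. complex_of_real (exp (- v t i / 2))) \<longlongrightarrow> 1) at_top"
   by (auto dest: Lim_transform_eventually simp: prob_space)
  from tendsto_Re[OF this] have "((%t. exp (- v t i / 2)) \<longlongrightarrow> 1) at_top" by simp
  hence "((%t. - 2 * ln (exp (- v t i / 2))) \<longlongrightarrow> - 2 * ln 1) at_top" by (intro tendsto_intros) auto
  thus ?thesis by simp
 qed
 show "((%t. LINT x|M. norm (noise P t x - noise Q t x)) \<longlongrightarrow> 0) at_top"
 proof (rule tendstoI)
  fix e :: real assume e: "0 < e"
  define dl where "dl = e / (2 * CARD('d))"
  have dl: "0 < dl" using e by (simp add: dl_def)
  have "((%t. SUM i:UNIV. (dl + v t i / dl)) \<longlongrightarrow> (SUM i:(UNIV::'d set). (dl + 0 / dl))) at_top"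
   using dl by (intro tendsto_intros v0) auto
  moreover have "(SUM i:(UNIV::'d set). (dl + 0 / dl)) < e" using e by (simp add: dl_def)
  ultimately have "\<forall>\<^sub>F t in at_top. (SUM i:UNIV. (dl + v t i / dl)) < e" by (rule order_tendstoD)
  thus "\<forall>\<^sub>F t in at_top. dist (LINT x|M. norm (noise P t x - noise Q t x)) 0 < e"
   using eventually_ge_at_top[of 0]
  proof eventually_elim
   case (elim t)
   have "(LINT x|M. norm (noise P t x - noise Q t x)) <= (LINT x|M. (SUM i:UNIV. \<bar>Y t i x\<bar>))"
    by (rule integral_mono[OF I int le]) (use elim in auto)
   also have "... = (SUM i:UNIV. (LINT x|M. \<bar>Y t i x\<bar>))"
    by (rule Bochner_Integration.integral_sum) (use mom(1)[OF elim(2)] in auto)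
   also have "... <= (SUM i:UNIV. (dl + v t i / dl))" by (intro sum_mono mom(2) elim dl)
   finally show ?case using elim(1) by simp
  qed
 qed
qed

end

section \<open>Conditional laws\<close>

locale cond_law = prob_space M for M :: "'a measure" +
 fixes G :: "'a measure" and X :: "'a => 'b::topological_space" and ka :: "'a => 'b measure"
 assumes subG: "subalgebra M G" and X [measurable]: "X : borel_measurable M"
  and ka: "ka : M \<rightarrow>\<^sub>M prob_algebra borel"
  and cond: "!!A. A : sets borel ==> AE w in M. measure (ka w) A = real_cond_exp M G (%w. indicator A (X w)) w"
begin

lemma kernel: "w : space M ==> prob_space (ka w)" "w : space M ==> sets (ka w) = sets borel"
 using measurable_space[OF ka] by (auto simp: space_prob_algebra)

lemma ka_subprob [measurable]: "ka : M \<rightarrow>\<^sub>M subprob_algebra borel"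
 by (rule measurable_prob_algebraD[OF ka])

lemma measure_kernel: "A : sets borel ==> (%w. measure (ka w) A) : borel_measurable M"
 using measurable_compose[OF ka_subprob measurable_measure_subprob_algebra] .

text \<open>The kernel evaluated at a fixed set agrees almost everywhere with a conditional
  expectation, which is measurable for \<open>G\<close>; this yields measurability for the null
  extension.\<close>

lemma measurable_kernel: "ka : null_ext M G \<rightarrow>\<^sub>M prob_algebra borel"
proof (intro measurable_prob_algebraI measurable_subprob_algebra)
 fix A :: "'b set" assume A: "A : sets borel"
 have "(%w. measure (ka w) A) : borel_measurable (null_ext M G)"
  by (rule measurable_null_extI[OF subG measure_kernel[OF A] _ cond[OF A]]) measurable
 hence "(%w. ennreal (measure (ka w) A)) : borel_measurable (null_ext M G)" by measurable
 moreover have "emeasure (ka w) A = ennreal (measure (ka w) A)" if "w : space (null_ext M G)" for w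
  using kernel(1)[of w] that by (intro finite_measure.emeasure_eq_measure prob_space.finite_measure) simp
 ultimately show "(%w. emeasure (ka w) A) : borel_measurable (null_ext M G)"
  by (subst measurable_cong) 
qed (use kernel in "auto intro: prob_space_imp_subprob_space")

lemma integral_kernel_measurable:
 fixes f :: "'b => 'c::{banach, second_countable_topology}"
 assumes "f : borel_measurable borel"
 shows "(%w. LINT x|ka w. f x) : borel_measurable (null_ext M G)"
 by (rule measurable_compose[OF measurable_prob_algebraD[OF measurable_kernel] integral_measurable_subprob_algebra[OF assms]])

text \<open>Disintegration: the joint law of the sample point, seen through the null extension, and
  of \<open>X\<close> is the restricted measure bound to the kernel. On rectangles this is the
  defining property of conditional expectation, and rectangles generate.\<close>

lemma integral_kernel:
 fixes F :: "'a \<times> 'b => real"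
 assumes F: "F : borel_measurable (null_ext M G \<Otimes>\<^sub>M borel)" and C: "!!z. \<bar>F z\<bar> <= C"
 shows "(LINT w|M. F (w, X w)) = (LINT w|M. (LINT x|ka w. F (w, x)))"
proof -
 interpret G: finite_measure_subalgebra M G by unfold_locales (rule subG)
 have sub: "subalgebra M (null_ext M G)" by (rule subalgebra_null_ext[OF subG])
 define R where "R = restr_to_subalg M (null_ext M G)"
 interpret R: prob_space R unfolding R_def by (rule prob_space_restr_to_subalg[OF sub prob_space_axioms])
 have sR [measurable_cong]: "sets R = sets (null_ext M G)" and spR: "space R = space M"
  by (simp_all add: R_def sets_restr_to_subalg[OF sub] space_restr_to_subalg)
 have [measurable]: "F : borel_measurable (R \<Otimes>\<^sub>M borel)" "ka : R \<rightarrow>\<^sub>M prob_algebra borel"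
  using F measurable_kernel by measurable
 have idR: "(%w. (w, X w)) : M \<rightarrow>\<^sub>M R \<Otimes>\<^sub>M borel"
  using sub by (intro measurable_Pair X) (auto intro!: measurableI simp: sR spR subalgebra_def)
 define K where "K = (%w. distr (ka w) (R \<Otimes>\<^sub>M borel) (Pair w))"
 have K: "K : R \<rightarrow>\<^sub>M prob_algebra (R \<Otimes>\<^sub>M borel)" unfolding K_def by measurable
 note Ks = measurable_prob_algebraD[OF K]
 have Pm: "Pair w : ka w \<rightarrow>\<^sub>M R \<Otimes>\<^sub>M borel" if "w : space M" for w
  using kernel(2)[OF that] that by (auto simp: spR cong: measurable_cong_sets)
 have "R \<bind> K = distr M (R \<Otimes>\<^sub>M borel) (%w. (w, X w))"
 proof (rule measure_eqI_generator_eq[OF Int_stable_pair_measure_generator, where A = "%_. space R \<times> space borel"])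
  let ?E = "{A \<times> B | A B. A : sets R & B : sets (borel :: 'b measure)}"
  show "?E <= Pow (space R \<times> space borel)" using sets.sets_into_space[of _ R] by auto
  show "sets (R \<bind> K) = sigma_sets (space R \<times> space borel) ?E"
   by (simp only: sets_bind_measurable[OF Ks R.not_empty] sets_pair_measure)
  show "sets (distr M (R \<Otimes>\<^sub>M borel) (%w. (w, X w))) = sigma_sets (space R \<times> space borel) ?E"
   by (simp only: sets_distr sets_pair_measure)
  show "emeasure (R \<bind> K) (space R \<times> space borel) ~= \<infinity>"
   using subprob_space.subprob_emeasure_le_1[OF subprob_space_bind[OF R.subprob_space_axioms Ks]]
   by (metis ennreal_one_less_top leD infinity_ennreal_def)
  fix Y assume "Y : ?E"
  then obtain D A where Y: "Y = D \<times> A" and DR[measurable]: "D : sets R" and A[measurable]: "A : sets borel" by auto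
  hence D: "D : sets (null_ext M G)" by (simp add: sR)
  obtain E where [measurable]: "D : sets M" "E : sets M" and E: "E : sets G" and DE: "AE w in M. w : D \<longleftrightarrow> w : E"
   using null_extE[OF subG D] by metis
  have mk[measurable]: "(%w. measure (ka w) A) : borel_measurable M" by (rule measure_kernel[OF A])
  have iX: "integrable M (%w. indicator A (X w) :: real)"
   by (intro integrable_const_bound[where B = 1]) (auto simp: indicator_def)
  have le1: "measure (ka w) A <= 1" if "w : space M" for w
   using prob_space.prob_le_1[OF kernel(1)[OF that]] .
  have "emeasure (R \<bind> K) Y = (\<integral>\<^sup>+w. emeasure (K w) Y \<partial>R)"
   by (rule emeasure_bind[OF R.not_empty Ks]) (simp add: Y)
  also have "... = (\<integral>\<^sup>+w. emeasure (K w) Y \<partial>M)"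
   unfolding R_def
  proof (rule nn_integral_subalgebra2[OF sub])
   have "(%w. emeasure (K w) Y) : borel_measurable R"
    by (rule measurable_compose[OF Ks measurable_emeasure_subprob_algebra]) (simp add: Y)
   thus "(%w. emeasure (K w) Y) : borel_measurable (null_ext M G)" by (simp add: sR cong: measurable_cong_sets)
  qed
  also have "... = (\<integral>\<^sup>+w. ennreal (indicator E w * measure (ka w) A) \<partial>M)"
  proof (rule nn_integral_cong_AE, use DE AE_space in eventually_elim)
   case (elim w)
   have "Pair w -` Y \<inter> space (ka w) = (if w : E then A else {})"
    using elim sets.sets_into_space[OF A] sets_eq_imp_space_eq[OF kernel(2)[OF elim(2)]] by (auto simp: Y)
   thus ?case unfolding K_def
    using elim kernel[OF elim(2)] by (subst emeasure_distr[OF Pm])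
     (auto simp: Y intro!: finite_measure.emeasure_eq_measure prob_space.finite_measure)
  qed
  also have "... = ennreal (LINT w|M. indicator E w * measure (ka w) A)"
   by (intro nn_integral_eq_integral integrable_const_bound[where B = 1]) (use le1 in "auto simp: indicator_def")
  also have "(LINT w|M. indicator E w * measure (ka w) A) = (LINT w|M. indicator E w * real_cond_exp M G (%w. indicator A (X w)) w)"
   by (intro integral_cong_AE borel_measurable_times borel_measurable_indicator mk borel_measurable_cond_exp2)
    (use cond[OF A] in auto)
  also have "... = (LINT w|M. indicator E w * indicator A (X w))"
   using G.real_cond_exp_intA[OF iX E] by (simp add: set_lebesgue_integral_def)
  also have "... = (LINT w|M. indicator ((%w. (w, X w)) -` Y \<inter> space M) w)"
  proof (rule integral_cong_AE)
   show "AE w in M. indicator E w * indicator A (X w) = indicat_real ((%w. (w, X w)) -` Y \<inter> space M) w"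
    using DE AE_space by eventually_elim (auto simp: Y indicator_def)
   show "indicat_real ((%w. (w, X w)) -` Y \<inter> space M) : borel_measurable M"
    using measurable_sets[OF idR, of Y] by (simp add: Y)
  qed measurable
  also have "ennreal ... = emeasure (distr M (R \<Otimes>\<^sub>M borel) (%w. (w, X w))) Y"
   using idR by (subst emeasure_distr) (auto simp: Y emeasure_eq_measure)
  finally show "emeasure (R \<bind> K) Y = emeasure (distr M (R \<Otimes>\<^sub>M borel) (%w. (w, X w))) Y" .
 qed (use sets.top[of R] sets.top[of "borel :: 'b measure"] in blast)+
 hence "(LINT w|M. F (w, X w)) = (LINT z|(R \<bind> K). F z)"
  using idR by (simp add: integral_distr)
 also have "... = (LINT w|R. (LINT z|K w. F z))"
  by (rule integral_bind[OF _ _ Ks R.finite_measure_axioms, where B = C and B' = 1])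
   (use C in "auto simp: subprob_space.subprob_emeasure_le_1[OF subprob_space_kernel[OF Ks]]")
 also have "... = (LINT w|M. (LINT z|K w. F z))"
  unfolding R_def
 proof (rule integral_subalgebra2[OF sub])
  have "(%w. LINT z|K w. F z) : borel_measurable R"
   by (rule measurable_compose[OF Ks integral_measurable_subprob_algebra]) measurable
  thus "(%w. LINT z|K w. F z) : borel_measurable (null_ext M G)" by (simp add: sR cong: measurable_cong_sets)
 qed
 also have "... = (LINT w|M. (LINT x|ka w. F (w, x)))"
  by (rule Bochner_Integration.integral_cong) (simp_all add: K_def integral_distr Pm)
 finally show ?thesis .
qed

lemma kernel_bounded:
 fixes f :: "'b => real"
 assumes w: "w : space M" and f: "f : borel_measurable borel" and C: "!!x. \<bar>f x\<bar> <= C"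
 shows "\<bar>\<integral>x. f x \<partial>ka w\<bar> <= C"
proof -
 interpret K: prob_space "ka w" by (rule kernel(1)[OF w])
 have "integrable (ka w) f"
  by (rule K.integrable_const_bound[where B = C]) (use C kernel(2)[OF w] f in "auto cong: measurable_cong_sets")
 hence "(LINT x|ka w. \<bar>f x\<bar>) <= (LINT x|ka w. C)" using C by (intro integral_mono) auto
 also have "... = C" by (simp add: K.prob_space)
 finally show ?thesis by (rule order_trans[OF integral_abs_bound])
qed

end

lemma conditional_law_process_cond_law:
 assumes "prob_space M" "conditional_law_process M X Z \<pi>" "!!t. 0 <= t ==> Z t : borel_measurable M"
  "0 <= t" "X t : borel_measurable M"
 shows "cond_law M (proc_sigma M Z {0..t}) (X t) (\<pi> t)"
proof -
 interpret prob_space M by fact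
 show ?thesis
  by unfold_locales (use assms in "auto simp: conditional_law_process_def intro: subalgebra_proc_sigma")
qed

section \<open>The optimal filter\<close>

lemma sets_proc_sigma_le:
 assumes "space G = space M" "!!t. t : T ==> Y t : borel_measurable G"
 shows "sets (proc_sigma M Y T) <= sets G"
 unfolding sets_proc_sigma assms(1)[symmetric]
 by (rule sets.sigma_sets_subset) (use assms(2) in "auto intro: measurable_sets")

locale filter_model = noise_model M F \<Sigma> H \<Gamma> SS GG B X W "[]" Om
 for M :: "'a measure" and F \<Sigma> :: "real^'d^'d" and H :: "real^'d^'k" and \<Gamma> :: "real^'k^'k"
  and SS :: "real^'d^'d" and GG :: "real^'k^'k" and B X :: "real => 'a => real^'d" and W :: "real => 'a => real^'k"
  and Om :: "'a set" +
 fixes Z :: "real => 'a => real^'k"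
 assumes Z: "!!t. 0 <= t ==> Z t : borel_measurable M"
  and X_path: "!!w. w : Om ==> continuous_on {0..} (%s. X s w)"
   "!!w t. w : Om ==> 0 <= t ==> X t w = X 0 w + integral {0..t} (%s. F *v X s w) + SS *v B t w"
  and Z_path: "!!w t. w : Om ==> 0 <= t ==> Z t w = integral {0..t} (%s. H *v X s w) + GG *v W t w"
begin

lemma Z_continuous: "continuous_on {0..} (%s. on_event Om Z s w)"
proof (rule on_event_continuous)
 fix w assume w: "w : Om"
 have "continuous_on {0..} (%t. integral {0..t} (%s. H *v X s w) + GG *v W t w)"
  by (intro continuous_intros continuous_on_integral_atLeast X_path W_path w)
 thus "continuous_on {0..} (%t. Z t w)" by (rule continuous_on_eq) (simp add: Z_path[OF w])
qed

definition filter_mean :: "(real => real^'d^'d) => real => 'a => real^'d" where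
 "filter_mean P t w = mean_path P (%s. on_event Om Z s w) t"

lemma sub_Z: "subalgebra M (proc_sigma M Z {0..t})"
 by (rule subalgebra_proc_sigma) (use Z in auto)

lemma Z_measurable:
 assumes "0 <= s" "s <= t"
 shows "on_event Om Z s : borel_measurable (null_ext M (proc_sigma M Z {0..t}))"
 by (rule measurable_on_event[OF sub_Z Om measurable_proc_sigma]) (use assms in auto)

lemma filter_mean_measurable:
 assumes "riccati P" "0 <= t"
 shows "filter_mean P t : borel_measurable (null_ext M (proc_sigma M Z {0..t}))"
 unfolding filter_mean_def[abs_def] by (intro mean_path_measurable assms Z_measurable Z_continuous)

text \<open>The signal satisfies the filter equation for every Riccati solution \<open>P\<close>,
  because the correction H X dt + GG dW - dZ formed with its own noise vanishes. It is used with
  \<open>R\<close> and with \<open>C\<close>.\<close>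

lemma signal_decomposition:
 assumes P: "riccati P" and w: "w : Om" and t: "0 <= t"
 shows "X t w = flow P t (X 0 w) + filter_mean P t w + noise P t w"
proof -
 have 1: "sint (gain P) (gain' P) (%t. integral {0..t} (%s. H *v X s w) + GG *v on_event Om W t w - on_event Om Z t w) t = 0"
  if "0 <= t" for t
 proof -
  have 0: "integral {0..s} (%s. H *v X s w) + GG *v on_event Om W s w - on_event Om Z s w = 0" if "s : {0..t}" for s
   using that w Z_path[OF w, of s] by (simp add: on_event_def)
  have "integral {0..t} (%s. gain' P s *v (integral {0..s} (%s. H *v X s w) + GG *v on_event Om W s w - on_event Om Z s w)) = integral {0..t} (%s. 0)"
   by (rule Henstock_Kurzweil_Integration.integral_cong) (simp only: 0 matrix_vector_mult_0_right)
  thus ?thesis using that 0[of t] unfolding sint_def by simp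
 qed
 show ?thesis
  unfolding filter_mean_def noise_def
 proof (rule path_decomposition[OF P noise_path_on_event[of w] Z_continuous X_path(1)[OF w] _ t])
  fix t :: real assume t: "0 <= t"
  show "X t w = X 0 w + integral {0..t} (%s. F *v X s w) + SS *v on_event Om B t w
    - sint (gain P) (gain' P) (%t. integral {0..t} (%s. H *v X s w) + GG *v on_event Om W t w - on_event Om Z t w) t"
   unfolding 1[OF t] using X_path(2)[OF w t] w by (simp only: on_event_def if_True diff_0_right)
 qed
qed

definition past :: "real => 'a measure" where
 "past t = sigma_join M [proc_sigma M X {0}, proc_sigma M Z {0..t}]"

lemma sub_past: "subalgebra M (past t)" "subalgebra (past t) (proc_sigma M X {0})" "subalgebra (past t) (proc_sigma M Z {0..t})"
 unfolding past_def by (rule subalgebra_sigma_join subalgebra_sigma_join_member; use sub_Z sub_proc(1) in auto)+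

text \<open>Time integrals of the observations are used instead of their values because the dual
  integrands are then differentiable; the values are recovered later by differentiation.\<close>

definition obs_functional :: "real => (real^'d) \<times> (real => real^'k) => 'a => real" where
 "obs_functional t j w = fst j \<bullet> on_event Om X 0 w + integral {0..t} (%u. snd j u \<bullet> on_event Om Z u w)"

definition obs_wiener :: "real => ('a => real) => bool" where
 "obs_wiener t Y \<longleftrightarrow> (EX r q et. continuous_on {0..t} et & q t = 0 &
  (ALL s:{0..t}. (q has_vector_derivative - (transpose F *v q s) - transpose H *v et s) (at s within {0..t})) &
  is_wiener M (X 0) B W t r (%s. SS *v q s) (%s. GG *v et s) Y)"

lemma obs_wiener_functional:
 assumes t: "0 <= t" and f: "continuous_on {0..t} f"
 shows "obs_wiener t (obs_functional t (r, f))"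
proof -
 define et where "et u = integral {0..t} f - integral {0..u} f" for u
 have et': "(et has_vector_derivative - f s) (at s within {0..t})" if "s : {0..t}" for s
  using has_vector_derivative_diff[OF has_vector_derivative_const integral_has_vector_derivative[OF f that]]
  unfolding et_def[abs_def] by simp
 have et: "continuous_on {0..t} et" by (rule derivative_continuous_on[OF et'])
 have ett: "et t = 0" by (simp add: et_def)
 obtain q where q: "q t = 0" "!!s. s : {0..t} ==> (q has_vector_derivative - (transpose F *v q s) - transpose H *v et s) (at s within {0..t})"
  using observation_dual_exists[OF et t] by blast
 have "is_wiener M (X 0) B W t (r + q 0) (%s. SS *v q s) (%s. GG *v et s) (obs_functional t (r, f))"
  unfolding is_wiener_def using Om(2)
 proof eventually_elim
  case (elim w)
  note d = observation_dual[OF B_path[OF elim] W_path[OF elim] X_path[OF elim] Z_path[OF elim] SS_props(1) GG_props(1) t f et' ett q(2,1)]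
  from tendsto_add[OF tendsto_const d, of "(r + q 0) \<bullet> X 0 w"] elim
  show ?case unfolding wiener_sum_def
   by (simp add: obs_functional_def on_event_def inner_add_left del: of_nat_Suc)
 qed
 thus ?thesis unfolding obs_wiener_def using q et by blast
qed

lemma obs_wiener_add_cmult:
 assumes "obs_wiener t Y" "obs_wiener t Y'"
 shows "obs_wiener t (%w. Y w + v * Y' w)"
proof -
 obtain r q et where 1: "continuous_on {0..t} et" "q t = 0"
  "!!s. s:{0..t} ==> (q has_vector_derivative - (transpose F *v q s) - transpose H *v et s) (at s within {0..t})"
  "is_wiener M (X 0) B W t r (%s. SS *v q s) (%s. GG *v et s) Y"
  using assms(1) unfolding obs_wiener_def by blast
 obtain r' q' et' where 2: "continuous_on {0..t} et'" "q' t = 0"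
  "!!s. s:{0..t} ==> (q' has_vector_derivative - (transpose F *v q' s) - transpose H *v et' s) (at s within {0..t})"
  "is_wiener M (X 0) B W t r' (%s. SS *v q' s) (%s. GG *v et' s) Y'"
  using assms(2) unfolding obs_wiener_def by blast
 have "continuous_on {0..t} (%s. et s + v *\<^sub>R et' s)" by (intro continuous_intros 1 2)
 moreover have "q t + v *\<^sub>R q' t = 0" using 1 2 by simp
 moreover have "((%s. q s + v *\<^sub>R q' s) has_vector_derivative
   - (transpose F *v (q s + v *\<^sub>R q' s)) - transpose H *v (et s + v *\<^sub>R et' s)) (at s within {0..t})" if s: "s : {0..t}" for s
  using has_vector_derivative_add[OF 1(3)[OF s] bounded_linear.has_vector_derivative[OF bounded_linear_scaleR_right 2(3)[OF s], of v]]
  by (simp add: matrix_vector_right_distrib matrix_vector_mult_scaleR scaleR_diff_right algebra_simps)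
 moreover have "is_wiener M (X 0) B W t (r + v *\<^sub>R r') (%s. SS *v (q s + v *\<^sub>R q' s)) (%s. GG *v (et s + v *\<^sub>R et' s)) (%w. Y w + v * Y' w)"
  using is_wiener_add[OF 1(4) is_wiener_cmult[OF 2(4), of v]]
  by (simp add: matrix_vector_right_distrib matrix_vector_mult_scaleR)
 ultimately show ?thesis unfolding obs_wiener_def by (intro exI conjI ballI)
qed

lemma obs_wiener_sum:
 fixes n :: nat
 assumes "0 <= t" "!!j. j < n ==> obs_wiener t (Y j)"
 shows "obs_wiener t (%w. SUM j<n. v j * Y j w)"
 using assms(2)
proof (induction n)
 case 0
 have "obs_wiener t (%w. obs_functional t (0, %_. 0) w + (-1) * obs_functional t (0, %_. 0) w)"
  by (intro obs_wiener_add_cmult obs_wiener_functional) (use assms(1) in auto)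
 thus ?case by simp
next
 case (Suc n)
 thus ?case using obs_wiener_add_cmult[of t "%w. SUM j<n. v j * Y j w" "Y n" "v n"] by simp
qed

lemma obs_wiener_indep:
 assumes R: "riccati R" "R 0 = 0" and t: "0 <= t" and Y: "obs_wiener t Y" "Y : borel_measurable M"
 shows "(LINT w|M. cis (l \<bullet> noise R t w) * cis (Y w)) = (LINT w|M. cis (l \<bullet> noise R t w)) * (LINT w|M. cis (Y w))"
proof -
 obtain p where p: "p t = l" "!!s. s : {0..t} ==> (p has_vector_derivative - (transpose (drift R s) *v p s)) (at s within {0..t})"
  using backward_solution_exists[OF R(1) t] by blast
 obtain r q et where q: "continuous_on {0..t} et" "q t = 0"
  "!!s. s:{0..t} ==> (q has_vector_derivative - (transpose F *v q s) - transpose H *v et s) (at s within {0..t})"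
  "is_wiener M (X 0) B W t r (%s. SS *v q s) (%s. GG *v et s) Y"
  using Y(1) unfolding obs_wiener_def by blast
 have m: "(%w. l \<bullet> noise R t w) : borel_measurable M"
  by (intro borel_measurable_inner borel_measurable_const noise_measurable_M R t)
 show ?thesis
  by (rule is_wiener_orthogonal[OF ind sub X0 B W t q(4) Y(2) noise_is_wiener[OF R(1) t p(2), unfolded p(1)] m
   dual_orthogonal[OF R t SS_props GG_props p(2) q(3,2,1)]])
qed

lemma obs_functional_measurable:
 assumes "0 <= t" "continuous_on {0..t} (snd j)" shows "obs_functional t j : borel_measurable M"
proof -
 have e: "on_event Om Y s : borel_measurable M" if "Y s : borel_measurable M" for Y :: "real => 'a => real^'x" and s
  using that Om(1) unfolding on_event_def[abs_def] by measurable
 show ?thesis unfolding obs_functional_def[abs_def]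
  by (intro borel_measurable_add borel_measurable_inner borel_measurable_const borel_measurable_integral_path assms e X0 Z)
   (auto intro!: continuous_intros continuous_Icc[OF Z_continuous] assms)
qed

text \<open>Orthogonality of the integrands factorizes the joint characteristic functions, which
  gives independence of the sigma-algebras generated by the linear functionals. It remains to see
  that, up to null sets, the observation functionals generate the whole past.\<close>

theorem noise_indep_past:
 assumes R: "riccati R" "R 0 = 0" and t: "0 <= t"
 obtains N where "subalgebra M N" "noise R t : borel_measurable N" "indep_set (sets N) (sets (null_ext M (past t)))"
proof -
 define J where "J = {j :: (real^'d) \<times> (real => real^'k). continuous_on {0..t} (snd j)}"
 define gX where "gX = {(%w. l \<bullet> noise R t w) -` A \<inter> space M | l A. l : UNIV & A : sets borel}"
 define gY where "gY = {obs_functional t j -` A \<inter> space M | j A. j : J & A : sets borel}"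
 have nm: "(%w. l \<bullet> noise R t w) : borel_measurable M" for l
  by (intro borel_measurable_inner borel_measurable_const noise_measurable_M R t)
 have om: "obs_functional t j : borel_measurable M" if "j : J" for j
  by (rule obs_functional_measurable) (use that t in "auto simp: J_def")
 have ind: "indep_set (sigma_sets (space M) gX) (sigma_sets (space M) gY)"
  unfolding gX_def gY_def
 proof (rule indep_set_cis[OF nm om])
  fix n m :: nat and xs :: "nat => real^'d" and ys u v assume ys: "!!j. j < m ==> ys j : J"
  have s: "(SUM j<n. u j * (xs j \<bullet> noise R t w)) = (SUM j<n. u j *\<^sub>R xs j) \<bullet> noise R t w" for w
   by (simp add: inner_sum_left)
  have "obs_wiener t (obs_functional t (ys j))" if "j < m" for j
   using obs_wiener_functional[OF t, of "snd (ys j)" "fst (ys j)"] ys[OF that] by (simp add: J_def)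
  thus "(LINT w|M. cis (SUM j<n. u j * (xs j \<bullet> noise R t w)) * cis (SUM j<m. v j * obs_functional t (ys j) w))
   = (LINT w|M. cis (SUM j<n. u j * (xs j \<bullet> noise R t w))) * (LINT w|M. cis (SUM j<m. v j * obs_functional t (ys j) w))"
   unfolding s
   by (intro obs_wiener_indep[OF R t] obs_wiener_sum[OF t] borel_measurable_sum borel_measurable_times borel_measurable_const om ys) auto
 qed auto
 define N where "N = sigma (space M) gX"
 define Y where "Y = sigma (space M) gY"
 have sX: "gX <= sets M" "gX <= Pow (space M)" and sY: "gY <= sets M" "gY <= Pow (space M)"
  using nm om by (auto simp: gX_def gY_def intro: measurable_sets)
 have N: "sets N = sigma_sets (space M) gX" "space N = space M" and Y: "sets Y = sigma_sets (space M) gY" "space Y = space M"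
  using sX sY by (simp_all add: N_def Y_def)
 have subN: "subalgebra M N" and subY: "subalgebra M Y"
  using sX(1) sY(1) by (auto simp: subalgebra_def N Y intro: sets.sigma_sets_subset[THEN subsetD])
 have lN: "(%w. l \<bullet> noise R t w) : borel_measurable N" for l
  by (rule measurableI) (auto simp: N gX_def intro!: sigma_sets.Basic)
 have noiseN: "noise R t : borel_measurable N"
  by (rule borel_measurable_euclidean_space[THEN iffD2]) (use lN in "simp add: inner_commute")
 have oY: "obs_functional t j : borel_measurable Y" if "j : J" for j
 proof (rule measurableI)
  fix A :: "real set" assume "A : sets borel"
  hence "obs_functional t j -` A \<inter> space M : gY" using that unfolding gY_def by blast
  thus "obs_functional t j -` A \<inter> space Y : sets Y" by (simp add: Y sigma_sets.Basic)
 qed simp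
 have "(%w. l \<bullet> on_event Om X 0 w) : borel_measurable Y" for l
  using oY[of "(l, %_. 0)"] by (simp add: J_def obs_functional_def[abs_def])
 hence "on_event Om X 0 : borel_measurable Y"
  by (intro borel_measurable_euclidean_space[THEN iffD2]) (simp add: inner_commute)
 moreover have "AE w in M. X 0 w = on_event Om X 0 w" using Om(2) by eventually_elim (simp add: on_event_def)
 ultimately have XY: "X 0 : borel_measurable (null_ext M Y)"
  using measurable_null_extI[OF subY X0] by blast
 have KY: "(%w. integral {0..s} (%u. l \<bullet> on_event Om Z u w)) : borel_measurable Y" if s: "s : {0..t}" for l s
 proof (rule borel_measurable_LIMSEQ_real)
  \<comment> \<open>Continuous cut-offs that decrease to the indicator of \<open>{0..s}\<close>,
    times \<open>l\<close>.\<close>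
  define f where "f n u = max 0 (1 - real n * max 0 (u - s)) *\<^sub>R l" for n u
  have f: "continuous_on A (f n)" for A n unfolding f_def by (intro continuous_intros)
  show "obs_functional t (0, f n) : borel_measurable Y" for n by (rule oY) (simp add: J_def f)
  fix w
  let ?z = "%u. l \<bullet> on_event Om Z u w"
  note Zc = continuous_Icc[OF Z_continuous]
  have "(%n. integral {0..t} (%u. f n u \<bullet> on_event Om Z u w)) ----> integral {0..t} (%u. if u : {0..s} then ?z u else 0)"
  proof (rule dominated_convergence(2)[where h = "%u. \<bar>?z u\<bar>"])
   show "(%n. f n u \<bullet> on_event Om Z u w) ----> (if u : {0..s} then ?z u else 0)" if u: "u : {0..t}" for u
   proof (cases "u <= s")
    case False
    obtain m :: nat where m: "1 / (u - s) < m" using reals_Archimedean2 by blast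
    have "f n u = 0" if "m <= n" for n
    proof -
     have "1 / (u - s) < real n" using m that by linarith
     thus ?thesis using False by (simp add: f_def field_simps)
    qed
    thus ?thesis using False by (intro tendsto_eventually eventually_sequentiallyI[of m]) simp
   qed (use u in "simp add: f_def")
   show "norm (f n u \<bullet> on_event Om Z u w) <= \<bar>?z u\<bar>" for n u
    by (simp add: f_def abs_mult mult_left_le_one_le)
  qed (intro integrable_continuous_real continuous_intros f Zc)+
  moreover have "min s t = s" using s by simp
  ultimately show "(%n. obs_functional t (0, f n) w) ----> integral {0..s} ?z"
   by (simp add: obs_functional_def integral_restrict_Int del: atLeastAtMost_iff)
 qed
 have lZ: "(%w. l \<bullet> on_event Om Z s w) : borel_measurable Y" if s: "0 < s" "s <= t" for l s
 proof (rule borel_measurable_LIMSEQ_real)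
  \<comment> \<open>The difference quotients are taken from the left, so that \<open>s = t\<close>
    is covered as well; time 0 is treated separately, since \<open>Z\<close> vanishes there on
    \<open>Om\<close>.\<close>
  define sn where "sn n = s - s / real (Suc n)" for n
  have sn: "0 <= sn n" "sn n < s" for n using s by (auto simp: sn_def field_simps)
  have "sn ----> s - 0" unfolding sn_def by (intro tendsto_intros LIMSEQ_Suc lim_const_over_n)
  hence fl: "filterlim sn (at s within {0..}) sequentially"
   using sn by (auto simp: filterlim_at less_imp_neq)
  let ?K = "%s w. integral {0..s} (%u. l \<bullet> on_event Om Z u w)"
  show "(%n. (?K (sn n) w - ?K s w) /\<^sub>R (sn n - s)) ----> l \<bullet> on_event Om Z s w" for w
   using integral_derivative_atLeast[OF continuous_on_inner[OF continuous_on_const Z_continuous], of s] s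
   by (intro filterlim_compose[OF _ fl]) (simp add: has_vector_derivative_slope)
  show "(%w. (?K (sn n) w - ?K s w) /\<^sub>R (sn n - s)) : borel_measurable Y" for n
   by (intro borel_measurable_scaleR borel_measurable_diff borel_measurable_const KY)
    (use s sn[of n] in "auto intro: order_trans[OF less_imp_le]")
 qed
 have ZY: "Z s : borel_measurable (null_ext M Y)" if s: "s : {0..t}" for s
 proof -
  have "on_event Om Z s : borel_measurable Y"
  proof (cases "s = 0")
   case True
   have "on_event Om Z s = (%w. 0)" using Z_path[of _ 0] W_path(2) True by (auto simp: on_event_def fun_eq_iff)
   thus ?thesis by simp
  next
   case False
   thus ?thesis using lZ[of s] s
    by (intro borel_measurable_euclidean_space[THEN iffD2]) (simp add: inner_commute)
  qed
  moreover have "AE w in M. Z s w = on_event Om Z s w" using Om(2) by eventually_elim (simp add: on_event_def)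
  ultimately show ?thesis using measurable_null_extI[OF subY Z] s by auto
 qed
 have "(\<Union>G\<in>set [proc_sigma M X {0}, proc_sigma M Z {0..t}]. sets G) <= sets (null_ext M Y)"
  using sets_proc_sigma_le[of "null_ext M Y" M "{0}" X] sets_proc_sigma_le[of "null_ext M Y" M "{0..t}" Z] XY ZY by auto
 hence "sets (past t) <= sets (null_ext M Y)"
  using sets.sigma_sets_subset[of _ "null_ext M Y"] sub_Z[of t] sub_proc(1)
  unfolding past_def by (subst sets_sigma_join) auto
 hence pY: "sets (null_ext M (past t)) <= sets (null_ext M Y)" by (rule null_ext_least[OF sub_past(1) subY])
 have "indep_set (sets (null_ext M N)) (sets (null_ext M Y))"
  by (rule indep_set_null_ext[OF _ subN subY]) (use ind N Y in simp)
 hence "indep_set (sets N) (sets (null_ext M (past t)))"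
  by (rule indep_set_mono[OF _ _ pY]) (use sets_subset_null_ext[OF subN] in auto)
 with subN noiseN show thesis by (rule that)
qed

end

section \<open>Conditional expectations under independent shifts\<close>

lemma (in prob_space) indep_set_sym:
 assumes "indep_set A B" shows "indep_set B A"
proof -
 have "A <= events" "B <= events" and AB: "!!a b. a : A ==> b : B ==> prob (a \<inter> b) = prob a * prob b"
  using assms unfolding indep_sets2_eq by auto
 moreover have "prob (b \<inter> a) = prob b * prob a" if "a : A" "b : B" for a b
  using AB[OF that] by (simp only: Int_commute mult.commute)
 ultimately show ?thesis unfolding indep_sets2_eq by blast
qed

text \<open>Freezing: given \<open>G\<close> the first argument is known, while the second is
  independent of \<open>G\<close> and is integrated out.\<close>

lemma (in prob_space) cond_exp_indep:
 fixes f :: "'a \<times> 'a => real"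
 assumes G: "subalgebra M G" and N: "subalgebra M N" "indep_set (sets G) (sets N)"
  and f: "f : borel_measurable (G \<Otimes>\<^sub>M N)" "!!z. \<bar>f z\<bar> <= C"
  and fM: "(%w. f (w, w)) : borel_measurable M"
 shows "AE w in M. real_cond_exp M G (%w. f (w, w)) w = (LINT w'|M. f (w, w'))"
proof -
 interpret G: finite_measure_subalgebra M G by unfold_locales (rule G)
 have s: "(LINT w|M. g (w, w)) = (LINT w|M. (LINT w'|M. g (w, w')))" "(%w. LINT w'|M. g (w, w')) : borel_measurable G"
  if "g : borel_measurable (G \<Otimes>\<^sub>M N)" "!!z. \<bar>g z\<bar> <= C" for g :: "'a \<times> 'a => real"
  using indep_set_integral_split[OF G N(1) N(2) that(1), of C] that(2) by auto
 show ?thesis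
 proof (rule G.real_cond_exp_charact)
  fix A assume A: "A : sets G"
  have "(%z. indicator A (fst z) * f z) : borel_measurable (G \<Otimes>\<^sub>M N)" using f(1) A by measurable
  moreover have "\<bar>indicator A (fst z) * f z\<bar> <= C" for z
   using f(2)[of z] order_trans[OF abs_ge_zero f(2)] by (simp add: indicator_def)
  ultimately show "(LINT w:A|M. f (w, w)) = (LINT w:A|M. (LINT w'|M. f (w, w')))"
   using s(1)[of "%z. indicator A (fst z) * f z"] by (simp add: set_lebesgue_integral_def)
 next
  have "\<bar>\<integral>w'. f (w, w') \<partial>M\<bar> <= C" for w
  proof (rule order_trans[OF integral_abs_bound])
   show "(LINT w'|M. \<bar>f (w, w')\<bar>) <= C"
   proof (cases "integrable M (%w'. \<bar>f (w, w')\<bar>)")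
    \<comment> \<open>The integral of a function that is not integrable is 0 by convention, which
      satisfies the bound too.\<close>
    case False
    thus ?thesis using order_trans[OF abs_ge_zero f(2)] by (simp add: not_integrable_integral_eq)
   qed (use f(2) in "auto intro: integral_le_const")
  qed
  thus "integrable M (%w. LINT w'|M. f (w, w'))"
   by (intro integrable_const_bound[where B = C] measurable_from_subalg[OF G s(2)] f) auto
 qed (use s(2)[OF f] f(2) fM in "auto intro!: integrable_const_bound[where B = C]")
qed

context cond_law
begin

lemma kernel_eq_cond_exp:
 fixes f :: "'b => real"
 assumes f[measurable]: "f : borel_measurable borel" and C: "!!x. \<bar>f x\<bar> <= C"
 shows "AE w in M. real_cond_exp M (null_ext M G) (%w. f (X w)) w = (LINT x|ka w. f x)"
proof -
 have sub: "subalgebra M (null_ext M G)" by (rule subalgebra_null_ext[OF subG])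
 interpret G: finite_measure_subalgebra M "null_ext M G" by unfold_locales (rule sub)
 note k = integral_kernel_measurable[OF f]
 show ?thesis
 proof (rule G.real_cond_exp_charact[OF _ _ _ k])
  fix D assume D: "D : sets (null_ext M G)"
  have "(%z. indicat_real D (fst z) * f (snd z)) : borel_measurable (null_ext M G \<Otimes>\<^sub>M borel)" using D by measurable
  moreover have "\<bar>indicat_real D (fst z) * f (snd z)\<bar> <= C" for z
   using C order_trans[OF abs_ge_zero C] by (simp add: indicator_def)
  ultimately show "(LINT w:D|M. f (X w)) = (LINT w:D|M. (LINT x|ka w. f x))"
   using integral_kernel[of "%z. indicat_real D (fst z) * f (snd z)" C] by (simp add: set_lebesgue_integral_def indicator_def)
 next
  show "integrable M (%w. f (X w))" "integrable M (%w. LINT x|ka w. f x)"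
   using C kernel_bounded[OF _ f C] measurable_from_subalg[OF sub k] by (auto intro!: integrable_const_bound[where B = C])
 qed
qed

end

locale cond_law_vector = cond_law M G X ka for M :: "'a measure" and G X and ka :: "'a => (real^'d) measure"
begin

lemma kernel_shift_estimate:
 fixes ph :: "real^'d => real"
 assumes N: "subalgebra M N" "indep_set (sets N) (sets (null_ext M G))" and g: "g : borel_measurable N"
  and m: "m : borel_measurable (null_ext M G)"
  and ksi: "integrable M ksi" "AE w in M. norm (X w - (m w + g w)) <= d * ksi w"
  and ph: "ph : borel_measurable borel" "!!x. \<bar>ph x\<bar> <= C" "!!x y. \<bar>ph x - ph y\<bar> <= eps + a * norm (x - y)" and a: "0 <= a"
 shows "AE w in M. \<bar>(LINT x|ka w. ph x) - (LINT w'|M. ph (m w + g w'))\<bar> <= eps + a * d * real_cond_exp M (null_ext M G) ksi w"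
proof -
 let ?E = "real_cond_exp M (null_ext M G)"
 have sub: "subalgebra M (null_ext M G)" by (rule subalgebra_null_ext[OF subG])
 interpret G: finite_measure_subalgebra M "null_ext M G" by unfold_locales (rule sub)
 note [measurable] = measurable_from_subalg[OF sub m] measurable_from_subalg[OF N(1) g] ph(1)
 have i: "integrable M (%w. ph (X w))" "integrable M (%w. ph (m w + g w))"
  by (rule integrable_const_bound[where B = C]; use ph(2) in auto)+
 have xi: "integrable M (%w. eps + a * d * ksi w)" using ksi(1) by auto
 have "(%z. ph (m (fst z) + g (snd z))) : borel_measurable (null_ext M G \<Otimes>\<^sub>M N)"
  by (intro measurable_compose[OF borel_measurable_add ph(1)] measurable_compose[OF measurable_fst m] measurable_compose[OF measurable_snd g])
 from cond_exp_indep[OF sub N(1) indep_set_sym[OF N(2)] this, of C] ph(2)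
 have 1: "AE w in M. ?E (%w. ph (m w + g w)) w = (LINT w'|M. ph (m w + g w'))" by simp
 have le: "AE w in M. \<bar>ph (X w) - ph (m w + g w)\<bar> <= eps + a * d * ksi w"
  using ksi(2)
 proof eventually_elim
  case (elim w)
  have "\<bar>ph (X w) - ph (m w + g w)\<bar> <= eps + a * norm (X w - (m w + g w))" by (rule ph(3))
  also have "... <= eps + a * (d * ksi w)" using elim a by (intro add_left_mono mult_left_mono)
  finally show ?case by (simp add: mult.assoc)
 qed
 have "AE w in M. ?E (%w. ph (X w) - ph (m w + g w)) w <= ?E (%w. eps + a * d * ksi w) w"
  "AE w in M. ?E (%w. ph (m w + g w) - ph (X w)) w <= ?E (%w. eps + a * d * ksi w) w"
  using le by (intro G.real_cond_exp_mono xi Bochner_Integration.integrable_diff i; auto elim: eventually_mono)+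
 moreover have "AE w in M. ?E (%w. eps + a * d * ksi w) w = ?E (%_. eps) w + ?E (%w. a * d * ksi w) w"
  using ksi(1) by (intro G.real_cond_exp_add) auto
 moreover have "AE w in M. ?E (%_. eps) w = eps" by (rule G.real_cond_exp_F_meas) auto
 ultimately show ?thesis
  using 1 kernel_eq_cond_exp[OF ph(1,2)] G.real_cond_exp_diff[OF i] G.real_cond_exp_diff[OF i(2,1)] G.real_cond_exp_cmult[OF ksi(1), of "a * d"]
  by eventually_elim auto
qed

end

text \<open>The conditional expectations of one variable satisfy the maximal inequality, so that
  exceeding \<open>n\<close> has probability at most the mean of \<open>ksi\<close> divided by
  \<open>n\<close>. Boundedness is enough, since these terms are later multiplied by decaying
  exponentials.\<close>

lemma (in prob_space) cond_exp_bounded_on_countable: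
 fixes G :: "real => 'a measure"
 assumes T: "countable T" and G: "!!t. t : T ==> subalgebra M (G t)"
  and mono: "!!s t. s : T ==> t : T ==> s <= t ==> sets (G s) <= sets (G t)"
  and ksi: "integrable M ksi" "!!w. 0 <= ksi w"
 shows "AE w in M. EX c. ALL t:T. real_cond_exp M (G t) ksi w <= c"
proof -
 let ?Y = "%t. real_cond_exp M (G t) ksi"
 define A where "A n = {w : space M. EX t:T. real n < ?Y t w}" for n :: nat
 have sfs: "finite_measure_subalgebra M (G t)" if "t : T" for t by unfold_locales (rule G[OF that])
 have int: "integrable M (?Y t)" if "t : T" for t
  using sigma_finite_subalgebra.real_cond_exp_int(1)[OF finite_measure_subalgebra_is_sigma_finite[OF sfs[OF that]] ksi(1)] .
 have le: "(LINT w:A|M. ?Y t w) <= (LINT w:A|M. ksi w)" if "t : T" "A : sets (G t)" for t A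
  using sigma_finite_subalgebra.real_cond_exp_intA[OF finite_measure_subalgebra_is_sigma_finite[OF sfs[OF that(1)]] ksi(1) that(2)] by simp
 have AM: "A n : sets M" for n
 proof -
  have "A n = (\<Union>t\<in>T. {w : space M. real n < ?Y t w})" by (auto simp: A_def)
  moreover have "{w : space M. real n < ?Y t w} : sets M" for t by measurable
  ultimately show ?thesis using T by (auto intro: sets.countable_UN')
 qed
 have P: "real n * prob (A n) <= (LINT w|M. ksi w)" for n
  unfolding A_def by (rule maximal_inequality_countable[OF T G mono _ int ksi le]) auto
 have "prob (\<Inter>n. A n) <= 0"
 proof (rule field_le_epsilon)
  fix e :: real assume e: "0 < e"
  obtain n :: nat where n: "(LINT w|M. ksi w) / e < real n" using reals_Archimedean2 by blast
  have "0 <= (LINT w|M. ksi w)" using ksi by simp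
  hence n0: "0 < real n" using n e by (meson divide_nonneg_pos order_le_less_trans)
  have "prob (\<Inter>n. A n) <= prob (A n)" by (intro finite_measure_mono AM) auto
  also have "... <= (LINT w|M. ksi w) / real n" using P[of n] n0 by (simp add: field_simps)
  also have "... <= e" using n n0 e by (simp add: field_simps)
  finally show "prob (\<Inter>n. A n) <= 0 + e" by simp
 qed
 hence "(\<Inter>n. A n) : null_sets M"
  using AM by (intro null_setsI) (auto simp: emeasure_eq_measure measure_nonneg antisym)
 hence "AE w in M. w ~: (\<Inter>n. A n)" by (rule AE_not_in)
 thus ?thesis using AE_space
 proof eventually_elim
  case (elim w)
  then obtain n where "w ~: A n" by auto
  thus ?case using elim(2) by (intro exI[of _ "real n"]) (auto simp: A_def not_less)
 qed
qed

section \<open>Second-order expansion of characteristic functions\<close>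

lemma P2D:
 assumes "p : (P2 :: (real^'d) measure set)"
 shows "prob_space p" "sets p = sets borel" "integrable p (%x. (norm x)^2)"
 using assms by (auto simp: P2_def space_prob_algebra)

lemma P2_integrable:
 fixes f :: "real^'d => 'b::{banach, second_countable_topology}"
 assumes p: "p : (P2 :: (real^'d) measure set)" and f: "f : borel_measurable borel" "!!x. norm (f x) <= c * (1 + (norm x)^2)"
 shows "integrable p f"
proof -
 interpret prob_space p by (rule P2D[OF p])
 have "integrable p (%x. c * (1 + (norm x)^2))" using P2D(3)[OF p] by auto
 thus ?thesis
  by (rule Bochner_Integration.integrable_bound) (use f P2D(2)[OF p] in "auto cong: measurable_cong_sets intro!: AE_I2 order_trans[OF f(2)]")
qed

text \<open>The factor \<open>1\<close> makes the bounds instances of the growth condition with a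
  constant \<open>c\<close>, as it occurs in \<open>P2_continuous\<close>.\<close>

lemma growth_bounds:
 fixes x :: "real^'d"
 shows "\<bar>x $ i\<bar> <= 1 * (1 + (norm x)^2)" "\<bar>x $ i * x $ j\<bar> <= 1 * (1 + (norm x)^2)"
  "norm x <= 1 * (1 + (norm x)^2)"
proof -
 have i: "\<bar>x $ i\<bar> <= norm x" for i by (rule component_le_norm_cart)
 show n: "norm x <= 1 * (1 + (norm x)^2)"
  using zero_le_power2[of "norm x - 1"] by (simp add: power2_eq_square algebra_simps) (smt (verit) norm_ge_zero)
 show "\<bar>x $ i\<bar> <= 1 * (1 + (norm x)^2)" using i[of i] n by simp
 show "\<bar>x $ i * x $ j\<bar> <= 1 * (1 + (norm x)^2)"
  using mult_mono[OF i[of i] i[of j]] by (simp add: abs_mult power2_eq_square)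
qed

lemma P2_integrable_component:
 assumes p: "p : (P2 :: (real^'d) measure set)"
 shows "integrable p (%x. x)" "integrable p (%x. x $ i)" "integrable p (%x. x $ i * x $ j)"
 by (rule P2_integrable[OF p _ growth_bounds(3)] P2_integrable[OF p _ growth_bounds(1)[folded real_norm_def]]
   P2_integrable[OF p _ growth_bounds(2)[folded real_norm_def]]; measurable)+

lemma cov_matrix_entry:
 assumes p: "p : (P2 :: (real^'d) measure set)"
 shows "cov_matrix p $ i $ j = (LINT x|p. x $ i * x $ j) - (LINT x|p. x $ i) * (LINT x|p. x $ j)"
proof -
 interpret prob_space p by (rule P2D[OF p])
 note 1 = P2_integrable_component[OF p]
 have "mean_vector p $ i = (LINT x|p. x $ i)" for i
  unfolding mean_vector_def
  by (rule integral_bounded_linear[OF bounded_linear_vec_nth 1(1), symmetric])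
 moreover have "(LINT x|p. (x $ i - a) * (x $ j - b)) = (LINT x|p. x $ i * x $ j) - b * (LINT x|p. x $ i) - a * (LINT x|p. x $ j) + a * b" for a b
 proof -
  have "(LINT x|p. (x $ i - a) * (x $ j - b)) = (LINT x|p. x $ i * x $ j - b * x $ i - a * x $ j + a * b)"
   by (rule Bochner_Integration.integral_cong) (auto simp: algebra_simps)
  thus ?thesis using 1 by (simp add: prob_space)
 qed
 ultimately show ?thesis by (simp add: cov_matrix_def)
qed

lemma transpose_cov_matrix: "transpose (cov_matrix p) = cov_matrix p"
 by (simp add: transpose_def cov_matrix_def vec_eq_iff mult.commute)

lemma cov_matrix_variance:
 assumes p: "p : (P2 :: (real^'d) measure set)"
 shows "l \<bullet> (cov_matrix p *v l) = (LINT x|p. (l \<bullet> x)^2) - (LINT x|p. l \<bullet> x)^2"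
proof -
 interpret prob_space p by (rule P2D[OF p])
 note 1 = P2_integrable_component[OF p]
 have "(LINT x|p. l \<bullet> x) = (SUM i:UNIV. l $ i * (LINT x|p. x $ i))"
  using 1 by (simp add: inner_vec_def)
 moreover have "(LINT x|p. (l \<bullet> x)^2) = (SUM i:UNIV. SUM j:UNIV. l $ i * l $ j * (LINT x|p. x $ i * x $ j))"
 proof -
  have "(LINT x|p. (l \<bullet> x)^2) = (LINT x|p. (SUM i:UNIV. SUM j:UNIV. l $ i * l $ j * (x $ i * x $ j)))"
   by (rule Bochner_Integration.integral_cong) (auto simp: inner_vec_def power2_eq_square sum_product mult_ac)
  thus ?thesis using 1 by simp
 qed
 ultimately show ?thesis
  by (simp add: inner_vec_def matrix_vector_mult_def cov_matrix_entry[OF p] power2_eq_square sum_product sum_distrib_left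
    right_diff_distrib left_diff_distrib sum_subtractf mult_ac)
qed

text \<open>The modulus of the characteristic function is insensitive to the mean, so its
  second-order term at 0 is the variance alone. This reads off the covariance while the conditional
  mean is still unknown.\<close>

lemma cis_second_order:
 assumes p: "p : (P2 :: (real^'d) measure set)"
 shows "(%n. (real (Suc n))^2 * (1 - (norm (LINT x|p. cis ((1 / real (Suc n)) *\<^sub>R l \<bullet> x)))^2)) ----> l \<bullet> (cov_matrix p *v l)"
proof -
 interpret prob_space p by (rule P2D[OF p])
 have [measurable]: "(%x. x) : borel_measurable p" using P2D(2)[OF p] by (simp cong: measurable_cong_sets)
 define m where "m = (LINT x|p. l \<bullet> x)"
 define z where "z x = l \<bullet> x - m" for x
 have [measurable]: "z : borel_measurable p" unfolding z_def by measurable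
 have li: "integrable p (%x. l \<bullet> x)"
  by (rule P2_integrable[OF p, where c = "norm l"]) (auto intro!: order_trans[OF Cauchy_Schwarz_ineq2] mult_left_mono growth_bounds(3)[simplified])
 have l2: "integrable p (%x. (l \<bullet> x)^2)"
 proof (rule P2_integrable[OF p, where c = "(norm l)^2"])
  fix x have "(l \<bullet> x)^2 <= (norm l)^2 * (norm x)^2"
   using power_mono[OF Cauchy_Schwarz_ineq2 abs_ge_zero, of l x 2] by (simp add: power_mult_distrib)
  also have "... <= (norm l)^2 * (1 + (norm x)^2)" by (intro mult_left_mono) auto
  finally show "norm ((l \<bullet> x)^2) <= (norm l)^2 * (1 + (norm x)^2)" by simp
 qed measurable
 have z2e: "(z x)^2 = (l \<bullet> x)^2 - 2 * m * (l \<bullet> x) + m^2" for x by (simp add: z_def power2_diff algebra_simps)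
 have zi: "integrable p z" "(LINT x|p. z x) = 0" using li unfolding z_def[abs_def] by (auto simp: m_def prob_space)
 have z2: "integrable p (%x. (z x)^2)" "(LINT x|p. (z x)^2) = l \<bullet> (cov_matrix p *v l)"
  unfolding z2e cov_matrix_variance[OF p] using li l2 by (auto simp: prob_space power2_eq_square simp flip: m_def)
 define c s where "c n = (LINT x|p. cos (z x / real (Suc n)))" and "s n = (LINT x|p. sin (z x / real (Suc n)))" for n
 have ci: "integrable p (%x. cos (z x / real (Suc n)))" "integrable p (%x. sin (z x / real (Suc n)))" for n
  by (intro integrable_const_bound[where B = 1]; simp)+
 have "(LINT x|p. cis ((1 / real (Suc n)) *\<^sub>R l \<bullet> x)) = cis (m / real (Suc n)) * Complex (c n) (s n)" for n
 proof -
  have cc: "complex_integrable p (%x. cis (z x / real (Suc n)))" by (intro integrable_const_bound[where B = 1]) auto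
  have "(LINT x|p. cis ((1 / real (Suc n)) *\<^sub>R l \<bullet> x)) = (LINT x|p. cis (m / real (Suc n)) * cis (z x / real (Suc n)))"
   by (rule Bochner_Integration.integral_cong) (auto simp: cis_mult z_def add_divide_distrib[symmetric])
  also have "... = cis (m / real (Suc n)) * (LINT x|p. cis (z x / real (Suc n)))" by (simp del: of_nat_Suc)
  also have "(LINT x|p. cis (z x / real (Suc n))) = Complex (c n) (s n)"
   using cc by (simp add: complex_eq_iff c_def s_def flip: integral_Re integral_Im del: of_nat_Suc)
  finally show ?thesis .
 qed
 hence nn: "(norm (LINT x|p. cis ((1 / real (Suc n)) *\<^sub>R l \<bullet> x)))^2 = (c n)^2 + (s n)^2" for n
  by (simp only: norm_mult norm_cis mult_1_left cmod_power2) simp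
 \<comment> \<open>The expression 1 - c^2 - s^2 is arranged so that every factor converges: the
   cosine part tends to twice half the variance, and the sine part vanishes because \<open>z\<close>
   is centred.\<close>
 have e: "(real (Suc n))^2 * (1 - (norm (LINT x|p. cis ((1 / real (Suc n)) *\<^sub>R l \<bullet> x)))^2)
  = ((real (Suc n))^2 * (1 - c n)) * (1 + c n) - (real (Suc n) * s n)^2" for n
  unfolding nn by (simp only: power2_eq_square algebra_simps)
 have "(%n. LINT x|p. real (Suc n) * sin (z x / real (Suc n))) ----> (LINT x|p. z x)"
 proof (rule integral_dominated_convergence[where w = "%x. \<bar>z x\<bar>"])
  show "AE x in p. norm (real (Suc n) * sin (z x / real (Suc n))) <= \<bar>z x\<bar>" for n
  proof (rule AE_I2)
   fix x have "\<bar>sin (z x / real (Suc n))\<bar> <= \<bar>z x / real (Suc n)\<bar>" by (rule abs_sin_x_le_abs_x)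
   from mult_left_mono[OF this, of "real (Suc n)"] show "norm (real (Suc n) * sin (z x / real (Suc n))) <= \<bar>z x\<bar>"
    by (simp add: abs_mult del: of_nat_Suc)
  qed
 qed (use zi in "auto intro!: sin_scaled_tendsto simp del: of_nat_Suc")
 hence ns: "(%n. real (Suc n) * s n) ----> 0" using ci zi(2) by (simp add: s_def del: of_nat_Suc)
 have "(%n. LINT x|p. (real (Suc n))^2 * (1 - cos (z x / real (Suc n)))) ----> (LINT x|p. (z x)^2 / 2)"
  by (rule integral_dominated_convergence[where w = "%x. (z x)^2 / 2"])
   (use z2 cos_scaled_tendsto cos_scaled_le in "auto simp del: of_nat_Suc")
 hence n2c: "(%n. (real (Suc n))^2 * (1 - c n)) ----> (l \<bullet> (cov_matrix p *v l)) / 2"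
  using ci z2(2) by (simp add: c_def prob_space del: of_nat_Suc)
 have "c ----> (LINT x|p. 1)" unfolding c_def[abs_def]
 proof (rule integral_dominated_convergence[where w = "%_. 1"])
  show "AE x in p. (%n. cos (z x / real (Suc n))) ----> 1"
  proof (rule AE_I2)
   fix x have "(%n. cos (z x / real (Suc n))) ----> cos 0" by (intro tendsto_cos LIMSEQ_Suc lim_const_over_n)
   thus "(%n. cos (z x / real (Suc n))) ----> 1" by simp
  qed
 qed auto
 hence c1: "c ----> 1" by (simp add: prob_space)
 have "(%n. ((real (Suc n))^2 * (1 - c n)) * (1 + c n) - (real (Suc n) * s n)^2) ----> (l \<bullet> (cov_matrix p *v l)) / 2 * (1 + 1) - 0^2"
  by (intro tendsto_intros n2c c1 ns)
 thus ?thesis unfolding e by simp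
qed

section \<open>Partitions at two scales\<close>

text \<open>Cell \<open>j\<close> of the fine partition lies in cell \<open>j div m n\<close> of the coarse one, which has \<open>Suc n\<close> cells.\<close>
lemma two_scale_sum_tendsto:
 fixes Ph :: "real => real => 'a::euclidean_space" and g :: "real => 'a" and m :: "nat => nat"
 assumes t: "0 <= t" and m: "!!n. 0 < m n" and Ph: "continuous_on ({0..t} \<times> {0..t}) (%z. Ph (fst z) (snd z))"
  and g: "continuous_on {0..t} g"
 defines "N == %n. Suc n * m n"
 shows "(%n. SUM j<N n. Ph (real j * t / N n) (real (j div m n) * t / Suc n)
   \<bullet> (integral {0..real (Suc j) * t / N n} g - integral {0..real j * t / N n} g)) ----> integral {0..t} (%s. Ph s s \<bullet> g s)"
proof (unfold N_def, rule tagged_sum_tendsto[OF t _ Ph g])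
 show "(%n. t / real (Suc n)) ----> 0" by (rule LIMSEQ_Suc[OF lim_const_over_n])
 show "0 < Suc n * m n" for n using m by simp
 fix n j assume j: "j < Suc n * m n"
 let ?r = "real j * t / (Suc n * m n)" and ?q = "real (j div m n) * t / Suc n"
 show r: "?r : {0..t}" using partition_in[of j "Suc n * m n" t] j t by simp
 have d1: "j div m n * m n <= j" "j < Suc (j div m n) * m n"
  using m[of n] by (auto simp: dividend_less_times_div mult.commute div_times_less_eq_dividend)
 have c: "real x * t / real (Suc n) = real (x * m n) * t / (Suc n * m n)" for x
  unfolding of_nat_mult using m[of n] by (simp del: of_nat_Suc)
 have qr: "?q <= ?r" unfolding c by (intro divide_right_mono mult_right_mono of_nat_mono[OF d1(1)] t) simp
 thus "?q : {0..t}" using r t by auto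
 fix s assume s: "s : {?r..real (Suc j) * t / (Suc n * m n)}"
 have "real (Suc j) * t / (Suc n * m n) <= real (Suc (j div m n)) * t / real (Suc n)"
  unfolding c by (intro divide_right_mono mult_right_mono of_nat_mono[OF Suc_leI[OF d1(2)]] t) simp
 moreover have "real (Suc (j div m n)) * t / real (Suc n) = ?q + t / real (Suc n)"
  by (simp add: add_divide_distrib distrib_right)
 ultimately have b: "?r <= s" "s <= ?q + t / real (Suc n)" using s by auto
 have "\<bar>r - s\<bar> <= h" "\<bar>q - s\<bar> <= h" if "q <= r" "r <= s" "s <= q + h" for q r h :: real using that by auto
 from this[OF qr b] show "\<bar>?r - s\<bar> <= t / real (Suc n)" "\<bar>?q - s\<bar> <= t / real (Suc n)" .
qed

lemma two_scale_riemann_sum_tendsto: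
 fixes Ph :: "real => real => real" and m :: "nat => nat"
 assumes t: "0 <= t" and m: "!!n. 0 < m n" and Ph: "continuous_on ({0..t} \<times> {0..t}) (%z. Ph (fst z) (snd z))"
 defines "N == %n. Suc n * m n"
 shows "(%n. SUM j<N n. Ph (real j * t / N n) (real (j div m n) * t / Suc n) * (t / N n)) ----> integral {0..t} (%s. Ph s s)"
proof -
 have "integral {0..real j * t / real n} (%_. 1::real) = real j * t / real n" for j n :: nat using t by simp
 hence d: "integral {0..real (Suc j) * t / real n} (%_. 1::real) - integral {0..real j * t / real n} (%_. 1) = t / real n" for j n :: nat
  by (simp only: diff_divide_distrib[symmetric] left_diff_distrib[symmetric]) simp
 from two_scale_sum_tendsto[where m = m, OF t m Ph continuous_on_const[of _ 1]]
 show ?thesis by (simp only: N_def d inner_real_def mult_1_right)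
qed

lemma telescope_block:
 fixes f :: "nat => 'a::ab_group_add"
 shows "(SUM j = i * m..<i * m + m. f (Suc j) - f j) = f (Suc i * m) - f (i * m)"
 using sum_Suc_diff'[of "i * m" "i * m + m" f] by (simp add: add.commute)

text \<open>The weights are frozen at the coarse points so that only the errors of the Ito sums at
 these finitely many points enter.\<close>
lemma ito_path_sum_tendsto:
 fixes x b J l l' :: "real => real^'d" and z w :: "real => real^'k" and K :: "real => real^'k^'d" and m :: "nat => nat"
  and F SS :: "real^'d^'d" and H :: "real^'d^'k" and GG :: "real^'k^'k"
 assumes t: "0 <= t" and m: "!!n. 0 < m n"
  and b: "continuous_on {0..} b" "b 0 = 0" and x: "continuous_on {0..} x"
  and xeq: "!!t. 0 <= t ==> x t = x 0 + integral {0..t} (%s. F *v x s) + SS *v b t - J t"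
  and l: "!!s. s : {0..t} ==> (l has_vector_derivative l' s) (at s within {0..t})" "continuous_on {0..t} l'"
  and K: "continuous_on {0..t} K"
  and l'x: "!!s. s : {0..t} ==> l' s \<bullet> x s + l s \<bullet> (F *v x s) = l s \<bullet> (K s *v (H *v x s))"
 defines "N == %n. Suc n * m n" and "V == %s. integral {0..s} (%r. H *v x r) + GG *v w s - z s"
 assumes err: "\<forall>\<^sub>F n in sequentially. ALL i<=Suc n. norm ((SUM j<i * m n. K (real j * t / N n) *v
   (V (real (Suc j) * t / N n) - V (real j * t / N n))) - J (real i * t / Suc n)) <= (1/2)^n / real (Suc (Suc n))"
 shows "(%n. (SUM j<N n. l (real (j div m n) * t / Suc n) \<bullet> (SS *v (b (real (Suc j) * t / N n) - b (real j * t / N n))))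
   - (SUM j<N n. l (real (j div m n) * t / Suc n) \<bullet> (K (real j * t / N n) *v (GG *v (w (real (Suc j) * t / N n) - w (real j * t / N n)))))
   + (SUM j<N n. l (real (j div m n) * t / Suc n) \<bullet> (K (real j * t / N n) *v (z (real (Suc j) * t / N n) - z (real j * t / N n)))))
  ----> l t \<bullet> x t - l 0 \<bullet> x 0" (is "?A ----> _")
proof -
 \<comment> \<open>\<open>J\<close> is not assumed continuous; through the equation \<open>n\<close>
   inherits continuity from \<open>x\<close> and its drift.\<close>
 define n where "n s = SS *v b s - J s" for s
 define I where "I s = integral {0..s} (%r. H *v x r)" for s
 have Fx: "continuous_on {0..} (%s. F *v x s)" and Hx: "continuous_on {0..} (%s. H *v x s)" by (intro continuous_intros x)+
 have neq: "n s = x s - (x 0 + integral {0..s} (%s. F *v x s))" if "0 <= s" for s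
  using xeq[OF that] by (simp only: n_def algebra_simps)
 have "continuous_on {0..} (%s. x s - (x 0 + integral {0..s} (%s. F *v x s)))"
  by (intro continuous_intros x continuous_on_integral_atLeast Fx)
 hence nc: "continuous_on {0..t} n"
  by (rule continuous_on_eq[OF continuous_Icc]) (simp add: neq)
 have n0: "n 0 = 0" using neq[of 0] by simp
 have lc: "continuous_on {0..t} l" by (rule derivative_continuous_on[OF l(1)])
 have xc: "continuous_on {0..t} x" by (rule continuous_Icc[OF x])
 have 1: "(%k. SUM i<Suc k. l (real i * t / Suc k) \<bullet> (n (real (Suc i) * t / Suc k) - n (real i * t / Suc k)))
  ----> l t \<bullet> n t - integral {0..t} (%u. l' u \<bullet> n u)"
  by (rule LIMSEQ_Suc[OF stieltjes_sum_tendsto_deriv[OF t nc n0 l]])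
 have "((%s. l s \<bullet> (F *v x s) + l' s \<bullet> (x s - n s)) has_integral l t \<bullet> (x t - n t) - l 0 \<bullet> (x 0 - n 0)) {0..t}"
 proof (rule fundamental_theorem_of_calculus[OF t], rule inner_derivative[OF l(1)])
  fix s assume s: "s : {0..t}"
  have "((%s. x 0 + integral {0..s} (%s. F *v x s)) has_vector_derivative 0 + F *v x s) (at s within {0..})"
   by (intro has_vector_derivative_add has_vector_derivative_const integral_derivative_atLeast[OF Fx]) (use s in auto)
  hence d: "((%s. x 0 + integral {0..s} (%s. F *v x s)) has_vector_derivative F *v x s) (at s within {0..t})"
   by (auto intro: has_vector_derivative_within_subset)
  show "((%s. x s - n s) has_vector_derivative F *v x s) (at s within {0..t})"
   by (rule has_vector_derivative_transform[OF s _ d]) (simp add: neq)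
 qed
 moreover have "l s \<bullet> (F *v x s) + l' s \<bullet> (x s - n s) = l s \<bullet> (K s *v (H *v x s)) - l' s \<bullet> n s" if "s : {0..t}" for s
  using l'x[OF that] by (simp add: inner_diff_right)
 ultimately have hi: "((%s. l s \<bullet> (K s *v (H *v x s)) - l' s \<bullet> n s) has_integral l t \<bullet> (x t - n t) - l 0 \<bullet> (x 0 - n 0)) {0..t}"
  using has_integral_eq by (metis (no_types, lifting))
 have i12: "(%s. l s \<bullet> (K s *v (H *v x s))) integrable_on {0..t}" "(%s. l' s \<bullet> n s) integrable_on {0..t}"
  by (intro integrable_continuous_real continuous_intros lc K xc l(2) nc)+
 have lim: "l t \<bullet> n t - integral {0..t} (%u. l' u \<bullet> n u) + integral {0..t} (%s. l s \<bullet> (K s *v (H *v x s))) = l t \<bullet> x t - l 0 \<bullet> x 0"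
  using integral_unique[OF hi] Henstock_Kurzweil_Integration.integral_diff[OF i12] n0 by (simp add: inner_diff_right)
 have KT: "y \<bullet> (K s *v v) = (transpose (K s) *v y) \<bullet> v" for y s v by (rule inner_matrix)
 have "continuous_on ({0..t} \<times> {0..t}) (%z. transpose (K (fst z)) *v l (snd z))"
  by (intro continuous_intros continuous_on_compose2[OF K] continuous_on_compose2[OF lc]) auto
 from two_scale_sum_tendsto[where m = m, OF t m this continuous_Icc[OF Hx]]
 have 2: "(%n. SUM j<N n. l (real (j div m n) * t / Suc n) \<bullet> (K (real j * t / N n) *v (I (real (Suc j) * t / N n) - I (real j * t / N n))))
  ----> integral {0..t} (%s. l s \<bullet> (K s *v (H *v x s)))"
  unfolding N_def I_def KT .
 \<comment> \<open>The error of the fine Ito sum at the coarse point \<open>i\<close>. There are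
   \<open>Suc k\<close> cells, each contributing two such errors of size at most
   \<open>(1/2)^k / real (Suc (Suc k))\<close>, so their weighted sum \<open>E\<close> tends to
   0.\<close>
 define e where "e k i = (SUM j<i * m k. K (real j * t / N k) *v (V (real (Suc j) * t / N k) - V (real j * t / N k))) - J (real i * t / Suc k)" for k i
 define E where "E k = (SUM i<Suc k. l (real i * t / Suc k) \<bullet> (e k (Suc i) - e k i))" for k
 obtain L where L: "!!s. s : {0..t} ==> norm (l s) <= L"
  using compact_imp_bounded[OF compact_continuous_image[OF lc compact_Icc]] unfolding bounded_iff ball_simps by blast
 have L0: "0 <= L" using L[of 0] t by (auto intro: order_trans[OF norm_ge_zero])
 have 3: "E ----> 0"
 proof (rule Lim_null_comparison)
  show "\<forall>\<^sub>F k in sequentially. norm (E k) <= 2 * L * (1/2)^k"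
   using err
  proof eventually_elim
   case (elim k)
   have ek: "norm (e k i) <= (1/2)^k / real (Suc (Suc k))" if "i <= Suc k" for i using elim that by (simp add: e_def)
   have "norm (E k) <= (SUM i<Suc k. L * (2 * ((1/2)^k / real (Suc (Suc k)))))"
    unfolding E_def
   proof (rule order_trans[OF norm_sum sum_mono])
    fix i assume i: "i : {..<Suc k}"
    have "norm (e k (Suc i) - e k i) <= 2 * ((1/2)^k / real (Suc (Suc k)))"
     using ek[of i] ek[of "Suc i"] i norm_triangle_ineq4[of "e k (Suc i)" "e k i"] by auto
    moreover have "norm (l (real i * t / Suc k)) <= L" by (rule L[OF partition_in]) (use i t in auto)
    ultimately show "norm (l (real i * t / Suc k) \<bullet> (e k (Suc i) - e k i)) <= L * (2 * ((1/2)^k / real (Suc (Suc k))))"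
     unfolding real_norm_def by (intro order_trans[OF Cauchy_Schwarz_ineq2] mult_mono L0 norm_ge_zero)
   qed
   also have "... = 2 * L * (1/2)^k * (real (Suc k) / real (Suc (Suc k)))" by (simp only: sum_constant card_lessThan) (simp add: field_simps)
   also have "... <= 2 * L * (1/2)^k * 1" using L0 by (intro mult_left_mono) auto
   finally show ?case by simp
  qed
  have "(%k. 2 * L * (1/2)^k) ----> 2 * L * 0" by (intro tendsto_intros LIMSEQ_realpow_zero) auto
  thus "(%k. 2 * L * (1/2)^k) ----> 0" by simp
 qed
 \<comment> \<open>The weight is constant on a coarse cell. Hence the increments of \<open>b\<close>
   telescope to coarse increments, and the fine Ito sums become coarse increments of
   \<open>J\<close> plus errors.\<close>
 have "?A k = (SUM i<Suc k. l (real i * t / Suc k) \<bullet> (n (real (Suc i) * t / Suc k) - n (real i * t / Suc k)))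
  + (SUM j<N k. l (real (j div m k) * t / Suc k) \<bullet> (K (real j * t / N k) *v (I (real (Suc j) * t / N k) - I (real j * t / N k)))) - E k" for k
 proof -
  have q: "real (i * m k) * t / N k = real i * t / Suc k" for i
   unfolding N_def of_nat_mult using m[of k] by (simp del: of_nat_Suc)
  define f where "f j = SS *v b (real j * t / N k)" for j :: nat
  define h where "h j = K (real j * t / N k) *v (V (real (Suc j) * t / N k) - V (real j * t / N k))" for j :: nat
  define c where "c i = l (real i * t / Suc k)" for i :: nat
  have block: "(SUM j<N k. c (j div m k) \<bullet> (g (Suc j) - g j)) = (SUM i<Suc k. c i \<bullet> (g (Suc i * m k) - g (i * m k)))" for g :: "nat => real^'d"
  proof -
   have "(SUM j<N k. c (j div m k) \<bullet> (g (Suc j) - g j)) = (SUM i<Suc k. SUM j = i * m k..<i * m k + m k. c (j div m k) \<bullet> (g (Suc j) - g j))"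
    unfolding N_def by (rule sum.nat_group[symmetric])
   also have "... = (SUM i<Suc k. c i \<bullet> (SUM j = i * m k..<i * m k + m k. g (Suc j) - g j))"
   proof (intro sum.cong refl)
    fix i
    have "j div m k = i" if "j : {i * m k..<i * m k + m k}" for j
     using that by (intro div_nat_eqI) (auto simp: mult.commute add.commute)
    thus "(SUM j = i * m k..<i * m k + m k. c (j div m k) \<bullet> (g (Suc j) - g j)) = c i \<bullet> (SUM j = i * m k..<i * m k + m k. g (Suc j) - g j)"
     by (simp add: inner_sum_right)
   qed
   finally show ?thesis by (simp only: telescope_block)
  qed
  have sV: "h j = K (real j * t / N k) *v (I (real (Suc j) * t / N k) - I (real j * t / N k))
   + K (real j * t / N k) *v (GG *v (w (real (Suc j) * t / N k) - w (real j * t / N k)))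
   - K (real j * t / N k) *v (z (real (Suc j) * t / N k) - z (real j * t / N k))" for j
   by (simp add: h_def V_def I_def matrix_vector_right_distrib matrix_vector_mult_diff_distrib algebra_simps del: of_nat_Suc)
  have B: "(SUM j<N k. c (j div m k) \<bullet> (SS *v (b (real (Suc j) * t / N k) - b (real j * t / N k))))
   = (SUM i<Suc k. c i \<bullet> (SS *v b (real (Suc i) * t / Suc k) - SS *v b (real i * t / Suc k)))"
   using block[of f] unfolding f_def q by (simp only: matrix_vector_mult_diff_distrib)
  have S: "(SUM j<N k. c (j div m k) \<bullet> h j)
   = (SUM i<Suc k. c i \<bullet> (J (real (Suc i) * t / Suc k) - J (real i * t / Suc k))) + E k"
  proof -
   have se: "sum h {..<i * m k} = e k i + J (real i * t / Suc k)" for i by (simp add: e_def h_def)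
   have "(SUM j<N k. c (j div m k) \<bullet> h j) = (SUM i<Suc k. c i \<bullet> (sum h {..<Suc i * m k} - sum h {..<i * m k}))"
    using block[of "%j. sum h {..<j}"] by (simp only: sum.lessThan_Suc add_diff_cancel_left')
   also have "... = (SUM i<Suc k. c i \<bullet> (J (real (Suc i) * t / Suc k) - J (real i * t / Suc k)) + c i \<bullet> (e k (Suc i) - e k i))"
    unfolding se by (intro sum.cong refl) (simp add: inner_diff_right inner_add_right)
   finally show ?thesis by (simp only: sum.distrib E_def c_def)
  qed
  have "(SUM j<N k. c (j div m k) \<bullet> h j) = (SUM j<N k. c (j div m k) \<bullet> (K (real j * t / N k) *v (I (real (Suc j) * t / N k) - I (real j * t / N k))))
   + (SUM j<N k. c (j div m k) \<bullet> (K (real j * t / N k) *v (GG *v (w (real (Suc j) * t / N k) - w (real j * t / N k)))))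
   - (SUM j<N k. c (j div m k) \<bullet> (K (real j * t / N k) *v (z (real (Suc j) * t / N k) - z (real j * t / N k))))"
   unfolding sV inner_diff_right inner_add_right sum_subtractf sum.distrib by simp
  moreover have "(SUM i<Suc k. c i \<bullet> (n (real (Suc i) * t / Suc k) - n (real i * t / Suc k)))
   = (SUM i<Suc k. c i \<bullet> (SS *v b (real (Suc i) * t / Suc k) - SS *v b (real i * t / Suc k)))
   - (SUM i<Suc k. c i \<bullet> (J (real (Suc i) * t / Suc k) - J (real i * t / Suc k)))"
   unfolding sum_subtractf[symmetric] inner_diff_right[symmetric] by (intro sum.cong refl arg_cong2[where f = inner]) (simp add: n_def)
  ultimately show ?thesis using B S unfolding c_def by linarith
 qed
 moreover have "(%k. (SUM i<Suc k. l (real i * t / Suc k) \<bullet> (n (real (Suc i) * t / Suc k) - n (real i * t / Suc k)))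
  + (SUM j<N k. l (real (j div m k) * t / Suc k) \<bullet> (K (real j * t / N k) *v (I (real (Suc j) * t / N k) - I (real j * t / N k)))) - E k)
  ----> l t \<bullet> n t - integral {0..t} (%u. l' u \<bullet> n u) + integral {0..t} (%s. l s \<bullet> (K s *v (H *v x s))) - 0"
  by (intro tendsto_diff tendsto_add 1 2 3)
 ultimately show ?thesis unfolding lim[symmetric] by simp
qed

section \<open>Identification of a continuous covariance path with a Riccati solution\<close>

context riccati_data
begin

text \<open>The Gronwall inequality for the path run backwards from \<open>t\<close>.\<close>

lemma backward_norm_bound:
 fixes p :: "real => real^'n"
 assumes t: "t : {0..T}" and A: "!!s x. s : {0..T} ==> norm (A s *v x) <= L * norm x" "0 <= L" "continuous_on {0..T} A"
  and p: "!!s. s : {0..t} ==> (p has_vector_derivative - (A s *v p s)) (at s within {0..t})" and s: "s : {0..t}"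
 shows "norm (p s) <= norm (p t) * exp (L * t)"
proof -
 have pc: "continuous_on {0..t} p" by (rule derivative_continuous_on[OF p])
 define u where "u r = norm (p (t - r))" for r
 have uc: "continuous_on {0..t} u" unfolding u_def by (intro continuous_intros continuous_on_compose2[OF pc]) auto
 have "u r <= norm (p t) * exp (L * r)" if r: "r : {0..t}" for r
 proof (rule gronwall[OF uc A(2) _ r])
  fix r assume r: "r : {0..t}"
  have f: "continuous_on {t - r..t} (%s. A s *v p s)"
   using t r by (intro continuous_intros continuous_on_subset[OF A(3)] continuous_on_subset[OF pc]) auto
  have "((%s. - (A s *v p s)) has_integral p t - p (t - r)) {t - r..t}"
   by (rule fundamental_theorem_of_calculus) (use r in "auto intro!: has_vector_derivative_within_subset[OF p]")
  from integral_unique[OF this] have "p (t - r) = p t + integral {t - r..t} (%s. A s *v p s)" by (simp add: algebra_simps)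
  hence "u r <= norm (p t) + norm (integral {t - r..t} (%s. A s *v p s))" by (simp add: u_def norm_triangle_ineq)
  also have "norm (integral {t - r..t} (%s. A s *v p s)) <= integral {t - r..t} (%s. L * norm (p s))"
   by (rule norm_integral_le[OF f]) (use t r A(1) in "auto intro!: continuous_intros continuous_on_subset[OF pc]")
  also have "integral {t - r..t} (%s. L * norm (p s)) = L * integral {0..r} u"
  proof -
   have "((%s. norm (p s)) has_integral integral {t - r..t} (%s. norm (p s))) (cbox (t - r) t)"
    unfolding cbox_interval using r by (intro integrable_integral integrable_continuous_interval continuous_intros continuous_on_subset[OF pc]) auto
   from has_integral_affinity[OF this, of "-1" t]
   have "(u has_integral integral {t - r..t} (%s. norm (p s))) ((%x. - x + t) ` {t - r..t})" by (simp add: u_def[abs_def] add.commute)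
   moreover have "(%x. - x + t) ` {t - r..t} = {0..r}" by (auto simp: image_iff intro!: bexI[of _ "t - _"])
   ultimately show ?thesis by (simp add: integral_unique)
  qed
  finally show "u r <= norm (p t) + L * integral {0..r} u" by simp
 qed
 from this[of "t - s"] s A(2) have "norm (p s) <= norm (p t) * exp (L * (t - s))" by (simp add: u_def)
 also have "... <= norm (p t) * exp (L * t)" using s A(2) by (intro mult_left_mono) (auto intro: mult_left_mono)
 finally show ?thesis .
qed

lemma covariance_eq_riccati:
 assumes P: "riccati P" and C: "continuous_on {0..} C" "!!t. 0 <= t ==> transpose (C t) = C t"
  and ident: "!!t i j. t : \<rat> ==> 0 <= t ==> EX p. p t = axis i 1 + axis j 1 &
   (ALL s:{0..t}. (p has_vector_derivative - (transpose (F - C s ** S) *v p s)) (at s within {0..t})) &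
   p t \<bullet> (C t *v p t) = p 0 \<bullet> (P 0 *v p 0) + integral {0..t} (%s. p s \<bullet> (\<Sigma> *v p s) + (C s *v p s) \<bullet> (S *v (C s *v p s)))"
  and t: "0 <= t"
 shows "C t = P t"
proof -
 define T where "T = t + 1"
 have T: "0 < T" "t : {0..T}" using t by (auto simp: T_def)
 define D where "D s = C s - P s" for s
 have Pc: "continuous_on {0..} P" by (rule riccati_continuous(1)[OF P])
 have Dc: "continuous_on {0..} D" unfolding D_def by (intro continuous_intros C Pc)
 define A where "A s = transpose (F - C s ** S)" for s
 have Ac: "continuous_on {0..T} A" unfolding A_def by (intro continuous_intros continuous_Icc[OF C(1)])
 obtain L0 where L0: "!!s. s : {0..T} ==> norm (A s) <= L0"
  using compact_imp_bounded[OF compact_continuous_image[OF Ac compact_Icc]] unfolding bounded_iff ball_simps by blast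
 obtain b where b: "!!s. s : {0..T} ==> norm (D s) <= b"
  using compact_imp_bounded[OF compact_continuous_image[OF continuous_Icc[OF Dc] compact_Icc]] unfolding bounded_iff ball_simps by blast
 have L0': "0 <= L0" "0 <= b" using L0[of 0] b[of 0] T by (auto intro: order_trans[OF norm_ge_zero])
 have AL: "norm (A s *v x) <= L0 * norm x" if "s : {0..T}" for s x
  by (rule order_trans[OF norm_matrix_vector_le]) (use L0[OF that] in "auto intro: mult_right_mono")
 \<comment> \<open>Of the quadratic term in \<open>D\<close>, one factor is bounded by
   \<open>b\<close> and the other is kept for the Gronwall inequality;
   \<open>2 * exp (L0 * T)\<close> bounds the dual solutions that end in a sum of two unit
   vectors.\<close>
 define k where "k = real CARD('d) * (real CARD('d) * (norm S * b * (2 * exp (L0 * T))^2))"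
 have k0: "0 <= k" using L0' by (simp add: k_def)
 have Dn: "continuous_on {0..} (%s. norm (D s))" by (intro continuous_intros Dc)
 have rat: "norm (D s) <= k * integral {0..s} (%s. norm (D s))" if s: "s : \<rat>" "0 <= s" "s <= T" for s
 proof -
  have "norm (D s) <= real CARD('d) * (real CARD('d) * (norm S * b * (2 * exp (L0 * T))^2 * integral {0..s} (%s. norm (D s))))"
  proof (rule norm_symmetric_matrix_le)
   show "transpose (D s) = D s" using C(2) riccatiD(2)[OF P] s by (simp add: D_def transpose_diff)
   fix i j :: 'd
   obtain p where p: "p s = axis i 1 + axis j 1" "!!r. r : {0..s} ==> (p has_vector_derivative - (A r *v p r)) (at r within {0..s})"
    and pe: "p s \<bullet> (C s *v p s) = p 0 \<bullet> (P 0 *v p 0) + integral {0..s} (%s. p s \<bullet> (\<Sigma> *v p s) + (C s *v p s) \<bullet> (S *v (C s *v p s)))"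
    using ident[OF s(1,2), of i j] unfolding A_def by blast
   have pc: "continuous_on {0..s} p" by (rule derivative_continuous_on[OF p(2)])
   have pb: "norm (p r) <= 2 * exp (L0 * T)" if r: "r : {0..s}" for r
   proof -
    have "norm (p r) <= norm (p s) * exp (L0 * s)"
     by (rule backward_norm_bound[OF _ AL L0'(1) Ac p(2) r]) (use s in auto)
    also have "... <= 2 * exp (L0 * T)"
     using norm_triangle_ineq[of "axis i (1::real)" "axis j 1"] s L0' by (intro mult_mono) (auto simp: p(1) norm_axis_1 intro: mult_left_mono)
    finally show ?thesis .
   qed
   note cs = pc continuous_Icc[OF C(1)] continuous_Icc[OF Pc] continuous_Icc[OF Dc]
   let ?q = "%r. p r \<bullet> (\<Sigma> *v p r) + (C r *v p r) \<bullet> (S *v (C r *v p r))" and ?d = "%r. (D r *v p r) \<bullet> (S *v (D r *v p r))"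
   have "((%r. ?q r - ?d r) has_integral p s \<bullet> (P s *v p s) - p 0 \<bullet> (P 0 *v p 0)) {0..s}"
   proof (rule fundamental_theorem_of_calculus[OF s(2)])
    fix r assume r: "r : {0..s}"
    have sym: "transpose (C r) = C r" using C(2) r by simp
    have "- (A r *v p r) = S *v (C r *v p r) - transpose F *v p r"
     by (simp add: A_def transpose_diff matrix_transpose_mul sym matrix_vector_mult_diff_rdistrib matrix_vector_mul_assoc)
    with riccati_backward_form[OF P _ _ p(2)[OF r]] r
    have "((%r. p r \<bullet> (P r *v p r)) has_real_derivative
     2 * ((S *v (C r *v p r) - transpose F *v p r) \<bullet> (P r *v p r)) + 2 * ((transpose F *v p r) \<bullet> (P r *v p r)) + p r \<bullet> (\<Sigma> *v p r)
     - (P r *v p r) \<bullet> (S *v (P r *v p r))) (at r within {0..s})" by simp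
    moreover have "(S *v (C r *v p r)) \<bullet> (P r *v p r) = (P r *v p r) \<bullet> (S *v (C r *v p r))" by (rule inner_commute)
    ultimately show "((%r. p r \<bullet> (P r *v p r)) has_vector_derivative ?q r - ?d r) (at r within {0..s})"
     using S_commute[of "C r *v p r" "P r *v p r"]
     by (simp add: has_real_derivative_iff_has_vector_derivative D_def matrix_vector_mult_diff_rdistrib matrix_vector_mult_diff_distrib
       inner_diff_left inner_diff_right algebra_simps)
   qed
   from integral_unique[OF this] Henstock_Kurzweil_Integration.integral_diff[of ?q "{0..s}" ?d]
   have "p s \<bullet> (D s *v p s) = integral {0..s} ?d"
    using pe integrable_continuous_real[of 0 s ?q] integrable_continuous_real[of 0 s ?d]
    by (simp add: D_def matrix_vector_mult_diff_rdistrib inner_diff_right continuous_intros cs)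
   also have "\<bar>...\<bar> <= integral {0..s} (%r. norm S * b * (2 * exp (L0 * T))^2 * norm (D r))"
   proof (rule norm_integral_le[where 'a = real, unfolded real_norm_def])
    fix r assume r: "r : {0..s}"
    have "\<bar>?d r\<bar> <= norm (D r *v p r) * norm (S *v (D r *v p r))" by (rule Cauchy_Schwarz_ineq2)
    also have "... <= norm (D r *v p r) * (norm S * norm (D r *v p r))" by (intro mult_left_mono norm_matrix_vector_le norm_ge_zero)
    also have "... = norm S * (norm (D r *v p r) * norm (D r *v p r))" by simp
    also have "... <= norm S * ((norm (D r) * (2 * exp (L0 * T))) * (b * (2 * exp (L0 * T))))"
     using b[of r] pb[OF r] r s L0'
     by (intro mult_left_mono mult_mono order_trans[OF norm_matrix_vector_le]) (auto intro: mult_mono)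
    finally show "\<bar>?d r\<bar> <= norm S * b * (2 * exp (L0 * T))^2 * norm (D r)" by (simp add: power2_eq_square mult_ac)
   qed (intro continuous_intros cs)+
   also have "... = norm S * b * (2 * exp (L0 * T))^2 * integral {0..s} (%r. norm (D r))" by simp
   finally show "\<bar>(axis i 1 + axis j 1) \<bullet> (D s *v (axis i 1 + axis j 1))\<bar> <= norm S * b * (2 * exp (L0 * T))^2 * integral {0..s} (%s. norm (D s))"
    by (simp add: p(1))
  qed
  thus ?thesis by (simp add: k_def mult_ac)
 qed
 have all: "norm (D s) <= 0 + k * integral {0..s} (%s. norm (D s))" if "s : {0..T}" for s
 proof -
  have "norm (D s) - k * integral {0..s} (%s. norm (D s)) <= 0"
   by (rule continuous_le_on_rationals[where a = 0 and b = T and f = "%s. norm (D s) - k * integral {0..s} (%s. norm (D s))"])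
    (use rat T that in "auto intro!: continuous_intros continuous_on_integral_atLeast Dn Dc")
  thus ?thesis by simp
 qed
 have "norm (D t) <= 0 * exp (k * t)"
  by (rule gronwall[OF continuous_Icc[OF Dn] k0 all T(2)])
 thus ?thesis by (simp add: D_def)
qed

end

section \<open>Characteristic functions of stochastic integrals with random integrands\<close>

lemma borel_measurable_vecI:
 fixes f :: "'w => 'b::euclidean_space ^ 'n"
 assumes "!!i. (%w. f w $ i) : borel_measurable G"
 shows "f : borel_measurable G"
proof (rule borel_measurable_euclidean_space[THEN iffD2], rule ballI)
 fix b :: "'b^'n" assume "b : Basis"
 then obtain i u where "b = axis i u" by (auto simp: Basis_vec_def)
 thus "(%w. f w \<bullet> b) : borel_measurable G"
  by (simp add: inner_axis) (intro borel_measurable_inner borel_measurable_const assms)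
qed

text \<open>The test functions may vary with \<open>n\<close>; the conjugate sign of
  \<open>g - c n\<close> turns the hypothesis into convergence in mean, hence almost everywhere
  along a subsequence. Only moduli need a limit \<open>a\<close>, since the phases of
  \<open>c n\<close> may fluctuate with the observations.\<close>

lemma (in prob_space) norm_limit_eq:
 fixes g :: "'a => complex" and c :: "nat => 'a => complex"
 assumes G: "subalgebra M G" and g: "g : borel_measurable G" "!!w. w : space M ==> norm (g w) <= 1"
  and c: "!!n. c n : borel_measurable G" "!!n w. norm (c n w) <= 1"
  and lim: "!!h. (!!n. h n : borel_measurable G) ==> (!!n w. norm (h n w) <= 1) ==>
   (%n. (LINT w|M. h n w * g w) - (LINT w|M. h n w * c n w)) ----> 0"
  and a: "AE w in M. (%n. norm (c n w)) ----> a w"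
 shows "AE w in M. norm (g w) = a w"
proof -
 define h where "h n w = cnj (sgn (g w - c n w))" for n w
 note [measurable] = measurable_from_subalg[OF G g(1)] measurable_from_subalg[OF G c(1)]
 have hG: "h n : borel_measurable G" for n
 proof -
  have d: "(%w. g w - c n w) : borel_measurable G" by (intro borel_measurable_diff g c)
  show ?thesis
   unfolding h_def sgn_div_norm
   by (intro measurable_compose[OF _ borel_measurable_continuous_onI[OF continuous_on_cnj[OF continuous_on_id]]]
     borel_measurable_scaleR borel_measurable_inverse measurable_compose[OF d borel_measurable_norm] d)
 qed
 have hb: "norm (h n w) <= 1" for n w by (simp add: h_def norm_sgn)
 have hm: "h n w * (g w - c n w) = complex_of_real (norm (g w - c n w))" for n w
 proof -
  have "cnj (sgn z) * z = (complex_of_real (norm z))^2 / complex_of_real (norm z)" for z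
   using complex_norm_square[of z] by (simp add: sgn_eq mult.commute)
  thus ?thesis by (simp add: h_def power2_eq_square)
 qed
 have i: "integrable M (%w. h n w * g w)" "integrable M (%w. h n w * c n w)" "integrable M g" "integrable M (c n)" for n
  using measurable_from_subalg[OF G hG] hb g(2) c(2)
  by (intro integrable_const_bound[where B = 1]; auto simp: norm_mult intro!: mult_le_one)+
 have "(LINT w|M. h n w * g w) - (LINT w|M. h n w * c n w) = complex_of_real (LINT w|M. norm (g w - c n w))" for n
  using Bochner_Integration.integral_diff[OF i(1,2), of n n] by (simp only: hm right_diff_distrib[symmetric] integral_complex_of_real)
 with lim[of h, OF hG hb] have "(%n. complex_of_real (LINT w|M. norm (g w - c n w))) ----> 0" by simp
 from tendsto_Re[OF this] have "(%n. LINT w|M. norm (g w - c n w)) ----> 0" by simp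
 from tendsto_L1_AE_subseq[OF Bochner_Integration.integrable_diff[OF i(3,4)] this]
 obtain r where r: "strict_mono r" "AE w in M. (%n. g w - c (r n) w) ----> 0" by blast
 from r(2) a show ?thesis
 proof eventually_elim
  case (elim w)
  from tendsto_norm[OF tendsto_diff[OF tendsto_const[of "g w"] elim(1)]] have "(%n. norm (c (r n) w)) ----> norm (g w)" by simp
  moreover have "(%n. norm (c (r n) w)) ----> a w" using LIMSEQ_subseq_LIMSEQ[OF elim(2) r(1)] by (simp add: o_def)
  ultimately show ?case by (rule LIMSEQ_unique)
 qed
qed

context cond_law_vector
begin

lemma norm_kernel_cis_le: "w : space M ==> norm (LINT x|ka w. cis (l \<bullet> x)) <= 1"
proof -
 assume w: "w : space M"
 interpret K: prob_space "ka w" by (rule kernel(1)[OF w])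
 show ?thesis using integral_norm_bound[of "ka w" "%x. cis (l \<bullet> x)"] by (simp add: K.prob_space)
qed

lemma integral_kernel_cis:
 fixes h :: "'a => complex"
 assumes h: "h : borel_measurable (null_ext M G)" "!!w. norm (h w) <= 1"
 shows "(LINT w|M. h w * (LINT x|ka w. cis (l \<bullet> x))) = (LINT w|M. h w * cis (l \<bullet> X w))"
proof -
 have hM[measurable]: "h : borel_measurable M" by (rule measurable_from_subalg[OF subalgebra_null_ext[OF subG] h(1)])
 \<comment> \<open>\<open>integral_kernel\<close> concerns real functions, so it is applied to real
   and imaginary parts, both covered by a bounded linear \<open>f\<close>.\<close>
 have *: "(LINT w|M. f (h w * (LINT x|ka w. cis (l \<bullet> x)))) = (LINT w|M. f (h w * cis (l \<bullet> X w)))"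
  if f: "bounded_linear f" "!!z. \<bar>f z\<bar> <= cmod z" for f
 proof -
  note [measurable] = borel_measurable_continuous_onI[OF linear_continuous_on[OF f(1)]] h(1)
  have "(LINT w|M. (%(w, x). f (h w * cis (l \<bullet> x))) (w, X w)) = (LINT w|M. (LINT x|ka w. (%(w, x). f (h w * cis (l \<bullet> x))) (w, x)))"
   by (rule integral_kernel[where C = 1]) (measurable, use h(2) in "auto intro!: order_trans[OF f(2)] simp: norm_mult")
  also have "... = (LINT w|M. f (h w * (LINT x|ka w. cis (l \<bullet> x))))"
  proof (rule Bochner_Integration.integral_cong[OF refl])
   fix w assume w: "w : space M"
   interpret K: prob_space "ka w" by (rule kernel(1)[OF w])
   have "complex_integrable (ka w) (%x. h w * cis (l \<bullet> x))"
    by (intro integrable_mult_right K.integrable_const_bound[where B = 1]) (use kernel(2)[OF w] in "auto cong: measurable_cong_sets")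
   from integral_bounded_linear[OF f(1) this] show "(LINT x|ka w. (%(w, x). f (h w * cis (l \<bullet> x))) (w, x)) = f (h w * (LINT x|ka w. cis (l \<bullet> x)))" by simp
  qed
  finally show ?thesis by simp
 qed
 have [measurable]: "(%w. LINT x|ka w. cis (l \<bullet> x)) : borel_measurable M"
  by (rule measurable_from_subalg[OF subalgebra_null_ext[OF subG] integral_kernel_measurable]) measurable
 have "complex_integrable M (%w. h w * (LINT x|ka w. cis (l \<bullet> x)))" "complex_integrable M (%w. h w * cis (l \<bullet> X w))"
  using h(2) norm_kernel_cis_le[of _ l] by (intro integrable_const_bound[where B = 1]; auto simp: norm_mult intro!: mult_le_one)+
 thus ?thesis using *[OF bounded_linear_Re abs_Re_le_cmod] *[OF bounded_linear_Im abs_Im_le_cmod]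
  by (simp only: complex_eq_iff flip: integral_Re integral_Im)
qed

end

context noise_model
begin

text \<open>The weights depend on \<open>G\<close> only, which is independent of the initial state
  and the noises; with the weights frozen, the deterministic formula \<open>noise_cis\<close>
  applies.\<close>

lemma random_integrand_cis:
 fixes h :: "'a => complex" and a :: "nat => 'a => real^'d" and c :: "nat => 'a => real^'k" and p :: "nat => real"
 assumes G: "subalgebra M G" "indep_set (sets G) (sets source)"
  and h: "h : borel_measurable G" "!!w. norm (h w) <= 1" and r: "r : borel_measurable G"
  and ac: "!!i. i < n ==> a i : borel_measurable G" "!!i. i < n ==> c i : borel_measurable G"
  and p: "!!i. 0 <= p i" "!!i. i < n ==> p i <= p (Suc i)"
 shows "(LINT w|M. h w * cis (r w \<bullet> X 0 w + ((SUM i<n. a i w \<bullet> (B (p (Suc i)) w - B (p i) w)) + (SUM i<n. c i w \<bullet> (W (p (Suc i)) w - W (p i) w)))))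
  = (LINT w|M. h w * ((LINT w'|M. cis (r w \<bullet> X 0 w')) * exp (- (SUM i<n. ((norm (a i w))^2 + (norm (c i w))^2) * (p (Suc i) - p i)) / 2)))"
proof -
 define f where "f z = h (fst z) * cis (r (fst z) \<bullet> X 0 (snd z) + ((SUM i<n. a i (fst z) \<bullet> (B (p (Suc i)) (snd z) - B (p i) (snd z)))
  + (SUM i<n. c i (fst z) \<bullet> (W (p (Suc i)) (snd z) - W (p i) (snd z)))))" for z
 note f1 = measurable_compose[OF measurable_fst, of _ G _ source] and f2 = measurable_compose[OF measurable_snd, of _ source _ G]
 have fm: "f : borel_measurable (G \<Otimes>\<^sub>M source)"
  unfolding f_def[abs_def]
  by (intro borel_measurable_times borel_measurable_cis borel_measurable_add borel_measurable_sum borel_measurable_inner borel_measurable_diff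
    f1[OF h(1)] f1[OF r] f1[OF ac(1)] f1[OF ac(2)] f2[OF source_measurable(1)] f2[OF source_measurable(2)] f2[OF source_measurable(3)] p(1)) auto
 have fb: "norm (f (x, y)) <= 1" for x y using h(2) by (simp add: f_def norm_mult)
 have e1: "(LINT w|M. f (w, w)) = (LINT w|M. (LINT w'|M. f (w, w')))"
  by (rule indep_set_integral_split(1)[OF G(1) sub_source(1) G(2) fm fb])
 have e2: "(LINT w'|M. f (w, w')) = h w * ((LINT w'|M. cis (r w \<bullet> X 0 w')) * exp (- (SUM i<n. ((norm (a i w))^2 + (norm (c i w))^2) * (p (Suc i) - p i)) / 2))" for w
 proof -
  have "(LINT w'|M. f (w, w')) = h w * (LINT w'|M. cis (r w \<bullet> X 0 w') * cis ((SUM i<n. a i w \<bullet> (B (p (Suc i)) w' - B (p i) w')) + (SUM i<n. c i w \<bullet> (W (p (Suc i)) w' - W (p i) w'))))"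
   by (simp add: f_def cis_mult)
  also have "(LINT w'|M. cis (r w \<bullet> X 0 w') * cis ((SUM i<n. a i w \<bullet> (B (p (Suc i)) w' - B (p i) w')) + (SUM i<n. c i w \<bullet> (W (p (Suc i)) w' - W (p i) w'))))
   = (LINT w'|M. cis (r w \<bullet> X 0 w')) * exp (- (SUM i<n. ((norm (a i w))^2 + (norm (c i w))^2) * (p (Suc i) - p i)) / 2)"
   by (rule noise_cis[OF ind _ B W]) (use sub sub_proc(1) p in "auto intro!: borel_measurable_cis borel_measurable_inner measurable_proc_sigma")
  finally show ?thesis .
 qed
 show ?thesis using e1 unfolding e2 by (simp only: f_def fst_conv snd_conv)
qed

end

section \<open>The covariance of the mean-field ensemble Kalman filter\<close>

locale enkf_model = noise_model M F \<Sigma> H \<Gamma> SS GG B X W "[proc_sigma M Z {0..}]" Om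
 for M :: "'a measure" and F \<Sigma> :: "real^'d^'d" and H :: "real^'d^'k" and \<Gamma> :: "real^'k^'k"
  and SS :: "real^'d^'d" and GG :: "real^'k^'k" and B X :: "real => 'a => real^'d" and W Z :: "real => 'a => real^'k"
  and Om :: "'a set" +
 fixes \<pi> :: "real => 'a => (real^'d) measure" and J :: "real => 'a => real^'d" and \<mu> :: "(real^'d) measure"
 assumes Z: "!!t. 0 <= t ==> Z t : borel_measurable M" and X: "!!t. 0 <= t ==> X t : borel_measurable M"
  and law: "!!t. 0 <= t ==> cond_law M (proc_sigma M Z {0..t}) (X t) (\<pi> t)"
  and \<pi>_path: "!!w. w : Om ==> P2_continuous (%t. \<pi> t w)"
  and Z_path: "!!w. w : Om ==> continuous_on {0..} (%s. Z s w)" "!!w. w : Om ==> Z 0 w = 0"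
  and X_path: "!!w. w : Om ==> continuous_on {0..} (%s. X s w)"
   "!!w t. w : Om ==> 0 <= t ==> X t w = X 0 w + integral {0..t} (%s. F *v X s w) + SS *v B t w - J t w"
  and ito: "!!t. 0 <= t ==> has_ito_integral M (%s w. cov_matrix (\<pi> s w) ** transpose H ** matrix_inv \<Gamma>)
   (%s w. integral {0..s} (%r. H *v X r w) + GG *v W s w - Z s w) t (J t)"
  and \<mu>: "distr M borel (X 0) = \<mu>" "\<mu> : P2"
begin

abbreviation innov :: "real => 'a => real^'k" where
 "innov s w == integral {0..s} (%r. H *v X r w) + GG *v W s w - Z s w"

abbreviation obs :: "real => 'a measure" where "obs t == null_ext M (proc_sigma M Z {0..t})"

lemma sub_Z: "subalgebra M (proc_sigma M Z {0..t})" and sub_Z': "subalgebra M (proc_sigma M Z {0..})"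
 by (rule subalgebra_proc_sigma; use Z in auto)+

lemma sub_obs: "subalgebra M (obs t)"
 by (rule subalgebra_null_ext[OF sub_Z])

lemma obs_mono: "s <= t ==> f : borel_measurable (obs s) ==> f : borel_measurable (obs t)"
proof (rule measurable_from_subalg[of "obs t" "obs s"])
 assume "s <= t"
 hence "sets (proc_sigma M Z {0..s}) <= sets (obs t)"
  using sets_proc_sigma_mono[of "{0..s}" "{0..t}" M Z] sets_subset_null_ext[OF sub_Z] by force
 thus "subalgebra (obs t) (obs s)"
  using null_ext_least[OF sub_Z sub_Z] by (simp add: subalgebra_def)
qed

lemma indep_obs: "indep_set (sets (obs t)) (sets source)"
proof -
 let ?J = "sigma_join M [proc_sigma M Z {0..}]"
 have s: "G : set ([proc_sigma M X {0}, proc_sigma M B {0..}, proc_sigma M W {0..}] @ [proc_sigma M Z {0..}] @ []) ==> subalgebra M G" for G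
  using sub_proc sub_Z' by auto
 have "indep_set (sets source) (sets ?J)"
  unfolding source_def by (rule mutually_indep_join[OF _ s]) (use ind in simp)
 moreover have sJ: "subalgebra M ?J" "subalgebra ?J (proc_sigma M Z {0..})"
  by (rule subalgebra_sigma_join subalgebra_sigma_join_member; use sub_Z' in auto)+
 ultimately have 1: "indep_set (sets (null_ext M ?J)) (sets (null_ext M source))"
  using indep_set_null_ext[OF indep_set_sym _ sub_source(1)] by blast
 have "sets (proc_sigma M Z {0..t}) <= sets (null_ext M ?J)"
 proof -
  have "sets (proc_sigma M Z {0..t}) <= sets (proc_sigma M Z {0..})" by (rule sets_proc_sigma_mono) auto
  thus ?thesis using sJ(2) sets_subset_null_ext[OF sJ(1)] unfolding subalgebra_def by blast
 qed
 hence "sets (obs t) <= sets (null_ext M ?J)" by (rule null_ext_least[OF sub_Z sJ(1)])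
 thus ?thesis by (rule indep_set_mono[OF 1]) (use sets_subset_null_ext[OF sub_source(1)] in auto)
qed

lemma Z_on_event:
 shows "continuous_on {0..} (%s. on_event Om Z s w)" and "0 <= s ==> s <= t ==> on_event Om Z s : borel_measurable (obs t)"
proof -
 show "continuous_on {0..} (%s. on_event Om Z s w)" by (rule on_event_continuous[OF Z_path(1)])
 show "on_event Om Z s : borel_measurable (obs t)" if "0 <= s" "s <= t"
  by (rule measurable_on_event[OF sub_Z Om measurable_proc_sigma]) (use that in auto)
qed

lemma \<pi>_P2: "w : Om ==> 0 <= t ==> \<pi> t w : P2"
 using \<pi>_path by (auto simp: P2_continuous_def)

definition cv :: "real => 'a => real^'d^'d" where
 "cv = on_event Om (%s w. cov_matrix (\<pi> s w))"

definition cgain :: "real => 'a => real^'k^'d" where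
 "cgain s w = cv s w ** transpose H ** matrix_inv \<Gamma>"

lemma cv_entry: "0 <= s ==> cv s w $ i $ j = (if w : Om then (LINT x|\<pi> s w. x $ i * x $ j) - (LINT x|\<pi> s w. x $ i) * (LINT x|\<pi> s w. x $ j) else 0)"
 by (simp add: cv_def on_event_def cov_matrix_entry[OF \<pi>_P2])

lemma cv_continuous: "continuous_on {0..} (%s. cv s w)"
 unfolding cv_def
proof (rule on_event_continuous)
 fix w assume w: "w : Om"
 have i: "continuous_on {0..} (%t. LINT x|\<pi> t w. f x)" if "continuous_on UNIV f" "!!x. \<bar>f x\<bar> <= 1 * (1 + (norm x)^2)" for f
  using \<pi>_path[OF w] that unfolding P2_continuous_def by blast
 have "continuous_on {0..} (%s. \<chi> i j. (LINT x|\<pi> s w. x $ i * x $ j) - (LINT x|\<pi> s w. x $ i) * (LINT x|\<pi> s w. x $ j))"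
  by (intro continuous_on_vec_lambda continuous_intros i growth_bounds)
 thus "continuous_on {0..} (%s. cov_matrix (\<pi> s w))"
  by (rule continuous_on_eq) (simp add: vec_eq_iff cov_matrix_entry[OF \<pi>_P2[OF w]])
qed

lemma cv_sym: "transpose (cv s w) = cv s w"
 by (simp add: cv_def on_event_def transpose_cov_matrix) (simp add: transpose_def vec_eq_iff)

lemma cv_measurable:
 assumes s: "0 <= s" "s <= t"
 shows "cv s : borel_measurable (obs t)"
proof (rule obs_mono[OF s(2)], intro borel_measurable_vecI)
 fix i j
 interpret L: cond_law M "proc_sigma M Z {0..s}" "X s" "\<pi> s" by (rule law[OF s(1)])
 have O: "Om \<inter> space (obs s) : sets (obs s)" using sets_null_ext_AE[OF sub_Z Om] by blast
 show "(%w. cv s w $ i $ j) : borel_measurable (obs s)"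
  unfolding cv_entry[OF s(1)]
  by (intro O measurable_If_set borel_measurable_diff borel_measurable_times L.integral_kernel_measurable borel_measurable_const)
   measurable
qed

lemma cgain_continuous: "continuous_on {0..} (%s. cgain s w)"
 unfolding cgain_def by (intro continuous_intros cv_continuous)

lemma cgain_measurable: "0 <= s ==> s <= t ==> cgain s : borel_measurable (obs t)"
 unfolding cgain_def[abs_def]
 by (intro borel_measurable_bounded_bilinear[OF bilinear_matrix_mult] cv_measurable borel_measurable_const)

text \<open>Convergence in probability at single times is upgraded to almost sure control at the
  coarse points. For each \<open>n\<close> there are \<open>n + 2\<close> of them, so one refinement
  \<open>m n\<close> serves all. The tolerance \<open>eps n\<close> adds up over these points to
  \<open>(1/2)^n\<close>, which is summable, and the Borel-Cantelli lemma applies.\<close>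

lemma ito_partition:
 assumes t: "0 <= t"
 obtains m :: "nat => nat" where "!!n. 0 < m n"
  "AE w in M. \<forall>\<^sub>F n in sequentially. ALL i<=Suc n. norm ((SUM j<i * m n. cgain (real j * t / (Suc n * m n)) w *v
   (innov (real (Suc j) * t / (Suc n * m n)) w
    - innov (real j * t / (Suc n * m n)) w))
   - J (real i * t / Suc n) w) <= (1/2)^n / real (Suc (Suc n))"
proof -
 define K where "K s w = cov_matrix (\<pi> s w) ** transpose H ** matrix_inv \<Gamma>" for s w
 define V where "V s w = innov s w" for s w
 define eps where "eps n = (1/2)^n / real (Suc (Suc n))" for n :: nat
 have eps: "0 < eps n" for n by (simp add: eps_def)
 define err where "err n m i w = norm ((SUM j<i * m. K (real j * t / (Suc n * m)) w *v (V (real (Suc j) * t / (Suc n * m)) w - V (real j * t / (Suc n * m)) w))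
   - J (real i * t / Suc n) w)" for n m i w
 have "EX m E. 0 < m & (ALL i<=Suc n. E i : sets M & measure M (E i) < eps n & {w : space M. eps n < err n m i w} <= E i)" for n
 proof -
  define Q where "Q i dl \<longleftrightarrow> (ALL k. ALL p :: nat => real. p 0 = 0 & p k = real i * t / Suc n & (ALL j<k. p j <= p (Suc j) & p (Suc j) - p j < dl) -->
    (EX E:sets M. measure M E < eps n & {w : space M. eps n < norm ((SUM j<k. K (p j) w *v (V (p (Suc j)) w - V (p j) w)) - J (real i * t / Suc n) w)} <= E))"
   for i dl
  have "EX dl>0. Q i dl" for i
   using ito[of "real i * t / Suc n"] t eps[of n] unfolding Q_def has_ito_integral_def K_def V_def by auto
  then obtain dl where dl: "!!i. 0 < dl i" "!!i. Q i (dl i)" by metis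
  define d where "d = Min (dl ` {..Suc n})"
  have d: "0 < d" "!!i. i <= Suc n ==> d <= dl i" using dl(1) by (auto simp: d_def)
  obtain m :: nat where m: "t / d < m" using reals_Archimedean2 by blast
  have m0: "0 < m" using m d t by (metis divide_nonneg_pos of_nat_0_less_iff order_le_less_trans)
  have "EX E. E : sets M & measure M E < eps n & {w : space M. eps n < err n m i w} <= E" if i: "i <= Suc n" for i
  proof -
   have "t / real (Suc n * m) <= t / real m" using m0 t by (intro divide_left_mono) (auto intro!: mult_pos_pos add_pos_nonneg)
   also have "... < d" using m m0 d(1) by (simp add: field_simps)
   also note d(2)[OF i]
   finally have st: "t / real (Suc n * m) < dl i" .
   have q: "real (i * m) * t / real (Suc n * m) = real i * t / real (Suc n)"
    unfolding of_nat_mult using m0 by (simp del: of_nat_Suc)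
   have "real (Suc j) * t / real (Suc n * m) - real j * t / real (Suc n * m) = t / real (Suc n * m)" for j
    by (simp only: diff_divide_distrib[symmetric] left_diff_distrib[symmetric]) simp
   moreover have "0 <= t / real (Suc n * m)" using t by simp
   ultimately have "real j * t / real (Suc n * m) <= real (Suc j) * t / real (Suc n * m) &
     real (Suc j) * t / real (Suc n * m) - real j * t / real (Suc n * m) < dl i" for j
    using st by (smt (verit))
   hence "EX E:sets M. measure M E < eps n & {w : space M. eps n < err n m i w} <= E"
    unfolding err_def
    by (intro dl(2)[unfolded Q_def, rule_format, where p = "%j. real j * t / real (Suc n * m)"] conjI allI impI)
     (simp_all add: q del: of_nat_Suc of_nat_mult mult_Suc)
   thus ?thesis by blast
  qed
  hence "ALL i. EX E. i <= Suc n --> E : sets M & measure M E < eps n & {w : space M. eps n < err n m i w} <= E" by blast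
  from choice[OF this] m0 show ?thesis by blast
 qed
 hence "ALL n. EX m. EX E. 0 < m & (ALL i<=Suc n. E i : sets M & measure M (E i) < eps n & {w : space M. eps n < err n m i w} <= E i)" ..
 from choice[OF this] obtain m where "ALL n. EX E. 0 < m n & (ALL i<=Suc n. E i : sets M & measure M (E i) < eps n & {w : space M. eps n < err n (m n) i w} <= E i)" ..
 from choice[OF this] obtain A where mE: "!!n. 0 < m n"
  "!!n i. i <= Suc n ==> A n i : sets M & measure M (A n i) < eps n & {w : space M. eps n < err n (m n) i w} <= A n i"
  by blast
 define E where "E n = (\<Union>i\<le>Suc n. A n i)" for n
 have EM: "E n : sets M" for n unfolding E_def using mE(2) by (intro sets.finite_UN) auto
 have Em: "measure M (E n) <= (1/2)^n" for n
 proof -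
  have "measure M (E n) <= (SUM i<=Suc n. measure M (A n i))"
   unfolding E_def by (rule finite_measure_subadditive_finite) (use mE(2) in auto)
  also have "... <= (SUM i<=Suc n. eps n)" by (rule sum_mono) (use mE(2) in "auto intro: less_imp_le")
  also have "... = (1/2)^n" by (simp only: sum_constant card_atMost eps_def) simp
  finally show ?thesis .
 qed
 have "summable (%n. measure M (E n))"
  by (rule summable_comparison_test'[OF summable_geometric[of "1/2 :: real"], where N = 0]) (use Em in auto)
 hence "AE w in M. \<forall>\<^sub>F n in sequentially. w : space M - E n"
  by (intro borel_cantelli_AE1 EM) (auto simp: emeasure_eq_measure)
 hence "AE w in M. \<forall>\<^sub>F n in sequentially. ALL i<=Suc n. err n (m n) i w <= eps n"
 proof eventually_elim
  case (elim w)
  thus ?case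
  proof eventually_elim
   case (elim n)
   show ?case
   proof (intro allI impI, rule ccontr)
    fix i assume "i <= Suc n" "~  err n (m n) i w <= eps n"
    hence "w : E n" using mE(2)[of i n] elim unfolding E_def by (auto simp: not_le)
    thus False using elim by simp
   qed
  qed
 qed
 with Om(2) have "AE w in M. \<forall>\<^sub>F n in sequentially. ALL i<=Suc n. norm ((SUM j<i * m n. cgain (real j * t / (Suc n * m n)) w *v
   (V (real (Suc j) * t / (Suc n * m n)) w - V (real j * t / (Suc n * m n)) w)) - J (real i * t / Suc n) w) <= eps n"
 proof eventually_elim
  case (elim w)
  thus ?case by (simp only: err_def K_def cgain_def cv_def on_event_def if_True)
 qed
 thus thesis using that[of m] mE(1) unfolding V_def eps_def by blast
qed

end

section \<open>The conditional characteristic function of an ensemble member\<close>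

context enkf_model
begin

lemma initial_cis: "(LINT w|M. cis (v \<bullet> X 0 w)) = (LINT x|\<mu>. cis (v \<bullet> x))"
 unfolding \<mu>(1)[symmetric] by (rule integral_distr[symmetric, OF X0]) (intro borel_measurable_cis borel_measurable_inner borel_measurable_const measurable_ident_sets refl)

text \<open>\<open>lam\<close> solves the dual equation with the random drift and thus depends on
  the observations up to \<open>t\<close>; this is harmless, because those are what is conditioned
  on. Given them, the functional of \<open>X t\<close> consists of a known phase, an initial term
  and a Gaussian of variance \<open>Q\<close>, and the modulus removes the phase.\<close>

lemma norm_kernel_cis:
 assumes t: "0 <= t"
  and lam: "!!w s. s : {0..t} ==> ((%s. lam s w) has_vector_derivative - (transpose (F - cv s w ** S) *v lam s w)) (at s within {0..t})"
  and lm: "!!s. s : {0..t} ==> lam s : borel_measurable (obs t)" and lt: "!!w. lam t w = l"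
 defines "Q == %w. integral {0..t} (%s. lam s w \<bullet> (\<Sigma> *v lam s w) + (cv s w *v lam s w) \<bullet> (S *v (cv s w *v lam s w)))"
 shows "AE w in M. norm (LINT x|\<pi> t w. cis (l \<bullet> x)) = norm (LINT x|\<mu>. cis (lam 0 w \<bullet> x)) * exp (- Q w / 2)"
proof -
 interpret L: cond_law_vector M "proc_sigma M Z {0..t}" "X t" "\<pi> t" by (rule cond_law_vector.intro[OF law[OF t]])
 obtain m :: "nat => nat" where m: "!!n. 0 < m n" and err: "AE w in M. \<forall>\<^sub>F n in sequentially. ALL i<=Suc n. norm ((SUM j<i * m n. cgain (real j * t / (Suc n * m n)) w *v
   (innov (real (Suc j) * t / (Suc n * m n)) w
    - innov (real j * t / (Suc n * m n)) w))
   - J (real i * t / Suc n) w) <= (1/2)^n / real (Suc (Suc n))"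
  using ito_partition[OF t] by blast
 define N where "N n = Suc n * m n" for n
 define r where "r n j = real j * t / N n" for n j
 define q where "q n j = real (j div m n) * t / Suc n" for n j
 have r: "r n j : {0..t}" if "j <= N n" for n j unfolding r_def by (rule partition_in[OF that t])
 have r0: "0 <= r n j" "r n j <= r n (Suc j)" for n j unfolding r_def using t by (auto intro!: divide_right_mono mult_right_mono)
 have q: "q n j : {0..t}" if "j < N n" for n j
 proof -
  have "j div m n < Suc n" using that m[of n] by (simp add: N_def less_mult_imp_div_less)
  thus ?thesis unfolding q_def by (intro partition_in t) simp
 qed
 define a where "a n j w = SS *v lam (q n j) w" for n j w
 define d where "d n j w = transpose (cgain (r n j) w) *v lam (q n j) w" for n j w
 define c where "c n j w = - (GG *v d n j w)" for n j w
 \<comment> \<open>The contribution of the observations to the discretized functional. It is known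
   given the observations, hence a pure phase, and needs no limit of its own.\<close>
 define ze where "ze n w = (SUM j<N n. d n j w \<bullet> (on_event Om Z (r n (Suc j)) w - on_event Om Z (r n j) w))" for n w
 define Y where "Y n w = (SUM j<N n. a n j w \<bullet> (B (r n (Suc j)) w - B (r n j) w)) + (SUM j<N n. c n j w \<bullet> (W (r n (Suc j)) w - W (r n j) w))" for n w
 define v where "v n w = (SUM j<N n. ((norm (a n j w))^2 + (norm (c n j w))^2) * (r n (Suc j) - r n j))" for n w
 \<comment> \<open>The conditional characteristic function of the discretized functional given the
   observations; its modulus is explicit and converges for every sample point.\<close>
 define cc where "cc n w = cis (ze n w) * ((LINT w'|M. cis (lam 0 w \<bullet> X 0 w')) * exp (- v n w / 2))" for n w
 have lamc: "continuous_on {0..t} (%s. lam s w)" for w by (rule derivative_continuous_on[OF lam])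
 have am: "a n j : borel_measurable (obs t)" if "j < N n" for n j
  unfolding a_def[abs_def] by (intro borel_measurable_matrix_vector lm q that)
 have dm: "d n j : borel_measurable (obs t)" if "j < N n" for n j
  unfolding d_def[abs_def]
  by (intro borel_measurable_bounded_bilinear[OF bilinear_matrix_vector] lm q that
    measurable_compose[OF _ borel_measurable_continuous_onI[OF continuous_on_transpose[OF continuous_on_id]]] cgain_measurable)
   (use r[of j n] that in auto)
 have cm: "c n j : borel_measurable (obs t)" if "j < N n" for n j
  unfolding c_def[abs_def] by (intro borel_measurable_uminus borel_measurable_matrix_vector dm that)
 have zem: "ze n : borel_measurable (obs t)" for n
  unfolding ze_def[abs_def] by (intro borel_measurable_sum borel_measurable_inner borel_measurable_diff dm Z_on_event(2) r0)
   (use r in "auto simp: Suc_le_eq")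
 have l0: "lam 0 : borel_measurable (obs t)" by (rule lm) (use t in simp)
 have \<mu>m: "(%w. LINT w'|M. cis (lam 0 w \<bullet> X 0 w')) : borel_measurable (obs t)"
 proof -
  have "(%z. cis (lam 0 (fst z) \<bullet> X 0 (snd z))) : borel_measurable (obs t \<Otimes>\<^sub>M source)"
   by (intro borel_measurable_cis borel_measurable_inner measurable_compose[OF measurable_fst l0] measurable_compose[OF measurable_snd source_measurable(1)])
  from indep_set_integral_split(2)[OF sub_obs sub_source(1) indep_obs this, of 1] show ?thesis by simp
 qed
 have vm: "v n : borel_measurable (obs t)" for n
  unfolding v_def[abs_def]
  by (intro borel_measurable_sum borel_measurable_times borel_measurable_add borel_measurable_power borel_measurable_const
    measurable_compose[OF am borel_measurable_norm] measurable_compose[OF cm borel_measurable_norm]) auto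
 have v0: "0 <= v n w" for n w unfolding v_def by (intro sum_nonneg mult_nonneg_nonneg) (use r0 in auto)
 have ccm: "cc n : borel_measurable (obs t)" for n
  unfolding cc_def[abs_def]
  by (intro borel_measurable_times borel_measurable_cis zem \<mu>m measurable_compose[OF _ borel_measurable_of_real] measurable_compose[OF _ borel_measurable_exp] borel_measurable_divide borel_measurable_uminus vm borel_measurable_const)
 have m1: "norm (LINT w'|M. cis (u \<bullet> X 0 w')) <= 1" for u
  using integral_norm_bound[of M "%w'. cis (u \<bullet> X 0 w')"] by (simp add: prob_space)
 have ccn: "norm (cc n w) = norm (LINT x|\<mu>. cis (lam 0 w \<bullet> x)) * exp (- v n w / 2)" for n w
  by (simp add: cc_def norm_mult initial_cis)
 have cc1: "norm (cc n w) <= 1" for n w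
  unfolding ccn using m1[of "lam 0 w"] v0[of n w] by (intro mult_le_one) (auto simp: initial_cis)
 have "v n w = (SUM j<N n. ((norm (SS *v lam (q n j) w))^2 + (norm (GG *v (transpose (cgain (r n j) w) *v lam (q n j) w)))^2) * (t / N n))" for n w
 proof -
  have "r n (Suc j) - r n j = t / N n" for j by (simp only: r_def diff_divide_distrib[symmetric] left_diff_distrib[symmetric]) simp
  thus ?thesis by (simp add: v_def a_def c_def d_def)
 qed
 moreover have "continuous_on ({0..t} \<times> {0..t}) (%z. (norm (SS *v lam (snd z) w))^2 + (norm (GG *v (transpose (cgain (fst z) w) *v lam (snd z) w)))^2)" for w
  by (intro continuous_intros continuous_on_compose2[OF lamc] continuous_on_compose2[OF continuous_Icc[OF cgain_continuous]]) auto
 from two_scale_riemann_sum_tendsto[where m = m, OF t m this]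
 have "(%n. SUM j<N n. ((norm (SS *v lam (q n j) w))^2 + (norm (GG *v (transpose (cgain (r n j) w) *v lam (q n j) w)))^2) * (t / N n))
  ----> integral {0..t} (%s. (norm (SS *v lam s w))^2 + (norm (GG *v (transpose (cgain s w) *v lam s w)))^2)" for w
  by (simp only: N_def q_def r_def)
 moreover have "(norm (SS *v u))^2 + (norm (GG *v (transpose (cgain s w) *v u)))^2 = u \<bullet> (\<Sigma> *v u) + (cv s w *v u) \<bullet> (S *v (cv s w *v u))" for u s w
 proof -
  have "(norm (SS *v u))^2 = u \<bullet> (\<Sigma> *v u)"
   unfolding SS_props(2)[symmetric] matrix_vector_mul_assoc[symmetric] power2_norm_eq_inner by (metis inner_matrix SS_props(1))
  moreover have "(norm (GG *v y))^2 = y \<bullet> (\<Gamma> *v y)" for y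
   unfolding GG_props(2)[symmetric] matrix_vector_mul_assoc[symmetric] power2_norm_eq_inner by (metis inner_matrix GG_props(1))
  moreover have "transpose (cgain s w) *v u = matrix_inv \<Gamma> *v (H *v (cv s w *v u))"
   by (simp add: cgain_def matrix_transpose_mul cv_sym matrix_vector_mul_assoc matrix_mul_assoc)
  moreover have "\<Gamma> *v (matrix_inv \<Gamma> *v y) = y" for y by (simp add: matrix_vector_mul_assoc)
  ultimately show ?thesis by (simp add: S_inner inner_commute)
 qed
 ultimately have vQ: "(%n. v n w) ----> Q w" for w by (simp add: Q_def)
 have lim: "(%n. norm (cc n w)) ----> norm (LINT x|\<mu>. cis (lam 0 w \<bullet> x)) * exp (- Q w / 2)" for w
  unfolding ccn by (intro tendsto_intros vQ) simp
 have conv: "AE w in M. (%n. ze n w + (lam 0 w \<bullet> X 0 w + Y n w)) ----> l \<bullet> X t w"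
  using err Om(2)
 proof eventually_elim
  case (elim w)
  note w = elim(2)
  have "(%n. (SUM j<N n. lam (q n j) w \<bullet> (SS *v (B (r n (Suc j)) w - B (r n j) w)))
   - (SUM j<N n. lam (q n j) w \<bullet> (cgain (r n j) w *v (GG *v (W (r n (Suc j)) w - W (r n j) w))))
   + (SUM j<N n. lam (q n j) w \<bullet> (cgain (r n j) w *v (Z (r n (Suc j)) w - Z (r n j) w)))) ----> lam t w \<bullet> X t w - lam 0 w \<bullet> X 0 w"
   unfolding N_def q_def r_def
  proof (rule ito_path_sum_tendsto[where b = "%s. B s w" and x = "%s. X s w" and J = "%s. J s w" and F = F and H = H and K = "%s. cgain s w" and l = "%s. lam s w"
    and m = m, OF t m B_path[OF w] X_path[OF w] lam _ _ _ elim(1)])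
   show "continuous_on {0..t} (%s. - (transpose (F - cv s w ** S) *v lam s w))"
    by (intro continuous_intros lamc continuous_Icc[OF cv_continuous])
   show "continuous_on {0..t} (%s. cgain s w)" by (rule continuous_Icc[OF cgain_continuous])
   show "- (transpose (F - cv s w ** S) *v lam s w) \<bullet> X s w + lam s w \<bullet> (F *v X s w) = lam s w \<bullet> (cgain s w *v (H *v X s w))" for s
    by (simp add: inner_matrix[symmetric] cgain_def S_def matrix_vector_mult_diff_rdistrib inner_diff_right matrix_vector_mul_assoc matrix_mul_assoc)
  qed
  moreover have "lam s w \<bullet> (SS *v x) = (SS *v lam s w) \<bullet> x" for s x by (metis inner_matrix SS_props(1))
  moreover have "(transpose K *v lam s w) \<bullet> (GG *v x) = (GG *v (transpose K *v lam s w)) \<bullet> x" for K s and x by (metis inner_matrix GG_props(1))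
  ultimately have "(%n. Y n w + ze n w) ----> l \<bullet> X t w - lam 0 w \<bullet> X 0 w"
   using w by (simp add: Y_def ze_def a_def c_def d_def lt on_event_def inner_matrix[of _ "cgain _ _"] sum_negf)
  from tendsto_add[OF this tendsto_const[of "lam 0 w \<bullet> X 0 w"]] show ?case by (simp add: add_ac)
 qed
 have Ym: "Y n : borel_measurable M" for n unfolding Y_def[abs_def]
  by (intro borel_measurable_add borel_measurable_sum borel_measurable_inner borel_measurable_diff measurable_from_subalg[OF sub_obs am]
    measurable_from_subalg[OF sub_obs cm] BM_measurable[OF B] BM_measurable[OF W] r0) auto
 show ?thesis
 proof (rule norm_limit_eq[OF sub_obs _ L.norm_kernel_cis_le ccm cc1])
  show "(%w. LINT x|\<pi> t w. cis (l \<bullet> x)) : borel_measurable (obs t)" by (rule L.integral_kernel_measurable) measurable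
  show "AE w in M. (%n. norm (cc n w)) ----> norm (LINT x|\<mu>. cis (lam 0 w \<bullet> x)) * exp (- Q w / 2)" using lim by simp
  fix h :: "nat => 'a => complex" assume h: "!!n. h n : borel_measurable (obs t)" "!!n w. norm (h n w) <= 1"
  let ?A = "%n w. ze n w + (lam 0 w \<bullet> X 0 w + Y n w)"
  note [measurable] = measurable_from_subalg[OF sub_obs h(1)] measurable_from_subalg[OF sub_obs zem] measurable_from_subalg[OF sub_obs l0] Ym X[OF t] X0
  have "(LINT w|M. h n w * cc n w) = (LINT w|M. h n w * cis (?A n w))" for n
  proof -
   have "(LINT w|M. (h n w * cis (ze n w)) * cis (lam 0 w \<bullet> X 0 w + Y n w))
    = (LINT w|M. (h n w * cis (ze n w)) * ((LINT w'|M. cis (lam 0 w \<bullet> X 0 w')) * exp (- v n w / 2)))"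
    unfolding Y_def v_def
    by (rule random_integrand_cis[OF sub_obs indep_obs]) (use h am cm l0 r0 in "auto simp: norm_mult intro!: borel_measurable_times borel_measurable_cis zem")
   thus ?thesis by (simp add: cc_def mult.assoc cis_mult)
  qed
  moreover have "(LINT w|M. h n w * (LINT x|\<pi> t w. cis (l \<bullet> x))) = (LINT w|M. h n w * cis (l \<bullet> X t w))" for n
   by (rule L.integral_kernel_cis[OF h])
  moreover have i: "complex_integrable M (%w. h n w * cis (l \<bullet> X t w))" "complex_integrable M (%w. h n w * cis (?A n w))" for n
   using h(2) by (intro integrable_const_bound[where B = 1]; simp add: norm_mult)+
  have "(%n. LINT w|M. h n w * (cis (l \<bullet> X t w) - cis (?A n w))) ----> (LINT w|M. 0)"
  proof (rule integral_dominated_convergence[where w = "%_. 2"])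
   show "AE w in M. (%n. h n w * (cis (l \<bullet> X t w) - cis (?A n w))) ----> 0"
    using conv
   proof eventually_elim
    case (elim w)
    have "(%n. cis (l \<bullet> X t w) - cis (?A n w)) ----> cis (l \<bullet> X t w) - cis (l \<bullet> X t w)" by (intro tendsto_intros elim)
    hence "(%n. norm (cis (l \<bullet> X t w) - cis (?A n w))) ----> 0" by (simp add: tendsto_norm_zero)
    thus ?case
     by (rule Lim_null_comparison[rotated])
      (use h(2) in "auto simp: norm_mult intro!: always_eventually mult_left_le_one_le")
   qed
   show "AE w in M. norm (h n w * (cis (l \<bullet> X t w) - cis (?A n w))) <= 2" for n
   proof (rule AE_I2)
    fix w
    have "norm (cis (l \<bullet> X t w) - cis (?A n w)) <= 2" using norm_triangle_ineq4[of "cis (l \<bullet> X t w)" "cis (?A n w)"] by simp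
    with mult_mono[OF h(2)[of n w] this] show "norm (h n w * (cis (l \<bullet> X t w) - cis (?A n w))) <= 2" by (simp add: norm_mult)
   qed
   show "(%w. h n w * (cis (l \<bullet> X t w) - cis (?A n w))) : borel_measurable M" for n
    using borel_measurable_integrable[OF Bochner_Integration.integrable_diff[OF i(1)[of n] i(2)[of n]]] by (simp only: right_diff_distrib)
  qed auto
  ultimately show "(%n. (LINT w|M. h n w * (LINT x|\<pi> t w. cis (l \<bullet> x))) - (LINT w|M. h n w * cc n w)) ----> 0"
   using i by (simp add: right_diff_distrib)
 qed
qed

end

section \<open>The Riccati equation for the ensemble covariance\<close>

context enkf_model
begin

lemma scaled_exp_tendsto: "(%n. (real (Suc n))^2 * (1 - exp (- a / (real (Suc n))^2))) ----> a"
 by (real_asymp simp: power2_eq_square)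

text \<open>The identity for moduli is used for all multiples \<open>1 / real (Suc n)\<close> of
  \<open>l\<close>. The dual solution scales linearly and the exponent quadratically, so comparing
  second-order terms gives the identity for the covariances.\<close>

lemma covariance_identity:
 assumes t: "0 <= t"
 shows "AE w in M. EX p. p t = l &
   (ALL s:{0..t}. (p has_vector_derivative - (transpose (F - cv s w ** S) *v p s)) (at s within {0..t})) &
   p t \<bullet> (cv t w *v p t) = p 0 \<bullet> (cov_matrix \<mu> *v p 0) + integral {0..t} (%s. p s \<bullet> (\<Sigma> *v p s) + (cv s w *v p s) \<bullet> (S *v (cv s w *v p s)))"
proof -
 define lam where "lam s w = backward_sol (%s. transpose (F - cv s w ** S)) t l s" for s w
 have Ac: "continuous_on {0..t} (%s. transpose (F - cv s w ** S))" for w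
  by (intro continuous_intros continuous_Icc[OF cv_continuous])
 have lt: "lam t w = l" and
  lam: "s : {0..t} ==> ((%s. lam s w) has_vector_derivative - (transpose (F - cv s w ** S) *v lam s w)) (at s within {0..t})" for s w
  unfolding lam_def by (rule backward_sol[OF Ac t]; assumption?)+
 have lm: "lam s : borel_measurable (obs t)" if s: "s : {0..t}" for s
  unfolding lam_def[abs_def] backward_sol_def
 proof (rule borel_measurable_vsol[OF bilinear_matrix_vector])
  show "(%w. transpose (F - cv (t - r) w ** S)) : borel_measurable (obs t)" if "r : {0..t - s}" for r
   by (intro measurable_compose[OF _ borel_measurable_continuous_onI[OF continuous_on_transpose[OF continuous_on_id]]]
     borel_measurable_diff borel_measurable_const borel_measurable_bounded_bilinear[OF bilinear_matrix_mult] cv_measurable)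
    (use that s in auto)
  show "continuous_on {0..t - s} (%r. transpose (F - cv (t - r) w ** S))" for w
   by (intro continuous_intros continuous_on_compose2[OF cv_continuous]) (use s in auto)
 qed (use s in auto)
 define Q where "Q w = integral {0..t} (%s. lam s w \<bullet> (\<Sigma> *v lam s w) + (cv s w *v lam s w) \<bullet> (S *v (cv s w *v lam s w)))" for w
 have "AE w in M. ALL n. norm (LINT x|\<pi> t w. cis ((1 / real (Suc n)) *\<^sub>R l \<bullet> x))
  = norm (LINT x|\<mu>. cis ((1 / real (Suc n)) *\<^sub>R lam 0 w \<bullet> x)) * exp (- (Q w / (real (Suc n))^2) / 2)"
  unfolding AE_all_countable
 proof
  fix n
  let ?u = "1 / real (Suc n)"
  have "AE w in M. norm (LINT x|\<pi> t w. cis (?u *\<^sub>R l \<bullet> x)) = norm (LINT x|\<mu>. cis (?u *\<^sub>R lam 0 w \<bullet> x))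
   * exp (- integral {0..t} (%s. (?u *\<^sub>R lam s w) \<bullet> (\<Sigma> *v (?u *\<^sub>R lam s w)) + (cv s w *v (?u *\<^sub>R lam s w)) \<bullet> (S *v (cv s w *v (?u *\<^sub>R lam s w)))) / 2)"
  proof (rule norm_kernel_cis[OF t])
   show "((%s. ?u *\<^sub>R lam s w) has_vector_derivative - (transpose (F - cv s w ** S) *v ?u *\<^sub>R lam s w)) (at s within {0..t})"
    if "s : {0..t}" for s w
    using bounded_linear.has_vector_derivative[OF bounded_linear_scaleR_right lam[OF that], of ?u] by (simp add: matrix_vector_mult_scaleR)
   show "(%w. ?u *\<^sub>R lam s w) : borel_measurable (obs t)" if "s : {0..t}" for s
    by (intro borel_measurable_scaleR borel_measurable_const lm that)
  qed (simp add: lt)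
  moreover have "integral {0..t} (%s. (?u *\<^sub>R lam s w) \<bullet> (\<Sigma> *v (?u *\<^sub>R lam s w)) + (cv s w *v (?u *\<^sub>R lam s w)) \<bullet> (S *v (cv s w *v (?u *\<^sub>R lam s w)))) = Q w / (real (Suc n))^2" for w
  proof -
   have "(?u *\<^sub>R y) \<bullet> (\<Sigma> *v (?u *\<^sub>R y)) + (C *v (?u *\<^sub>R y)) \<bullet> (S *v (C *v (?u *\<^sub>R y))) = ?u^2 * (y \<bullet> (\<Sigma> *v y) + (C *v y) \<bullet> (S *v (C *v y)))" for y C
    by (simp only: matrix_vector_mult_scaleR inner_scaleR_left inner_scaleR_right power2_eq_square distrib_left mult.assoc)
   thus ?thesis by (simp only: integral_mult_right Q_def) (simp add: power_divide)
  qed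
  ultimately show "AE w in M. norm (LINT x|\<pi> t w. cis (?u *\<^sub>R l \<bullet> x)) = norm (LINT x|\<mu>. cis (?u *\<^sub>R lam 0 w \<bullet> x)) * exp (- (Q w / (real (Suc n))^2) / 2)"
   by simp
 qed
 thus ?thesis using Om(2)
 proof eventually_elim
  case (elim w)
  have \<pi>P: "\<pi> t w : P2" by (rule \<pi>_P2[OF elim(2) t])
  let ?c = "%n. (norm (LINT x|\<mu>. cis ((1 / real (Suc n)) *\<^sub>R lam 0 w \<bullet> x)))^2"
  note \<mu>l = cis_second_order[OF \<mu>(2), of "lam 0 w"]
  have "(%n. (1 / real (Suc n))^2 * ((real (Suc n))^2 * (1 - ?c n))) ----> 0^2 * (lam 0 w \<bullet> (cov_matrix \<mu> *v lam 0 w))"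
   by (intro tendsto_mult \<mu>l tendsto_power LIMSEQ_Suc[OF lim_1_over_n])
  hence "(%n. 1 - ?c n) ----> 0" by (simp add: power_divide del: of_nat_Suc)
  from tendsto_diff[OF tendsto_const[of 1] this] have c1: "?c ----> 1" by simp
  \<comment> \<open>From 1 - c e = (1 - c) + c (1 - e): the first part yields the initial covariance
    and the second the accumulated term \<open>Q w\<close>, as \<open>?c\<close> tends to 1.\<close>
  have "(real (Suc n))^2 * (1 - (norm (LINT x|\<pi> t w. cis ((1 / real (Suc n)) *\<^sub>R l \<bullet> x)))^2)
   = (real (Suc n))^2 * (1 - ?c n) + ?c n * ((real (Suc n))^2 * (1 - exp (- Q w / (real (Suc n))^2)))" for n
  proof -
   have "(exp (- (Q w / (real (Suc n))^2) / 2))^2 = exp (- Q w / (real (Suc n))^2)"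
    unfolding exp_double[symmetric] by (simp del: of_nat_Suc)
   thus ?thesis unfolding elim(1)[rule_format] power_mult_distrib by (simp add: algebra_simps del: of_nat_Suc)
  qed
  with cis_second_order[OF \<pi>P, of l]
  have "(%n. (real (Suc n))^2 * (1 - ?c n) + ?c n * ((real (Suc n))^2 * (1 - exp (- Q w / (real (Suc n))^2)))) ----> l \<bullet> (cov_matrix (\<pi> t w) *v l)"
   by (simp only:)
  moreover have "(%n. (real (Suc n))^2 * (1 - ?c n) + ?c n * ((real (Suc n))^2 * (1 - exp (- Q w / (real (Suc n))^2))))
   ----> lam 0 w \<bullet> (cov_matrix \<mu> *v lam 0 w) + 1 * Q w"
   by (intro tendsto_add tendsto_mult \<mu>l c1 scaled_exp_tendsto)
  ultimately have "l \<bullet> (cov_matrix (\<pi> t w) *v l) = lam 0 w \<bullet> (cov_matrix \<mu> *v lam 0 w) + Q w"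
   using LIMSEQ_unique by fastforce
  thus ?case using lam[of _ w] lt[of w] elim(2)
   by (intro exI[of _ "%s. lam s w"]) (simp add: Q_def cv_def on_event_def)
 qed
qed

lemma covariance_riccati:
 assumes P: "riccati P" "P 0 = cov_matrix \<mu>"
 shows "AE w in M. ALL t>=0. cv t w = P t"
proof -
 have "AE w in M. ALL t:\<rat> \<inter> {0..}. ALL i j. EX p. p t = axis i 1 + axis j 1 &
   (ALL s:{0..t}. (p has_vector_derivative - (transpose (F - cv s w ** S) *v p s)) (at s within {0..t})) &
   p t \<bullet> (cv t w *v p t) = p 0 \<bullet> (P 0 *v p 0) + integral {0..t} (%s. p s \<bullet> (\<Sigma> *v p s) + (cv s w *v p s) \<bullet> (S *v (cv s w *v p s)))"
  unfolding P(2) using covariance_identity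
  by (intro AE_ball_countable[THEN iffD2] ballI AE_all_countable[THEN iffD2] allI) (auto simp: countable_rat)
 thus ?thesis
 proof eventually_elim
  case (elim w)
  show ?case
   by (intro allI impI covariance_eq_riccati[OF P(1) cv_continuous cv_sym]) (use elim in auto)
 qed
qed

text \<open>With the covariance identified, the gain is deterministic and C1. The partition sums at
  time \<open>t\<close> then have two limits, the Ito integral along the chosen refinement and the
  pathwise integral by parts, and these must agree.\<close>

lemma ito_eq_sint:
 assumes P: "riccati P" "P 0 = cov_matrix \<mu>" and t: "0 <= t"
 shows "AE w in M. J t w = sint (gain P) (gain' P) (%s. innov s w) t"
proof -
 obtain m :: "nat => nat" where m: "!!n. 0 < m n" and err: "AE w in M. \<forall>\<^sub>F n in sequentially. ALL i<=Suc n. norm ((SUM j<i * m n. cgain (real j * t / (Suc n * m n)) w *v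
   (innov (real (Suc j) * t / (Suc n * m n)) w
    - innov (real j * t / (Suc n * m n)) w))
   - J (real i * t / Suc n) w) <= (1/2)^n / real (Suc (Suc n))"
  using ito_partition[OF t] by blast
 show ?thesis using err covariance_riccati[OF P] Om(2)
 proof eventually_elim
  case (elim w)
  note w = elim(3)
  note cont = riccati_continuous[OF P(1), THEN continuous_Icc]
  define V where "V s = innov s w" for s
  have Vc: "continuous_on {0..t} V" unfolding V_def
   by (rule continuous_Icc) (intro continuous_intros continuous_on_integral_atLeast X_path W_path Z_path w)
  have V0: "V 0 = 0" using W_path(2)[OF w] Z_path(2)[OF w] by (simp add: V_def)
  define N where "N n = Suc n * m n" for n
  define I where "I k = (SUM j<k. gain P (real j * t / k) *v (V (real (Suc j) * t / k) - V (real j * t / k)))" for k :: nat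
  have "n <= N n" for n using m[of n] by (cases "m n") (auto simp: N_def)
  hence Nt: "filterlim N at_top sequentially" by (rule filterlim_at_top_mono[OF filterlim_ident[of at_top] always_eventually, rule_format])
  have 1: "(%n. I (N n)) ----> J t w"
  proof (rule LIM_zero_cancel, rule Lim_null_comparison)
   show "\<forall>\<^sub>F n in sequentially. norm (I (N n) - J t w) <= (1/2)^n"
    using elim(1)
   proof eventually_elim
    case (elim n)
    have g: "cgain (real j * t / N n) w = gain P (real j * t / N n)" for j
     using \<open>ALL t>=0. cv t w = P t\<close> t by (simp add: cgain_def gain_def)
    have "norm (I (N n) - J t w) <= (1/2)^n / real (Suc (Suc n))"
     using elim[rule_format, of "Suc n"] unfolding I_def V_def N_def[symmetric] g by (simp del: of_nat_Suc)
    also have "... <= (1/2)^n" using divide_left_mono[of 1 "real (Suc (Suc n))" "(1/2)^n"] by simp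
    finally show ?case .
   qed
  qed (intro LIMSEQ_realpow_zero; simp)
  have "l \<bullet> J t w = l \<bullet> sint (gain P) (gain' P) V t" for l
  proof -
   have d: "((%s. transpose (gain P s) *v l) has_vector_derivative transpose (gain' P s) *v l) (at s within {0..t})" if s: "s : {0..t}" for s
   proof -
    have "(gain P has_vector_derivative gain' P s) (at s within {0..t})"
     by (rule has_vector_derivative_within_subset[OF gain_has_vector_derivative[OF P(1)]]) (use s in auto)
    from matrix_vector_derivative[OF bounded_linear.has_vector_derivative[OF bounded_linear_transpose this] has_vector_derivative_const[of l]]
    show ?thesis by simp
   qed
   have "continuous_on {0..t} (%s. transpose (gain' P s) *v l)" by (intro continuous_intros cont)
   from filterlim_compose[OF stieltjes_sum_tendsto_deriv[OF t Vc V0 d this] Nt]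
   have "(%n. l \<bullet> I (N n)) ----> (transpose (gain P t) *v l) \<bullet> V t - integral {0..t} (%u. (transpose (gain' P u) *v l) \<bullet> V u)"
    by (simp add: I_def inner_sum_right inner_matrix del: of_nat_Suc)
   moreover have "(transpose (gain P t) *v l) \<bullet> V t - integral {0..t} (%u. (transpose (gain' P u) *v l) \<bullet> V u) = l \<bullet> sint (gain P) (gain' P) V t"
   proof -
    have "(%u. gain' P u *v V u) integrable_on {0..t}" by (intro integrable_continuous_real continuous_intros cont Vc)
    from integral_linear[OF this bounded_linear_inner_right[of l]] show ?thesis
     by (simp add: sint_def inner_diff_right inner_matrix o_def)
   qed
   ultimately show ?thesis using LIMSEQ_unique[OF tendsto_inner[OF tendsto_const 1, of l]] by simp
  qed
  hence "J t w = sint (gain P) (gain' P) V t" by (rule vector_eq_ldot[THEN iffD1, OF allI])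
  thus ?case unfolding V_def[abs_def] .
 qed
qed

theorem enkf_decomposition:
 assumes P: "riccati P" "P 0 = cov_matrix \<mu>"
 shows "AE w in M. ALL t>=0. X t w = flow P t (X 0 w) + mean_path P (%s. on_event Om Z s w) t + noise P t w"
proof -
 let ?V = "%w s. innov s w"
 have "AE w in M. ALL t:\<rat> \<inter> {0..}. J t w = sint (gain P) (gain' P) (?V w) t"
  using ito_eq_sint[OF P] by (intro AE_ball_countable[THEN iffD2] ballI) (auto simp: countable_rat)
 thus ?thesis using Om(2)
 proof eventually_elim
  case (elim w)
  note w = elim(2)
  have Vc: "continuous_on {0..} (?V w)" by (intro continuous_intros continuous_on_integral_atLeast X_path W_path Z_path w)
  have c: "continuous_on {0..} (%t. X 0 w + integral {0..t} (%s. F *v X s w) + SS *v B t w - X t w)"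
   by (intro continuous_intros continuous_on_integral_atLeast X_path B_path w)
  have e: "J t w = X 0 w + integral {0..t} (%s. F *v X s w) + SS *v B t w - X t w" if "0 <= t" for t
   using X_path(2)[OF w that] by (simp only: algebra_simps)
  \<comment> \<open>The Ito integral was given time by time; the equation for \<open>X\<close>
    supplies the continuity that extends the equality from rational times.\<close>
  have Jc: "continuous_on {0..} (%t. J t w)" by (rule continuous_on_eq[OF c]) (simp add: e)
  have J: "J t w = sint (gain P) (gain' P) (?V w) t" if t: "0 <= t" for t
  proof -
   have "norm (J t w - sint (gain P) (gain' P) (?V w) t) <= 0"
    by (rule continuous_le_on_rationals[where a = 0 and b = "t + 1" and f = "%t. norm (J t w - sint (gain P) (gain' P) (?V w) t)"])
     (use elim(1) t in "auto intro!: continuous_intros Jc sint_continuous riccati_continuous[OF P(1)] Vc")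
   thus ?thesis by simp
  qed
  show ?case
  proof (intro allI impI)
   fix t :: real assume t: "0 <= t"
   have "X t w = flow P t (X 0 w) + mean_path P (%s. Z s w) t + noise_path P SS GG (%s. B s w) (%s. W s w) t"
   proof (rule path_decomposition[OF P(1) B_path[OF w] W_path[OF w] Z_path(1)[OF w] X_path(1)[OF w] _ t])
    fix t :: real assume t: "0 <= t"
    show "X t w = X 0 w + integral {0..t} (%s. F *v X s w) + SS *v B t w - sint (gain P) (gain' P) (?V w) t"
     unfolding J[OF t, symmetric] by (rule X_path(2)[OF w t])
   qed
   thus "X t w = flow P t (X 0 w) + mean_path P (%s. on_event Om Z s w) t + noise P t w"
    using w by (simp add: noise_def on_event_def)
  qed
 qed
qed

end

section \<open>Comparison of the two filters\<close>

text \<open>The estimates for conditional laws concern bounded functions, whereas coordinates are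
  unbounded; truncation keeps the modulus of continuity.\<close>

definition truncate :: "nat => real => real" where
 "truncate n x = max (- real n) (min (real n) x)"

lemma truncate: "\<bar>truncate n x\<bar> <= real n" "\<bar>truncate n x - truncate n y\<bar> <= \<bar>x - y\<bar>" "\<bar>truncate n x\<bar> <= \<bar>x\<bar>"
 by (auto simp: truncate_def max_def min_def abs_if)

lemma truncate_tendsto: "(%n. truncate n x) ----> x"
proof (rule tendsto_eventually)
 obtain k :: nat where "\<bar>x\<bar> < k" using reals_Archimedean2 by blast
 thus "\<forall>\<^sub>F n in sequentially. truncate n x = x"
  by (intro eventually_sequentiallyI[of k]) (auto simp: truncate_def)
qed

lemma (in prob_space) AE_event:
 assumes "AE w in M. P w"
 obtains A where "A : sets M" "AE w in M. w : A" "!!w. w : A ==> P w"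
proof -
 obtain N where N: "{w : space M. ~  P w} <= N" "N : null_sets M"
  using assms by (auto elim: AE_E simp: null_sets_def)
 show thesis
 proof (rule that[of "space M - N"])
  show "AE w in M. w : space M - N" using AE_not_in[OF N(2)] AE_space by eventually_elim auto
 qed (use N in auto)
qed

locale two_filters =
 E: enkf_model M F \<Sigma> H \<Gamma> SS GG B X W Z Om \<pi> J \<mu> + O: filter_model M F \<Sigma> H \<Gamma> SS GG B\<^sub>0 X\<^sub>0 W\<^sub>0 Om Z
 for M :: "'a measure" and F \<Sigma> :: "real^'d^'d" and H :: "real^'d^'k" and \<Gamma> :: "real^'k^'k"
  and SS :: "real^'d^'d" and GG :: "real^'k^'k" and B X B\<^sub>0 X\<^sub>0 J :: "real => 'a => real^'d" and W W\<^sub>0 Z :: "real => 'a => real^'k"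
  and Om :: "'a set" and \<pi> :: "real => 'a => (real^'d) measure" and \<mu> +
 fixes \<pi>' :: "real => 'a => (real^'d) measure" and R C :: "real => real^'d^'d" and c al c' al' :: real
 assumes det: "c_detectable H F"
  and law': "!!t. 0 <= t ==> cond_law M (proc_sigma M Z {0..t}) (X\<^sub>0 t) (\<pi>' t)"
  and \<pi>'_path: "!!w. w : Om ==> P2_continuous (%t. \<pi>' t w)"
  and int: "integrable M (%w. norm (X 0 w))" "integrable M (%w. norm (X\<^sub>0 0 w))"
  and R: "E.riccati R" "R 0 = 0" "E.exp_stable R c al" and C: "E.riccati C" "C 0 = cov_matrix \<mu>" "E.exp_stable C c' al'"
begin

definition rest :: "real => 'a => real" where
 "rest t w = c * exp (- al * t) * real_cond_exp M (E.obs t) (%w. norm (X\<^sub>0 0 w)) w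
  + c' * exp (- al' * t) * real_cond_exp M (E.obs t) (%w. norm (X 0 w)) w
  + norm (O.filter_mean C t w - O.filter_mean R t w) + (LINT w'|M. norm (O.noise C t w' - O.noise R t w'))"

text \<open>The two noises are driven by different Brownian motions, but both are Gaussian with
  variances determined by \<open>C\<close>. So the ensemble noise can be replaced by its counterpart
  on the signal side, where it can be compared path by path with the noise for
  \<open>R\<close>.\<close>

lemma noise_law: "0 <= t ==> distr M borel (E.noise C t) = distr M borel (O.noise C t)"
proof (rule E.distr_eq_cis)
 assume t: "0 <= t"
 show "E.noise C t : borel_measurable M" "O.noise C t : borel_measurable M"
  by (rule E.noise_measurable_M[OF C(1) t] O.noise_measurable_M[OF C(1) t])+
 fix v
 obtain p where p: "p t = v" "!!s. s : {0..t} ==> (p has_vector_derivative - (transpose (E.drift C s) *v p s)) (at s within {0..t})"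
  using E.backward_solution_exists[OF C(1) t] by blast
 show "(LINT w|M. cis (v \<bullet> E.noise C t w)) = (LINT w|M. cis (v \<bullet> O.noise C t w))"
  using E.noise_cis_eq[OF C(1) t p(2)] O.noise_cis_eq[OF C(1) t p(2)] by (simp add: p(1))
qed

text \<open>A chain of comparisons: \<open>1\<close> replaces the ensemble law by its mean path plus
  noise, \<open>3\<close> moves that noise to the signal side, \<open>4\<close> passes from
  \<open>C\<close> to \<open>R\<close> with both noises on the same Brownian motions, and
  \<open>2\<close> returns to the optimal filter. The steps \<open>1\<close>, \<open>2\<close> and
  \<open>4\<close> cost one \<open>eps\<close> each.\<close>

lemma bounded_estimate:
 assumes t: "0 <= t" and f: "f : borel_measurable borel" "!!x. \<bar>f x\<bar> <= b" "!!x y. \<bar>f x - f y\<bar> <= eps + a * norm (x - y)" and a: "0 <= a"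
 shows "AE w in M. \<bar>(LINT x|\<pi> t w. f x) - (LINT x|\<pi>' t w. f x)\<bar> <= 3 * eps + a * rest t w"
proof -
 interpret L: cond_law_vector M "proc_sigma M Z {0..t}" "X t" "\<pi> t" by (rule cond_law_vector.intro[OF E.law[OF t]])
 interpret L': cond_law_vector M "proc_sigma M Z {0..t}" "X\<^sub>0 t" "\<pi>' t" by (rule cond_law_vector.intro[OF law'[OF t]])
 note mm = O.filter_mean_measurable[OF _ t]
 have fl: "norm (E.flow P t x + m + g - (m + g)) <= k * exp (- bt * t) * norm x" if "E.riccati P" "E.exp_stable P k bt" for P k bt x m g
  using E.flow_decay[OF that t] by (simp add: add.assoc)
 have 1: "AE w in M. \<bar>(LINT x|\<pi> t w. f x) - (LINT w'|M. f (O.filter_mean C t w + E.noise C t w'))\<bar>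
   <= eps + a * (c' * exp (- al' * t)) * real_cond_exp M (E.obs t) (%w. norm (X 0 w)) w"
 proof (rule L.kernel_shift_estimate[OF subalgebra_null_ext[OF E.sub_source(1)] _ E.noise_measurable[OF C(1) t] mm[OF C(1)] int(1) _ f a])
  show "E.indep_set (sets (null_ext M E.source)) (sets (E.obs t))"
   by (rule E.indep_set_sym[OF E.indep_set_mono[OF E.indep_set_null_ext[OF E.indep_obs E.sub_obs E.sub_source(1)] _ subset_refl]])
    (use sets_subset_null_ext[OF E.sub_obs] in blast)
  show "AE w in M. norm (X t w - (O.filter_mean C t w + E.noise C t w)) <= c' * exp (- al' * t) * norm (X 0 w)"
   using E.enkf_decomposition[OF C(1,2)]
  proof eventually_elim
   case (elim w)
   show ?case unfolding elim[rule_format, OF t] O.filter_mean_def by (rule fl[OF C(1,3)])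
  qed
 qed
 obtain N where N: "subalgebra M N" "O.noise R t : borel_measurable N" "E.indep_set (sets N) (sets (null_ext M (O.past t)))"
  using O.noise_indep_past[OF R(1,2) t] by blast
 have 2: "AE w in M. \<bar>(LINT x|\<pi>' t w. f x) - (LINT w'|M. f (O.filter_mean R t w + O.noise R t w'))\<bar>
   <= eps + a * (c * exp (- al * t)) * real_cond_exp M (E.obs t) (%w. norm (X\<^sub>0 0 w)) w"
 proof (rule L'.kernel_shift_estimate[OF N(1) _ N(2) mm[OF R(1)] int(2) _ f a])
  have "sets (proc_sigma M Z {0..t}) <= sets (null_ext M (O.past t))"
   using O.sub_past(3)[of t] sets_subset_null_ext[OF O.sub_past(1)[of t]] by (auto simp: subalgebra_def)
  thus "E.indep_set (sets N) (sets (E.obs t))"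
   by (intro E.indep_set_mono[OF N(3)] null_ext_least[OF O.sub_Z O.sub_past(1)]) auto
  show "AE w in M. norm (X\<^sub>0 t w - (O.filter_mean R t w + O.noise R t w)) <= c * exp (- al * t) * norm (X\<^sub>0 0 w)"
   using O.Om(2)
  proof eventually_elim
   case (elim w)
   show ?case unfolding O.signal_decomposition[OF R(1) elim t] by (rule fl[OF R(1,3)])
  qed
 qed
 have nm: "E.noise C t : borel_measurable M" "O.noise C t : borel_measurable M" "O.noise R t : borel_measurable M"
  by (rule E.noise_measurable_M[OF C(1) t] O.noise_measurable_M[OF C(1) t] O.noise_measurable_M[OF R(1) t])+
 have fm: "(%x. f (y + x)) : borel_measurable borel" for y by (rule measurable_compose[OF _ f(1)]) measurable
 have 3: "(LINT w'|M. f (y + E.noise C t w')) = (LINT w'|M. f (y + O.noise C t w'))" for y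
  using integral_distr[OF nm(1) fm[of y]] integral_distr[OF nm(2) fm[of y]] noise_law[OF t] by simp
 have 4: "\<bar>(LINT w'|M. f (y + O.noise C t w')) - (LINT w'|M. f (z + O.noise R t w'))\<bar>
   <= eps + a * (norm (y - z) + (LINT w'|M. norm (O.noise C t w' - O.noise R t w')))" for y z
 proof -
  have i: "integrable M (%w'. f (y + O.noise C t w'))" "integrable M (%w'. f (z + O.noise R t w'))"
   by (rule E.integrable_const_bound[where B = b]; use f(2) measurable_compose[OF nm(2) fm] measurable_compose[OF nm(3) fm] in auto)+
  have j: "integrable M (%w'. norm (O.noise C t w' - O.noise R t w'))" by (rule O.noise_diff_mean_tendsto(1)[OF det C(1) R(1) t])
  have "\<bar>(LINT w'|M. f (y + O.noise C t w') - f (z + O.noise R t w'))\<bar> <= (LINT w'|M. \<bar>f (y + O.noise C t w') - f (z + O.noise R t w')\<bar>)"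
   by (rule integral_abs_bound)
  also have "... <= (LINT w'|M. eps + a * (norm (y - z) + norm (O.noise C t w' - O.noise R t w')))"
  proof (rule integral_mono)
   fix w'
   have "norm ((y + O.noise C t w') - (z + O.noise R t w')) <= norm (y - z) + norm (O.noise C t w' - O.noise R t w')"
    using norm_triangle_ineq[of "y - z" "O.noise C t w' - O.noise R t w'"] by (simp add: algebra_simps)
   thus "\<bar>f (y + O.noise C t w') - f (z + O.noise R t w')\<bar> <= eps + a * (norm (y - z) + norm (O.noise C t w' - O.noise R t w'))"
    using f(3)[of "y + O.noise C t w'" "z + O.noise R t w'"] a by (meson add_left_mono mult_left_mono order_trans)
  qed (use i j in auto)
  also have "... = eps + a * (norm (y - z) + (LINT w'|M. norm (O.noise C t w' - O.noise R t w')))"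
   using j by (simp add: E.prob_space)
  finally show ?thesis using i by simp
 qed
 show ?thesis using 1 2
 proof eventually_elim
  case (elim w)
  show ?case using elim 4[of "O.filter_mean C t w" "O.filter_mean R t w"] unfolding 3 rest_def by (simp add: algebra_simps)
 qed
qed

text \<open>The same signal is decomposed along \<open>R\<close> and along \<open>C\<close> with the
  same observations. Subtracting the two expresses the difference of the means by flows and noises,
  which are known to merge.\<close>

lemma mean_diff_tendsto: "AE w in M. ((%t. O.filter_mean C t w - O.filter_mean R t w) \<longlongrightarrow> 0) at_top"
 using O.noise_diff_tendsto[OF det R(1) C(1)] O.Om(2)
proof eventually_elim
 case (elim w)
 have fl: "((%t. E.flow P t x) \<longlongrightarrow> 0) at_top" if "E.riccati P" "E.exp_stable P k bt" for P k bt x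
 proof (rule exp_bounded_tendsto_0[where k = "- bt"])
  show "exp_bounded (%t. E.flow P t x) (- bt)" unfolding exp_bounded_def
   using E.flow_decay[OF that, of _ x] by (intro exI[of _ "k * norm x"]) (simp add: mult_ac)
 qed (use that(2) in "simp add: E.exp_stable_def")
 have "((%t. E.flow R t (X\<^sub>0 0 w) - E.flow C t (X\<^sub>0 0 w) + (O.noise R t w - O.noise C t w)) \<longlongrightarrow> 0 - 0 + 0) at_top"
  by (intro tendsto_intros fl[OF R(1,3)] fl[OF C(1,3)] elim)
 moreover have "\<forall>\<^sub>F t in at_top. E.flow R t (X\<^sub>0 0 w) - E.flow C t (X\<^sub>0 0 w) + (O.noise R t w - O.noise C t w) = O.filter_mean C t w - O.filter_mean R t w"
  using eventually_ge_at_top[of 0]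
 proof eventually_elim
  case (elim t)
  show ?case using O.signal_decomposition[OF C(1) \<open>w : Om\<close> elim] O.signal_decomposition[OF R(1) \<open>w : Om\<close> elim]
   by (simp add: algebra_simps)
 qed
 ultimately show ?case by (auto dest: Lim_transform_eventually)
qed

text \<open>The conditional expectations of the initial states are bounded along rational times
  only, hence the restriction. There they are multiplied by decaying exponentials.\<close>

lemma rest_tendsto: "AE w in M. ALL dl>0. EX T>=0. ALL t:\<rat>. T <= t --> rest t w < dl"
proof -
 let ?T = "\<rat> \<inter> {0::real..}"
 have cnt: "countable ?T" using countable_rat by auto
 have mono: "sets (E.obs s) <= sets (E.obs t)" if "s <= t" for s t
 proof -
  have "sets (proc_sigma M Z {0..s}) <= sets (proc_sigma M Z {0..t})" by (rule sets_proc_sigma_mono) (use that in auto)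
  thus ?thesis using sets_subset_null_ext[OF E.sub_Z] by (intro null_ext_least[OF E.sub_Z E.sub_Z]) blast
 qed
 have bd: "AE w in M. EX k. ALL t:?T. real_cond_exp M (E.obs t) (%w. norm (Y w)) w <= k" if "integrable M (%w. norm (Y w))" for Y :: "'a => real^'d"
  by (rule E.cond_exp_bounded_on_countable[OF cnt E.sub_obs mono that]) auto
 show ?thesis using bd[OF int(1)] bd[OF int(2)] mean_diff_tendsto
 proof eventually_elim
  case (elim w)
  obtain k1 where k1: "!!t. t : ?T ==> real_cond_exp M (E.obs t) (%w. norm (X 0 w)) w <= k1" using elim(1) by blast
  obtain k2 where k2: "!!t. t : ?T ==> real_cond_exp M (E.obs t) (%w. norm (X\<^sub>0 0 w)) w <= k2" using elim(2) by blast
  have cs: "0 <= c" "0 < al" "0 <= c'" "0 < al'" using R(3) C(3) by (auto simp: E.exp_stable_def)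
  have ex: "((%t. exp (- bt * t)) \<longlongrightarrow> 0) at_top" if "0 < bt" for bt :: real
   by (rule exp_bounded_tendsto_0[where k = "- bt"]) (use that in "auto simp: exp_bounded_def intro!: exI[of _ 1]")
  define u where "u t = c * exp (- al * t) * k2 + c' * exp (- al' * t) * k1 + norm (O.filter_mean C t w - O.filter_mean R t w)
   + (LINT w'|M. norm (O.noise C t w' - O.noise R t w'))" for t
  have "(u \<longlongrightarrow> c * 0 * k2 + c' * 0 * k1 + 0 + 0) at_top"
   unfolding u_def[abs_def]
   by (intro tendsto_add tendsto_mult tendsto_const ex cs tendsto_norm_zero elim(3) O.noise_diff_mean_tendsto(2)[OF det C(1) R(1)])
  hence u: "(u \<longlongrightarrow> 0) at_top" by simp
  show ?case
  proof (intro allI impI)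
   fix dl :: real assume "0 < dl"
   with u have "\<forall>\<^sub>F t in at_top. u t < dl" by (rule order_tendstoD(2))
   then obtain T where T: "!!t. T <= t ==> u t < dl" by (auto simp: eventually_at_top_linorder)
   have "rest t w <= u t" if "t : \<rat>" "0 <= t" for t
    unfolding rest_def u_def using k1[of t] k2[of t] that cs by (intro add_right_mono add_mono mult_left_mono) auto
   thus "EX T>=0. ALL t:\<rat>. T <= t --> rest t w < dl"
    using T by (intro exI[of _ "max 0 T"]) (auto intro: le_less_trans)
  qed
 qed
qed

text \<open>The hypothesis \<open>lip\<close>, a Lipschitz bound up to an arbitrarily small error,
  is the common property of bounded uniformly continuous functions and of coordinates.\<close>

lemma filters_merge:
 fixes ph :: "real^'d => real"
 assumes ph: "continuous_on UNIV ph" "!!x. \<bar>ph x\<bar> <= k * (1 + (norm x)^2)"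
  and lip: "!!eps. 0 < eps ==> EX a>=0. ALL x y. \<bar>ph x - ph y\<bar> <= eps + a * norm (x - y)"
 shows "AE w in M. ((%t. (LINT x|\<pi> t w. ph x) - (LINT x|\<pi>' t w. ph x)) \<longlongrightarrow> 0) at_top"
proof -
 have m: "ph : borel_measurable borel" by (rule borel_measurable_continuous_onI[OF ph(1)])
 have pt: "AE w in M. \<bar>(LINT x|\<pi> t w. ph x) - (LINT x|\<pi>' t w. ph x)\<bar> <= 3 * eps + a * rest t w"
  if t: "0 <= t" and a: "0 <= a" "!!x y. \<bar>ph x - ph y\<bar> <= eps + a * norm (x - y)" for t eps a
 proof -
  have "AE w in M. ALL n. \<bar>(LINT x|\<pi> t w. truncate n (ph x)) - (LINT x|\<pi>' t w. truncate n (ph x))\<bar> <= 3 * eps + a * rest t w"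
   unfolding AE_all_countable
  proof
   fix n show "AE w in M. \<bar>(LINT x|\<pi> t w. truncate n (ph x)) - (LINT x|\<pi>' t w. truncate n (ph x))\<bar> <= 3 * eps + a * rest t w"
   proof (rule bounded_estimate[OF t _ truncate(1) _ a(1)])
    show "(%x. truncate n (ph x)) : borel_measurable borel" unfolding truncate_def
     by (intro borel_measurable_max borel_measurable_min borel_measurable_const m)
    show "\<bar>truncate n (ph x) - truncate n (ph y)\<bar> <= eps + a * norm (x - y)" for x y
     by (rule order_trans[OF truncate(2) a(2)])
   qed
  qed
  thus ?thesis using E.Om(2)
  proof eventually_elim
   case (elim w)
   have lim: "(%n. LINT x|p. truncate n (ph x)) ----> (LINT x|p. ph x)" if p: "p : P2" for p
   proof (rule integral_dominated_convergence[where w = "%x. \<bar>ph x\<bar>"])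
    have i: "integrable p ph" by (rule P2_integrable[OF p m]) (use ph(2) in simp)
    thus "ph : borel_measurable p" "integrable p (%x. \<bar>ph x\<bar>)" by auto
    thus "(%x. truncate n (ph x)) : borel_measurable p" for n unfolding truncate_def by measurable
   qed (auto simp: truncate(3) truncate_tendsto)
   have "\<pi>' t w : P2" using \<pi>'_path[OF elim(2)] t by (simp add: P2_continuous_def)
   hence "(%n. \<bar>(LINT x|\<pi> t w. truncate n (ph x)) - (LINT x|\<pi>' t w. truncate n (ph x))\<bar>) ----> \<bar>(LINT x|\<pi> t w. ph x) - (LINT x|\<pi>' t w. ph x)\<bar>"
    by (intro tendsto_intros lim E.\<pi>_P2[OF elim(2) t])
   thus ?case by (rule LIMSEQ_le_const2) (use elim(1) in auto)
  qed
 qed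
 have "AE w in M. ALL k. EX a>=0. ALL t:\<rat> \<inter> {0..}. \<bar>(LINT x|\<pi> t w. ph x) - (LINT x|\<pi>' t w. ph x)\<bar> <= 3 * (1 / real (Suc k)) + a * rest t w"
  unfolding AE_all_countable
 proof
  fix k
  obtain a where a: "0 <= a" "!!x y. \<bar>ph x - ph y\<bar> <= 1 / real (Suc k) + a * norm (x - y)" using lip[of "1 / real (Suc k)"] by auto
  have "AE w in M. ALL t:\<rat> \<inter> {0..}. \<bar>(LINT x|\<pi> t w. ph x) - (LINT x|\<pi>' t w. ph x)\<bar> <= 3 * (1 / real (Suc k)) + a * rest t w"
   by (intro AE_ball_countable[THEN iffD2] ballI pt a) (auto simp: countable_rat)
  thus "AE w in M. EX a>=0. ALL t:\<rat> \<inter> {0..}. \<bar>(LINT x|\<pi> t w. ph x) - (LINT x|\<pi>' t w. ph x)\<bar> <= 3 * (1 / real (Suc k)) + a * rest t w"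
   by eventually_elim (use a(1) in blast)
 qed
 thus ?thesis using rest_tendsto E.Om(2)
 proof eventually_elim
  case (elim w)
  let ?D = "%t. (LINT x|\<pi> t w. ph x) - (LINT x|\<pi>' t w. ph x)"
  have Dc: "continuous_on {0..} ?D"
   using E.\<pi>_path[OF elim(3)] \<pi>'_path[OF elim(3)] ph unfolding P2_continuous_def by (intro continuous_intros) blast+
  show ?case
  proof (rule tendstoI)
   fix e :: real assume e: "0 < e"
   obtain n :: nat where n: "6 / e < n" using reals_Archimedean2 by blast
   \<comment> \<open>The choice \<open>6 / e < n\<close> spends less than half of \<open>e\<close>
     on the three approximation errors.\<close>
   have k: "3 * (1 / real (Suc n)) < e / 2" using n e by (simp add: field_simps)
   obtain a where a: "0 <= a" "!!t. t : \<rat> ==> 0 <= t ==> \<bar>?D t\<bar> <= 3 * (1 / real (Suc n)) + a * rest t w" using elim(1) by (metis Int_iff atLeast_iff)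
   \<comment> \<open>Dividing by \<open>a + 1\<close> instead of \<open>a\<close> covers
     \<open>a = 0\<close>; multiplied by \<open>a\<close>, the threshold stays within what is left
     of \<open>e / 2\<close>.\<close>
   obtain T where T: "0 <= T" "!!t. t : \<rat> ==> T <= t ==> rest t w < (e / 2 - 3 * (1 / real (Suc n))) / (a + 1)"
    using elim(2)[rule_format, of "(e / 2 - 3 * (1 / real (Suc n))) / (a + 1)"] k a(1) by (auto simp del: of_nat_Suc)
   have frac: "a * (y / (a + 1)) <= y" if "0 <= y" for y using a(1) that by (simp add: field_simps)
   have rat: "\<bar>?D t\<bar> <= e / 2" if "t : \<rat>" "T <= t" for t
   proof -
    have "a * rest t w <= a * ((e / 2 - 3 * (1 / real (Suc n))) / (a + 1))" using T(2)[OF that] a(1) by (intro mult_left_mono) auto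
    also have "... <= e / 2 - 3 * (1 / real (Suc n))" by (rule frac) (use k in linarith)
    finally show ?thesis using a(2)[OF that(1)] T(1) that(2) by linarith
   qed
   have D: "\<bar>?D t\<bar> <= e / 2" if "T <= t" for t
    by (rule continuous_le_on_rationals[where f = "%t. \<bar>?D t\<bar>" and a = T and b = "t + 1"]) (use rat T(1) that in "auto intro!: continuous_intros Dc")
   show "\<forall>\<^sub>F t in at_top. dist (?D t) 0 < e"
    using eventually_ge_at_top[of T]
   proof eventually_elim
    case (elim t)
    show ?case using D[OF elim] e by (simp add: dist_real_def)
   qed
  qed
 qed
qed

end

text \<open>Within the distance \<open>dl\<close> uniform continuity suffices; beyond it, the slope
  \<open>2 * k / dl\<close> already pays for the largest possible difference
  \<open>2 * k\<close>.\<close>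

lemma uniformly_continuous_bounded_modulus:
 fixes f :: "'a::real_normed_vector => real"
 assumes u: "uniformly_continuous_on UNIV f" and b: "bounded (range f)" and eps: "0 < eps"
 shows "EX a>=0. ALL x y. \<bar>f x - f y\<bar> <= eps + a * norm (x - y)"
proof -
 obtain dl where dl: "0 < dl" "!!x y. norm (x - y) < dl ==> \<bar>f x - f y\<bar> < eps"
  using u eps unfolding uniformly_continuous_on_def dist_norm real_norm_def by (metis UNIV_I)
 obtain k where k: "!!x. \<bar>f x\<bar> <= k" using b unfolding bounded_iff by auto
 have k0: "0 <= k" using k[of 0] by linarith
 have "\<bar>f x - f y\<bar> <= eps + 2 * k / dl * norm (x - y)" for x y
 proof (cases "norm (x - y) < dl")
  case True
  have "0 <= 2 * k / dl * norm (x - y)" using k0 dl(1) by simp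
  thus ?thesis using dl(2)[OF True] by linarith
 next
  case False
  hence "2 * k / dl * dl <= 2 * k / dl * norm (x - y)" using k0 dl(1) by (intro mult_left_mono) auto
  thus ?thesis using k[of x] k[of y] dl(1) eps by (simp add: abs_le_iff)
 qed
 moreover have "0 <= 2 * k / dl" using k0 dl(1) by simp
 ultimately show ?thesis by blast
qed

theorem corollary3p17:
  fixes M :: "'a measure"
    and F \<Sigma> sqrt\<Sigma> :: "real^'d^'d"
    and H :: "real^'d^'k"
    and \<Gamma> sqrt\<Gamma> :: "real^'k^'k"
    and \<phi> :: "real^'d \<Rightarrow> real"
    and \<mu> \<nu> :: "(real^'d) measure"
    and B\<^sub>0 X\<^sub>0 B X :: "real \<Rightarrow> 'a \<Rightarrow> real^'d"
    and W\<^sub>0 Z W :: "real \<Rightarrow> 'a \<Rightarrow> real^'k"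
    and \<pi> \<pi>' :: "real \<Rightarrow> 'a \<Rightarrow> (real^'d) measure"
  assumes "prob_space M"
    and "c_detectable H F"
    and "spd \<Sigma>" and "spd \<Gamma>"
    and "is_psd_sqrt sqrt\<Sigma> \<Sigma>" and "is_psd_sqrt sqrt\<Gamma> \<Gamma>"
    and "(uniformly_continuous_on UNIV \<phi> \<and> bounded (range \<phi>)) \<or> (\<exists>i. \<phi> = (\<lambda>x. x $ i))"
    and "\<mu> \<in> P2" and "\<nu> \<in> P2"
    and "spd (cov_matrix \<mu>)" and "spd (cov_matrix \<nu>)"
    and "signal_observation M F sqrt\<Sigma> H sqrt\<Gamma> \<nu> B\<^sub>0 W\<^sub>0 X\<^sub>0 Z"
    and "conditional_law_process M X\<^sub>0 Z \<pi>'"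
    and "mean_field_EnKF M F sqrt\<Sigma> H \<Gamma> sqrt\<Gamma> \<mu> Z B W X \<pi>"
  shows "AE \<omega> in M. ((\<lambda>t. (\<integral>x. \<phi> x \<partial>(\<pi> t \<omega>)) - (\<integral>x. \<phi> x \<partial>(\<pi>' t \<omega>))) \<longlongrightarrow> 0) at_top"
proof -
 interpret prob_space M by fact
 interpret D: riccati_data F \<Sigma> H \<Gamma> by unfold_locales fact+
 note sig = assms(12)[unfolded signal_observation_def] and enkf = assms(14)[unfolded mean_field_EnKF_def]
 obtain J where J: "!!t. 0 <= t ==> has_ito_integral M (%s w. cov_matrix (\<pi> s w) ** transpose H ** matrix_inv \<Gamma>)
   (%s w. integral {0..s} (%r. H *v X r w) + sqrt\<Gamma> *v W s w - Z s w) t (J t)"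
  "AE w in M. ALL t>=0. X t w = X 0 w + integral {0..t} (%s. F *v X s w) + sqrt\<Sigma> *v B t w - J t w"
  using enkf by blast
 have BM: "standard_BM M B" "standard_BM M W" "standard_BM M B\<^sub>0" "standard_BM M W\<^sub>0" using sig enkf by blast+
 have meas: "!!t. 0 <= t ==> X\<^sub>0 t : borel_measurable M" "!!t. 0 <= t ==> Z t : borel_measurable M" "!!t. 0 <= t ==> X t : borel_measurable M"
  using sig enkf by blast+
 have laws: "distr M borel (X\<^sub>0 0) = \<nu>" "distr M borel (X 0) = \<mu>" using sig enkf by blast+
 have cl: "conditional_law_process M X Z \<pi>" using enkf by blast
 \<comment> \<open>All path properties of both models are gathered so that one measurable event of
   full measure carries them and can serve as the common \<open>Om\<close>.\<close>
 have paths: "AE w in M. (continuous_on {0..} (%t. B t w) & B 0 w = 0 & continuous_on {0..} (%t. W t w) & W 0 w = 0 &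
   continuous_on {0..} (%t. B\<^sub>0 t w) & B\<^sub>0 0 w = 0 & continuous_on {0..} (%t. W\<^sub>0 t w) & W\<^sub>0 0 w = 0) &
   (continuous_on {0..} (%t. X t w) & continuous_on {0..} (%t. X\<^sub>0 t w) & P2_continuous (%t. \<pi> t w) & P2_continuous (%t. \<pi>' t w)) &
   (ALL t>=0. X t w = X 0 w + integral {0..t} (%s. F *v X s w) + sqrt\<Sigma> *v B t w - J t w) &
   (ALL t>=0. X\<^sub>0 t w = X\<^sub>0 0 w + integral {0..t} (%s. F *v X\<^sub>0 s w) + sqrt\<Sigma> *v B\<^sub>0 t w) &
   (ALL t>=0. Z t w = integral {0..t} (%s. H *v X\<^sub>0 s w) + sqrt\<Gamma> *v W\<^sub>0 t w)"
  using BM sig enkf J(2) cl assms(13) unfolding standard_BM_def conditional_law_process_def by (intro AE_conjI) blast+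
 obtain \<Omega> where \<Omega>: "\<Omega> : sets M" "AE w in M. w : \<Omega>" and path: "!!w. w : \<Omega> ==>
   (continuous_on {0..} (%t. B t w) & B 0 w = 0 & continuous_on {0..} (%t. W t w) & W 0 w = 0 &
   continuous_on {0..} (%t. B\<^sub>0 t w) & B\<^sub>0 0 w = 0 & continuous_on {0..} (%t. W\<^sub>0 t w) & W\<^sub>0 0 w = 0) &
   (continuous_on {0..} (%t. X t w) & continuous_on {0..} (%t. X\<^sub>0 t w) & P2_continuous (%t. \<pi> t w) & P2_continuous (%t. \<pi>' t w)) &
   (ALL t>=0. X t w = X 0 w + integral {0..t} (%s. F *v X s w) + sqrt\<Sigma> *v B t w - J t w) &
   (ALL t>=0. X\<^sub>0 t w = X\<^sub>0 0 w + integral {0..t} (%s. F *v X\<^sub>0 s w) + sqrt\<Sigma> *v B\<^sub>0 t w) &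
   (ALL t>=0. Z t w = integral {0..t} (%s. H *v X\<^sub>0 s w) + sqrt\<Gamma> *v W\<^sub>0 t w)"
  using AE_event[OF paths] by blast
 have Z0: "Z 0 w = 0" and Zc: "continuous_on {0..} (%t. Z t w)" if "w : \<Omega>" for w
 proof -
  have Z: "Z t w = integral {0..t} (%s. H *v X\<^sub>0 s w) + sqrt\<Gamma> *v W\<^sub>0 t w" if "0 <= t" for t
   using path[OF \<open>w : \<Omega>\<close>] that by blast
  show "Z 0 w = 0" using Z[of 0] path[OF that] by simp
  have c: "continuous_on {0..} (%t. integral {0..t} (%s. H *v X\<^sub>0 s w) + sqrt\<Gamma> *v W\<^sub>0 t w)"
   using path[OF that] by (intro continuous_intros continuous_on_integral_atLeast) blast+
  show "continuous_on {0..} (%t. Z t w)" by (rule continuous_on_eq[OF c]) (simp add: Z)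
 qed
 \<comment> \<open>\<open>R\<close> starts at 0 because the initial state of the signal goes
   entirely into its flow. \<open>C\<close> starts at the covariance of \<mu> because the ensemble
   computes its gain from its own covariance.\<close>
 obtain R where R: "D.riccati R" "R 0 = 0" using D.riccati_exists[of 0] by (auto simp: transpose_def vec_eq_iff)
 obtain C where C: "D.riccati C" "C 0 = cov_matrix \<mu>"
  using D.riccati_exists[of "cov_matrix \<mu>"] assms(10) unfolding spd_def by (metis inner_zero_left less_imp_le order_refl)
 obtain c \<alpha> where Rs: "D.exp_stable R c \<alpha>" using D.riccati_bounds(2)[OF assms(2) R(1)] by blast
 obtain c' \<alpha>' where Cs: "D.exp_stable C c' \<alpha>'" using D.riccati_bounds(2)[OF assms(2) C(1)] by blast
 have int: "integrable M (%w. norm (Y w))" if "distr M borel Y : P2" "Y : borel_measurable M" for Y :: "'a => real^'d"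
 proof -
  have "integrable (distr M borel Y) norm"
   by (rule P2_integrable[OF that(1) borel_measurable_norm, of 1]) (use growth_bounds(3) in simp)
  thus ?thesis by (simp add: integrable_distr_eq[OF that(2)])
 qed
 interpret two_filters M F \<Sigma> H \<Gamma> sqrt\<Sigma> sqrt\<Gamma> B X B\<^sub>0 X\<^sub>0 J W W\<^sub>0 Z \<Omega> \<pi> \<mu> \<pi>' R C c \<alpha> c' \<alpha>'
 proof (intro two_filters.intro enkf_model.intro filter_model.intro noise_model.intro two_filters_axioms.intro
   enkf_model_axioms.intro filter_model_axioms.intro noise_model_axioms.intro assms(1) D.riccati_data_axioms)
  show "mutually_indep M [proc_sigma M X {0}, proc_sigma M B {0..}, proc_sigma M W {0..}, proc_sigma M Z {0..}]"
   "mutually_indep M [proc_sigma M X\<^sub>0 {0}, proc_sigma M B\<^sub>0 {0..}, proc_sigma M W\<^sub>0 {0..}]" using sig enkf by blast+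
  show "subalgebra M G" if "G : set [proc_sigma M Z {0..}]" for G
   using that meas(2) by (auto intro: subalgebra_proc_sigma)
  show "cond_law M (proc_sigma M Z {0..t}) (X t) (\<pi> t)" "cond_law M (proc_sigma M Z {0..t}) (X\<^sub>0 t) (\<pi>' t)" if "0 <= t" for t
   by (rule conditional_law_process_cond_law[OF assms(1) _ meas(2) that]; use cl assms(13) meas that in blast)+
  show "integrable M (%w. norm (X 0 w))" "integrable M (%w. norm (X\<^sub>0 0 w))"
   using int[of "X 0"] int[of "X\<^sub>0 0"] laws assms(8,9) meas by auto
  show "!!G. G : set [] ==> subalgebra M G" by simp
 qed (use path in "blast intro: assms(1-6,8) BM meas \<Omega> Z0 Zc J(1) laws R C Rs Cs")+
 show ?thesis
 proof (rule filters_merge)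
  show "continuous_on UNIV \<phi>"
   using assms(7) by (auto intro: uniformly_continuous_imp_continuous continuous_intros)
  have "EX k. ALL x. \<bar>\<phi> x\<bar> <= k * (1 + (norm x)^2)"
   using assms(7)
  proof
   assume "uniformly_continuous_on UNIV \<phi> & bounded (range \<phi>)"
   then obtain k where k: "!!x. \<bar>\<phi> x\<bar> <= k" unfolding bounded_iff by auto
   have "0 <= k" using k[of 0] by linarith
   hence "\<bar>\<phi> x\<bar> <= k * (1 + (norm x)^2)" for x using k[of x] by (simp add: distrib_left add_increasing2)
   thus ?thesis by blast
  qed (use growth_bounds(1) in blast)
  thus "\<bar>\<phi> x\<bar> <= (SOME k. ALL x. \<bar>\<phi> x\<bar> <= k * (1 + (norm x)^2)) * (1 + (norm x)^2)" for x
   by (rule someI_ex[THEN spec])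
  show "EX a>=0. ALL x y. \<bar>\<phi> x - \<phi> y\<bar> <= \<epsilon> + a * norm (x - y)" if "0 < \<epsilon>" for \<epsilon>
   using assms(7)
  proof
   assume "uniformly_continuous_on UNIV \<phi> & bounded (range \<phi>)"
   thus ?thesis using uniformly_continuous_bounded_modulus that by blast
  next
   assume "EX i. \<phi> = (%x. x $ i)"
   then obtain i where i: "\<phi> = (%x. x $ i)" ..
   have "\<bar>x $ i - y $ i\<bar> <= \<epsilon> + 1 * norm (x - y)" for x y :: "real^'d"
    using component_le_norm_cart[of "x - y" i] that by simp
   thus ?thesis unfolding i by (intro exI[of _ 1]) simp
  qed
 qed
qed

end
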